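(* Let $\Gamma$ be a finite quiver with $n$ vertices which has enough loops (at least one loop at each vertex). For every integer $m\ge1$ and every $\lambda_*\in(\mathcal{P}_m)^n\setminus\{0\}$, $$A_\Gamma(\lambda_*,q)=A_{\Gamma_m}(\tau_m(\lambda_* ),q).$$ Hence, for every $\lambda_*\in\mathcal{P}^n\setminus\{0\}$, the refined Kac function $A_\Gamma(\lambda_*,q)$ is a polynomial in $q$ with non-negative integer coefficients.
   Context: $\mathbb{N}$ is the set of non-negative integers. A finite quiver $\Gamma$ has vertices $v_1,\dots,v_n$ and $a_{ij}\in\mathbb{N}$ arrows from $v_i$ to $v_j$; $C(\Gamma)=[a_{ij}]$ is its companion matrix. The Euler form is $\langle\alpha,\beta\rangle=\alpha(I-C(\Gamma))\beta^t$ for row vectors $\alpha,\beta\in\mathbb{Z}^n$. For $\alpha\in\mathbb{N}^n$, the following are treated as polynomials in $q$: $|\mathrm{R}_\Gamma(\alpha,\mathbb{F}_q)|=q^{\alpha C(\Gamma)\alpha^t}$ and $|\mathrm{GL}(\alpha,\mathbb{F}_q)|=\prod_{i=1}^n\prod_{s=0}^{\alpha_i-1}(q^{\alpha_i}-q^s)$. $\mathcal{P}$ is the set of partitions of all non-negative integers (including the empty partition, written $0$ or $[0]$), $\mathcal{P}_m$ is the set of partitions all of whose parts are $\le m$, and $m_\lambda^{(k)}$ is the number of parts of $\lambda$ equal to $k$. For $\lambda_*=(\lambda^1,\dots,\lambda^n)\in\mathcal{P}^n$ put $\lambda_*^{(k)}=(m_{\lambda^1}^{(k)},\dots,m_{\lambda^n}^{(k)})\in\mathbb{N}^n$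 and $\lambda_*^{\mathrm{v}}=(\lambda_*^{(1)},\dots,\lambda_*^{(r)})$, where $r$ is the largest part occurring among all $\lambda^i$. $0\in\mathcal{P}^n$ denotes the tuple of empty partitions. Refined Kac functions (of any finite quiver $\Gamma$ with $n$ ordered vertices). Work in $\mathbb{Q}(q)[[X_{ik}]]_{1\le i\le n,\,k\ge1}$. For a tuple $\alpha_*=(\alpha^1,\dots,\alpha^r)$ with $\alpha^k=(\alpha^k_1,\dots,\alpha^k_n)\in\mathbb{N}^n$ (superscripts are labels) put $X^{\alpha_*}=\prod_{i=1}^n\prod_{k=1}^r X_{ik}^{k\alpha_i^k}$. Define $$Q_\Gamma=1+\sum_{\alpha_*}\Big(\prod_{k=1}^{r}\frac{q^{\langle\alpha^k,\alpha^k\rangle}}{q^{\langle\beta^k,\beta^k\rangle}}\frac{|\mathrm{R}_\Gamma(\alpha^k,\mathbb{F}_q)|}{|\mathrm{GL}(\alpha^k,\mathbb{F}_q)|}\Big)X^{\alpha_*},$$ where the sum is over all tuples $\alpha_*=(\alpha^1,\dots,\alpha^r)$ with $r\ge1$, $\alpha^k\in\mathbb{N}^n$, $\alpha^r\ne0$, and $\beta^k=\sum_{i\ge k}\alpha^i$. Let $\psi_k$ be the operation replacing $q$ by $q^k$ and every variable $X$ by $X^k$. For a power series $f$ with zero constant term, $\mathrm{Exp}(f)=\exp\big(\sum_{k\ge1}\psi_k(f)/k\big)$; its inverse is $\mathrm{Log}(1+f)=\sum_{k\ge1}\frac{\mu(k)}{k}\psi_k(\log(1+f))$, with $\mu$ the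 Möbius function. The refined Kac functions $A_\Gamma(\lambda_*,q)\in\mathbb{Q}(q)$, $\lambda_*\in\mathcal{P}^n\setminus\{0\}$, are defined by $$(q-1)\,\mathrm{Log}(Q_\Gamma)=\sum_{\lambda_*\in\mathcal{P}^n\setminus\{0\}}A_\Gamma(\lambda_*,q)\,X^{\lambda_*^{\mathrm{v}}}.$$ The quiver $\Gamma_m$ (for $\Gamma$ with enough loops). $\Gamma_m$ has $mn$ vertices $v_i^k$, $1\le i\le n$, $1\le k\le m$, linearly ordered by: $v_i^k\prec v_s^t$ if $k<t$, or $k=t$ and $i<s$. Consider the quadratic form $$\sum_{k=1}^m\Big(\alpha^k(\alpha^k)^t+\beta^k(C(\Gamma)-I)(\beta^k)^t\Big),\qquad \beta^k=\sum_{i=k}^m\alpha^i,$$ in the $mn$ variables $\alpha_i^k$, where $\alpha^k=(\alpha_1^k,\dots,\alpha_n^k)$ and the superscript $t$ on a vector denotes its transpose. The number of arrows of $\Gamma_m$ from $v_i^k$ to $v_s^t$ is the coefficient of the monomial $\alpha_i^k\alpha_s^t$ in this form if $v_i^k\preceq v_s^t$, and zero otherwise. (This is well defined because $C(\Gamma)-I$ has non-negative integer entries.) The refined Kac functions of $\Gamma_m$ are indexed by $\mathcal{P}^{mn}\setminus\{0\}$, with the entries ordered according to $\prec$. The map $\tau_m:(\mathcal{P}_m)^n\to(\mathcal{P}_1)^{mn}$ sends $(\lambda^1,\dots,\lambda^n)$ to $([1^{\alpha_i^k}])$ arranged in the order $\prec$ of the index pairs $(i,k)$, where $\alpha_i^k=m_{\lambda^i}^{(k)}$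 and $[1^r]$ is the partition with $r$ parts all equal to $1$. *)

theory Defs
  imports
    "HOL-Computational_Algebra.Polynomial_Factorial"
    "HOL-Computational_Algebra.Squarefree"
    "HOL-Library.Poly_Mapping"
    "HOL-Library.Multiset"
    "Jordan_Normal_Form.Matrix"
begin

section \<open>Power series in arbitrarily many variables\<close>

text \<open>A monomial in variables from \<^typ>\<open>'v\<close> is its finitely supported exponent function
  \<^typ>\<open>'v \<Rightarrow>\<^sub>0 nat\<close>, so multiplication of monomials is written \<open>+\<close> and the constant
  monomial is \<open>0\<close>.\<close>

typedef ('v, 'a) mps = "UNIV :: (('v \<Rightarrow>\<^sub>0 nat) \<Rightarrow> 'a) set"
  morphisms mps_nth Abs_mps ..

setup_lifting type_definition_mps

lemma mps_nth_Abs [simp]: "mps_nth (Abs_mps f) = f"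
  by (simp add: Abs_mps_inverse)

lemma mps_eqI: "(\<And>M. mps_nth f M = mps_nth g M) \<Longrightarrow> f = g"
  by transfer auto

definition antidiag :: "('v \<Rightarrow>\<^sub>0 nat) \<Rightarrow> (('v \<Rightarrow>\<^sub>0 nat) \<times> ('v \<Rightarrow>\<^sub>0 nat)) set" where
  "antidiag M = {(A, B). A + B = M}"

lemma mem_antidiag [simp]: "(A, B) \<in> antidiag M \<longleftrightarrow> A + B = M"
  by (simp add: antidiag_def)

lemma finite_antidiag [simp]: "finite (antidiag M)"
proof -
  define K where "K = Poly_Mapping.keys M"
  define m where "m = (\<Sum>v\<in>K. Poly_Mapping.lookup M v)"
  define S where "S = {f. \<forall>v. (v \<in> K \<longrightarrow> f v \<in> {..m}) \<and> (v \<notin> K \<longrightarrow> f v = 0)}"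
  have fin: "finite S"
    unfolding S_def by (rule finite_set_of_finite_funs) (simp_all add: K_def)
  have S: "Poly_Mapping.lookup A \<in> S" if le: "\<And>v. Poly_Mapping.lookup A v \<le> Poly_Mapping.lookup M v" for A
  proof -
    have "Poly_Mapping.lookup A v \<le> m" if "v \<in> K" for v
      using le[of v] member_le_sum[OF that, of "Poly_Mapping.lookup M"] by (simp add: m_def K_def)
    moreover have "Poly_Mapping.lookup A v = 0" if "v \<notin> K" for v
      using le[of v] that by (simp add: K_def in_keys_iff)
    ultimately show ?thesis by (simp add: S_def)
  qed
  define h :: "('a \<Rightarrow>\<^sub>0 nat) \<times> ('a \<Rightarrow>\<^sub>0 nat) \<Rightarrow> _"
    where "h = map_prod Poly_Mapping.lookup Poly_Mapping.lookup"
  have "h ` antidiag M \<subseteq> S \<times> S"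
    by (auto simp: h_def antidiag_def lookup_add intro!: S)
  moreover have "inj_on h (antidiag M)"
    unfolding h_def by (rule inj_onI) (auto simp: lookup_inject)
  moreover have "finite (S \<times> S)"
    using fin by (rule finite_cartesian_product[OF _ fin])
  ultimately show ?thesis
    by (meson finite_imageD finite_subset)
qed

instantiation mps :: (type, comm_ring_1) comm_ring_1
begin

lift_definition zero_mps :: "('a, 'b) mps" is "\<lambda>M. 0" .
lift_definition one_mps :: "('a, 'b) mps" is "\<lambda>M. if M = 0 then 1 else 0" .
lift_definition plus_mps :: "('a, 'b) mps \<Rightarrow> ('a, 'b) mps \<Rightarrow> ('a, 'b) mps"
  is "\<lambda>f g M. f M + g M" .
lift_definition minus_mps :: "('a, 'b) mps \<Rightarrow> ('a, 'b) mps \<Rightarrow> ('a, 'b) mps"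
  is "\<lambda>f g M. f M - g M" .
lift_definition uminus_mps :: "('a, 'b) mps \<Rightarrow> ('a, 'b) mps"
  is "\<lambda>f M. - f M" .
lift_definition times_mps :: "('a, 'b) mps \<Rightarrow> ('a, 'b) mps \<Rightarrow> ('a, 'b) mps"
  is "\<lambda>f g M. \<Sum>(A, B)\<in>antidiag M. f A * g B" .

instance
proof
  fix f g h :: "('a, 'b) mps"
  show "f * g * h = f * (g * h)"
  proof (rule mps_eqI)
    fix M
    have "mps_nth (f * g * h) M =
        (\<Sum>(p, C)\<in>antidiag M. \<Sum>(A, B)\<in>antidiag p. mps_nth f A * mps_nth g B * mps_nth h C)"
      by (simp add: times_mps.rep_eq sum_distrib_right case_prod_unfold)
    also have "\<dots> = (\<Sum>((p, C), (A, B))\<in>(SIGMA x:antidiag M. antidiag (fst x)).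
        mps_nth f A * mps_nth g B * mps_nth h C)"
      by (subst sum.Sigma[symmetric]) (auto simp: case_prod_unfold)
    also have "\<dots> = (\<Sum>((A, p), (B, C))\<in>(SIGMA x:antidiag M. antidiag (snd x)).
        mps_nth f A * (mps_nth g B * mps_nth h C))"
      by (rule sum.reindex_bij_witness[where
            i = "\<lambda>((A, p), (B, C)). ((A + B, C), (A, B))" and
            j = "\<lambda>((p, C), (A, B)). ((A, B + C), (B, C))"])
        (auto simp: algebra_simps)
    also have "\<dots> = (\<Sum>(A, p)\<in>antidiag M. \<Sum>(B, C)\<in>antidiag p.
        mps_nth f A * (mps_nth g B * mps_nth h C))"
      by (subst sum.Sigma[symmetric]) (auto simp: case_prod_unfold)
    also have "\<dots> = mps_nth (f * (g * h)) M"
      by (simp add: times_mps.rep_eq sum_distrib_left case_prod_unfold)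
    finally show "mps_nth (f * g * h) M = mps_nth (f * (g * h)) M" .
  qed
  show "f * g = g * f"
  proof (rule mps_eqI)
    fix M
    show "mps_nth (f * g) M = mps_nth (g * f) M"
      unfolding times_mps.rep_eq
      by (rule sum.reindex_bij_witness[where i = prod.swap and j = prod.swap])
        (auto simp: algebra_simps)
  qed
  show "1 * f = f"
  proof (rule mps_eqI)
    fix M
    have "mps_nth (1 * f) M = (\<Sum>(A, B)\<in>{(0, M)}. mps_nth 1 A * mps_nth f B)"
      unfolding times_mps.rep_eq
      by (rule sum.mono_neutral_right)
        (auto simp: one_mps.rep_eq split: if_splits)
    then show "mps_nth (1 * f) M = mps_nth f M" by (simp add: one_mps.rep_eq)
  qed
  show "(f + g) * h = f * h + g * h"
    by (rule mps_eqI)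
      (simp add: times_mps.rep_eq plus_mps.rep_eq distrib_right sum.distrib case_prod_unfold)
  show "(0 :: ('a, 'b) mps) \<noteq> 1"
  proof
    assume "(0 :: ('a, 'b) mps) = 1"
    then have "mps_nth (0 :: ('a, 'b) mps) 0 = mps_nth 1 0" by simp
    then show False by (simp add: zero_mps.rep_eq one_mps.rep_eq)
  qed
qed (transfer; simp add: fun_eq_iff algebra_simps)+

end

definition mps_const :: "'a::zero \<Rightarrow> ('v, 'a) mps" where
  "mps_const c = Abs_mps (\<lambda>M. if M = 0 then c else 0)"

text \<open>The sum \<open>F 1 + F 2 + \<dots>\<close>. It is meant for families that are locally finite, that is, in
  which every monomial has a non-zero coefficient in only finitely many of the \<^term>\<open>F k\<close>:
  \<^const>\<open>Sum_any\<close> sums over the support of its argument.\<close>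

definition mps_suminf :: "(nat \<Rightarrow> ('v, 'a::comm_monoid_add) mps) \<Rightarrow> ('v, 'a) mps" where
  "mps_suminf F = Abs_mps (\<lambda>M. Sum_any (\<lambda>k. if 1 \<le> k then mps_nth (F k) M else 0))"

definition mps_log :: "('v, 'a::field) mps \<Rightarrow> ('v, 'a) mps" where
  "mps_log f = mps_suminf (\<lambda>j. mps_const ((- 1) ^ (j + 1) / of_nat j) * (f - 1) ^ j)"


section \<open>The plethystic logarithm over \<open>\<rat>(q)\<close>\<close>

abbreviation qvar :: "rat poly fract" where
  "qvar \<equiv> to_fract [:0, 1:]"

definition q_subst :: "nat \<Rightarrow> rat poly fract \<Rightarrow> rat poly fract" where
  "q_subst k x = (case SOME (a, b). b \<noteq> 0 \<and> x = Fract a b of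
     (a, b) \<Rightarrow> Fract (pcompose a (monom 1 k)) (pcompose b (monom 1 k)))"

lemma q_subst_Fract:
  assumes "k \<ge> 1" "b \<noteq> 0"
  shows "q_subst k (Fract a b) = Fract (pcompose a (monom 1 k)) (pcompose b (monom 1 k))"
proof -
  obtain c d where cd: "(SOME (c, d). d \<noteq> 0 \<and> Fract a b = Fract c d) = (c, d)" by fastforce
  have "case (SOME (c, d). d \<noteq> 0 \<and> Fract a b = Fract c d) of
      (c, d) \<Rightarrow> d \<noteq> 0 \<and> Fract a b = Fract c d"
    by (rule someI[where x = "(a, b)"]) (use assms in simp)
  then have d: "d \<noteq> 0" and "Fract a b = Fract c d" by (auto simp: cd)
  then have "a * d = c * b" using assms by (simp add: eq_fract)
  then have "pcompose a (monom 1 k) * pcompose d (monom 1 k) =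
      pcompose c (monom 1 k) * pcompose b (monom 1 k)"
    by (metis pcompose_mult)
  moreover have "pcompose p (monom 1 k) \<noteq> 0" if "p \<noteq> 0" for p :: "rat poly"
  proof
    assume "pcompose p (monom 1 k) = 0"
    then have "p = 0"
      by (rule pcompose_eq_0) (use assms(1) in \<open>simp add: degree_monom_eq\<close>)
    with that show False by simp
  qed
  ultimately show ?thesis
    using assms d by (simp add: q_subst_def cd eq_fract)
qed

text \<open>\<open>N\<close> ranges over the monomials whose \<open>k\<close>-th power is \<open>M\<close>; for \<open>k \<ge> 1\<close> there is
  at most one.\<close>

definition psi :: "nat \<Rightarrow> ('v, rat poly fract) mps \<Rightarrow> ('v, rat poly fract) mps" where
  "psi k f = Abs_mps (\<lambda>M. \<Sum>N | Poly_Mapping.map ((*) k) N = M. q_subst k (mps_nth f N))"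

definition moebius :: "nat \<Rightarrow> int" where
  "moebius k = (if squarefree k then (- 1) ^ card (prime_factors k) else 0)"

definition Log :: "('v, rat poly fract) mps \<Rightarrow> ('v, rat poly fract) mps" where
  "Log f = mps_suminf (\<lambda>k. mps_const (of_int (moebius k) / of_nat k) * psi k (mps_log f))"


section \<open>Refined Kac functions\<close>

text \<open>A quiver with \<open>n\<close> ordered vertices is given by its companion matrix \<open>C\<close>, in
  \<^term>\<open>carrier_mat n n :: nat mat set\<close>. Vertices are numbered from \<open>0\<close>, so
  \<open>v\<^sub>i\<close> has index \<open>i - 1\<close>.\<close>

definition enough_loops :: "nat mat \<Rightarrow> bool" where
  "enough_loops C \<longleftrightarrow> (\<forall>i < dim_row C. C $$ (i, i) \<ge> 1)"

definition euler_form :: "nat mat \<Rightarrow> int vec \<Rightarrow> int vec \<Rightarrow> int" where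
  "euler_form C \<alpha> \<beta> = \<alpha> \<bullet> ((1\<^sub>m (dim_row C) - map_mat int C) *\<^sub>v \<beta>)"

definition card_R :: "nat mat \<Rightarrow> nat vec \<Rightarrow> rat poly fract" where
  "card_R C \<alpha> = qvar ^ (\<alpha> \<bullet> (C *\<^sub>v \<alpha>))"

definition card_GL :: "nat vec \<Rightarrow> rat poly fract" where
  "card_GL \<alpha> = (\<Prod>i<dim_vec \<alpha>. \<Prod>s<\<alpha> $ i. qvar ^ (\<alpha> $ i) - qvar ^ s)"

text \<open>A tuple \<open>(\<alpha>\<^sup>1, \<dots>, \<alpha>\<^sup>r)\<close> is a list \<open>as\<close>, whose entry \<open>\<alpha>\<^sup>k\<close> is
  \<open>as ! (k - 1)\<close>. The variable \<open>X\<^sub>i\<^sub>k\<close> is \<open>(i, k)\<close>, with \<open>i\<close> counted from \<open>0\<close>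
  and \<open>k\<close> from \<open>1\<close>.\<close>

definition vec_tuples :: "nat \<Rightarrow> nat vec list set" where
  "vec_tuples n = {as. as \<noteq> [] \<and> set as \<subseteq> carrier_vec n \<and> last as \<noteq> 0\<^sub>v n}"

definition X_mon :: "nat \<Rightarrow> nat vec list \<Rightarrow> (nat \<times> nat) \<Rightarrow>\<^sub>0 nat" where
  "X_mon n as = (\<Sum>i<n. \<Sum>k=1..length as. Poly_Mapping.single (i, k) (k * as ! (k - 1) $ i))"

definition tail_sum :: "nat \<Rightarrow> nat vec list \<Rightarrow> nat \<Rightarrow> nat vec" where
  "tail_sum n as k = vec n (\<lambda>i. \<Sum>l=k..length as. as ! (l - 1) $ i)"

definition Q_coeff :: "nat mat \<Rightarrow> nat vec list \<Rightarrow> rat poly fract" where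
  "Q_coeff C as = (\<Prod>k=1..length as.
     let \<alpha> = as ! (k - 1); \<beta> = tail_sum (dim_row C) as k
     in qvar powi euler_form C (map_vec int \<alpha>) (map_vec int \<alpha>) /
        qvar powi euler_form C (map_vec int \<beta>) (map_vec int \<beta>) *
        (card_R C \<alpha> / card_GL \<alpha>))"

definition Q_series :: "nat mat \<Rightarrow> (nat \<times> nat, rat poly fract) mps" where
  "Q_series C = 1 + Abs_mps (\<lambda>M.
     \<Sum>as | as \<in> vec_tuples (dim_row C) \<and> X_mon (dim_row C) as = M. Q_coeff C as)"

definition partitions :: "nat multiset set" where
  "partitions = {p. 0 \<notin># p}"

definition partitions_le :: "nat \<Rightarrow> nat multiset set" where
  "partitions_le m = {p \<in> partitions. \<forall>x \<in># p. x \<le> m}"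

definition tuples :: "nat \<Rightarrow> 'a set \<Rightarrow> 'a vec set" where
  "tuples n S = {v \<in> carrier_vec n. set\<^sub>v v \<subseteq> S}"

definition partition_vecs :: "nat multiset vec \<Rightarrow> nat vec list" where
  "partition_vecs lam =
     (let r = Max (\<Union>p \<in> set\<^sub>v lam. set_mset p)
      in map (\<lambda>k. map_vec (\<lambda>p. count p k) lam) [1..<r + 1])"

text \<open>The refined Kac functions are the coefficients in the expansion of
  \<open>(q - 1) Log Q\<close> into the monomials given by the non-zero tuples of partitions. These monomials
  are pairwise distinct and no others occur; see \<open>kac_expansion\<close> at the end of this theory.\<close>

definition kac :: "nat mat \<Rightarrow> nat multiset vec \<Rightarrow> rat poly fract" where
  "kac C lam = mps_nth (mps_const (qvar - 1) * Log (Q_series C))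
                (X_mon (dim_row C) (partition_vecs lam))"


section \<open>The quiver \<open>\<Gamma>\<^sub>m\<close>\<close>

text \<open>Polynomials over \<open>\<int>\<close> in the variables \<open>\<alpha>\<^sub>i\<^sup>k\<close>, indexed by \<open>(i, k)\<close> with \<open>i\<close>
  counted from \<open>0\<close>.\<close>

type_synonym int_mpoly = "((nat \<times> nat) \<Rightarrow>\<^sub>0 nat) \<Rightarrow>\<^sub>0 int"

definition var :: "nat \<Rightarrow> nat \<Rightarrow> int_mpoly" where
  "var i k = Poly_Mapping.single (Poly_Mapping.single (i, k) 1) 1"

definition Gamma_form :: "nat \<Rightarrow> nat mat \<Rightarrow> int_mpoly" where
  "Gamma_form m C = (let n = dim_row C in
     \<Sum>k=1..m.
       let \<alpha> = vec n (\<lambda>i. var i k); \<beta> = vec n (\<lambda>i. \<Sum>l=k..m. var i l)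
       in \<alpha> \<bullet> \<alpha> + \<beta> \<bullet> (map_mat of_int (map_mat int C - 1\<^sub>m n) *\<^sub>v \<beta>))"

text \<open>The vertex \<open>v\<^sub>i\<^sup>k\<close> (with \<open>i\<close> counted from \<open>0\<close>) has position \<open>(k - 1) * n + i\<close> in the
  order \<open>\<prec>\<close>. Position \<open>p\<close> thus belongs to \<open>i = p mod n\<close> and \<open>k = p div n + 1\<close>, and
  \<open>\<preceq>\<close> is \<open>\<le>\<close> on positions.\<close>

definition Gamma :: "nat \<Rightarrow> nat mat \<Rightarrow> nat mat" where
  "Gamma m C = (let n = dim_row C in mat (m * n) (m * n) (\<lambda>(p, p').
     if p \<le> p'
     then nat (Poly_Mapping.lookup (Gamma_form m C)
       (Poly_Mapping.single (p mod n, p div n + 1) 1 + Poly_Mapping.single (p' mod n, p' div n + 1) 1))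
     else 0))"

definition tau :: "nat \<Rightarrow> nat multiset vec \<Rightarrow> nat multiset vec" where
  "tau m lam = (let n = dim_vec lam in
     vec (m * n) (\<lambda>p. replicate_mset (count (lam $ (p mod n)) (p div n + 1)) 1))"

section \<open>The defining expansion of the refined Kac functions\<close>

lemma lookup_X_mon:
  "Poly_Mapping.lookup (X_mon n as) (i, k) =
     (if i < n \<and> 1 \<le> k \<and> k \<le> length as then k * as ! (k - 1) $ i else 0)"
proof -
  have "Poly_Mapping.lookup (X_mon n as) (i, k) =
      (\<Sum>i'<n. \<Sum>k'=1..length as. if i' = i then if k' = k then k * as ! (k - 1) $ i else 0 else 0)"
    unfolding X_mon_def lookup_sum
    by (intro sum.cong refl) (auto simp: lookup_single when_def)
  also have "\<dots> = (\<Sum>i'<n. if i' = i then \<Sum>k'=1..length as. if k' = k then k * as ! (k - 1) $ i else 0 else 0)"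
    by (intro sum.cong refl) auto
  also have "\<dots> = (if i < n \<and> 1 \<le> k \<and> k \<le> length as then k * as ! (k - 1) $ i else 0)"
    by (simp add: sum.delta)
  finally show ?thesis .
qed

lemma lookup_X_mon_partition_vecs:
  assumes "lam \<in> tuples n partitions - {0\<^sub>v n}"
  shows "Poly_Mapping.lookup (X_mon n (partition_vecs lam)) (i, k) =
     (if i < n then k * count (lam $ i) k else 0)"
proof -
  define P where "P = (\<Union>p \<in> set\<^sub>v lam. set_mset p)"
  have dim: "dim_vec lam = n" using assms by (auto simp: tuples_def)
  have fin: "finite P" by (auto simp: P_def vec_set_def)
  have "k \<le> Max P" if "i < n" "count (lam $ i) k > 0"
  proof (rule Max_ge[OF fin])
    show "k \<in> P" using that dim by (auto simp: P_def vec_set_def)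
  qed
  moreover have "partition_vecs lam = map (\<lambda>k. map_vec (\<lambda>p. count p k) lam) [1..<Max P + 1]"
    by (simp add: partition_vecs_def Let_def P_def)
  ultimately show ?thesis using dim
    by (cases "count (lam $ i) k = 0")
      (auto simp: lookup_X_mon nth_upt simp del: upt_Suc)
qed

lemma inj_on_X_mon_partition_vecs:
  "inj_on (\<lambda>lam. X_mon n (partition_vecs lam)) (tuples n partitions - {0\<^sub>v n})"
proof (rule inj_onI)
  fix a b assume a: "a \<in> tuples n partitions - {0\<^sub>v n}" and b: "b \<in> tuples n partitions - {0\<^sub>v n}"
    and eq: "X_mon n (partition_vecs a) = X_mon n (partition_vecs b)"
  have dim: "dim_vec a = n" "dim_vec b = n" using a b by (auto simp: tuples_def)
  show "a = b"
  proof (rule eq_vecI)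
    fix i assume "i < dim_vec b"
    then have i: "i < n" using dim by simp
    have ab: "a $ i \<in> partitions" "b $ i \<in> partitions"
      using a b i dim by (auto simp: tuples_def vec_set_def)
    show "a $ i = b $ i"
    proof (rule multiset_eqI)
      fix k
      have "k * count (a $ i) k = k * count (b $ i) k"
        using arg_cong[OF eq, of "\<lambda>M. Poly_Mapping.lookup M (i, k)"] i
        unfolding lookup_X_mon_partition_vecs[OF a] lookup_X_mon_partition_vecs[OF b] by simp
      then show "count (a $ i) k = count (b $ i) k"
        using ab by (cases "k = 0") (auto simp: partitions_def not_in_iff)
    qed
  qed (use dim in simp)
qed

lemma inj_on_X_mon: "inj_on (X_mon n) (vec_tuples n)"
proof -
  have len: "length as \<le> length bs"
    if a: "as \<in> vec_tuples n" and eq: "X_mon n as = X_mon n bs" for as bs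
  proof (rule ccontr)
    assume "\<not> length as \<le> length bs"
    have l: "last as = as ! (length as - 1)" "length as \<ge> 1"
      using a by (auto simp: vec_tuples_def last_conv_nth Suc_le_eq)
    have "last as \<in> carrier_vec n" using a by (auto simp: vec_tuples_def)
    moreover have "last as $ i = 0" if "i < n" for i
      using arg_cong[OF eq, of "\<lambda>M. Poly_Mapping.lookup M (i, length as)"] that l
        \<open>\<not> length as \<le> length bs\<close> by (auto simp: lookup_X_mon)
    ultimately have "last as = 0\<^sub>v n" by (intro eq_vecI) auto
    then show False using a by (auto simp: vec_tuples_def)
  qed
  show ?thesis
  proof (rule inj_onI)
    fix as bs assume a: "as \<in> vec_tuples n" and b: "bs \<in> vec_tuples n"
      and eq: "X_mon n as = X_mon n bs"
    have l: "length as = length bs" using len[OF a eq] len[OF b eq[symmetric]] by simp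
    show "as = bs"
    proof (rule nth_equalityI[OF l])
      fix j assume j: "j < length as"
      have "as ! j \<in> carrier_vec n" "bs ! j \<in> carrier_vec n"
        using a b j l by (auto simp: vec_tuples_def subset_iff)
      moreover have "as ! j $ i = bs ! j $ i" if "i < n" for i
        using arg_cong[OF eq, of "\<lambda>M. Poly_Mapping.lookup M (i, Suc j)"] that j l
        by (simp add: lookup_X_mon flip: mult_Suc)
      ultimately show "as ! j = bs ! j" by (intro eq_vecI) auto
    qed
  qed
qed

text \<open>The constant monomial together with the monomials \<open>X\<close> of all vector tuples.\<close>

definition kac_mons :: "nat \<Rightarrow> ((nat \<times> nat) \<Rightarrow>\<^sub>0 nat) set" where
  "kac_mons n = {M. \<forall>i k. k dvd Poly_Mapping.lookup M (i, k) \<and>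
     (Poly_Mapping.lookup M (i, k) \<noteq> 0 \<longrightarrow> i < n)}"

definition supp_in :: "('v, 'a::zero) mps \<Rightarrow> ('v \<Rightarrow>\<^sub>0 nat) set \<Rightarrow> bool" where
  "supp_in f G \<longleftrightarrow> (\<forall>M. M \<notin> G \<longrightarrow> mps_nth f M = 0)"

lemma kac_mons_0: "0 \<in> kac_mons n" by (simp add: kac_mons_def)

lemma kac_mons_add: "A \<in> kac_mons n \<Longrightarrow> B \<in> kac_mons n \<Longrightarrow> A + B \<in> kac_mons n"
  by (auto simp: kac_mons_def lookup_add)

lemma lookup_map_mult: "Poly_Mapping.lookup (Poly_Mapping.map ((*) k) N) v = k * Poly_Mapping.lookup (N :: 'v \<Rightarrow>\<^sub>0 nat) v"
  by transfer (auto simp: when_def)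

lemma kac_mons_map: "N \<in> kac_mons n \<Longrightarrow> Poly_Mapping.map ((*) k) N \<in> kac_mons n"
  by (auto simp: kac_mons_def lookup_map_mult)

lemma supp_in_mult:
  assumes "supp_in f (kac_mons n)" "supp_in g (kac_mons n)"
  shows "supp_in (f * g) (kac_mons n)"
  unfolding supp_in_def times_mps.rep_eq
proof (intro allI impI sum.neutral ballI)
  fix M x assume M: "M \<notin> kac_mons n" and "x \<in> antidiag M"
  then have "fst x + snd x = M" by (auto simp: antidiag_def)
  then have "fst x \<notin> kac_mons n \<or> snd x \<notin> kac_mons n" using M kac_mons_add by metis
  then show "(case x of (A, B) \<Rightarrow> mps_nth f A * mps_nth g B) = 0"
    using assms by (auto simp: supp_in_def case_prod_unfold)
qed

lemma supp_in_const: "supp_in (mps_const c) (kac_mons n)"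
  by (auto simp: supp_in_def mps_const_def kac_mons_0)

lemma supp_in_1: "supp_in 1 (kac_mons n)"
  by (auto simp: supp_in_def one_mps.rep_eq kac_mons_0)

lemma supp_in_power: "supp_in f (kac_mons n) \<Longrightarrow> supp_in (f ^ j) (kac_mons n)"
  by (induction j) (auto intro: supp_in_mult supp_in_1)

lemma supp_in_suminf: "(\<And>k. k \<ge> 1 \<Longrightarrow> supp_in (F k) G) \<Longrightarrow> supp_in (mps_suminf F) G"
  unfolding supp_in_def mps_suminf_def mps_nth_Abs
proof (intro allI impI)
  fix M assume F: "\<And>k. 1 \<le> k \<Longrightarrow> \<forall>M. M \<notin> G \<longrightarrow> mps_nth (F k) M = 0" and "M \<notin> G"
  then have "(\<lambda>k. if 1 \<le> k then mps_nth (F k) M else 0) = (\<lambda>k. 0)" by auto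
  then show "Sum_any (\<lambda>k. if 1 \<le> k then mps_nth (F k) M else 0) = 0"
    by (simp only: Sum_any.neutral)
qed

lemma mps_suminf_0:
  "(\<And>k. k \<ge> 1 \<Longrightarrow> mps_nth (F k) M = 0) \<Longrightarrow> mps_nth (mps_suminf F) M = 0"
  using supp_in_suminf[of F "- {M}"] by (simp add: supp_in_def)

lemma q_subst_0: "k \<ge> 1 \<Longrightarrow> q_subst k 0 = 0"
  using q_subst_Fract[of k 1 0] by (simp add: Zero_fract_def pcompose_1 eq_fract)

lemma supp_in_psi: "k \<ge> 1 \<Longrightarrow> supp_in f (kac_mons n) \<Longrightarrow> supp_in (psi k f) (kac_mons n)"
  unfolding supp_in_def psi_def mps_nth_Abs
  by (intro allI impI sum.neutral ballI) (use kac_mons_map[of _ n k] q_subst_0[of k] in \<open>(simp, metis)\<close>)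

lemma supp_in_Q_series: "supp_in (Q_series C) (kac_mons (dim_row C))"
proof -
  have "X_mon (dim_row C) as \<in> kac_mons (dim_row C)" for as
    by (auto simp: kac_mons_def lookup_X_mon)
  then have e: "{as \<in> vec_tuples (dim_row C). X_mon (dim_row C) as = M} = {}"
    if "M \<notin> kac_mons (dim_row C)" for M using that by auto
  show ?thesis
    unfolding supp_in_def
  proof (intro allI impI)
    fix M assume M: "M \<notin> kac_mons (dim_row C)"
    then have "M \<noteq> 0" using kac_mons_0 by metis
    then show "mps_nth (Q_series C) M = 0"
      by (simp only: Q_series_def plus_mps.rep_eq mps_nth_Abs one_mps.rep_eq e[OF M] sum.empty if_False add_0)
  qed
qed

lemma mps_nth_const_mult: "mps_nth (mps_const c * f) M = c * mps_nth f M"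
  for c :: "'a::comm_ring_1" and f :: "('v, 'a) mps"
proof -
  have "mps_nth (mps_const c * f) M = (\<Sum>(A, B)\<in>{(0, M)}. mps_nth (mps_const c :: ('v, 'a) mps) A * mps_nth f B)"
    unfolding times_mps.rep_eq
    by (rule sum.mono_neutral_right)
      (auto simp: mps_const_def split: if_splits)
  then show ?thesis by (simp add: mps_const_def)
qed

lemma antidiag_0: "antidiag 0 = {(0, 0)}"
proof -
  have "A = 0" if "A + B = 0" for A B :: "'a \<Rightarrow>\<^sub>0 nat"
  proof (rule poly_mapping_eqI)
    fix v
    show "Poly_Mapping.lookup A v = Poly_Mapping.lookup 0 v"
      using arg_cong[OF that, of "\<lambda>M. Poly_Mapping.lookup M v"] by (simp add: lookup_add)
  qed
  then have *: "A + B = 0 \<longleftrightarrow> A = 0 \<and> B = 0" for A B :: "'a \<Rightarrow>\<^sub>0 nat"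
    by (metis add_0)
  show ?thesis unfolding antidiag_def * by auto
qed

lemma mps_nth_mult_0: "mps_nth (f * g) 0 = mps_nth f 0 * mps_nth g 0"
  by (simp add: times_mps.rep_eq antidiag_0)

lemma mps_nth_power_0: "mps_nth (f ^ j) 0 = mps_nth f 0 ^ j"
  by (induction j) (auto simp: mps_nth_mult_0 one_mps.rep_eq)

lemma mps_nth_Q_series_0: "mps_nth (Q_series C) 0 = 1"
proof -
  have "X_mon n as \<noteq> 0" if a: "as \<in> vec_tuples n" for n as
  proof
    assume eq: "X_mon n as = 0"
    have l: "last as = as ! (length as - 1)" "length as \<ge> 1"
      using a by (auto simp: vec_tuples_def last_conv_nth Suc_le_eq)
    have "last as \<in> carrier_vec n" using a by (auto simp: vec_tuples_def)
    moreover have "last as $ i = 0" if "i < n" for i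
      using arg_cong[OF eq, of "\<lambda>M. Poly_Mapping.lookup M (i, length as)"] that l
      by (auto simp: lookup_X_mon)
    ultimately have "last as = 0\<^sub>v n" by (intro eq_vecI) auto
    then show False using a by (auto simp: vec_tuples_def)
  qed
  then have "{as. as \<in> vec_tuples (dim_row C) \<and> X_mon (dim_row C) as = 0} = {}" by blast
  then show ?thesis
    by (simp only: Q_series_def plus_mps.rep_eq one_mps.rep_eq mps_nth_Abs sum.empty) simp
qed

lemma mps_nth_Log_Q_0: "mps_nth (Log (Q_series C)) 0 = 0"
proof -
  have l: "mps_nth (mps_log (Q_series C)) 0 = 0"
    unfolding mps_log_def
    by (rule mps_suminf_0) (simp add: mps_nth_const_mult mps_nth_power_0 minus_mps.rep_eq
        mps_nth_Q_series_0 one_mps.rep_eq power_0_left)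
  have "mps_nth (psi k (mps_log (Q_series C))) 0 = 0" if k: "k \<ge> 1" for k
  proof -
    have "N = 0" if "Poly_Mapping.map ((*) k) N = 0" for N :: "nat \<times> nat \<Rightarrow>\<^sub>0 nat"
      using lookup_map_mult[of k N] that k by (intro poly_mapping_eqI) simp
    then show ?thesis using k l unfolding psi_def mps_nth_Abs
      by (intro sum.neutral ballI) (metis mem_Collect_eq q_subst_0)
  qed
  then show ?thesis unfolding Log_def by (intro mps_suminf_0) (simp add: mps_nth_const_mult)
qed

lemma supp_in_minus: "supp_in f G \<Longrightarrow> supp_in g G \<Longrightarrow> supp_in (f - g) (G :: ('v \<Rightarrow>\<^sub>0 nat) set)"
  for f g :: "('v, 'a::comm_ring_1) mps"
  by (auto simp: supp_in_def minus_mps.rep_eq)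

lemma supp_in_Log_Q: "supp_in (Log (Q_series C)) (kac_mons (dim_row C))"
  unfolding Log_def mps_log_def
  by (intro supp_in_suminf supp_in_mult supp_in_const supp_in_psi supp_in_power
      supp_in_minus supp_in_1 supp_in_Q_series)

lemma kac_mons_image:
  assumes "M \<in> kac_mons n" "M \<noteq> 0"
  obtains lam where "lam \<in> tuples n partitions - {0\<^sub>v n}" "X_mon n (partition_vecs lam) = M"
proof -
  define c where "c i k = Poly_Mapping.lookup M (i, k) div k" for i k
  have fin: "finite {k. c i k > 0}" for i
  proof (rule finite_subset)
    show "{k. c i k > 0} \<subseteq> snd ` Poly_Mapping.keys M"
    proof
      fix k assume "k \<in> {k. c i k > 0}"
      then have "(i, k) \<in> Poly_Mapping.keys M" by (cases "Poly_Mapping.lookup M (i, k) = 0") (auto simp: c_def in_keys_iff)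
      then show "k \<in> snd ` Poly_Mapping.keys M" by force
    qed
  qed simp
  define lam where "lam = vec n (\<lambda>i. Abs_multiset (c i))"
  have count: "count (lam $ i) k = c i k" if "i < n" for i k
    using that fin[of i] by (simp add: lam_def count_Abs_multiset)
  have c: "k * c i k = Poly_Mapping.lookup M (i, k)" for i k
    using assms(1) by (simp add: c_def kac_mons_def)
  have out: "Poly_Mapping.lookup M (i, k) = 0" if "\<not> i < n" for i k
    using assms(1) that by (auto simp: kac_mons_def)
  have T: "lam \<in> tuples n partitions"
    unfolding tuples_def partitions_def
  proof (clarsimp simp: vec_set_def, intro conjI image_subsetI)
    show "lam \<in> carrier_vec n" by (simp add: lam_def)
    fix i assume "i \<in> {..<dim_vec lam}"
    then have "count (lam $ i) 0 = 0" using count[of i 0] by (simp add: lam_def c_def)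
    then show "lam $ i \<in> {p. 0 \<notin># p}" by (simp add: count_eq_zero_iff)
  qed
  have "lam \<noteq> 0\<^sub>v n"
  proof
    assume z: "lam = 0\<^sub>v n"
    have "Poly_Mapping.lookup M (i, k) = 0" for i k
      using z count[of i k] c[of k i] out[of i k] by (cases "i < n") auto
    then have "M = 0" by (intro poly_mapping_eqI) auto
    with assms(2) show False ..
  qed
  with T have L: "lam \<in> tuples n partitions - {0\<^sub>v n}" by simp
  have "X_mon n (partition_vecs lam) = M"
  proof (rule poly_mapping_eqI)
    fix v :: "nat \<times> nat"
    obtain i k where v: "v = (i, k)" by fastforce
    show "Poly_Mapping.lookup (X_mon n (partition_vecs lam)) v = Poly_Mapping.lookup M v"
      using lookup_X_mon_partition_vecs[OF L, of i k] count[of i k] c[of k i] out[of i k]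
      by (auto simp: v)
  qed
  with L show thesis using that by blast
qed

lemma kac_expansion:
  assumes "C \<in> carrier_mat n n"
  shows "mps_nth (mps_const (qvar - 1) * Log (Q_series C)) M =
    (\<Sum>lam | lam \<in> tuples n partitions - {0\<^sub>v n} \<and> X_mon n (partition_vecs lam) = M. kac C lam)"
proof (cases "\<exists>lam \<in> tuples n partitions - {0\<^sub>v n}. X_mon n (partition_vecs lam) = M")
  case True
  then obtain lam where lam: "lam \<in> tuples n partitions - {0\<^sub>v n}" "X_mon n (partition_vecs lam) = M"
    by blast
  then have "{lam. lam \<in> tuples n partitions - {0\<^sub>v n} \<and> X_mon n (partition_vecs lam) = M} = {lam}"
    using inj_on_X_mon_partition_vecs[of n] by (auto dest: inj_onD)
  then show ?thesis using assms lam by (simp add: kac_def)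
next
  case False
  have "mps_nth (Log (Q_series C)) M = 0"
  proof (cases "M = 0")
    case True then show ?thesis by (simp add: mps_nth_Log_Q_0)
  next
    case nz: False
    with False have "M \<notin> kac_mons n" by (metis kac_mons_image)
    then show ?thesis using supp_in_Log_Q[of C] assms by (auto simp: supp_in_def)
  qed
  moreover have "{lam. lam \<in> tuples n partitions - {0\<^sub>v n} \<and> X_mon n (partition_vecs lam) = M} = {}"
    using False by blast
  ultimately show ?thesis by (simp only: mps_nth_const_mult sum.empty mult_zero_right)
qed

end

theory Submission
  imports Defs "HOL-Library.Function_Algebras" "HOL-Combinatorics.Permutations"
    "HOL-Computational_Algebra.Formal_Laurent_Series"
begin

text \<open>The plethystic logarithm of a series is determined by a recursion, obtained by applying an Euler
  derivation to the series. With \<open>\<alpha>\<^sup>k\<close> placed at the monomial of the \<open>X\<^sub>i\<^sub>k\<^sup>k\<close>, the Euler forms in the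
  coefficients of \<open>Q\<^sub>\<Gamma>\<close> combine to the quadratic form that defines \<open>\<Gamma>\<^sub>m\<close>. So \<open>Q\<^sub>\<Gamma>\<close> and the part
  of \<open>Q\<close> of \<open>\<Gamma>\<^sub>m\<close> with tuples of length one have the same coefficients
  \<open>q\<^bsup>\<gamma> C \<gamma>\<^esup> / |GL(\<gamma>)|\<close>, with \<open>C\<close> the matrix of \<open>\<Gamma>\<^sub>m\<close>, and the two logarithms agree.

  Positivity follows Efimov's theorem on the cohomological Hall algebra of the symmetric quiver with
  \<open>h\<^sub>i\<^sub>j = c\<^sub>i\<^sub>j + c\<^sub>j\<^sub>i - 2 \<delta>\<^sub>i\<^sub>j\<close>, which is non-negative because of the loops. This algebra consists
  of symmetric polynomials with the shuffle product, and its Hilbert series are the expansions at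
  \<open>q = \<infinity>\<close> of the coefficients above. It is a free commutative algebra, and so the recursion for the
  logarithm counts generators. In a fixed colour type the number of generators of degree \<open>e\<close> does not
  decrease with \<open>e\<close>, as multiplication by the sum of all variables is injective modulo decomposables,
  and it is eventually constant, as differences of variables are nilpotent modulo decomposables. Hence
  \<open>q - 1\<close> times the logarithm is a Laurent polynomial with non-negative coefficients. It is regular at
  \<open>q = 0\<close>, since all coefficients of the series are.\<close>

text \<open>A relation that would contradict freeness involves all variables at once. It is
  localised at a set \<open>B\<close> of variables: in a product on \<open>S\<close>, every term
  that distributes \<open>B\<close> over several factors lies in the ideal \<open>I B\<close> of the
  kernels \<open>K T (B - T)\<close>. For \<open>B\<close> of the largest type in play, the
  surviving terms have one factor exactly on \<open>B\<close>, so modulo \<open>I B\<close> the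
  relation is linear in the values of generators on \<open>B\<close>. The common factor
  \<open>K B (S - B)\<close> can be cancelled because \<open>I B\<close> is stable under the
  derivation that translates all variables of \<open>B\<close> simultaneously, while each linear
  factor has a non-zero constant derivative. The same cancellation, applied to the sum of the
  variables, gives the injectivity behind monotonicity. Symmetric polynomials are kept as families,
  one polynomial for each finite set of coloured variables, so that subsets and relabellings need no
  numbering. With \<open>X = 1 / q\<close> one has \<open>q - 1 = 1 / X - 1\<close>, and this factor
  turns the numbers of generators into their increments: monotonicity becomes positivity, and
  eventual constancy together with the lower bound for degrees becomes finiteness.\<close>

abbreviation "lookup \<equiv> Poly_Mapping.lookup"
abbreviation "single \<equiv> Poly_Mapping.single"
abbreviation "keys \<equiv> Poly_Mapping.keys"

section \<open>Polynomials\<close>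

lemma poly_mapping_sum_single: "x = (\<Sum>a\<in>keys x. single a (lookup x a))"
  for x :: "'a \<Rightarrow>\<^sub>0 'b::comm_monoid_add"
proof (rule poly_mapping_eqI)
  fix k
  have "lookup (\<Sum>a\<in>keys x. single a (lookup x a)) k = (\<Sum>a\<in>keys x. if a = k then lookup x a else 0)"
    by (simp add: lookup_sum lookup_single when_def)
  also have "\<dots> = lookup x k"
    by (auto simp: sum.delta' in_keys_iff)
  finally show "lookup x k = lookup (\<Sum>a\<in>keys x. single a (lookup x a)) k" ..
qed

lemma poly_mapping_induct [case_names single add]:
  fixes x :: "'a \<Rightarrow>\<^sub>0 'b::comm_monoid_add"
  assumes s: "\<And>a c. P (single a c)" and a: "\<And>x y. P x \<Longrightarrow> P y \<Longrightarrow> P (x + y)"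
  shows "P x"
proof -
  have "P 0" using s[of undefined 0] by simp
  with s a have "P (\<Sum>a\<in>A. single a (lookup x a))" if "finite A" for A
    using that by (induction A rule: infinite_finite_induct) auto
  from this[of "keys x"] show ?thesis using poly_mapping_sum_single[of x] by simp
qed

text \<open>Values over a common fibre of \<open>f\<close> are added, so \<open>f\<close> may
  identify points. The map is used on two levels: on the exponents of a monomial and on the
  coefficients of a polynomial.\<close>

definition pmap :: "('a \<Rightarrow> 'b) \<Rightarrow> ('a \<Rightarrow>\<^sub>0 'c::comm_monoid_add) \<Rightarrow> ('b \<Rightarrow>\<^sub>0 'c)" where
  "pmap f x = (\<Sum>a\<in>keys x. single (f a) (lookup x a))"

lemma pmap_superset: "finite A \<Longrightarrow> keys x \<subseteq> A \<Longrightarrow> pmap f x = (\<Sum>a\<in>A. single (f a) (lookup x a))"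
  unfolding pmap_def by (rule sum.mono_neutral_left) (auto simp: in_keys_iff)

lemma pmap_0 [simp]: "pmap f 0 = 0" by (simp add: pmap_def)

lemma pmap_single [simp]: "pmap f (single a c) = single (f a) c"
  by (subst pmap_superset[of "{a}"]) auto

lemma pmap_add: "pmap f (x + y) = pmap f x + pmap f y"
proof -
  have "finite (keys x \<union> keys y)" by simp
  from pmap_superset[OF this, of "x + y" f] pmap_superset[OF this, of x f] pmap_superset[OF this, of y f]
  show ?thesis using keys_add[of x y] by (simp add: lookup_add single_add sum.distrib)
qed

lemma pmap_uminus: "pmap f (- x) = - pmap f x" for x :: "_ \<Rightarrow>\<^sub>0 'b::ab_group_add"
  using pmap_add[of f x "- x"] by (simp add: eq_neg_iff_add_eq_0 add.commute)

lemma pmap_diff: "pmap f (x - y) = pmap f x - pmap f y" for x :: "_ \<Rightarrow>\<^sub>0 'b::ab_group_add"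
  using pmap_add[of f x "- y"] by (simp add: pmap_uminus)

lemma pmap_sum: "pmap f (sum g A) = (\<Sum>a\<in>A. pmap f (g a))"
  by (induction A rule: infinite_finite_induct) (auto simp: pmap_add)

lemma pmap_pmap: "pmap f (pmap g x) = pmap (f \<circ> g) x"
  by (induction x rule: poly_mapping_induct) (auto simp: pmap_add)

lemma pmap_cong: "(\<And>a. a \<in> keys x \<Longrightarrow> f a = g a) \<Longrightarrow> pmap f x = pmap g x"
  by (simp add: pmap_def)

lemma pmap_ident: "(\<And>a. a \<in> keys x \<Longrightarrow> f a = a) \<Longrightarrow> pmap f x = x"
  using poly_mapping_sum_single[of x] by (simp add: pmap_def)

lemma keys_pmap: "keys (pmap f x) \<subseteq> f ` keys x"
  unfolding pmap_def using keys_sum[of "\<lambda>a. single (f a) (lookup x a)" "keys x"]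
  by (auto split: if_splits)

lemma lookup_pmap:
  assumes "finite A" "keys x \<subseteq> A"
  shows "lookup (pmap f x) b = (\<Sum>a\<in>{a\<in>A. f a = b}. lookup x a)"
  unfolding pmap_superset[OF assms] lookup_sum lookup_single when_def
  using assms(1) by (simp add: sum.inter_filter)

lemma lookup_pmap_inj: "inj_on f (insert a (keys x)) \<Longrightarrow> lookup (pmap f x) (f a) = lookup x a"
proof -
  assume i: "inj_on f (insert a (keys x))"
  have "lookup (pmap f x) (f a) = (\<Sum>a'\<in>{a'\<in>insert a (keys x). f a' = f a}. lookup x a')"
    by (rule lookup_pmap) auto
  also have "{a'\<in>insert a (keys x). f a' = f a} = {a}"
    using i unfolding inj_on_def by blast
  finally show ?thesis by simp
qed

lemma pmap_mult:
  fixes x :: "'a::monoid_add \<Rightarrow>\<^sub>0 'c::comm_semiring_1" and f :: "'a \<Rightarrow> 'b::monoid_add"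
  assumes "\<And>a b. f (a + b) = f a + f b"
  shows "pmap f (x * y) = pmap f x * pmap f y"
proof (induction x rule: poly_mapping_induct)
  case (single a c)
  show ?case
    by (induction y rule: poly_mapping_induct) (auto simp: mult_single assms pmap_add distrib_left)
qed (simp add: distrib_right pmap_add)

lemma pmap_1: "f 0 = 0 \<Longrightarrow> pmap f 1 = 1"
  by (metis pmap_single single_one)

section \<open>Rational polynomials in arbitrary variables, renaming, and the variables that
  occur\<close>

type_synonym 'x mon = "'x \<Rightarrow>\<^sub>0 nat"
type_synonym 'x pol = "'x mon \<Rightarrow>\<^sub>0 rat"

definition V :: "'x \<Rightarrow> 'x pol" where "V a = single (single a 1) 1"

definition Cn :: "rat \<Rightarrow> 'x pol" where "Cn c = single 0 c"

definition ren :: "('x \<Rightarrow> 'y) \<Rightarrow> 'x pol \<Rightarrow> 'y pol" where "ren p = pmap (pmap p)"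

lemma Cn_0 [simp]: "Cn 0 = 0" and Cn_1 [simp]: "Cn 1 = 1"
  and Cn_add: "Cn (a + b) = Cn a + Cn b" and Cn_mult: "Cn (a * b) = Cn a * Cn b"
  by (simp_all add: Cn_def single_add mult_single)

lemma Cn_of_nat: "Cn (of_nat n) = of_nat n"
  by (simp add: Cn_def)

lemma Cn_uminus: "Cn (- c) = - Cn c"
  by (simp add: Cn_def single_uminus)

lemma Cn_mult_single: "Cn c * single m d = single m (c * d)"
  by (simp add: Cn_def mult_single)

lemma lookup_Cn_mult: "lookup (Cn c * f) m = c * lookup f m"
proof (induction f rule: poly_mapping_induct)
  case (single a d)
  then show ?case by (simp add: Cn_mult_single lookup_single when_def)
qed (simp add: distrib_left lookup_add)

lemma ren_single [simp]: "ren p (single m c) = single (pmap p m) c" by (simp add: ren_def)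
lemma ren_V [simp]: "ren p (V a) = V (p a)" by (simp add: V_def)
lemma ren_Cn [simp]: "ren p (Cn c) = Cn c" by (simp add: Cn_def)
lemma ren_0 [simp]: "ren p 0 = 0" by (simp add: ren_def)
lemma ren_1 [simp]: "ren p 1 = 1" by (simp add: ren_def pmap_1)
lemma ren_add: "ren p (f + g) = ren p f + ren p g" by (simp add: ren_def pmap_add)
lemma ren_diff: "ren p (f - g) = ren p f - ren p g" by (simp add: ren_def pmap_diff)
lemma ren_sum: "ren p (sum f A) = (\<Sum>a\<in>A. ren p (f a))" by (simp add: ren_def pmap_sum)
lemma ren_mult: "ren p (f * g) = ren p f * ren p g" by (simp add: ren_def pmap_mult pmap_add)
lemma ren_power: "ren p (f ^ n) = ren p f ^ n" by (induction n) (auto simp: ren_mult)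
lemma ren_prod: "ren p (prod f A) = (\<Prod>a\<in>A. ren p (f a))"
  by (induction A rule: infinite_finite_induct) (auto simp: ren_mult)

lemma ren_ren:
  fixes q :: "'x \<Rightarrow> 'y" and p :: "'y \<Rightarrow> 'z"
  shows "ren p (ren q f) = ren (p \<circ> q) f"
proof -
  have "pmap p \<circ> pmap q = (pmap (p \<circ> q) :: 'x mon \<Rightarrow> _)" by (auto simp: pmap_pmap)
  then show ?thesis by (simp only: ren_def pmap_pmap)
qed

definition polys :: "'x set \<Rightarrow> 'x pol set" where
  "polys S = {f. \<forall>m\<in>keys f. keys m \<subseteq> S}"

lemma polys_0 [simp]: "0 \<in> polys S" by (simp add: polys_def)
lemma polys_single: "keys m \<subseteq> S \<Longrightarrow> single m c \<in> polys S" by (simp add: polys_def)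
lemma polys_1 [simp]: "1 \<in> polys S" by (simp add: polys_def)
lemma polys_Cn [simp]: "Cn c \<in> polys S" by (simp add: Cn_def polys_single)
lemma polys_V: "a \<in> S \<Longrightarrow> V a \<in> polys S" by (simp add: V_def polys_single)
lemma polys_add: "f \<in> polys S \<Longrightarrow> g \<in> polys S \<Longrightarrow> f + g \<in> polys S"
  unfolding polys_def using keys_add[of f g] by blast
lemma polys_diff: "f \<in> polys S \<Longrightarrow> g \<in> polys S \<Longrightarrow> f - g \<in> polys S"
  unfolding polys_def using keys_diff[of f g] by blast
lemma polys_mult: "f \<in> polys S \<Longrightarrow> g \<in> polys S \<Longrightarrow> f * g \<in> polys S"
proof -
  assume f: "f \<in> polys S" and g: "g \<in> polys S"
  have "keys m \<subseteq> S" if "m \<in> keys (f * g)" for m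
  proof -
    from that keys_mult[of f g] obtain a b where "m = a + b" "a \<in> keys f" "b \<in> keys g" by blast
    then show ?thesis using f g keys_add[of a b] unfolding polys_def by blast
  qed
  then show ?thesis by (simp add: polys_def)
qed
lemma polys_sum: "(\<And>a. a \<in> A \<Longrightarrow> f a \<in> polys S) \<Longrightarrow> sum f A \<in> polys S"
  by (induction A rule: infinite_finite_induct) (auto intro: polys_add)
lemma polys_power: "f \<in> polys S \<Longrightarrow> f ^ n \<in> polys S"
  by (induction n) (auto intro: polys_mult)
lemma polys_prod: "(\<And>a. a \<in> A \<Longrightarrow> f a \<in> polys S) \<Longrightarrow> prod f A \<in> polys S"
  by (induction A rule: infinite_finite_induct) (auto intro: polys_mult)
lemma polys_mono: "S \<subseteq> T \<Longrightarrow> polys S \<subseteq> polys T" by (auto simp: polys_def)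

lemma polys_ren: "f \<in> polys S \<Longrightarrow> ren p f \<in> polys (p ` S)"
proof -
  assume f: "f \<in> polys S"
  have "keys m \<subseteq> p ` S" if "m \<in> keys (ren p f)" for m
  proof -
    from that keys_pmap[of "pmap p" f] obtain m' where "m' \<in> keys f" "m = pmap p m'"
      by (auto simp: ren_def)
    then show ?thesis using keys_pmap[of p m'] f by (fastforce simp: polys_def)
  qed
  then show ?thesis by (simp add: polys_def)
qed

lemma ren_cong: "f \<in> polys S \<Longrightarrow> (\<And>a. a \<in> S \<Longrightarrow> p a = q a) \<Longrightarrow> ren p f = ren q f"
  unfolding ren_def by (rule pmap_cong, rule pmap_cong) (auto simp: polys_def)

section \<open>Degrees, homogeneous components and linear extension from monomials\<close>

definition deg :: "'x mon \<Rightarrow> nat" where "deg m = (\<Sum>a\<in>keys m. lookup m a)"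

lemma deg_superset: "finite A \<Longrightarrow> keys m \<subseteq> A \<Longrightarrow> deg m = (\<Sum>a\<in>A. lookup m a)"
  unfolding deg_def by (rule sum.mono_neutral_left) (auto simp: in_keys_iff)

lemma deg_0 [simp]: "deg 0 = 0" by (simp add: deg_def)

lemma deg_single [simp]: "deg (single a k) = k"
  by (subst deg_superset[of "{a}"]) auto

lemma deg_add: "deg (m + m') = deg m + deg m'"
  using deg_superset[of "keys m \<union> keys m'"] keys_add[of m m']
  by (simp add: lookup_add sum.distrib)

lemma deg_eq_0: "deg m = 0 \<longleftrightarrow> m = 0"
  by (auto simp: deg_def in_keys_iff intro!: poly_mapping_eqI)

lemma deg_pmap: "deg (pmap p m) = deg m"
  by (induction m rule: poly_mapping_induct) (auto simp: deg_add pmap_add)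

definition homog :: "nat \<Rightarrow> 'x pol \<Rightarrow> bool" where
  "homog d f \<longleftrightarrow> (\<forall>m\<in>keys f. deg m = d)"

lemma homog_0 [simp]: "homog d 0" by (simp add: homog_def)
lemma homog_single: "deg m = d \<Longrightarrow> homog d (single m c)" by (simp add: homog_def)
lemma homog_1: "homog 0 1" by (simp add: homog_def)
lemma homog_V: "homog 1 (V a)" by (simp add: V_def homog_def)
lemma homog_Cn: "homog 0 (Cn c)" by (simp add: Cn_def homog_def)
lemma homog_add: "homog d f \<Longrightarrow> homog d g \<Longrightarrow> homog d (f + g)"
  unfolding homog_def using keys_add[of f g] by blast
lemma homog_diff: "homog d f \<Longrightarrow> homog d g \<Longrightarrow> homog d (f - g)"
  unfolding homog_def using keys_diff[of f g] by blast
lemma homog_sum: "(\<And>a. a \<in> A \<Longrightarrow> homog d (f a)) \<Longrightarrow> homog d (sum f A)"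
  by (induction A rule: infinite_finite_induct) (auto intro: homog_add)
lemma homog_mult: "homog d f \<Longrightarrow> homog e g \<Longrightarrow> homog (d + e) (f * g)"
proof -
  assume f: "homog d f" and g: "homog e g"
  have "deg m = d + e" if "m \<in> keys (f * g)" for m
  proof -
    from that keys_mult[of f g] obtain a b where "m = a + b" "a \<in> keys f" "b \<in> keys g" by blast
    then show ?thesis using f g by (simp add: homog_def deg_add)
  qed
  then show ?thesis by (simp add: homog_def)
qed
lemma homog_Cn_mult: "homog d f \<Longrightarrow> homog d (Cn c * f)"
  using homog_mult[OF homog_Cn] by fastforce
lemma homog_power: "homog d f \<Longrightarrow> homog (n * d) (f ^ n)"
  by (induction n) (auto intro: homog_1 dest: homog_mult)
lemma homog_prod: "(\<And>a. a \<in> A \<Longrightarrow> homog (d a) (f a)) \<Longrightarrow> homog (sum d A) (prod f A)"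
  by (induction A rule: infinite_finite_induct) (auto intro: homog_1 homog_mult)
lemma homog_ren: "homog d f \<Longrightarrow> homog d (ren p f)"
  unfolding homog_def ren_def using keys_pmap[of "pmap p" f] by (auto simp: deg_pmap)

definition hcomp :: "nat \<Rightarrow> 'x pol \<Rightarrow> 'x pol" where
  "hcomp d f = (\<Sum>m\<in>{m\<in>keys f. deg m = d}. single m (lookup f m))"

lemma lookup_hcomp: "lookup (hcomp d f) m = (if deg m = d then lookup f m else 0)"
  unfolding hcomp_def lookup_sum lookup_single when_def
  by (auto simp: sum.delta in_keys_iff)

lemma keys_hcomp: "keys (hcomp d f) = {m\<in>keys f. deg m = d}"
  by (auto simp: in_keys_iff lookup_hcomp simp del: lookup_not_eq_zero_eq_in_keys split: if_splits)

lemma hcomp_add: "hcomp d (f + g) = hcomp d f + hcomp d g"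
  by (rule poly_mapping_eqI) (simp add: lookup_hcomp lookup_add)
lemma hcomp_0 [simp]: "hcomp d 0 = 0"
  by (rule poly_mapping_eqI) (simp add: lookup_hcomp)
lemma hcomp_sum: "hcomp d (sum f A) = (\<Sum>a\<in>A. hcomp d (f a))"
  by (induction A rule: infinite_finite_induct) (auto simp: hcomp_add)
lemma homog_hcomp: "homog d (hcomp d f)"
  by (simp add: homog_def keys_hcomp)
lemma hcomp_homog: "homog d f \<Longrightarrow> hcomp d f = f"
  by (rule poly_mapping_eqI) (auto simp: lookup_hcomp homog_def in_keys_iff)
lemma polys_hcomp: "f \<in> polys S \<Longrightarrow> hcomp d f \<in> polys S"
  by (simp add: polys_def keys_hcomp)

lemma hcomp_mult_homog:
  assumes "homog e g"
  shows "hcomp d (f * g) = (if e \<le> d then hcomp (d - e) f * g else 0)"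
proof (induction f rule: poly_mapping_induct)
  case (single m c)
  have h: "homog (deg m + e) (single m c * g)" using assms by (intro homog_mult homog_single) auto
  have s: "hcomp k (single m c) = (if deg m = k then single m c else 0)" for k
    by (rule poly_mapping_eqI) (auto simp: lookup_hcomp lookup_single when_def)
  have "hcomp d (single m c * g) = (if deg m + e = d then single m c * g else 0)"
    by (rule poly_mapping_eqI) (use h in \<open>auto simp: lookup_hcomp homog_def not_in_keys_iff_lookup_eq_zero[symmetric]\<close>)
  then show ?case by (auto simp: s)
next
  case (add x y) then show ?case by (simp add: distrib_right hcomp_add)
qed

text \<open>The derivation and the extraction of coefficients below are linear extensions of this
  kind.\<close>

definition plin :: "('x mon \<Rightarrow> 'y pol) \<Rightarrow> 'x pol \<Rightarrow> 'y pol" where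
  "plin \<phi> f = (\<Sum>m\<in>keys f. Cn (lookup f m) * \<phi> m)"

lemma plin_superset: "finite A \<Longrightarrow> keys f \<subseteq> A \<Longrightarrow> plin \<phi> f = (\<Sum>m\<in>A. Cn (lookup f m) * \<phi> m)"
  unfolding plin_def by (rule sum.mono_neutral_left) (auto simp: in_keys_iff)

lemma plin_single: "plin \<phi> (single m c) = Cn c * \<phi> m"
  by (subst plin_superset[of "{m}"]) auto

lemma plin_add: "plin \<phi> (f + g) = plin \<phi> f + plin \<phi> g"
proof -
  have "finite (keys f \<union> keys g)" by simp
  from plin_superset[OF this, of "f + g" \<phi>] plin_superset[OF this, of f \<phi>] plin_superset[OF this, of g \<phi>]
  show ?thesis using keys_add[of f g] by (simp add: lookup_add Cn_add distrib_right sum.distrib)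
qed

lemma plin_0 [simp]: "plin \<phi> 0 = 0"
  by (simp add: plin_def)

lemma plin_sum: "plin \<phi> (sum f A) = (\<Sum>a\<in>A. plin \<phi> (f a))"
  by (induction A rule: infinite_finite_induct) (auto simp: plin_add)

text \<open>The derivation \<open>\<Sum>\<^sub>a\<^sub>\<in>\<^sub>S \<partial>\<^sub>a\<close>. It annihilates all differences of two variables from \<open>S\<close>.\<close>

definition der_mon :: "'x set \<Rightarrow> 'x mon \<Rightarrow> 'x pol" where
  "der_mon S m = (\<Sum>a\<in>S. single (m - single a 1) (of_nat (lookup m a)))"

definition der :: "'x set \<Rightarrow> 'x pol \<Rightarrow> 'x pol" where
  "der S = plin (der_mon S)"

lemma der_single: "der S (single m c) = Cn c * der_mon S m"
  by (simp add: der_def plin_single)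

lemma der_add: "der S (f + g) = der S f + der S g"
  by (simp add: der_def plin_add)

lemma der_0 [simp]: "der S 0 = 0" by (simp add: der_def plin_def)

lemma der_sum: "der S (sum f A) = (\<Sum>a\<in>A. der S (f a))"
  by (induction A rule: infinite_finite_induct) (auto simp: der_add)

lemma der_mon_add: "der_mon S (m + m') = der_mon S m * single m' 1 + single m 1 * der_mon S m'"
proof -
  \<comment> \<open>Subtraction of exponents is truncated, but a monomial without \<open>a\<close>
    gets the coefficient zero.\<close>
  have *: "single (m + m' - single a 1) (of_nat (lookup m a)) =
      single (m - single a 1) (of_nat (lookup m a)) * single m' (1::rat)" for a and m m' :: "'a mon"
  proof (cases "lookup m a = 0")
    case False
    then have "m + m' - single a 1 = (m - single a 1) + m'"
      by (intro poly_mapping_eqI) (auto simp: lookup_minus lookup_add lookup_single when_def)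
    then show ?thesis by (simp add: mult_single)
  qed simp
  have "single (m + m' - single a 1) (of_nat (lookup (m + m') a)) =
      single (m - single a 1) (of_nat (lookup m a)) * single m' (1::rat) +
      single m 1 * single (m' - single a 1) (of_nat (lookup m' a))" for a
    using *[of m m' a] *[of m' m a]
    by (simp add: lookup_add single_add add.commute mult.commute)
  then show ?thesis
    by (simp add: der_mon_def sum.distrib sum_distrib_left sum_distrib_right)
qed

lemma der_mult: "der S (f * g) = der S f * g + f * der S g"
proof (induction f rule: poly_mapping_induct)
  case (single m c)
  show ?case
  proof (induction g rule: poly_mapping_induct)
    case (single m' c')
    have "der S (single m c * single m' c') = Cn c * Cn c' * (der_mon S m * single m' 1 + single m 1 * der_mon S m')"
      by (simp add: mult_single der_single der_mon_add Cn_mult)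
    also have "\<dots> = Cn c * der_mon S m * (Cn c' * single m' 1) + (Cn c * single m 1) * (Cn c' * der_mon S m')"
      by (simp add: algebra_simps)
    finally show ?case by (simp add: der_single Cn_mult_single)
  qed (simp add: distrib_left der_add algebra_simps)
qed (simp add: distrib_right der_add algebra_simps)

lemma der_Cn [simp]: "der S (Cn c) = 0"
  by (simp add: Cn_def der_single der_mon_def)
lemma der_1 [simp]: "der S 1 = 0" using der_Cn[of S 1] by simp

lemma der_V: "finite S \<Longrightarrow> der S (V a) = (if a \<in> S then 1 else 0)"
proof -
  assume S: "finite S"
  have "der S (V a) = (\<Sum>b\<in>S. single (single a 1 - single b 1) (of_nat (lookup (single a (1::nat)) b)))"
    by (simp add: V_def der_single der_mon_def)
  also have "\<dots> = (\<Sum>b\<in>S. if a = b then 1 else 0)"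
    by (intro sum.cong refl) (auto simp: lookup_single when_def)
  finally show ?thesis using S by (simp add: sum.delta)
qed

lemma der_diff: "der S (f - g) = der S f - der S g"
  using der_add[of S "f - g" g] by simp

lemma der_power: "der S f = 0 \<Longrightarrow> der S (f ^ n) = 0"
  by (induction n) (auto simp: der_mult)

lemma der_prod: "(\<And>a. a \<in> A \<Longrightarrow> der S (f a) = 0) \<Longrightarrow> der S (prod f A) = 0"
  by (induction A rule: infinite_finite_induct) (auto simp: der_mult)

text \<open>Only a bound on the degree is tracked, since the polynomials to which local nilpotency
  is applied need not be homogeneous.\<close>

lemma der_lowers:
  assumes "\<forall>m\<in>keys f. deg m \<le> n" shows "\<forall>m\<in>keys (der S f). deg m \<le> n - 1"
proof
  fix m assume "m \<in> keys (der S f)"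
  then have "lookup (der S f) m \<noteq> 0" by (simp add: in_keys_iff)
  then obtain m' where m': "m' \<in> keys f" "lookup (Cn (lookup f m') * der_mon S m') m \<noteq> 0"
    unfolding der_def plin_def lookup_sum by (meson sum.neutral)
  then have "lookup (der_mon S m') m \<noteq> 0" by (simp add: lookup_Cn_mult)
  then obtain a where a: "lookup (single (m' - single a 1) (of_nat (lookup m' a) :: rat)) m \<noteq> 0"
    unfolding der_mon_def lookup_sum by (meson sum.neutral)
  then have ma: "m = m' - single a 1" "lookup m' a \<noteq> 0" by (auto simp: lookup_single when_def split: if_splits)
  then have "m' = m + single a 1"
    by (intro poly_mapping_eqI) (auto simp: lookup_minus lookup_add lookup_single when_def)
  then have "deg m' = deg m + 1" by (simp add: deg_add)
  then show "deg m \<le> n - 1" using assms m' by fastforce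
qed

lemma der_nilpotent: "\<exists>n. (der S ^^ n) f = 0"
proof -
  have "(der S ^^ Suc n) f = 0" if "\<forall>m\<in>keys f. deg m \<le> n" for n f
    using that
  proof (induction n arbitrary: f)
    case 0
    then have "f = Cn (lookup f 0)"
      by (intro poly_mapping_eqI) (auto simp: Cn_def lookup_single when_def deg_eq_0 in_keys_iff)
    then show ?case by (metis der_Cn funpow_0 funpow_Suc_right comp_apply)
  next
    case (Suc n)
    then show ?case using der_lowers[OF Suc.prems, of S] by (subst funpow_Suc_right) simp
  qed
  moreover have "\<forall>m\<in>keys f. deg m \<le> Max (deg ` keys f)" by simp
  ultimately show ?thesis by blast
qed

section \<open>Ideals stable under a derivation\<close>

text \<open>A commutative ring is a module over itself, and the span of a set is the ideal that it
  generates. Ideals thus inherit the calculus of spans, including induction over generators.\<close>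

interpretation ideal: Modules.module "(*) :: 'a::comm_ring_1 \<Rightarrow> 'a \<Rightarrow> 'a"
  by unfold_locales (auto simp: algebra_simps)

declare ideal.scale_scale [simp del]

lemma ideal_mult_right: "x \<in> ideal.span G \<Longrightarrow> x * y \<in> ideal.span G" for x :: "'a::comm_ring_1"
  using ideal.span_scale[of x G y] by (simp add: mult.commute)

lemma der_ideal:
  assumes "\<And>g. g \<in> G \<Longrightarrow> der S g \<in> ideal.span G" "x \<in> ideal.span G"
  shows "der S x \<in> ideal.span G"
  using assms(2)
proof (induction rule: ideal.span_induct_alt)
  case (step c x y)
  have "der S (c * x + y) = der S c * x + c * der S x + der S y" by (simp add: der_add der_mult)
  also have "\<dots> \<in> ideal.span G"
    using step assms(1) by (intro ideal.span_add ideal.span_scale) (auto intro: ideal.span_base)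
  finally show ?case .
qed (simp add: ideal.span_zero)

text \<open>If \<open>u\<close> were not in the ideal, take the largest \<open>d\<close> such that the \<open>d\<close>-th derivative of
  \<open>u\<close> is not: the derivative of order \<open>d + 1\<close> of \<open>u l\<close> is then a non-zero multiple of it.\<close>

lemma cancel_linear:
  fixes u :: "'x pol"
  assumes G: "\<And>g. g \<in> G \<Longrightarrow> der S g \<in> ideal.span G"
    and l: "der S l = Cn c" "c \<noteq> 0" and ul: "u * l \<in> ideal.span G"
  shows "u \<in> ideal.span G"
proof (rule ccontr)
  assume u: "u \<notin> ideal.span G"
  define P where "P k \<longleftrightarrow> (der S ^^ k) u \<in> ideal.span G" for k
  obtain n where "(der S ^^ n) u = 0" using der_nilpotent by blast
  then have n: "P n" by (simp add: P_def ideal.span_zero)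
  have "\<not> P 0" using u by (simp add: P_def)
  with n have "\<exists>d. \<not> P d \<and> P (Suc d)" by (induction n) auto
  then obtain d where d: "\<not> P d" "P (Suc d)" by blast
  \<comment> \<open>Leibniz's rule; no further terms arise because the derivative of
    \<open>l\<close> is a constant. For \<open>k = 0\<close> the exponent \<open>k - 1\<close> is
    harmless, since its term has the factor zero.\<close>
  have "(der S ^^ k) (u * l) = (der S ^^ k) u * l + of_nat k * Cn c * (der S ^^ (k - 1)) u" for k
  proof (induction k)
    case (Suc k)
    have "der S (of_nat k) = 0" using der_Cn[of S "of_nat k"] by (simp only: Cn_of_nat)
    moreover have "der S ((der S ^^ (k - 1)) u) = (der S ^^ k) u" if "k > 0"
      using that by (cases k) auto
    ultimately show ?case using Suc l(1) by (cases "k = 0") (auto simp: der_add der_mult algebra_simps)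
  qed simp
  from this[of "Suc d"] have e: "Cn (of_nat (Suc d) * c) * (der S ^^ d) u =
      (der S ^^ Suc d) (u * l) - (der S ^^ Suc d) u * l"
    by (simp add: Cn_mult Cn_of_nat del: of_nat_Suc)
  have "(der S ^^ k) (u * l) \<in> ideal.span G" for k
    by (induction k) (auto intro: ul der_ideal[OF G])
  then have "Cn (of_nat (Suc d) * c) * (der S ^^ d) u \<in> ideal.span G"
    unfolding e using d(2) by (intro ideal.span_diff ideal_mult_right) (auto simp: P_def simp del: funpow.simps)
  then have "Cn (inverse (of_nat (Suc d) * c)) * (Cn (of_nat (Suc d) * c) * (der S ^^ d) u) \<in> ideal.span G"
    by (rule ideal.span_scale)
  moreover have "Cn (inverse (of_nat (Suc d) * c)) * Cn (of_nat (Suc d) * c) = (1 :: 'x pol)"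
    using l(2) by (subst Cn_mult[symmetric], subst left_inverse) (auto simp del: of_nat_Suc)
  ultimately have "(der S ^^ d) u \<in> ideal.span G" by (simp add: mult.assoc[symmetric])
  with d(1) show False by (simp add: P_def)
qed

lemma cancel_power:
  assumes "\<And>g. g \<in> G \<Longrightarrow> der S g \<in> ideal.span G" "der S l = Cn c" "c \<noteq> 0" "u * l ^ k \<in> ideal.span G"
  shows "u \<in> ideal.span G"
  using assms(4)
proof (induction k arbitrary: u)
  case (Suc k)
  then have "u * l ^ k * l \<in> ideal.span G" by (simp add: algebra_simps)
  then have "u * l ^ k \<in> ideal.span G" using cancel_linear[of G S l c "u * l ^ k"] assms(1-3) by blast
  then show ?case by (rule Suc.IH)
qed simp

lemma cancel_prod:
  assumes "\<And>g. g \<in> G \<Longrightarrow> der S g \<in> ideal.span G" "finite A"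
    and "\<And>a u. a \<in> A \<Longrightarrow> u * f a \<in> ideal.span G \<Longrightarrow> u \<in> ideal.span G"
    and "u * prod f A \<in> ideal.span G"
  shows "u \<in> ideal.span (G :: 'x pol set)"
  using assms(2-4)
proof (induction A arbitrary: u)
  case (insert a A)
  have "(u * prod f A) * f a \<in> ideal.span G" using insert by (simp add: algebra_simps)
  then have "u * prod f A \<in> ideal.span G" using insert.prems(1) by blast
  then show ?case using insert by blast
qed simp

section \<open>Coefficients with respect to some of the variables\<close>

definition restr :: "'x set \<Rightarrow> 'x mon \<Rightarrow> 'x mon" where
  "restr A m = (\<Sum>a\<in>keys m \<inter> A. single a (lookup m a))"

lemma lookup_restr: "lookup (restr A m) a = (if a \<in> A then lookup m a else 0)"
proof -
  have "lookup (restr A m) a = (\<Sum>b\<in>keys m \<inter> A. if b = a then lookup m b else 0)"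
    by (simp add: restr_def lookup_sum lookup_single when_def)
  then show ?thesis by (auto simp: sum.delta' not_in_keys_iff_lookup_eq_zero)
qed

lemma restr_add: "restr A (m + m') = restr A m + restr A m'"
  by (rule poly_mapping_eqI) (simp add: lookup_restr lookup_add)

lemma restr_disjoint: "keys m \<inter> A = {} \<Longrightarrow> restr A m = 0"
  by (simp add: restr_def)

lemma restr_subset: "keys m \<subseteq> A \<Longrightarrow> restr A m = m"
  by (rule poly_mapping_eqI) (auto simp: lookup_restr in_keys_iff)

lemma keys_restr: "keys (restr A m) = keys m \<inter> A"
  by (auto simp: in_keys_iff lookup_restr simp del: lookup_not_eq_zero_eq_in_keys split: if_splits)

text \<open>The coefficient of the monomial \<open>\<mu>\<close> when the variables outside \<open>A\<close> count as constants.\<close>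

definition coeff_in :: "'x set \<Rightarrow> 'x mon \<Rightarrow> 'x pol \<Rightarrow> 'x pol" where
  "coeff_in A \<mu> = plin (\<lambda>m. if restr A m = \<mu> then single (m - \<mu>) 1 else 0)"

text \<open>A monomial of \<open>g\<close> has no variable from \<open>A\<close>, so multiplication
  by it does not change the part of a monomial that lies in \<open>A\<close>. Extraction is
  therefore linear over the polynomials in the variables of \<open>B\<close>.\<close>

lemma coeff_in_mult:
  assumes "g \<in> polys B" "A \<inter> B = {}"
  shows "coeff_in A \<mu> (g * f) = g * coeff_in A \<mu> f"
proof -
  have s: "coeff_in A \<mu> (single m c * f) = single m c * coeff_in A \<mu> f" if "keys m \<inter> A = {}" for m c
  proof (induction f rule: poly_mapping_induct)
    case (single m' c')
    have r: "restr A (m + m') = restr A m'" using that by (simp add: restr_add restr_disjoint)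
    have "m + m' - \<mu> = m + (m' - \<mu>)" if "restr A m' = \<mu>"
      by (rule poly_mapping_eqI) (auto simp: that[symmetric] lookup_minus lookup_add lookup_restr)
    then show ?case by (simp add: coeff_in_def mult_single plin_single r Cn_mult_single)
  qed (simp add: distrib_left plin_add coeff_in_def)
  have "coeff_in A \<mu> (g * f) = coeff_in A \<mu> (\<Sum>m\<in>keys g. single m (lookup g m) * f)"
    by (simp only: sum_distrib_right[symmetric] poly_mapping_sum_single[symmetric])
  also have "\<dots> = (\<Sum>m\<in>keys g. single m (lookup g m) * coeff_in A \<mu> f)"
    unfolding coeff_in_def plin_sum unfolding coeff_in_def[symmetric]
    using assms by (intro sum.cong refl s) (auto simp: polys_def)
  also have "\<dots> = g * coeff_in A \<mu> f"
    by (simp only: sum_distrib_right[symmetric] poly_mapping_sum_single[symmetric])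
  finally show ?thesis .
qed

lemma coeff_in_polys:
  assumes "v \<in> polys A" shows "coeff_in A \<mu> v = Cn (lookup v \<mu>)"
proof -
  have "coeff_in A \<mu> v = (\<Sum>m\<in>keys v. if m = \<mu> then Cn (lookup v m) else 0)"
    unfolding coeff_in_def plin_def
  proof (intro sum.cong refl)
    fix m assume "m \<in> keys v"
    then have "restr A m = m" using assms by (intro restr_subset) (auto simp: polys_def)
    then show "Cn (lookup v m) * (if restr A m = \<mu> then single (m - \<mu>) 1 else 0) = (if m = \<mu> then Cn (lookup v m) else 0)"
      by simp
  qed
  then show ?thesis by (auto simp: sum.delta' not_in_keys_iff_lookup_eq_zero)
qed

lemma coeff_in_add: "coeff_in A \<mu> (f + g) = coeff_in A \<mu> f + coeff_in A \<mu> g"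
  by (simp add: coeff_in_def plin_add)

lemma coeff_in_sum: "coeff_in A \<mu> (sum f X) = (\<Sum>a\<in>X. coeff_in A \<mu> (f a))"
  by (simp add: coeff_in_def plin_sum)

text \<open>The generators are free of the variables in \<open>A\<close>, so extraction only acts on
  their cofactors. It serves to turn polynomial coefficients into scalar ones and, for
  \<open>\<mu> = 0\<close>, to remove foreign variables from a presentation.\<close>

lemma coeff_in_ideal:
  assumes "G \<subseteq> polys B" "A \<inter> B = {}" "f \<in> ideal.span G"
  shows "coeff_in A \<mu> f \<in> ideal.span G"
  using assms(3)
proof (induction rule: ideal.span_induct_alt)
  case base
  then show ?case by (simp add: coeff_in_def ideal.span_zero)
next
  case (step c x y)
  have "coeff_in A \<mu> (c * x + y) = coeff_in A \<mu> c * x + coeff_in A \<mu> y"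
    using coeff_in_mult[of x B A \<mu> c] assms(1,2) step(1) by (auto simp: coeff_in_add mult.commute)
  also have "\<dots> \<in> ideal.span G" using step
    by (intro ideal.span_add ideal.span_scale) (auto intro: ideal.span_base)
  finally show ?case .
qed

section \<open>Families of polynomials indexed by sets of coloured variables\<close>

type_synonym var = "nat \<times> nat"
type_synonym fam = "var set \<Rightarrow> var pol"

text \<open>The first component of a variable is its colour. The colour type of a set of variables is
  the dimension vector of the corresponding component of the cohomological Hall algebra.\<close>

definition ctype :: "var set \<Rightarrow> nat \<Rightarrow>\<^sub>0 nat" where
  "ctype S = (\<Sum>a\<in>S. single (fst a) 1)"

lemma ctype_empty [simp]: "ctype {} = 0" by (simp add: ctype_def)

lemma ctype_Un: "finite S \<Longrightarrow> finite T \<Longrightarrow> S \<inter> T = {} \<Longrightarrow> ctype (S \<union> T) = ctype S + ctype T"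
  by (simp add: ctype_def sum.union_disjoint)

lemma ctype_Diff: "finite S \<Longrightarrow> T \<subseteq> S \<Longrightarrow> ctype T + ctype (S - T) = ctype S"
  using ctype_Un[of T "S - T"] finite_subset[of T S] by (simp add: Un_absorb1)

lemma deg_ctype: "deg (ctype S) = card S"
  by (cases "finite S") (auto simp: ctype_def, induction S rule: finite_induct, auto simp: deg_add)

lemma ctype_image: "inj_on p S \<Longrightarrow> (\<And>a. a \<in> S \<Longrightarrow> fst (p a) = fst a) \<Longrightarrow> ctype (p ` S) = ctype S"
  by (simp add: ctype_def sum.reindex)

lemma ctype_eq_0: "finite S \<Longrightarrow> ctype S = 0 \<longleftrightarrow> S = {}"
  using deg_ctype[of S] by (auto simp: deg_eq_0[symmetric])

text \<open>In the induction, the colour of the new variable occurs in \<open>\<gamma>\<close> or in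
  \<open>\<gamma>'\<close>; the variable goes into \<open>B\<close> in the first case and stays
  outside in the second.\<close>

lemma ctype_subset_exists:
  assumes "finite S" "\<gamma> + \<gamma>' = ctype S" shows "\<exists>B\<subseteq>S. ctype B = \<gamma>"
  using assms
proof (induction S arbitrary: \<gamma> \<gamma>' rule: finite_induct)
  case empty
  then have "deg \<gamma> = 0" using deg_add[of \<gamma> \<gamma>'] by simp
  then show ?case by (simp add: deg_eq_0)
next
  case (insert a S)
  define e where "e = single (fst a) (1::nat)"
  have c: "\<gamma> + \<gamma>' = e + ctype S" using insert by (simp add: ctype_def e_def)
  have m: "e + (\<delta> - e) = \<delta>" if "lookup \<delta> (fst a) > 0" for \<delta>
    using that by (intro poly_mapping_eqI) (auto simp: lookup_add lookup_minus e_def lookup_single when_def)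
  have "lookup \<gamma> (fst a) + lookup \<gamma>' (fst a) > 0"
    using arg_cong[OF c, of "\<lambda>m. lookup m (fst a)"] by (simp add: lookup_add e_def)
  then consider "lookup \<gamma> (fst a) > 0" | "lookup \<gamma>' (fst a) > 0" by linarith
  then show ?case
  proof cases
    case 1
    have "e + ((\<gamma> - e) + \<gamma>') = e + ctype S" using c m[OF 1] by (metis add.assoc)
    then have "(\<gamma> - e) + \<gamma>' = ctype S" by simp
    then obtain B where B: "B \<subseteq> S" "ctype B = \<gamma> - e" using insert.IH by blast
    then have "ctype (Set.insert a B) = e + ctype B"
      using insert.hyps finite_subset[OF B(1)] by (subst ctype_def, subst sum.insert) (auto simp: ctype_def e_def)
    then show ?thesis using B m[OF 1] by (intro exI[of _ "Set.insert a B"]) auto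
  next
    case 2
    have "e + (\<gamma> + (\<gamma>' - e)) = e + ctype S" using c m[OF 2] by (metis add.left_commute)
    then have "\<gamma> + (\<gamma>' - e) = ctype S" by simp
    then show ?thesis using insert.IH by blast
  qed
qed

lemma sum_sum_mset_swap: "(\<Sum>a\<in>A. \<Sum>w\<in>#M. f w a) = (\<Sum>w\<in>#M. \<Sum>a\<in>A. f w a)"
  by (induction M) (auto simp: sum.distrib)

lemma sum_mset_remove: "w \<in># M \<Longrightarrow> (\<Sum>x\<in>#M. f x) = f w + (\<Sum>x\<in>#M - {#w#}. f x)"
  by (auto dest!: multi_member_split)

text \<open>\<open>h i j\<close> is the number of equal linear factors that the product carries for
  each pair of variables of colours \<open>i\<close> and \<open>j\<close> placed in different
  factors. Evenness on the diagonal makes these powers insensitive to the order of two variables of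
  one colour.\<close>

locale kernel =
  fixes h :: "nat \<Rightarrow> nat \<Rightarrow> nat"
  assumes h_sym: "h i j = h j i" and h_even: "even (h i i)"
begin

text \<open>Orienting the difference by the colours makes \<open>kf\<close> symmetric, so that the product below is
  commutative without sign twists.\<close>

definition kf :: "var \<Rightarrow> var \<Rightarrow> var pol" where
  "kf a b = (if fst a \<le> fst b then V a - V b else V b - V a) ^ h (fst a) (fst b)"

definition K :: "var set \<Rightarrow> var set \<Rightarrow> var pol" where
  "K T U = (\<Prod>a\<in>T. \<Prod>b\<in>U. kf a b)"

lemma kf_sym: "kf a b = kf b a"
proof (cases "fst a = fst b")
  case True
  have "(V a - V b) ^ h (fst a) (fst a) = (V b - V a) ^ h (fst a) (fst a)"
    using power_minus_even[OF h_even[of "fst a"], of "V b - V a"] by simp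
  with True show ?thesis by (simp add: kf_def)
next
  case False
  then show ?thesis using h_sym[of "fst a" "fst b"] by (auto simp: kf_def)
qed

lemma K_sym: "K T U = K U T"
  unfolding K_def by (subst prod.swap) (intro prod.cong refl kf_sym)

lemma K_Un_left: "finite T \<Longrightarrow> finite T' \<Longrightarrow> T \<inter> T' = {} \<Longrightarrow> K (T \<union> T') U = K T U * K T' U"
  by (simp add: K_def prod.union_disjoint)

lemma K_Un_right: "finite U \<Longrightarrow> finite U' \<Longrightarrow> U \<inter> U' = {} \<Longrightarrow> K T (U \<union> U') = K T U * K T U'"
  using K_Un_left[of U U' T] by (simp add: K_sym)

lemma K_empty [simp]: "K {} U = 1" "K T {} = 1"
  by (simp_all add: K_def)

lemma kf_polys: "a \<in> S \<Longrightarrow> b \<in> S \<Longrightarrow> kf a b \<in> polys S"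
  by (auto simp: kf_def intro!: polys_power polys_diff polys_V)

lemma K_polys: "T \<subseteq> S \<Longrightarrow> U \<subseteq> S \<Longrightarrow> K T U \<in> polys S"
  unfolding K_def by (intro polys_prod kf_polys) auto

lemma K_ren:
  assumes "inj_on p (T \<union> U)" "\<And>a. a \<in> T \<union> U \<Longrightarrow> fst (p a) = fst a"
  shows "ren p (K T U) = K (p ` T) (p ` U)"
proof -
  have i: "inj_on p T" "inj_on p U" using assms(1) by (auto intro: inj_on_subset)
  have "ren p (kf a b) = kf (p a) (p b)" if "a \<in> T" "b \<in> U" for a b
    using that assms(2) by (simp add: kf_def ren_power ren_diff)
  then show ?thesis
    by (simp add: K_def ren_prod prod.reindex[OF i(1)] prod.reindex[OF i(2)])
qed

lemma K_homog: "homog (\<Sum>a\<in>T. \<Sum>b\<in>U. h (fst a) (fst b)) (K T U)"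
proof -
  have 1: "homog 1 (if fst a \<le> fst b then V a - V b else V b - V a)" for a b :: var
    using homog_diff[OF homog_V[of a] homog_V[of b]] homog_diff[OF homog_V[of b] homog_V[of a]] by simp
  have "homog (h (fst a) (fst b)) (kf a b)" for a b
    using homog_power[OF 1[of a b], of "h (fst a) (fst b)"] by (simp only: kf_def mult_1_right)
  then show ?thesis unfolding K_def by (intro homog_prod)
qed

lemma der_kf: "finite S \<Longrightarrow> a \<in> S \<Longrightarrow> b \<in> S \<Longrightarrow> der S (kf a b) = 0"
  unfolding kf_def by (intro der_power) (auto simp: der_diff der_V)

lemma der_K: "finite S \<Longrightarrow> T \<subseteq> S \<Longrightarrow> U \<subseteq> S \<Longrightarrow> der S (K T U) = 0"
  unfolding K_def by (intro der_prod der_kf) auto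

text \<open>These kernels occur when the variables of \<open>S\<close> are distributed over two
  non-empty blocks. A product of two families that vanish on the empty set takes its value at a
  finite \<open>S\<close> in the ideal that they generate.\<close>

definition gens :: "var set \<Rightarrow> var pol set" where
  "gens S = {K T (S - T) | T. T \<subseteq> S \<and> T \<noteq> {} \<and> T \<noteq> S}"

definition I :: "var set \<Rightarrow> var pol set" where
  "I S = ideal.span (gens S)"

lemma gens_polys: "gens S \<subseteq> polys S"
  by (auto simp: gens_def intro!: K_polys)

lemma der_gens: "finite S \<Longrightarrow> g \<in> gens S \<Longrightarrow> der S g = 0"
  by (auto simp: gens_def intro!: der_K)

text \<open>Every linear factor of \<open>K B C\<close> joins a variable of \<open>B\<close> to one
  outside \<open>B\<close>. The derivation along \<open>B\<close> takes it to \<open>1\<close> or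
  \<open>- 1\<close>, while it kills the generators, which are built from differences inside
  \<open>B\<close>; so the factors can be cancelled one after the other.\<close>

lemma cancel_K:
  assumes "finite B" "finite C" "B \<inter> C = {}" "u * K B C \<in> I B"
  shows "u \<in> I B"
proof -
  have d: "\<And>g. g \<in> gens B \<Longrightarrow> der B g \<in> ideal.span (gens B)"
    using der_gens[OF assms(1)] by (simp add: ideal.span_zero)
  have kf: "u \<in> I B" if "a \<in> B" "b \<in> C" "u * kf a b \<in> I B" for a b u
  proof -
    have ab: "a \<in> B" "b \<notin> B" using that assms(3) by auto
    show ?thesis
    proof (cases "fst a \<le> fst b")
      case True
      have "der B (V a - V b) = Cn 1" using ab assms(1) by (simp add: der_diff der_V)
      then show ?thesis
        using cancel_power[OF d, of "V a - V b" 1 u "h (fst a) (fst b)"] that(3) True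
        by (simp add: I_def kf_def)
    next
      case False
      have "der B (V b - V a) = Cn (- 1)" using ab assms(1)
        by (simp add: der_diff der_V Cn_uminus)
      then show ?thesis
        using cancel_power[OF d, of "V b - V a" "- 1" u "h (fst a) (fst b)"] that(3) False
        by (simp add: I_def kf_def)
    qed
  qed
  have "u \<in> ideal.span (gens B)" if "a \<in> B" "u * (\<Prod>b\<in>C. kf a b) \<in> ideal.span (gens B)" for a u
    using cancel_prod[OF d assms(2), of "kf a" u] kf that unfolding I_def by blast
  then show ?thesis
    using cancel_prod[OF d assms(1), of "\<lambda>a. \<Prod>b\<in>C. kf a b" u] assms(4) unfolding I_def K_def by blast
qed

section \<open>The shuffle product\<close>

definition star :: "fam \<Rightarrow> fam \<Rightarrow> fam" where
  "star F G S = (if finite S then \<Sum>T\<in>Pow S. F T * G (S - T) * K T (S - T) else 0)"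

definition one_fam :: fam where
  "one_fam S = (if S = {} then 1 else 0)"

lemma star_commute: "star F G = star G F"
proof
  fix S
  have "(\<Sum>T\<in>Pow S. F T * G (S - T) * K T (S - T)) = (\<Sum>T\<in>Pow S. G T * F (S - T) * K T (S - T))"
    by (rule sum.reindex_bij_witness[where i = "\<lambda>T. S - T" and j = "\<lambda>T. S - T"])
      (auto simp: double_diff K_sym mult.commute)
  then show "star F G S = star G F S" by (simp add: star_def)
qed

text \<open>Both sides are the sum over all ordered partitions of \<open>S\<close> into three
  blocks, possibly empty, weighted by the kernels of the three pairs of blocks; this rests on
  \<open>K\<close> being multiplicative in each argument.\<close>

lemma star_assoc: "star (star F G) H = star F (star G H)"
proof
  fix S :: "var set"
  show "star (star F G) H S = star F (star G H) S"
  proof (cases "finite S")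
    case True
    then have fin: "finite T" if "T \<subseteq> S" for T using that finite_subset by blast
    have "star (star F G) H S =
        (\<Sum>U\<in>Pow S. \<Sum>T\<in>Pow U. F T * G (U - T) * K T (U - T) * (H (S - U) * K U (S - U)))"
      using True fin by (auto simp: star_def sum_distrib_right mult.assoc intro!: sum.cong)
    also have "\<dots> = (\<Sum>(U, T)\<in>(SIGMA U:Pow S. Pow U). F T * G (U - T) * K T (U - T) * (H (S - U) * K U (S - U)))"
      using True fin by (subst sum.Sigma) auto
    also have "\<dots> = (\<Sum>(T, W)\<in>(SIGMA T:Pow S. Pow (S - T)).
        F T * (G W * H (S - T - W) * K W (S - T - W)) * K T (S - T))"
    proof (rule sum.reindex_bij_witness[where i = "\<lambda>(T, W). (T \<union> W, T)" and j = "\<lambda>(U, T). (T, U - T)"], goal_cases)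
      case (5 x)
      obtain U T where x: "x = (U, T)" "U \<subseteq> S" "T \<subseteq> U" using 5 by auto
      have e: "S - T - (U - T) = S - U" "T \<union> (U - T) = U" "S - T = (U - T) \<union> (S - U)" using x by auto
      have "K U (S - U) = K T (S - U) * K (U - T) (S - U)"
        using K_Un_left[of T "U - T" "S - U"] fin x e by auto
      moreover have "K T (S - T) = K T (U - T) * K T (S - U)"
        using K_Un_right[of "U - T" "S - U" T] True x fin[OF x(2)] by (subst e(3)) auto
      ultimately show ?case using x e by (simp add: algebra_simps)
    qed auto
    also have "\<dots> = (\<Sum>T\<in>Pow S. \<Sum>W\<in>Pow (S - T).
        F T * (G W * H (S - T - W) * K W (S - T - W)) * K T (S - T))"
      using True fin by (subst sum.Sigma) auto
    also have "\<dots> = star F (star G H) S"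
      using True fin by (auto simp: star_def sum_distrib_left sum_distrib_right intro!: sum.cong)
    finally show ?thesis .
  qed (simp add: star_def)
qed

lemma star_left_commute: "star F (star G H) = star G (star F H)"
  by (metis star_assoc star_commute)

lemma star_one: "finite S \<Longrightarrow> star F one_fam S = F S"
proof -
  assume S: "finite S"
  have "star F one_fam S = (\<Sum>T\<in>Pow S. if T = S then F S else 0)"
    unfolding star_def one_fam_def if_P[OF S] by (intro sum.cong refl) auto
  also have "\<dots> = F S" using S by (simp add: sum.delta')
  finally show ?thesis .
qed

text \<open>Left commutativity is what the fold needs. The family \<open>one_fam\<close> is a unit
  on finite sets only, because products are zero on infinite ones.\<close>

definition Pi :: "('w \<Rightarrow> fam) \<Rightarrow> 'w multiset \<Rightarrow> fam" where
  "Pi g M = fold_mset (\<lambda>w. star (g w)) one_fam M"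

lemma Pi_empty [simp]: "Pi g {#} = one_fam" by (simp add: Pi_def)

lemma Pi_add_mset [simp]: "Pi g (add_mset w M) = star (g w) (Pi g M)"
proof -
  interpret comp_fun_commute "\<lambda>w. star (g w)"
    by unfold_locales (auto simp: star_left_commute)
  show ?thesis by (simp add: Pi_def)
qed

text \<open>The subsets \<open>T\<close> are sorted by how they meet \<open>B\<close>. If
  \<open>T\<close> cuts \<open>B\<close> into two non-empty pieces, then \<open>K T (S - T)\<close>
  has the factor \<open>K (T \<inter> B) (B - T \<inter> B)\<close>, a generator of
  \<open>I B\<close>. In the two remaining cases \<open>B\<close> lies inside \<open>T\<close> or
  inside its complement.\<close>

lemma star_split:
  assumes "finite S" "B \<subseteq> S" "B \<noteq> {}"
  shows "star F G S - ((\<Sum>T\<in>Pow (S - B). F (B \<union> T) * G (S - B - T) * K (B \<union> T) (S - B - T)) +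
    (\<Sum>T\<in>Pow (S - B). F T * G (S - T) * K T (S - T))) \<in> I B"
proof -
  define X where "X T = F T * G (S - T) * K T (S - T)" for T
  define P1 where "P1 = {T\<in>Pow S. B \<subseteq> T}"
  define P2 where "P2 = Pow (S - B)"
  define P3 where "P3 = {T\<in>Pow S. \<not> B \<subseteq> T \<and> T \<inter> B \<noteq> {}}"
  have fin: "finite P1" "finite P2" "finite P3" using assms(1) by (auto simp: P1_def P2_def P3_def)
  have "star F G S = sum X (Pow S)" using assms by (simp add: star_def X_def)
  also have "Pow S = P1 \<union> P2 \<union> P3" using assms by (auto simp: P1_def P2_def P3_def)
  also have "sum X \<dots> = sum X P1 + sum X P2 + sum X P3"
    using fin assms(3) by (subst sum.union_disjoint; (subst sum.union_disjoint)?) (auto simp: P1_def P2_def P3_def)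
  finally have e: "star F G S - (sum X P1 + sum X P2) = sum X P3" by simp
  have "sum X P1 = (\<Sum>T\<in>Pow (S - B). F (B \<union> T) * G (S - B - T) * K (B \<union> T) (S - B - T))"
    unfolding P1_def
  proof (rule sum.reindex_bij_witness[where i = "\<lambda>T. B \<union> T" and j = "\<lambda>T. T - B"], goal_cases)
    case (5 T)
    then have e: "B \<union> (T - B) = T" "S - B - (T - B) = S - T" by auto
    show ?case unfolding X_def e ..
  qed (use assms in auto)
  moreover have "X T \<in> I B" if "T \<in> P3" for T
  proof -
    have T: "T \<subseteq> S" "\<not> B \<subseteq> T" "T \<inter> B \<noteq> {}" using that by (auto simp: P3_def)
    have fT: "finite T" "finite (S - T)" using T(1) assms(1) finite_subset by auto
    have "K T (S - T) = K (T \<inter> B \<union> (T - B)) (S - T)" by (simp add: Int_Diff_Un)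
    also have "\<dots> = K (T \<inter> B) (S - T) * K (T - B) (S - T)" using fT by (intro K_Un_left) auto
    finally have 1: "K T (S - T) = K (T \<inter> B) (S - T) * K (T - B) (S - T)" .
    have e: "S - T = (B - T \<inter> B) \<union> (S - T - B)" using assms by auto
    have 2: "K (T \<inter> B) (S - T) = K (T \<inter> B) (B - T \<inter> B) * K (T \<inter> B) (S - T - B)"
      using fT finite_subset[OF assms(2,1)] by (subst e, intro K_Un_right) auto
    obtain Y where "K T (S - T) = K (T \<inter> B) (B - T \<inter> B) * Y"
      unfolding 1 2 mult.assoc by blast
    moreover have "K (T \<inter> B) (B - T \<inter> B) \<in> I B"
      unfolding I_def using T by (intro ideal.span_base) (auto simp: gens_def)
    ultimately show ?thesis
      by (simp add: X_def I_def ideal.span_scale ideal_mult_right)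
  qed
  then have "sum X P3 \<in> I B" unfolding I_def by (intro ideal.span_sum) auto
  ultimately show ?thesis using e by (simp add: X_def P2_def)
qed

text \<open>Modulo \<open>I B\<close> a product only sees the ways to let one of its factors occupy \<open>B\<close> exactly,
  provided that no factor lives on a proper superset of \<open>B\<close>.\<close>

lemma Pi_split:
  assumes "finite S" "B \<subseteq> S" "B \<noteq> {}"
    and "\<And>w T. w \<in># M \<Longrightarrow> finite T \<Longrightarrow> B \<subset> T \<Longrightarrow> g w T = 0"
  shows "Pi g M S - (\<Sum>w\<in>#M. g w B * Pi g (M - {#w#}) (S - B)) * K B (S - B) \<in> I B"
  using assms
proof (induction M arbitrary: S)
  case empty
  then show ?case by (auto simp: one_fam_def I_def ideal.span_zero)
next
  case (add w M)
  note fS = add.prems(1) and BS = add.prems(2) and B = add.prems(3)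
  define W where "W U = (\<Sum>w'\<in>#M. g w' B * Pi g (M - {#w'#}) U)" for U
  define A1 where "A1 = (\<Sum>T\<in>Pow (S - B). g w (B \<union> T) * Pi g M (S - B - T) * K (B \<union> T) (S - B - T))"
  define A2 where "A2 = (\<Sum>T\<in>Pow (S - B). g w T * Pi g M (S - T) * K T (S - T))"
  define A3 where "A3 = (\<Sum>T\<in>Pow (S - B). g w T * (W (S - T - B) * K B (S - T - B)) * K T (S - T))"
  have 1: "Pi g (add_mset w M) S - (A1 + A2) \<in> I B"
    unfolding A1_def A2_def Pi_add_mset by (rule star_split[OF fS BS B])
  \<comment> \<open>Unless \<open>T\<close> is empty, \<open>B \<union> T\<close> strictly contains
    \<open>B\<close>, and there \<open>g w\<close> vanishes by hypothesis.\<close>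
  have "A1 = (\<Sum>T\<in>Pow (S - B). if T = {} then g w B * Pi g M (S - B) * K B (S - B) else 0)"
    unfolding A1_def
  proof (intro sum.cong refl)
    fix T assume T: "T \<in> Pow (S - B)"
    show "g w (B \<union> T) * Pi g M (S - B - T) * K (B \<union> T) (S - B - T) =
      (if T = {} then g w B * Pi g M (S - B) * K B (S - B) else 0)"
    proof (cases "T = {}")
      case False
      then have "B \<subset> B \<union> T" "finite (B \<union> T)" using T fS BS finite_subset[of "B \<union> T" S] by auto
      then have "g w (B \<union> T) = 0" using add.prems(4)[of w "B \<union> T"] by simp
      then show ?thesis using False by simp
    qed simp
  qed
  then have A1: "A1 = g w B * Pi g M (S - B) * K B (S - B)" using fS by (simp add: sum.delta')
  \<comment> \<open>Here \<open>B\<close> lies in the part \<open>S - T\<close> left to the factors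
    from \<open>M\<close>, and the induction hypothesis applies on this set.\<close>
  have "A2 - A3 = (\<Sum>T\<in>Pow (S - B). g w T * K T (S - T) * (Pi g M (S - T) - W (S - T - B) * K B (S - T - B)))"
    by (simp add: A2_def A3_def sum_subtractf algebra_simps)
  also have "\<dots> \<in> I B"
    unfolding I_def
  proof (intro ideal.span_sum ideal.span_scale)
    fix T assume "T \<in> Pow (S - B)"
    then have "B \<subseteq> S - T" using BS by auto
    then show "Pi g M (S - T) - W (S - T - B) * K B (S - T - B) \<in> ideal.span (gens B)"
      using add.IH[of "S - T"] fS B add.prems(4) by (simp add: W_def I_def)
  qed
  finally have 2: "A2 - A3 \<in> I B" .
  \<comment> \<open>The factor \<open>K B (S - B)\<close> can be taken out, since it is the product
    of \<open>K B T\<close> and \<open>K B (S - B - T)\<close>.\<close>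
  have "A3 = (\<Sum>T\<in>Pow (S - B). g w T * W (S - B - T) * K T (S - B - T)) * K B (S - B)"
    unfolding A3_def sum_distrib_right
  proof (intro sum.cong refl)
    fix T assume T: "T \<in> Pow (S - B)"
    have f: "finite T" "finite B" using T fS BS finite_subset by blast+
    have e: "S - T = B \<union> (S - B - T)" "S - B = T \<union> (S - B - T)" "S - T - B = S - B - T" using T BS by auto
    have "K T (S - T) = K T B * K T (S - B - T)" using f fS by (subst e(1), intro K_Un_right) auto
    moreover have "K B (S - B) = K B T * K B (S - B - T)" using f fS by (subst e(2), intro K_Un_right) auto
    ultimately show "g w T * (W (S - T - B) * K B (S - T - B)) * K T (S - T) =
      g w T * W (S - B - T) * K T (S - B - T) * K B (S - B)"
      unfolding e(3) by (simp add: K_sym[of T B] algebra_simps)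
  qed
  also have "(\<Sum>T\<in>Pow (S - B). g w T * W (S - B - T) * K T (S - B - T)) =
      (\<Sum>w'\<in>#M. g w' B * star (g w) (Pi g (M - {#w'#})) (S - B))"
    using fS by (simp only: W_def sum_mset_distrib_left sum_mset_distrib_right sum_sum_mset_swap star_def
        finite_Diff if_True sum_distrib_left mult_ac)
  also have "\<dots> = (\<Sum>w'\<in>#M. g w' B * Pi g (add_mset w M - {#w'#}) (S - B))"
    by (intro arg_cong[of _ _ sum_mset] image_mset_cong) (auto simp: Pi_add_mset[symmetric] simp del: Pi_add_mset)
  finally have A3: "A3 = (\<Sum>w'\<in>#M. g w' B * Pi g (add_mset w M - {#w'#}) (S - B)) * K B (S - B)" .
  have "A1 + A3 = (\<Sum>w'\<in>#add_mset w M. g w' B * Pi g (add_mset w M - {#w'#}) (S - B)) * K B (S - B)"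
    by (simp add: A1 A3 distrib_right)
  moreover have "Pi g (add_mset w M) S - (A1 + A3) \<in> I B"
    using ideal.span_add[OF 1[unfolded I_def] 2[unfolded I_def]] by (simp add: I_def algebra_simps)
  ultimately show ?case by simp
qed

section \<open>Linear independence of products\<close>

lemma sum_mset_count:
  fixes f :: "'w \<Rightarrow> 'b::comm_semiring_1"
  assumes "finite A" "set_mset M \<subseteq> A"
  shows "(\<Sum>w\<in>#M. f w) = (\<Sum>w\<in>A. of_nat (count M w) * f w)"
  using assms(2)
proof (induction M)
  case (add x M)
  have "(\<Sum>w\<in>A. of_nat (count (add_mset x M) w) * f w) =
      (\<Sum>w\<in>A. (if w = x then f x else 0) + of_nat (count M w) * f w)"
    by (intro sum.cong refl) (auto simp: algebra_simps)
  also have "\<dots> = f x + (\<Sum>w\<in>A. of_nat (count M w) * f w)"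
    using add.prems assms(1) by (simp add: sum.distrib sum.delta)
  finally show ?case using add by simp
qed simp

lemma Pi_polys:
  assumes "\<And>w T. w \<in># M \<Longrightarrow> g w T \<in> polys T"
  shows "Pi g M S \<in> polys S"
  using assms
proof (induction M arbitrary: S)
  case (add w M)
  have "g w T * Pi g M (S - T) * K T (S - T) \<in> polys S" if "T \<subseteq> S" for T
    using add that polys_mono[of T S] polys_mono[of "S - T" S]
    by (intro polys_mult K_polys) (auto simp: subset_iff)
  then show ?case by (auto simp: star_def intro!: polys_sum)
qed (auto simp: one_fam_def)

text \<open>A relation is localised at a set \<open>B\<close> whose type is that of a generator
  \<open>w0\<close> of the largest size occurring. By this choice all occurring generators vanish on
  proper supersets of \<open>B\<close>, so \<open>Pi_split\<close> makes the relation linear in the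
  values on \<open>B\<close>, modulo \<open>I B\<close> and up to a factor that
  \<open>cancel_K\<close> removes. Independence modulo \<open>I B\<close> isolates the cofactor of
  \<open>w0\<close>, which is a relation on the smaller set \<open>S - B\<close>.\<close>

lemma Pi_independent:
  fixes g :: "'w \<Rightarrow> fam" and \<gamma> :: "'w \<Rightarrow> nat \<Rightarrow>\<^sub>0 nat"
  assumes supp: "\<And>w S. w \<in> \<Omega> \<Longrightarrow> finite S \<Longrightarrow> ctype S \<noteq> \<gamma> w \<Longrightarrow> g w S = 0"
    and pol: "\<And>w S. w \<in> \<Omega> \<Longrightarrow> g w S \<in> polys S"
    and nz: "\<And>w. w \<in> \<Omega> \<Longrightarrow> \<gamma> w \<noteq> 0"
    and indep: "\<And>B A c w. finite B \<Longrightarrow> finite A \<Longrightarrow> A \<subseteq> {w\<in>\<Omega>. \<gamma> w = ctype B} \<Longrightarrow>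
      (\<Sum>w\<in>A. Cn (c w) * g w B) \<in> I B \<Longrightarrow> w \<in> A \<Longrightarrow> c w = 0"
  shows "finite S \<Longrightarrow> finite \<M> \<Longrightarrow> \<forall>M\<in>\<M>. set_mset M \<subseteq> \<Omega> \<and> (\<Sum>w\<in>#M. \<gamma> w) = ctype S \<Longrightarrow>
    (\<Sum>M\<in>\<M>. Cn (c M) * Pi g M S) = 0 \<Longrightarrow> M \<in> \<M> \<Longrightarrow> c M = 0"
proof (induction "card S" arbitrary: S \<M> c M rule: less_induct)
  case less
  note fS = less.prems(1) and fM = less.prems(2)
  have \<M>: "set_mset M \<subseteq> \<Omega>" "(\<Sum>w\<in>#M. \<gamma> w) = ctype S" if "M \<in> \<M>" for M
    using less.prems(3) that by auto
  show ?case
  proof (cases "S = {}")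
    case True
    have "M = {#}" if "M \<in> \<M>" for M
    proof (cases M)
      case (add w M')
      have "deg (\<gamma> w) = 0"
        using arg_cong[OF \<M>(2)[OF that], of deg] by (simp add: True add deg_add)
      then show ?thesis using nz[of w] \<M>(1)[OF that] by (simp add: add deg_eq_0)
    qed simp
    then have "\<M> = {{#}}" "M = {#}" using less.prems(5) by auto
    then show ?thesis using less.prems(4)
      by (simp add: one_fam_def True) (metis Cn_def lookup_single_eq lookup_zero)
  next
    case False
    \<comment> \<open>Only products with a non-zero coefficient may influence the choice of
      \<open>w0\<close> below; otherwise the induction would yield no contradiction.\<close>
    define \<M>' where "\<M>' = {M\<in>\<M>. c M \<noteq> 0}"
    have fM': "finite \<M>'" using fM by (simp add: \<M>'_def)
    show ?thesis
    proof (rule ccontr)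
      assume "c M \<noteq> 0"
      then have M: "M \<in> \<M>'" using less.prems(5) by (simp add: \<M>'_def)
      define W where "W = (\<Union>M\<in>\<M>'. set_mset M)"
      have W: "finite W" "W \<subseteq> \<Omega>" using fM' \<M>(1) by (auto simp: W_def \<M>'_def)
      have "M \<noteq> {#}"
      proof
        assume "M = {#}"
        then have "ctype S = 0" using \<M>(2)[OF less.prems(5)] by simp
        then show False using False ctype_eq_0[OF fS] by simp
      qed
      then have "W \<noteq> {}" using M by (auto simp: W_def)
      define d where "d = Max ((\<lambda>w. deg (\<gamma> w)) ` W)"
      have "d \<in> (\<lambda>w. deg (\<gamma> w)) ` W" unfolding d_def using W \<open>W \<noteq> {}\<close> by (intro Max_in) auto
      then obtain w0 where w0: "w0 \<in> W" "deg (\<gamma> w0) = d" by auto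
      have dmax: "deg (\<gamma> w) \<le> d" if "w \<in> W" for w
        using W that by (auto simp: d_def intro!: Max_ge)
      obtain M0 where M0: "M0 \<in> \<M>'" "w0 \<in># M0" using w0 by (auto simp: W_def)
      have "\<gamma> w0 + (\<Sum>w\<in>#M0 - {#w0#}. \<gamma> w) = ctype S"
        using \<M>(2)[of M0] M0 by (simp add: \<M>'_def sum_mset_remove[of w0])
      then obtain B where B: "B \<subseteq> S" "ctype B = \<gamma> w0"
        using ctype_subset_exists[OF fS] by blast
      have fB: "finite B" using B fS finite_subset by blast
      have "B \<noteq> {}" using B nz[of w0] w0 W by auto
      have gz: "g w T = 0" if "w \<in> W" "finite T" "B \<subset> T" for w T
      proof -
        have "card B < card T" using that by (intro psubset_card_mono)
        then have "ctype T \<noteq> \<gamma> w" using dmax[OF that(1)] w0(2) B(2) by (metis deg_ctype not_less)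
        then show ?thesis using supp that W by blast
      qed
      \<comment> \<open>The cofactor of \<open>g w B\<close>: the relation with one factor
        \<open>w\<close> removed, each product counted as often as \<open>w\<close> occurs in
        it.\<close>
      define v where "v w = (\<Sum>M\<in>\<M>'. Cn (c M * of_nat (count M w)) * Pi g (M - {#w#}) (S - B))" for w
      define u where "u = (\<Sum>w\<in>W. g w B * v w)"
      have "(\<Sum>M\<in>\<M>'. Cn (c M) * Pi g M S) = (\<Sum>M\<in>\<M>. Cn (c M) * Pi g M S)"
        unfolding \<M>'_def by (rule sum.mono_neutral_left) (use fM in auto)
      then have 0: "(\<Sum>M\<in>\<M>'. Cn (c M) * Pi g M S) = 0" using less.prems(4) by simp
      have "(\<Sum>M\<in>\<M>'. Cn (c M) * (Pi g M S - (\<Sum>w\<in>#M. g w B * Pi g (M - {#w#}) (S - B)) * K B (S - B))) \<in> I B"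
        unfolding I_def
      proof (intro ideal.span_sum ideal.span_scale)
        fix M assume "M \<in> \<M>'"
        then have "w \<in> W" if "w \<in># M" for w using that by (auto simp: W_def)
        then show "Pi g M S - (\<Sum>w\<in>#M. g w B * Pi g (M - {#w#}) (S - B)) * K B (S - B) \<in> ideal.span (gens B)"
          unfolding I_def[symmetric] by (intro Pi_split fS B \<open>B \<noteq> {}\<close> gz)
      qed
      also have "(\<Sum>M\<in>\<M>'. Cn (c M) * (Pi g M S - (\<Sum>w\<in>#M. g w B * Pi g (M - {#w#}) (S - B)) * K B (S - B))) =
          - (\<Sum>M\<in>\<M>'. Cn (c M) * (\<Sum>w\<in>#M. g w B * Pi g (M - {#w#}) (S - B))) * K B (S - B)"
        by (simp only: right_diff_distrib sum_subtractf 0 sum_distrib_right mult.assoc mult_minus_left diff_0)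
      also have "(\<Sum>M\<in>\<M>'. Cn (c M) * (\<Sum>w\<in>#M. g w B * Pi g (M - {#w#}) (S - B))) =
          (\<Sum>M\<in>\<M>'. \<Sum>w\<in>W. g w B * (Cn (c M * of_nat (count M w)) * Pi g (M - {#w#}) (S - B)))"
      proof (intro sum.cong refl)
        fix M assume "M \<in> \<M>'"
        then have "set_mset M \<subseteq> W" by (auto simp: W_def)
        from sum_mset_count[OF W(1) this, of "\<lambda>w. g w B * Pi g (M - {#w#}) (S - B)"]
        show "Cn (c M) * (\<Sum>w\<in>#M. g w B * Pi g (M - {#w#}) (S - B)) =
          (\<Sum>w\<in>W. g w B * (Cn (c M * of_nat (count M w)) * Pi g (M - {#w#}) (S - B)))"
          by (simp add: sum_distrib_left Cn_mult Cn_of_nat mult_ac)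
      qed
      also have "\<dots> = u"
        unfolding u_def v_def by (subst sum.swap) (simp add: sum_distrib_left)
      finally have "- u * K B (S - B) \<in> I B" .
      then have "- u \<in> I B" by (rule cancel_K[OF fB _ _, rotated 2]) (use fS in auto)
      from ideal.span_neg[OF this[unfolded I_def]] have u: "u \<in> I B" by (simp add: I_def)
      have v0: "v w0 = 0"
      proof (rule poly_mapping_eqI)
        fix \<mu>
        \<comment> \<open>The cofactors only involve variables outside \<open>B\<close>, so their
          coefficients at \<open>\<mu>\<close> are scalars, while the values \<open>g w B\<close>
          are constants for the extraction.\<close>
        have v: "v w \<in> polys (S - B)" for w
          unfolding v_def using pol \<M>(1)
          by (intro polys_sum polys_mult Pi_polys polys_Cn) (auto simp: \<M>'_def dest!: in_diffD)
        define A where "A = {w\<in>W. \<gamma> w = ctype B}"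
        have "coeff_in (S - B) \<mu> u = (\<Sum>w\<in>W. g w B * Cn (lookup (v w) \<mu>))"
          unfolding u_def coeff_in_sum
          by (intro sum.cong refl, subst coeff_in_mult[of _ B]) (use W pol coeff_in_polys[OF v] in auto)
        also have "\<dots> = (\<Sum>w\<in>A. g w B * Cn (lookup (v w) \<mu>))"
        proof (rule sum.mono_neutral_right)
          have "g w B = 0" if "w \<in> W - A" for w
            using that W(2) supp[of w B] fB by (auto simp: A_def)
          then show "\<forall>w\<in>W - A. g w B * Cn (lookup (v w) \<mu>) = 0" by simp
        qed (use W in \<open>auto simp: A_def\<close>)
        finally have "(\<Sum>w\<in>A. Cn (lookup (v w) \<mu>) * g w B) \<in> I B"
          using coeff_in_ideal[OF gens_polys _ u[unfolded I_def], of "S - B" \<mu>]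
          by (auto simp: I_def mult.commute)
        moreover have "finite A" "A \<subseteq> {w\<in>\<Omega>. \<gamma> w = ctype B}" "w0 \<in> A"
          using W w0 B by (auto simp: A_def)
        ultimately show "lookup (v w0) \<mu> = lookup 0 \<mu>"
          using indep[OF fB, of A "\<lambda>w. lookup (v w) \<mu>" w0] by simp
      qed
      define N where "N = (\<lambda>M. M - {#w0#}) ` {M\<in>\<M>'. w0 \<in># M}"
      \<comment> \<open>Removing \<open>w0\<close> multiplies a coefficient by the multiplicity of
        \<open>w0\<close>, which is not zero in characteristic zero.\<close>
      define c' where "c' M = c (add_mset w0 M) * of_nat (count (add_mset w0 M) w0)" for M
      have "0 = (\<Sum>M\<in>{M\<in>\<M>'. w0 \<in># M}. Cn (c M * of_nat (count M w0)) * Pi g (M - {#w0#}) (S - B))"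
        unfolding v0[symmetric] v_def
        by (rule sum.mono_neutral_right) (use fM' in \<open>auto simp: not_in_iff\<close>)
      also have "\<dots> = (\<Sum>M\<in>N. Cn (c' M) * Pi g M (S - B))"
        unfolding N_def
        by (subst sum.reindex) (auto simp: c'_def inj_on_def insert_DiffM2 intro!: sum.cong dest: arg_cong[of _ _ "add_mset w0"])
      finally have 1: "(\<Sum>M\<in>N. Cn (c' M) * Pi g M (S - B)) = 0" ..
      have 2: "set_mset M \<subseteq> \<Omega> \<and> (\<Sum>w\<in>#M. \<gamma> w) = ctype (S - B)" if M: "M \<in> N" for M
      proof -
        obtain M1 where M1: "M1 \<in> \<M>'" "w0 \<in># M1" "M = M1 - {#w0#}" using M by (auto simp: N_def)
        have "\<gamma> w0 + (\<Sum>w\<in>#M. \<gamma> w) = ctype B + ctype (S - B)"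
          using \<M>(2)[of M1] M1 ctype_Diff[OF fS B(1)] by (simp add: \<M>'_def sum_mset_remove[of w0])
        then show ?thesis using \<M>(1)[of M1] M1 B(2) by (auto simp: \<M>'_def dest: in_diffD)
      qed
      have "card (S - B) < card S"
        using B fS \<open>B \<noteq> {}\<close> by (intro psubset_card_mono) auto
      moreover have "M0 - {#w0#} \<in> N" using M0 by (auto simp: N_def)
      moreover have "finite N" using fM' by (simp add: N_def)
      ultimately have "c' (M0 - {#w0#}) = 0"
        using less.hyps[of "S - B" N c' "M0 - {#w0#}"] fS 1 2 by blast
      then show False using M0 by (auto simp: c'_def \<M>'_def insert_DiffM2 count_eq_zero_iff)
    qed
  qed
qed

end

section \<open>Colour-preserving permutations and symmetrisation\<close>

definition cperm :: "(var \<Rightarrow> var) \<Rightarrow> bool" where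
  "cperm q \<longleftrightarrow> bij q \<and> (\<forall>a. fst (q a) = fst a)"

lemma lookup_ctype: "finite S \<Longrightarrow> lookup (ctype S) i = card {a\<in>S. fst a = i}"
proof -
  assume S: "finite S"
  have "lookup (ctype S) i = (\<Sum>a\<in>S. if fst a = i then 1 else 0)"
    by (simp add: ctype_def lookup_sum lookup_single when_def cong: if_cong)
  then show ?thesis using S by (simp add: sum.If_cases Int_def)
qed

lemma ctype_eq_bij:
  assumes "finite S" "finite T" "ctype S = ctype T"
  shows "\<exists>f. bij_betw f S T \<and> (\<forall>a\<in>S. fst (f a) = fst a)"
  using assms
proof (induction S arbitrary: T rule: finite_induct)
  case empty
  then have "T = {}" using ctype_eq_0[of T] by simp
  then show ?case by (simp add: bij_betw_def)
next
  case (insert a S)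
  have "lookup (ctype T) (fst a) > 0"
    unfolding insert.prems(2)[symmetric] using insert.hyps
    by (simp add: ctype_def lookup_add)
  then have "{b\<in>T. fst b = fst a} \<noteq> {}"
    using lookup_ctype[OF insert.prems(1), of "fst a"] by (auto simp: card_gt_0_iff)
  then obtain b where b: "b \<in> T" "fst b = fst a" by blast
  have "single (fst a) 1 + ctype S = single (fst a) 1 + ctype (T - {b})"
    using insert.prems(2) insert.hyps b insert.prems(1)
    by (simp add: ctype_def sum.remove[of T b])
  then have "ctype S = ctype (T - {b})" by simp
  then obtain f where f: "bij_betw f S (T - {b})" "\<forall>a\<in>S. fst (f a) = fst a"
    using insert.IH[of "T - {b}"] insert.prems(1) by auto
  define f' where "f' = f(a := b)"
  have "bij_betw f' S (T - {b})" using f(1) insert.hyps(2)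
    by (subst bij_betw_cong[of S f' f]) (auto simp: f'_def)
  then have "bij_betw f' (S \<union> {a}) (T - {b} \<union> {f' a})"
    using insert.hyps by (intro notIn_Un_bij_betw) (auto simp: f'_def)
  moreover have "S \<union> {a} = Set.insert a S" "T - {b} \<union> {f' a} = T" using b by (auto simp: f'_def)
  ultimately have "bij_betw f' (Set.insert a S) T" by (simp only:)
  moreover have "\<forall>x\<in>Set.insert a S. fst (f' x) = fst x" using f(2) b by (auto simp: f'_def)
  ultimately show ?case by blast
qed

text \<open>The sets \<open>S - B\<close> and \<open>B - S\<close> have the same type, so a
  colour-preserving bijection back from the first to the second closes \<open>p\<close> up; all
  other variables are fixed.\<close>

lemma extend_cperm:
  assumes "finite B" "bij_betw p B S" "\<And>a. a \<in> B \<Longrightarrow> fst (p a) = fst a"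
  shows "\<exists>q. cperm q \<and> (\<forall>a\<in>B. q a = p a)"
proof -
  have S: "finite S" using assms bij_betw_finite by blast
  have "ctype S = ctype B"
    using ctype_image[of p B] assms by (auto simp: bij_betw_def)
  then have "ctype (S \<inter> B) + ctype (S - B) = ctype (S \<inter> B) + ctype (B - S)"
    using ctype_Diff[OF S, of "S \<inter> B"] ctype_Diff[OF assms(1), of "S \<inter> B"]
    by (simp add: Diff_Int)
  then have "ctype (S - B) = ctype (B - S)" by simp
  then obtain f where f: "bij_betw f (S - B) (B - S)" "\<forall>a\<in>S - B. fst (f a) = fst a"
    using ctype_eq_bij[of "S - B" "B - S"] S assms(1) by auto
  define q where "q a = (if a \<in> B then p a else if a \<in> S then f a else a)" for a
  have "bij_betw q B S" using assms(2) by (subst bij_betw_cong[of B q p]) (auto simp: q_def)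
  moreover have "bij_betw q (S - B) (B - S)" using f(1) by (subst bij_betw_cong[of "S - B" q f]) (auto simp: q_def)
  ultimately have "bij_betw q (B \<union> (S - B)) (S \<union> (B - S))" by (intro bij_betw_combine) auto
  moreover have "bij_betw q (- (B \<union> S)) (- (B \<union> S))"
    by (subst bij_betw_cong[of _ q id]) (auto simp: q_def)
  moreover have "B \<union> (S - B) = B \<union> S" "S \<union> (B - S) = B \<union> S" by auto
  ultimately have "bij_betw q (B \<union> S \<union> - (B \<union> S)) (B \<union> S \<union> - (B \<union> S))"
    by (intro bij_betw_combine[of q "B \<union> S"]) (simp_all only: Compl_disjoint)
  then have "bij q" by (simp only: Compl_partition)
  then show ?thesis using assms(3) f(2) by (intro exI[of _ q]) (auto simp: cperm_def q_def)
qed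

text \<open>Extensionality lets each bijection occur once, so that sums over them are
  finite.\<close>

definition Bij :: "var set \<Rightarrow> var set \<Rightarrow> (var \<Rightarrow> var) set" where
  "Bij B S = {p \<in> extensional B. bij_betw p B S \<and> (\<forall>a\<in>B. fst (p a) = fst a)}"

lemma finite_Bij: "finite B \<Longrightarrow> finite (Bij B S)"
proof (cases "finite S")
  case True
  assume "finite B"
  have "Bij B S \<subseteq> B \<rightarrow>\<^sub>E S" by (auto simp: Bij_def bij_betw_def PiE_def)
  then show ?thesis using finite_PiE[OF \<open>finite B\<close>, of "\<lambda>_. S"] True finite_subset by blast
next
  case False
  assume "finite B"
  then have "Bij B S = {}" using False bij_betw_finite by (auto simp: Bij_def)
  then show ?thesis by simp
qed

lemma Bij_ctype: "p \<in> Bij B S \<Longrightarrow> ctype S = ctype B"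
  using ctype_image[of p B] by (auto simp: Bij_def bij_betw_def)

lemma Bij_comp:
  assumes "cperm q"
  shows "bij_betw (\<lambda>p. restrict (q \<circ> p) B) (Bij B S) (Bij B (q ` S))"
proof (rule bij_betw_byWitness[where f' = "\<lambda>p. restrict (inv_into UNIV q \<circ> p) B"])
  have q: "bij q" "inj q" "\<And>a. fst (q a) = fst a" using assms by (auto simp: cperm_def bij_def)
  have iq: "fst (inv_into UNIV q a) = fst a" for a by (metis q(1,3) bij_inv_eq_iff)
  have qS: "bij_betw q X (q ` X)" for X by (rule bij_betw_subset[OF q(1)]) auto
  have iqS: "bij_betw (inv_into UNIV q) (q ` X) X" for X
    using bij_betw_inv_into_subset[OF q(1), of X "q ` X"] by simp
  show "\<forall>p\<in>Bij B S. restrict (inv_into UNIV q \<circ> restrict (q \<circ> p) B) B = p"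
    using q by (auto simp: Bij_def fun_eq_iff extensional_def)
  show "\<forall>p\<in>Bij B (q ` S). restrict (q \<circ> restrict (inv_into UNIV q \<circ> p) B) B = p"
    using q by (auto simp: Bij_def fun_eq_iff extensional_def bij_is_surj surj_f_inv_f)
  have gen: "restrict (r \<circ> p) B \<in> Bij B (r ` X)"
    if "p \<in> Bij B X" "\<And>a. fst (r a) = fst a" "bij_betw r X (r ` X)" for r p X
    using that bij_betw_trans[of p B X r "r ` X"] by (simp add: Bij_def)
  show "(\<lambda>p. restrict (q \<circ> p) B) ` Bij B S \<subseteq> Bij B (q ` S)"
    using gen[OF _ q(3) qS] by blast
  have "inv_into UNIV q ` q ` S = S" using iqS[of S] by (simp add: bij_betw_def)
  then show "(\<lambda>p. restrict (inv_into UNIV q \<circ> p) B) ` Bij B (q ` S) \<subseteq> Bij B S"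
    using gen[OF _ iq, of _ "q ` S"] iqS[of S] by auto
qed

text \<open>For fixed \<open>S\<close> this says that \<open>F S\<close> is symmetric in the
  variables of each colour; for varying \<open>S\<close> it says that one value determines those on
  all sets of the same type.\<close>

definition natural :: "fam \<Rightarrow> bool" where
  "natural F \<longleftrightarrow> (\<forall>q S. cperm q \<longrightarrow> finite S \<longrightarrow> ren q (F S) = F (q ` S))"

text \<open>Symmetrisation of \<open>f\<close> without division, transported at the same time to
  every set \<open>S\<close> of the type of \<open>B\<close>.\<close>

definition orbp :: "var set \<Rightarrow> var pol \<Rightarrow> fam" where
  "orbp B f S = (\<Sum>p\<in>Bij B S. ren p f)"

lemma orbp_natural:
  assumes "finite B" "f \<in> polys B" shows "natural (orbp B f)"
  unfolding natural_def
proof (intro allI impI)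
  fix q S assume q: "cperm q"
  have "ren q (orbp B f S) = (\<Sum>p\<in>Bij B S. ren (restrict (q \<circ> p) B) f)"
    unfolding orbp_def ren_sum ren_ren using assms(2) by (intro sum.cong refl ren_cong) auto
  also have "\<dots> = orbp B f (q ` S)"
    unfolding orbp_def by (rule sum.reindex_bij_betw[OF Bij_comp[OF q]])
  finally show "ren q (orbp B f S) = orbp B f (q ` S)" .
qed

lemma orbp_polys: "f \<in> polys B \<Longrightarrow> orbp B f S \<in> polys S"
  unfolding orbp_def
proof (intro polys_sum)
  fix p assume "f \<in> polys B" "p \<in> Bij B S"
  then show "ren p f \<in> polys S" using polys_ren[of f B p] by (auto simp: Bij_def bij_betw_def)
qed

lemma orbp_support:
  assumes "finite B" "\<not> (finite S \<and> ctype S = ctype B)" shows "orbp B f S = 0"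
proof -
  have "Bij B S = {}"
  proof (rule equals0I)
    fix p assume p: "p \<in> Bij B S"
    then have "finite S" using assms(1) bij_betw_finite[of p B S] by (simp add: Bij_def)
    then show False using Bij_ctype[OF p] assms(2) by simp
  qed
  then show ?thesis by (simp add: orbp_def)
qed

lemma orbp_add: "orbp B (f + g) = orbp B f + orbp B g"
  by (auto simp: orbp_def fun_eq_iff ren_add sum.distrib)

lemma orbp_0 [simp]: "orbp B 0 = 0"
  by (auto simp: orbp_def fun_eq_iff)

lemma orbp_sum: "orbp B (sum f A) = (\<Sum>a\<in>A. orbp B (f a))"
  by (induction A rule: infinite_finite_induct) (auto simp: orbp_add)

section \<open>The vector space of families and its grading\<close>

definition fsc :: "rat \<Rightarrow> fam \<Rightarrow> fam" where
  "fsc c F = (\<lambda>S. Cn c * F S)"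

interpretation fam: vector_space fsc
  by unfold_locales (auto simp: fsc_def fun_eq_iff Cn_add Cn_mult algebra_simps)

lemma fsc_apply: "fsc c F S = Cn c * F S" by (simp add: fsc_def)

lemma sum_fam_apply: "(\<Sum>a\<in>A. F a) S = (\<Sum>a\<in>A. F a S)" for F :: "'a \<Rightarrow> fam"
  by (induction A rule: infinite_finite_induct) auto

text \<open>Degrees in the algebra are shifted by integers, so the degree required of a polynomial
  may be negative; only the zero polynomial then qualifies.\<close>

definition homogi :: "int \<Rightarrow> 'x pol \<Rightarrow> bool" where
  "homogi k f \<longleftrightarrow> (\<forall>m\<in>keys f. int (deg m) = k)"

lemma homogi_0 [simp]: "homogi k 0" by (simp add: homogi_def)
lemma homogi_int: "homogi (int d) f \<longleftrightarrow> homog d f" by (simp add: homogi_def homog_def)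
lemma homogi_cases: "homogi k f \<Longrightarrow> f = 0 \<or> (\<exists>d. k = int d \<and> homog d f)"
proof (cases "f = 0")
  case False
  assume f: "homogi k f"
  obtain m where "m \<in> keys f" using False keys_eq_empty[of f] by blast
  then have "k = int (deg m)" using f by (simp add: homogi_def)
  then show ?thesis using f by (auto simp: homogi_def homog_def)
qed simp
lemma homogi_add: "homogi k f \<Longrightarrow> homogi k g \<Longrightarrow> homogi k (f + g)"
  unfolding homogi_def using keys_add[of f g] by blast
lemma homogi_sum: "(\<And>a. a \<in> A \<Longrightarrow> homogi k (f a)) \<Longrightarrow> homogi k (sum f A)"
  by (induction A rule: infinite_finite_induct) (auto intro: homogi_add)
lemma homogi_mult: "homogi k f \<Longrightarrow> homogi l g \<Longrightarrow> homogi (k + l) (f * g)"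
  using homogi_cases[of k f] homogi_cases[of l g] homog_mult
  by (auto simp: homogi_int simp flip: of_nat_add)
lemma homogi_Cn_mult: "homogi k f \<Longrightarrow> homogi k (Cn c * f)"
  using homogi_mult[of 0 "Cn c" k f] homog_Cn[of c] by (simp add: homogi_int[of 0, symmetric])
lemma homogi_ren: "homogi k f \<Longrightarrow> homogi k (ren p f)"
  using homogi_cases[of k f] by (auto simp: homogi_int homog_ren)

text \<open>With the shift \<open>e0\<close>, degrees are additive under the product although the
  kernel raises the polynomial degree: by \<open>e0_Un\<close> the shift drops by exactly the degree
  of \<open>K T U\<close>.\<close>

locale graded_kernel = kernel +
  fixes e0 :: "(nat \<Rightarrow>\<^sub>0 nat) \<Rightarrow> int"
  assumes e0_0: "e0 0 = 0"
    and e0_Un: "finite T \<Longrightarrow> finite U \<Longrightarrow> T \<inter> U = {} \<Longrightarrow>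
      e0 (ctype T + ctype U) = e0 (ctype T) + e0 (ctype U) - (\<Sum>a\<in>T. \<Sum>b\<in>U. int (h (fst a) (fst b)))"
begin

text \<open>The component of type \<open>\<gamma>\<close> and degree \<open>e\<close>. Its elements
  are symmetric polynomials recorded on every set of variables of this type at once.\<close>

definition H :: "(nat \<Rightarrow>\<^sub>0 nat) \<Rightarrow> int \<Rightarrow> fam set" where
  "H \<gamma> e = {F. natural F \<and> (\<forall>S. F S \<in> polys S) \<and>
    (\<forall>S. \<not> (finite S \<and> ctype S = \<gamma>) \<longrightarrow> F S = 0) \<and> (\<forall>S. homogi (e - e0 \<gamma>) (F S))}"

lemma H_natural: "F \<in> H \<gamma> e \<Longrightarrow> cperm q \<Longrightarrow> finite S \<Longrightarrow> ren q (F S) = F (q ` S)"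
  and H_polys: "F \<in> H \<gamma> e \<Longrightarrow> F S \<in> polys S"
  and H_support: "F \<in> H \<gamma> e \<Longrightarrow> ctype S \<noteq> \<gamma> \<Longrightarrow> F S = 0"
  and H_infinite: "F \<in> H \<gamma> e \<Longrightarrow> infinite S \<Longrightarrow> F S = 0"
  and H_homogi: "F \<in> H \<gamma> e \<Longrightarrow> homogi (e - e0 \<gamma>) (F S)"
  by (auto simp: H_def natural_def)

lemma subspace_H: "fam.subspace (H \<gamma> e)"
proof (rule fam.subspaceI)
  show "0 \<in> H \<gamma> e" by (auto simp: H_def natural_def)
next
  fix F G assume "F \<in> H \<gamma> e" "G \<in> H \<gamma> e"
  then show "F + G \<in> H \<gamma> e" by (auto simp: H_def natural_def ren_add intro: polys_add homogi_add)
next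
  fix c F assume "F \<in> H \<gamma> e"
  then show "fsc c F \<in> H \<gamma> e"
    by (auto simp: H_def natural_def ren_mult fsc_def intro: polys_mult homogi_Cn_mult)
qed

lemma K_homogi:
  assumes "finite T" "finite U" "T \<inter> U = {}"
  shows "homogi (e0 (ctype T) + e0 (ctype U) - e0 (ctype T + ctype U)) (K T U)"
proof -
  have "e0 (ctype T) + e0 (ctype U) - e0 (ctype T + ctype U) = int (\<Sum>a\<in>T. \<Sum>b\<in>U. h (fst a) (fst b))"
    using e0_Un[OF assms] by simp
  then show ?thesis using K_homog[where T = T and U = U] by (simp only: homogi_int)
qed

lemma star_H:
  assumes F: "F \<in> H \<gamma> e" and G: "G \<in> H \<gamma>' e'"
  shows "star F G \<in> H (\<gamma> + \<gamma>') (e + e')"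
  unfolding H_def mem_Collect_eq
proof (intro conjI allI impI)
  show "natural (star F G)" unfolding natural_def
  proof (intro allI impI)
    fix q S assume q: "cperm q" and S: "finite (S :: var set)"
    have i: "inj q" "inj_on q X" for X using q by (auto simp: cperm_def bij_def inj_on_def)
    have "ren q (star F G S) = (\<Sum>T\<in>Pow S. F (q ` T) * G (q ` (S - T)) * K (q ` T) (q ` (S - T)))"
      unfolding star_def if_P[OF S] ren_sum ren_mult
    proof (intro sum.cong refl)
      fix T assume "T \<in> Pow S"
      then have f: "finite T" "finite (S - T)" using S finite_subset by auto
      have "ren q (K T (S - T)) = K (q ` T) (q ` (S - T))"
        using i q by (intro K_ren) (auto simp: cperm_def)
      then show "ren q (F T) * ren q (G (S - T)) * ren q (K T (S - T)) =
        F (q ` T) * G (q ` (S - T)) * K (q ` T) (q ` (S - T))"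
        using H_natural[OF F q f(1)] H_natural[OF G q f(2)] by simp
    qed
    also have "\<dots> = (\<Sum>T\<in>Pow S. F (q ` T) * G (q ` S - q ` T) * K (q ` T) (q ` S - q ` T))"
      by (intro sum.cong refl) (auto simp: image_set_diff[OF i(1)])
    also have "\<dots> = (\<Sum>T\<in>(`) q ` Pow S. F T * G (q ` S - T) * K T (q ` S - T))"
      using i by (subst sum.reindex) (auto simp: inj_on_def inj_image_eq_iff)
    also have "(`) q ` Pow S = Pow (q ` S)" by (auto simp: image_Pow_surj[symmetric])
    finally show "ren q (star F G S) = star F G (q ` S)" using S by (simp add: star_def)
  qed
next
  fix S
  have "F T * G (S - T) * K T (S - T) \<in> polys S" if "T \<subseteq> S" for T
    using H_polys[OF F, of T] H_polys[OF G, of "S - T"] that polys_mono[of T S] polys_mono[of "S - T" S]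
    by (intro polys_mult K_polys) auto
  then show "star F G S \<in> polys S" by (auto simp: star_def intro!: polys_sum)
  \<comment> \<open>A summand survives only if both of its sets have the prescribed types; support
    and degree of the product are read off from this.\<close>
  have z: "F T * G (S - T) * K T (S - T) = 0 \<or> (ctype T = \<gamma> \<and> ctype (S - T) = \<gamma>')" for T
    using H_support[OF F, of T] H_support[OF G, of "S - T"]
    by (cases "F T = 0"; cases "G (S - T) = 0") auto
  { assume n: "\<not> (finite S \<and> ctype S = \<gamma> + \<gamma>')"
    show "star F G S = 0"
    proof (cases "finite S")
      case True
      then have "F T * G (S - T) * K T (S - T) = 0" if "T \<subseteq> S" for T
        using z[of T] n ctype_Diff[OF True that] by auto
      then show ?thesis by (auto simp: star_def intro!: sum.neutral)
    qed (simp add: star_def) }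
  show "homogi (e + e' - e0 (\<gamma> + \<gamma>')) (star F G S)"
  proof (cases "finite S")
    case True
    have "homogi (e + e' - e0 (\<gamma> + \<gamma>')) (F T * G (S - T) * K T (S - T))" if "T \<subseteq> S" for T
    proof (cases "ctype T = \<gamma> \<and> ctype (S - T) = \<gamma>'")
      case t: True
      have "homogi ((e - e0 \<gamma>) + (e' - e0 \<gamma>') + (e0 \<gamma> + e0 \<gamma>' - e0 (\<gamma> + \<gamma>'))) (F T * G (S - T) * K T (S - T))"
        using K_homogi[of T "S - T"] t True that finite_subset[OF that]
        by (intro homogi_mult H_homogi[OF F] H_homogi[OF G]) auto
      then show ?thesis by (simp add: algebra_simps)
    next
      case False
      then have "F T * G (S - T) * K T (S - T) = 0" using z[of T] by blast
      then show ?thesis by simp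
    qed
    then show ?thesis using True by (auto simp: star_def intro!: homogi_sum)
  qed (simp add: star_def)
qed

lemma one_fam_H: "one_fam \<in> H 0 0"
  unfolding H_def mem_Collect_eq
proof (intro conjI allI impI)
  show "natural one_fam" by (auto simp: natural_def one_fam_def)
  fix S
  show "one_fam S \<in> polys S" by (simp add: one_fam_def)
  show "homogi (0 - e0 0) (one_fam S)"
    using homogi_int[of 0 "1 :: var pol"] by (auto simp: one_fam_def e0_0 homog_1)
qed (auto simp: one_fam_def)

lemma Pi_H:
  assumes "\<And>w. w \<in># M \<Longrightarrow> g w \<in> H (\<gamma> w) (\<epsilon> w)"
  shows "Pi g M \<in> H (\<Sum>w\<in>#M. \<gamma> w) (\<Sum>w\<in>#M. \<epsilon> w)"
  using assms by (induction M) (auto intro!: star_H one_fam_H)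

lemma orbp_H:
  assumes "finite B" "f \<in> polys B" "homogi (e - e0 (ctype B)) f"
  shows "orbp B f \<in> H (ctype B) e"
  unfolding H_def using orbp_natural orbp_polys orbp_support assms
  by (auto simp: orbp_def intro!: homogi_sum homogi_ren)

text \<open>A bijection from \<open>B\<close> to \<open>S\<close> extends to a permutation of all
  variables, so naturality turns each summand into \<open>F S\<close>; the number of summands is the
  same for all \<open>S\<close> of this type.\<close>

lemma orbp_H_self:
  assumes "F \<in> H (ctype B) e" "finite B"
  shows "orbp B (F B) = fsc (of_nat (card (Bij B B))) F"
proof
  fix S
  show "orbp B (F B) S = fsc (of_nat (card (Bij B B))) F S"
  proof (cases "finite S \<and> ctype S = ctype B")
    case True
    obtain f where f: "bij_betw f B S" "\<forall>a\<in>B. fst (f a) = fst a"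
      using ctype_eq_bij[OF assms(2), of S] True by auto
    obtain q where q: "cperm q" "\<forall>a\<in>B. q a = f a" using extend_cperm[OF assms(2) f(1)] f(2) by blast
    have "q ` B = S" using q f by (auto simp: bij_betw_def)
    then have c: "card (Bij B S) = card (Bij B B)"
      using bij_betw_same_card[OF Bij_comp[OF q(1), of B B]] by simp
    have "ren p (F B) = F S" if pB: "p \<in> Bij B S" for p
    proof -
      obtain q where q: "cperm q" "\<forall>a\<in>B. q a = p a"
        using extend_cperm[OF assms(2), of p S] pB unfolding Bij_def by blast
      have "ren p (F B) = ren q (F B)" by (rule ren_cong[OF H_polys[OF assms(1)]]) (use q in auto)
      also have "\<dots> = F (q ` B)" by (rule H_natural[OF assms(1) q(1) assms(2)])
      also have "q ` B = S" using q pB by (auto simp: Bij_def bij_betw_def)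
      finally show ?thesis .
    qed
    then show ?thesis by (simp add: orbp_def fsc_apply c Cn_of_nat)
  next
    case False
    then show ?thesis using orbp_support[OF assms(2) False] H_support[OF assms(1), of S] H_infinite[OF assms(1), of S]
      by (auto simp: fsc_apply)
  qed
qed

lemma card_Bij_pos: "finite B \<Longrightarrow> card (Bij B B) > 0"
proof -
  assume B: "finite B"
  have "restrict (\<lambda>a. a) B \<in> Bij B B"
    by (auto simp: Bij_def intro!: bij_betwI[where g = "\<lambda>a. a"])
  then show ?thesis using finite_Bij[OF B, of B] by (auto simp: card_gt_0_iff)
qed

lemma H_eq_orbp:
  assumes "F \<in> H (ctype B) e" "finite B"
  shows "F = fsc (inverse (of_nat (card (Bij B B)))) (orbp B (F B))"
  using card_Bij_pos[OF assms(2)] unfolding orbp_H_self[OF assms] by (simp add: fam.scale_scale)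

text \<open>A colour-preserving bijection from \<open>B\<close> to \<open>S\<close> is the same as
  an image \<open>U\<close> of \<open>T\<close> together with such bijections from \<open>T\<close>
  to \<open>U\<close> and from \<open>B - T\<close> to \<open>S - U\<close>.\<close>

lemma star_orbp:
  assumes "finite B" "T \<subseteq> B" "f \<in> polys T" "g \<in> polys (B - T)"
  shows "star (orbp T f) (orbp (B - T) g) = orbp B (f * g * K T (B - T))"
proof
  fix S
  show "star (orbp T f) (orbp (B - T) g) S = orbp B (f * g * K T (B - T)) S"
  proof (cases "finite S")
    case True
    have fin: "finite T" "finite (B - T)" using assms finite_subset by auto
    define Z where "Z U p p' = ren p f * ren p' g * K U (S - U)" for U p p'
    have "star (orbp T f) (orbp (B - T) g) S =
        (\<Sum>U\<in>Pow S. \<Sum>p\<in>Bij T U. \<Sum>p'\<in>Bij (B - T) (S - U). Z U p p')"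
      by (simp only: star_def if_P[OF True] orbp_def sum_product) (simp only: sum_distrib_right Z_def)
    also have "\<dots> = (\<Sum>(U, p, p')\<in>(SIGMA U:Pow S. Bij T U \<times> Bij (B - T) (S - U)). Z U p p')"
      using True fin finite_Bij by (simp add: sum.Sigma sum.cartesian_product case_prod_unfold)
    also have "\<dots> = (\<Sum>r\<in>Bij B S. ren r (f * g * K T (B - T)))"
    proof (rule sum.reindex_bij_witness[where
          j = "\<lambda>(U, p, p'). \<lambda>a. if a \<in> T then p a else p' a" and
          i = "\<lambda>r. (r ` T, restrict r T, restrict r (B - T))"], goal_cases)
      case (1 x)
      then obtain U p p' where x: "x = (U, p, p')" "U \<subseteq> S" "p \<in> Bij T U" "p' \<in> Bij (B - T) (S - U)" by auto
      have "(\<lambda>a. if a \<in> T then p a else p' a) ` T = U" using x by (auto simp: Bij_def bij_betw_def)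
      moreover have "restrict (\<lambda>a. if a \<in> T then p a else p' a) T = p"
        "restrict (\<lambda>a. if a \<in> T then p a else p' a) (B - T) = p'"
        using x by (auto simp: Bij_def extensional_def fun_eq_iff)
      ultimately show ?case by (simp add: x)
    next
      case (2 x)
      then obtain U p p' where x: "x = (U, p, p')" "U \<subseteq> S" "p \<in> Bij T U" "p' \<in> Bij (B - T) (S - U)" by auto
      define r where "r a = (if a \<in> T then p a else p' a)" for a
      have "bij_betw r T U" using x by (subst bij_betw_cong[of T r p]) (auto simp: r_def Bij_def)
      moreover have "bij_betw r (B - T) (S - U)" using x by (subst bij_betw_cong[of "B - T" r p']) (auto simp: r_def Bij_def)
      ultimately have "bij_betw r (T \<union> (B - T)) (U \<union> (S - U))" by (intro bij_betw_combine) auto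
      moreover have "T \<union> (B - T) = B" "U \<union> (S - U) = S" using x assms by auto
      ultimately have "r \<in> Bij B S" using x assms(2) by (auto simp: Bij_def r_def extensional_def)
      moreover have "r = (\<lambda>a. if a \<in> T then p a else p' a)" by (simp add: r_def fun_eq_iff)
      ultimately show ?case by (simp add: x)
    next
      case (3 r)
      then show ?case using assms(2) by (auto simp: Bij_def extensional_def fun_eq_iff)
    next
      case (4 r)
      then have r: "inj_on r B" "r ` B = S" "\<forall>a\<in>B. fst (r a) = fst a" by (auto simp: Bij_def bij_betw_def)
      have "bij_betw r T (r ` T)" using r assms(2) by (meson inj_on_imp_bij_betw inj_on_subset)
      moreover have "bij_betw r (B - T) (S - r ` T)"
        using r assms(2) by (auto simp: bij_betw_def inj_on_image_set_diff[of r B] intro: inj_on_subset)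
      ultimately show ?case using r assms(2) by (auto simp: Bij_def)
    next
      case (5 x)
      then obtain U p p' where x: "x = (U, p, p')" "U \<subseteq> S" "p \<in> Bij T U" "p' \<in> Bij (B - T) (S - U)" by auto
      define r where "r a = (if a \<in> T then p a else p' a)" for a
      have p: "bij_betw p T U" "\<forall>a\<in>T. fst (p a) = fst a" "bij_betw p' (B - T) (S - U)" "\<forall>a\<in>B - T. fst (p' a) = fst a"
        using x by (auto simp: Bij_def)
      have im: "r ` T = U" "r ` (B - T) = S - U" using p by (auto simp: r_def bij_betw_def)
      have "inj_on r (T \<union> (B - T))"
      proof (rule inj_on_Un[THEN iffD2], intro conjI)
        show "inj_on r T" using p by (auto simp: r_def inj_on_def bij_betw_def)
        show "inj_on r (B - T)" using p by (auto simp: r_def inj_on_def bij_betw_def)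
        show "r ` (T - (B - T)) \<inter> r ` (B - T - T) = {}" using im by auto
      qed
      then have "ren r (K T (B - T)) = K U (S - U)"
        using p im by (subst K_ren) (auto simp: r_def)
      moreover have "ren r f = ren p f" by (rule ren_cong[OF assms(3)]) (simp add: r_def)
      moreover have "ren r g = ren p' g" by (rule ren_cong[OF assms(4)]) (simp add: r_def)
      moreover have "(\<lambda>a. if a \<in> T then p a else p' a) = r" by (simp add: r_def fun_eq_iff)
      ultimately show ?case by (simp add: x Z_def ren_mult)
    qed
    finally show ?thesis by (simp add: orbp_def)
  next
    case False
    then show ?thesis using orbp_support[OF assms(1), of S] by (simp add: star_def)
  qed
qed

text \<open>Non-zero types exclude multiples of the unit as factors.\<close>

definition Dec :: "(nat \<Rightarrow>\<^sub>0 nat) \<Rightarrow> int \<Rightarrow> fam set" where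
  "Dec \<gamma> e = {star F G | F G \<gamma>1 \<gamma>2 e1 e2. F \<in> H \<gamma>1 e1 \<and> G \<in> H \<gamma>2 e2 \<and> \<gamma>1 \<noteq> 0 \<and> \<gamma>2 \<noteq> 0 \<and>
    \<gamma>1 + \<gamma>2 = \<gamma> \<and> e1 + e2 = e}"

text \<open>For \<open>A = - B\<close> and \<open>\<mu> = 0\<close> the extraction drops every
  monomial with a variable outside \<open>B\<close>, that is, it sets these variables to
  zero.\<close>

lemma coeff_in_0_polys: "coeff_in (- B) 0 f \<in> polys B"
  unfolding coeff_in_def plin_def
proof (intro polys_sum polys_mult polys_Cn)
  fix m
  show "(if restr (- B) m = 0 then single (m - 0) 1 else 0) \<in> polys B"
    using keys_restr[of "- B" m] by (auto intro!: polys_single)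
qed

lemma coeff_in_0_self:
  assumes "f \<in> polys B" shows "coeff_in (- B) 0 f = f"
proof -
  have "coeff_in (- B) 0 (single 0 1) = 1"
    unfolding coeff_in_def plin_single by (simp add: restr_def)
  then show ?thesis using coeff_in_mult[OF assms, of "- B" 0 1] by simp
qed

text \<open>The monomial splits into its parts on \<open>T\<close> and on \<open>B - T\<close>, and
  \<open>star_orbp\<close> shows the symmetrisation to be a product of two orbit sums.\<close>

lemma orbp_K_Dec:
  assumes "finite B" "T \<subseteq> B" "T \<noteq> {}" "T \<noteq> B" "keys m \<subseteq> B"
    and "homogi (e - e0 (ctype B)) (single m c * K T (B - T))" "K T (B - T) \<noteq> 0"
  shows "orbp B (single m c * K T (B - T)) \<in> fam.span (Dec (ctype B) e)"
proof (cases "c = 0")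
  case False
  have fin: "finite T" "finite (B - T)" using assms finite_subset by auto
  have cB: "ctype T + ctype (B - T) = ctype B" using ctype_Diff assms by blast
  define m1 where "m1 = restr T m"
  define m2 where "m2 = restr (B - T) m"
  have m: "m = m1 + m2"
    by (rule poly_mapping_eqI) (use assms(2,5) in \<open>auto simp: m1_def m2_def lookup_add lookup_restr in_keys_iff subset_iff\<close>)
  have s: "single m c = single m1 c * single m2 1" by (simp add: m mult_single)
  have p: "single m1 c \<in> polys T" "single m2 1 \<in> polys (B - T)"
    by (auto simp: m1_def m2_def keys_restr intro!: polys_single)
  have "homogi (int (deg m) + (e0 (ctype T) + e0 (ctype (B - T)) - e0 (ctype B))) (single m c * K T (B - T))"
    using K_homogi[of T "B - T"] fin cB by (intro homogi_mult) (auto simp: homogi_int homog_single)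
  \<comment> \<open>As the product is not zero, its degree is well defined and determines
    \<open>e\<close>.\<close>
  moreover have "single m c * K T (B - T) \<noteq> 0"
  proof
    assume "single m c * K T (B - T) = 0"
    then have "lookup (single m c * K T (B - T)) (m + m') = 0" for m' by simp
    moreover have "lookup (single m c * f) (m + m') = c * lookup f m'" for f :: "var pol" and m'
      by (induction f rule: poly_mapping_induct)
        (auto simp: mult_single lookup_single when_def distrib_left lookup_add)
    ultimately have "lookup (K T (B - T)) m' = 0" for m' using False by simp
    then show False using assms(7) by (metis poly_mapping_eqI lookup_zero)
  qed
  ultimately have e: "e = int (deg m) + e0 (ctype T) + e0 (ctype (B - T))"
    using assms(6) unfolding homogi_def by (metis (no_types, lifting) add_diff_cancel_right' add_diff_eq diff_add_cancel equals0I keys_eq_empty)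
  have "orbp T (single m1 c) \<in> H (ctype T) (int (deg m1) + e0 (ctype T))"
    using fin p by (intro orbp_H) (auto simp: homogi_int homog_single)
  moreover have "orbp (B - T) (single m2 1) \<in> H (ctype (B - T)) (int (deg m2) + e0 (ctype (B - T)))"
    using fin p by (intro orbp_H) (auto simp: homogi_int homog_single)
  moreover have "ctype T \<noteq> 0" "ctype (B - T) \<noteq> 0" using ctype_eq_0 fin assms by auto
  moreover have "int (deg m1) + e0 (ctype T) + (int (deg m2) + e0 (ctype (B - T))) = e"
    by (simp add: e m deg_add)
  ultimately have "star (orbp T (single m1 c)) (orbp (B - T) (single m2 1)) \<in> Dec (ctype B) e"
    using cB unfolding Dec_def by blast
  also have "star (orbp T (single m1 c)) (orbp (B - T) (single m2 1)) = orbp B (single m c * K T (B - T))"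
    unfolding s by (rule star_orbp[OF assms(1,2) p])
  finally show ?thesis by (rule fam.span_base)
qed (simp add: fam.span_zero)

text \<open>A symmetric element of the ideal is a sum of products: average a presentation of it over the
  colour-preserving permutations.\<close>

lemma H_ideal_Dec:
  assumes F: "F \<in> H (ctype B) e" and B: "finite B" and FB: "F B \<in> I B"
  shows "F \<in> fam.span (Dec (ctype B) e)"
proof -
  \<comment> \<open>A presentation in the ideal may use arbitrary cofactors. Setting foreign
    variables to zero and taking the component of degree \<open>d\<close> makes induction over the
    span possible; for the degree of \<open>F B\<close>, both operations leave \<open>F B\<close>
    unchanged.\<close>
  have Q: "orbp B (hcomp d (coeff_in (- B) 0 x)) \<in> fam.span (Dec (ctype B) (int d + e0 (ctype B)))"
    if "x \<in> ideal.span (gens B)" for x d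
    using that
  proof (induction rule: ideal.span_induct_alt)
    case base
    have "coeff_in (- B) 0 0 = 0" by (simp add: coeff_in_def)
    then show ?case by (simp only: hcomp_0 orbp_0 fam.span_zero)
  next
    case (step c g y)
    then obtain T where T: "g = K T (B - T)" "T \<subseteq> B" "T \<noteq> {}" "T \<noteq> B" by (auto simp: gens_def)
    define c' where "c' = coeff_in (- B) 0 c"
    have c': "c' \<in> polys B" unfolding c'_def by (rule coeff_in_0_polys)
    have g: "g \<in> polys B" using T by (auto intro: K_polys)
    have "coeff_in (- B) 0 (c * g + y) = c' * g + coeff_in (- B) 0 y"
      using coeff_in_mult[OF g, of "- B" 0 c] by (simp add: coeff_in_add c'_def mult.commute)
    then have e: "orbp B (hcomp d (coeff_in (- B) 0 (c * g + y))) =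
        orbp B (hcomp d (c' * g)) + orbp B (hcomp d (coeff_in (- B) 0 y))"
      by (simp add: hcomp_add orbp_add)
    define k where "k = (\<Sum>a\<in>T. \<Sum>b\<in>B - T. h (fst a) (fst b))"
    have k: "homog k g" unfolding T(1) k_def by (rule K_homog)
    have "orbp B (hcomp d (c' * g)) \<in> fam.span (Dec (ctype B) (int d + e0 (ctype B)))"
    proof (cases "k \<le> d \<and> g \<noteq> 0")
      case True
      define c'' where "c'' = hcomp (d - k) c'"
      have "hcomp d (c' * g) = c'' * g" using hcomp_mult_homog[OF k] True by (simp add: c''_def)
      also have "\<dots> = (\<Sum>m\<in>keys c''. single m (lookup c'' m) * g)"
        by (simp only: sum_distrib_right[symmetric] poly_mapping_sum_single[symmetric])
      finally have "orbp B (hcomp d (c' * g)) = (\<Sum>m\<in>keys c''. orbp B (single m (lookup c'' m) * K T (B - T)))"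
        by (simp add: orbp_sum T(1))
      also have "\<dots> \<in> fam.span (Dec (ctype B) (int d + e0 (ctype B)))"
      proof (intro fam.span_sum orbp_K_Dec B T)
        fix m assume m: "m \<in> keys c''"
        show "keys m \<subseteq> B" using m polys_hcomp[OF c', of "d - k"] by (auto simp: polys_def c''_def)
        show "K T (B - T) \<noteq> 0" using True T by simp
        have "deg m = d - k" using m homog_hcomp[of "d - k" c'] by (simp add: homog_def c''_def)
        then have "homog (d - k + k) (single m (lookup c'' m) * K T (B - T))"
          using k T(1) by (intro homog_mult homog_single) auto
        then show "homogi (int d + e0 (ctype B) - e0 (ctype B)) (single m (lookup c'' m) * K T (B - T))"
          using True by (simp add: homogi_int)
      qed
      finally show ?thesis .
    next
      case False
      then have "hcomp d (c' * g) = 0" using hcomp_mult_homog[OF k] by auto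
      then show ?thesis by (simp add: fam.span_zero)
    qed
    then show ?case unfolding e using step by (intro fam.span_add)
  qed
  show ?thesis
  proof (cases "F B = 0")
    case True
    then have "F = 0" using H_eq_orbp[OF F B] by simp
    then show ?thesis by (simp add: fam.span_zero)
  next
    case False
    then obtain d where d: "e - e0 (ctype B) = int d" "homog d (F B)"
      using homogi_cases[OF H_homogi[OF F]] by blast
    have "orbp B (F B) \<in> fam.span (Dec (ctype B) e)"
      using Q[OF FB[unfolded I_def], of d] d by (simp add: coeff_in_0_self[OF H_polys[OF F]] hcomp_homog diff_eq_eq)
    then show ?thesis by (subst H_eq_orbp[OF F B]) (rule fam.span_scale)
  qed
qed

end

section \<open>Complements of subspaces\<close>

locale vector_space_complements = vector_space
begin

definition indep_mod :: "'b set \<Rightarrow> 'b set \<Rightarrow> bool" where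
  "indep_mod D A \<longleftrightarrow> (\<forall>t c. finite t \<longrightarrow> t \<subseteq> A \<longrightarrow> (\<Sum>v\<in>t. scale (c v) v) \<in> D \<longrightarrow> (\<forall>v\<in>t. c v = 0))"

lemma indep_modD:
  "indep_mod D A \<Longrightarrow> finite t \<Longrightarrow> t \<subseteq> A \<Longrightarrow> (\<Sum>v\<in>t. scale (c v) v) \<in> D \<Longrightarrow> v \<in> t \<Longrightarrow> c v = 0"
  by (auto simp: indep_mod_def)

lemma indep_mod_disjoint: "indep_mod D A \<Longrightarrow> D \<inter> A = {}"
proof (rule equals0I)
  fix v assume i: "indep_mod D A" and v: "v \<in> D \<inter> A"
  then show False using indep_modD[OF i, of "{v}" "\<lambda>_. 1" v] by simp
qed

lemma independent_Un_indep_mod: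
  assumes D: "subspace D" and B: "independent B" "B \<subseteq> D" and A: "indep_mod D A"
  shows "independent (B \<union> A)"
  unfolding independent_explicit_module
proof (intro allI impI)
  fix t u v
  assume t: "finite t" "t \<subseteq> B \<union> A" and s: "(\<Sum>v\<in>t. scale (u v) v) = 0" and v: "v \<in> t"
  have AB: "A \<inter> B = {}" using indep_mod_disjoint[OF A] B by blast
  have "(\<Sum>v\<in>t. scale (u v) v) = (\<Sum>v\<in>t \<inter> A. scale (u v) v) + (\<Sum>v\<in>t - A. scale (u v) v)"
    using t(1) by (subst sum.union_disjoint[symmetric]) (auto intro: sum.cong)
  then have e: "(\<Sum>v\<in>t \<inter> A. scale (u v) v) = - (\<Sum>v\<in>t - A. scale (u v) v)"
    using s by (simp add: eq_neg_iff_add_eq_0)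
  have "(\<Sum>v\<in>t - A. scale (u v) v) \<in> D"
    using t B(2) by (intro subspace_sum[OF D] subspace_scale[OF D]) auto
  then have "(\<Sum>v\<in>t \<inter> A. scale (u v) v) \<in> D" unfolding e by (rule subspace_neg[OF D])
  then have 0: "u v = 0" if "v \<in> t \<inter> A" for v
    using indep_modD[OF A, of "t \<inter> A" u v] t that by auto
  then have "(\<Sum>v\<in>t - A. scale (u v) v) = 0" using e by simp
  then have "u v = 0" if "v \<in> t - A" for v
    using independentD[OF B(1), of "t - A" u v] t that by auto
  then show "u v = 0" using 0 v by blast
qed

text \<open>A basis of \<open>D\<close> is extended to one of \<open>H\<close>, and \<open>W\<close>
  consists of the added vectors. The last two clauses express that its size is the dimension of the
  quotient: sets independent modulo \<open>D\<close> are at most as large, sets that span modulo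
  \<open>D\<close> at least as large.\<close>

lemma complement_exists:
  assumes D: "subspace D" and DH: "D \<subseteq> H" and X: "finite X" "H \<subseteq> span X"
  shows "\<exists>W. finite W \<and> W \<subseteq> H \<and> indep_mod D W \<and> H \<subseteq> span (D \<union> W) \<and>
    (\<forall>A\<subseteq>H. indep_mod D A \<longrightarrow> finite A \<and> card A \<le> card W) \<and>
    (\<forall>A. finite A \<longrightarrow> H \<subseteq> span (D \<union> A) \<longrightarrow> card W \<le> card A)"
proof -
  obtain B0 where B0: "B0 \<subseteq> D" "independent B0" "D \<subseteq> span B0"
    using maximal_independent_subset by blast
  obtain B where B: "B0 \<subseteq> B" "B \<subseteq> H" "independent B" "H \<subseteq> span B"
    using maximal_independent_subset_extend[OF order_trans[OF B0(1) DH] B0(2)] by blast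
  have fB: "finite B" using independent_span_bound[OF X(1) B(3)] B(2) X(2) by blast
  have fB0: "finite B0" using B(1) fB finite_subset by blast
  define W where "W = B - B0"
  have cB: "card B = card B0 + card W"
    unfolding W_def using card_Diff_subset[OF fB0 B(1)] card_mono[OF fB B(1)] by simp
  have "indep_mod D W" unfolding indep_mod_def
  proof (intro allI impI ballI)
    fix t c v assume t: "finite t" "t \<subseteq> W" "(\<Sum>v\<in>t. scale (c v) v) \<in> D" and v: "v \<in> t"
    then obtain d where d: "(\<Sum>v\<in>t. scale (c v) v) = (\<Sum>b\<in>B0. scale (d b) b)"
      using B0(3) span_finite[OF fB0] by blast
    define u where "u x = (if x \<in> t then c x else - d x)" for x
    have "(\<Sum>x\<in>t \<union> B0. scale (u x) x) = (\<Sum>x\<in>t. scale (u x) x) + (\<Sum>x\<in>B0. scale (u x) x)"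
      using t fB0 by (intro sum.union_disjoint) (auto simp: W_def)
    also have "(\<Sum>x\<in>t. scale (u x) x) = (\<Sum>v\<in>t. scale (c v) v)" by (simp add: u_def)
    also have "(\<Sum>x\<in>B0. scale (u x) x) = (\<Sum>x\<in>B0. - scale (d x) x)"
      using t by (intro sum.cong refl) (auto simp: u_def W_def)
    finally have "(\<Sum>x\<in>t \<union> B0. scale (u x) x) = 0" by (simp add: d sum_negf)
    then have "u v = 0" using independentD[OF B(3), of "t \<union> B0" u v] t v fB0 B(1) by (auto simp: W_def)
    then show "c v = 0" using v by (simp add: u_def)
  qed
  moreover have "H \<subseteq> span (D \<union> W)"
    using B(4) span_mono[of B "D \<union> W"] B0(1) by (auto simp: W_def)
  moreover have "finite A \<and> card A \<le> card W" if A: "A \<subseteq> H" "indep_mod D A" for A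
  proof -
    have "B0 \<union> A \<subseteq> span B" using A(1) B B0(1) DH by blast
    from independent_span_bound[OF fB independent_Un_indep_mod[OF D B0(2,1) A(2)] this]
    have "finite A" "card (B0 \<union> A) \<le> card B" by auto
    moreover have "card (B0 \<union> A) = card B0 + card A"
      using indep_mod_disjoint[OF A(2)] B0(1) fB0 \<open>finite A\<close> by (intro card_Un_disjoint) auto
    ultimately show ?thesis using cB by simp
  qed
  moreover have "card W \<le> card A" if A: "finite A" "H \<subseteq> span (D \<union> A)" for A
  proof -
    have "D \<union> A \<subseteq> span (B0 \<union> A)" using B0(3) span_mono[of B0 "B0 \<union> A"] span_superset[of "B0 \<union> A"] by blast
    then have "span (D \<union> A) \<subseteq> span (B0 \<union> A)" by (rule span_minimal) simp
    then have "B \<subseteq> span (B0 \<union> A)" using A(2) B(2) by blast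
    then have "card B \<le> card (B0 \<union> A)" using independent_span_bound[OF _ B(3)] fB0 A(1) by blast
    then show ?thesis using cB card_Un_le[of B0 A] by simp
  qed
  moreover have "finite W" "W \<subseteq> H" using fB B by (auto simp: W_def)
  ultimately show ?thesis by blast
qed

text \<open>The map induced by \<open>f\<close> on quotients is injective, because an element of
  \<open>H\<close> that is sent into \<open>D'\<close> already lies in \<open>D\<close>.\<close>

lemma indep_mod_image:
  assumes f: "\<And>x y. f (x + y) = f x + f y" "\<And>c x. f (scale c x) = scale c (f x)"
    and A: "indep_mod D A" "subspace H" "A \<subseteq> H" "0 \<in> D'" and fD: "\<And>x. x \<in> H \<Longrightarrow> f x \<in> D' \<Longrightarrow> x \<in> D"
  shows "inj_on f A \<and> indep_mod D' (f ` A)"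
proof -
  have f0: "f 0 = 0" using f(2)[of 0 0] by simp
  have fs: "f (\<Sum>v\<in>t. scale (c v) v) = (\<Sum>v\<in>t. scale (c v) (f v))" for t c
    by (induction t rule: infinite_finite_induct) (auto simp: f f0)
  have inj: "inj_on f A"
  proof (rule inj_onI, rule ccontr)
    fix x y assume xy: "x \<in> A" "y \<in> A" "f x = f y" "x \<noteq> y"
    define c where "c v = (if v = x then 1 else - 1 :: 'a)" for v
    have "(\<Sum>v\<in>{x, y}. scale (c v) v) = x - y" using xy(4) by (simp add: c_def)
    moreover have "f (\<Sum>v\<in>{x, y}. scale (c v) v) = 0" unfolding fs using xy by (simp add: c_def)
    ultimately have "(\<Sum>v\<in>{x, y}. scale (c v) v) \<in> D"
      using fD[of "x - y"] A xy by (auto intro: subspace_diff)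
    then have "c x = 0" using indep_modD[OF A(1), of "{x, y}" c x] xy by auto
    then show False by (simp add: c_def)
  qed
  moreover have "indep_mod D' (f ` A)" unfolding indep_mod_def
  proof (intro allI impI ballI)
    fix t c v assume t: "finite t" "t \<subseteq> f ` A" "(\<Sum>v\<in>t. scale (c v) v) \<in> D'" and v: "v \<in> t"
    define s where "s = {x\<in>A. f x \<in> t}"
    have i: "inj_on f s" using inj by (rule inj_on_subset) (auto simp: s_def)
    have st: "f ` s = t" using t(2) by (auto simp: s_def)
    then have "finite s" using t(1) finite_imageD[OF _ i] by simp
    have "f (\<Sum>x\<in>s. scale (c (f x)) x) = (\<Sum>v\<in>t. scale (c v) v)"
      unfolding fs st[symmetric] by (simp add: sum.reindex[OF i])
    then have "(\<Sum>x\<in>s. scale (c (f x)) x) \<in> D"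
      using t(3) A(3) by (intro fD subspace_sum[OF A(2)] subspace_scale[OF A(2)]) (auto simp: s_def)
    then have "c (f x) = 0" if "x \<in> s" for x
      using indep_modD[OF A(1) \<open>finite s\<close>, of "\<lambda>x. c (f x)" x] that by (auto simp: s_def)
    then show "c v = 0" using v st by blast
  qed
  ultimately show ?thesis by blast
qed

end

interpretation fam: vector_space_complements fsc ..

section \<open>The dimensions of the components\<close>

lemma finite_mons: "finite S \<Longrightarrow> finite {m :: 'x mon. keys m \<subseteq> S \<and> deg m = d}"
proof -
  assume S: "finite S"
  define R where "R = {f :: 'x \<Rightarrow> nat. \<forall>v. (v \<in> S \<longrightarrow> f v \<in> {..d}) \<and> (v \<notin> S \<longrightarrow> f v = 0)}"
  have "finite R" unfolding R_def by (rule finite_set_of_finite_funs) (use S in auto)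
  moreover have "lookup ` {m. keys m \<subseteq> S \<and> deg m = d} \<subseteq> R"
  proof
    fix f assume "f \<in> lookup ` {m. keys m \<subseteq> S \<and> deg m = d}"
    then obtain m where m: "f = lookup m" "keys m \<subseteq> S" "deg m = d" by auto
    have "lookup m v \<le> d" if "v \<in> S" for v
      using member_le_sum[OF that, of "lookup m"] deg_superset[OF S m(2)] m(3) S by simp
    then show "f \<in> R" using m by (auto simp: R_def in_keys_iff subset_iff)
  qed
  ultimately show ?thesis
    by (meson finite_imageD finite_subset inj_onI lookup_inject)
qed

text \<open>The complete invariant of a monomial under colour-preserving permutations of
  \<open>S\<close>. Variables of exponent zero are recorded too, so that the type of
  \<open>S\<close> can be recovered.\<close>

definition shape :: "var set \<Rightarrow> var mon \<Rightarrow> (nat \<times> nat) multiset" where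
  "shape S m = image_mset (\<lambda>a. (fst a, lookup m a)) (mset_set S)"

definition mct :: "(nat \<times> nat) multiset \<Rightarrow> nat \<Rightarrow>\<^sub>0 nat" where
  "mct \<nu> = (\<Sum>x\<in>#\<nu>. single (fst x) 1)"

definition mdeg :: "(nat \<times> nat) multiset \<Rightarrow> nat" where
  "mdeg \<nu> = (\<Sum>x\<in>#\<nu>. snd x)"

lemma mct_shape: "mct (shape S m) = ctype S"
  by (simp add: mct_def shape_def ctype_def sum_unfold_sum_mset multiset.map_comp comp_def)

lemma mdeg_shape: "finite S \<Longrightarrow> keys m \<subseteq> S \<Longrightarrow> mdeg (shape S m) = deg m"
  by (simp add: mdeg_def shape_def deg_superset sum_unfold_sum_mset multiset.map_comp comp_def)

lemma ctype_exists: "\<exists>B. finite B \<and> ctype B = \<gamma>"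
proof -
  define B where "B = (SIGMA i:keys \<gamma>. {..<lookup \<gamma> i})"
  have "finite B" by (auto simp: B_def)
  moreover have "lookup (ctype B) i = lookup \<gamma> i" for i
  proof -
    have "{a\<in>B. fst a = i} = {i} \<times> {..<lookup \<gamma> i}" by (auto simp: B_def in_keys_iff)
    then show ?thesis using lookup_ctype[OF \<open>finite B\<close>, of i] by (simp add: card_cartesian_product)
  qed
  ultimately show ?thesis by (intro exI[of _ B] conjI poly_mapping_eqI) auto
qed

lemma ctype_Diff_single:
  assumes "finite B" "b \<in> B" shows "ctype B = single (fst b) 1 + ctype (B - {b})"
  using assms by (simp add: ctype_def sum.remove)

lemma shape_exists:
  assumes "finite B" "mct \<nu> = ctype B" shows "\<exists>m. keys m \<subseteq> B \<and> shape B m = \<nu>"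
  using assms
proof (induction \<nu> arbitrary: B)
  case empty
  then have "B = {}" using ctype_eq_0[of B] by (simp add: mct_def)
  then show ?case by (intro exI[of _ 0]) (simp add: shape_def)
next
  case (add x \<nu>)
  have c: "single (fst x) 1 + mct \<nu> = ctype B" using add.prems(2) by (simp add: mct_def)
  have "lookup (ctype B) (fst x) > 0" unfolding c[symmetric] by (simp add: lookup_add)
  then have "{b\<in>B. fst b = fst x} \<noteq> {}"
    using lookup_ctype[OF add.prems(1), of "fst x"] by (auto simp: card_gt_0_iff)
  then obtain b where b: "b \<in> B" "fst b = fst x" by blast
  then have "mct \<nu> = ctype (B - {b})" using c ctype_Diff_single[OF add.prems(1) b(1)] by simp
  then obtain m where m: "keys m \<subseteq> B - {b}" "shape (B - {b}) m = \<nu>"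
    using add.IH[of "B - {b}"] add.prems(1) by auto
  define m' where "m' = m + single b (snd x)"
  have l: "lookup m' a = (if a = b then snd x else lookup m a)" for a
    using m(1) by (auto simp: m'_def lookup_add lookup_single when_def in_keys_iff)
  have "keys m' \<subseteq> B" using m(1) b by (auto simp: in_keys_iff l subset_iff simp del: lookup_not_eq_zero_eq_in_keys split: if_splits)
  moreover have "mset_set B = add_mset b (mset_set (B - {b}))"
    using add.prems(1) b(1) by (metis mset_set.remove)
  then have "shape B m' = add_mset (fst b, snd x) (image_mset (\<lambda>a. (fst a, lookup m' a)) (mset_set (B - {b})))"
    by (simp add: shape_def l)
  moreover have "image_mset (\<lambda>a. (fst a, lookup m' a)) (mset_set (B - {b})) = shape (B - {b}) m"
    unfolding shape_def using add.prems(1) by (intro image_mset_cong) (auto simp: l)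
  ultimately show ?case using m(2) b(2) by (intro exI[of _ m']) simp
qed

lemma shape_eq_perm:
  assumes "finite B" "keys m \<subseteq> B" "keys m' \<subseteq> B" "shape B m = shape B m'"
  shows "\<exists>q. cperm q \<and> q ` B = B \<and> pmap q m = m'"
proof -
  obtain q where q: "q permutes B" "\<forall>a\<in>B. (fst a, lookup m a) = (fst (q a), lookup m' (q a))"
    using image_mset_eq_implies_permutes[OF assms(1) assms(4)[unfolded shape_def]] by blast
  have inj: "inj q" using q(1) by (rule permutes_inj)
  have "cperm q" unfolding cperm_def
    using permutes_bij[OF q(1)] q(2) permutes_not_in[OF q(1)] by (metis prod.inject)
  moreover have "pmap q m = m'"
  proof (rule poly_mapping_eqI)
    fix b
    obtain a where b: "b = q a" using permutes_surj[OF q(1)] by (metis surjD)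
    have "lookup (pmap q m) (q a) = lookup m a" by (rule lookup_pmap_inj[OF inj_on_subset[OF inj subset_UNIV]])
    also have "\<dots> = lookup m' (q a)"
    proof (cases "a \<in> B")
      case False
      then have "q a \<notin> B" using q(1) by (simp add: permutes_in_image)
      then show ?thesis using False assms(2,3) by (metis in_keys_iff subset_iff)
    qed (use q(2) in auto)
    finally show "lookup (pmap q m) b = lookup m' b" by (simp add: b)
  qed
  ultimately show ?thesis using permutes_image[OF q(1)] by blast
qed

text \<open>The monomial symmetric functions, as families.\<close>

definition shape_fam :: "(nat \<times> nat) multiset \<Rightarrow> fam" where
  "shape_fam \<nu> S = (if finite S then \<Sum>m\<in>{m. keys m \<subseteq> S \<and> shape S m = \<nu>}. single m 1 else 0)"

lemma lookup_shape_fam: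
  assumes "finite S"
  shows "lookup (shape_fam \<nu> S) m = (if keys m \<subseteq> S \<and> shape S m = \<nu> then 1 else 0)"
proof -
  have "{m. keys m \<subseteq> S \<and> shape S m = \<nu>} \<subseteq> {m. keys m \<subseteq> S \<and> deg m = mdeg \<nu>}"
    using mdeg_shape[OF assms] by auto
  then have "finite {m. keys m \<subseteq> S \<and> shape S m = \<nu>}"
    using finite_mons[OF assms, of "mdeg \<nu>"] finite_subset by blast
  then show ?thesis using assms
    by (simp add: shape_fam_def lookup_sum lookup_single when_def sum.delta)
qed

lemma keys_pmap_inj: "inj q \<Longrightarrow> keys (pmap q m) = q ` keys m"
proof -
  assume q: "inj q"
  then have "lookup (pmap q m) (q a) = lookup m a" for a
    by (intro lookup_pmap_inj) (auto simp: inj_on_def)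
  then have "q ` keys m \<subseteq> keys (pmap q m)" by (auto simp: in_keys_iff simp del: lookup_not_eq_zero_eq_in_keys)
  then show ?thesis using keys_pmap[of q m] by blast
qed

lemma inj_pmap: "inj q \<Longrightarrow> inj (pmap q)"
proof (rule injI)
  fix x y :: "'a \<Rightarrow>\<^sub>0 'c" assume q: "inj q" and e: "pmap q x = pmap q y"
  have "lookup (pmap q z) (q a) = lookup z a" for z :: "'a \<Rightarrow>\<^sub>0 'c" and a
    using q by (intro lookup_pmap_inj) (auto simp: inj_on_def)
  then show "x = y" using e by (metis poly_mapping_eqI)
qed

lemma lookup_ren: "inj q \<Longrightarrow> lookup (ren q f) (pmap q m) = lookup f m"
  unfolding ren_def using inj_pmap[of q] by (intro lookup_pmap_inj) (auto simp: inj_on_def)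

lemma natural_shape_fam: "natural (shape_fam \<nu>)"
  unfolding natural_def
proof (intro allI impI)
  fix q S assume q: "cperm q" and S: "finite (S :: var set)"
  have inj: "inj q" using q by (simp add: cperm_def bij_def)
  show "ren q (shape_fam \<nu> S) = shape_fam \<nu> (q ` S)"
  proof (rule poly_mapping_eqI)
    fix m :: "var mon"
    have "pmap q (pmap (inv_into UNIV q) m) = m"
      unfolding pmap_pmap using q by (intro pmap_ident) (simp add: cperm_def bij_is_surj surj_f_inv_f)
    then obtain m' where m: "m = pmap q m'" by metis
    have "lookup (pmap q m') (q a) = lookup m' a" for a
      by (rule lookup_pmap_inj[OF inj_on_subset[OF inj subset_UNIV]])
    moreover have "mset_set (q ` S) = image_mset q (mset_set S)"
      using inj by (intro image_mset_mset_set[symmetric]) (auto simp: inj_on_def)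
    moreover have "fst (q a) = fst a" for a using q unfolding cperm_def by blast
    ultimately have "shape (q ` S) (pmap q m') = shape S m'"
      by (simp add: shape_def multiset.map_comp comp_def)
    moreover have "keys (pmap q m') \<subseteq> q ` S \<longleftrightarrow> keys m' \<subseteq> S"
      unfolding keys_pmap_inj[OF inj] using inj by (simp add: inj_image_subset_iff)
    ultimately show "lookup (ren q (shape_fam \<nu> S)) m = lookup (shape_fam \<nu> (q ` S)) m"
      using S by (simp add: m lookup_ren[OF inj] lookup_shape_fam)
  qed
qed

context graded_kernel
begin

definition shapes :: "(nat \<Rightarrow>\<^sub>0 nat) \<Rightarrow> int \<Rightarrow> (nat \<times> nat) multiset set" where
  "shapes \<gamma> e = {\<nu>. mct \<nu> = \<gamma> \<and> int (mdeg \<nu>) = e - e0 \<gamma>}"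

lemma shape_fam_H: "\<nu> \<in> shapes \<gamma> e \<Longrightarrow> shape_fam \<nu> \<in> H \<gamma> e"
  unfolding H_def mem_Collect_eq
proof (intro conjI allI impI natural_shape_fam)
  fix S assume \<nu>: "\<nu> \<in> shapes \<gamma> e"
  have k: "keys m \<subseteq> S \<and> shape S m = \<nu>" if "m \<in> keys (shape_fam \<nu> S)" "finite S" for m
    using that lookup_shape_fam[OF that(2), of \<nu> m] by (auto simp: in_keys_iff split: if_splits)
  have inf: "shape_fam \<nu> S = 0" if "infinite S" using that by (simp add: shape_fam_def)
  show "shape_fam \<nu> S \<in> polys S" using k inf by (cases "finite S") (auto simp: polys_def)
  show "homogi (e - e0 \<gamma>) (shape_fam \<nu> S)"
  proof (cases "finite S")
    case True
    have "int (deg m) = e - e0 \<gamma>" if "m \<in> keys (shape_fam \<nu> S)" for m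
      using k[OF that True] mdeg_shape[OF True, of m] \<nu> by (auto simp: shapes_def)
    then show ?thesis by (simp add: homogi_def)
  qed (simp add: inf)
  show "shape_fam \<nu> S = 0" if "\<not> (finite S \<and> ctype S = \<gamma>)"
  proof (cases "finite S")
    case True
    have "keys (shape_fam \<nu> S) = {}"
    proof (rule equals0I)
      fix m assume "m \<in> keys (shape_fam \<nu> S)"
      then show False using k[OF _ True, of m] mct_shape[of S m] \<nu> that True by (auto simp: shapes_def)
    qed
    then show ?thesis using keys_eq_empty by blast
  qed (rule inf)
qed

lemma finite_shapes: "finite (shapes \<gamma> e)"
proof -
  obtain B where B: "finite B" "ctype B = \<gamma>" using ctype_exists by blast
  have "shapes \<gamma> e \<subseteq> shape B ` {m. keys m \<subseteq> B \<and> deg m = nat (e - e0 \<gamma>)}"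
  proof
    fix \<nu> assume \<nu>: "\<nu> \<in> shapes \<gamma> e"
    then obtain m where m: "keys m \<subseteq> B" "shape B m = \<nu>"
      using shape_exists[OF B(1), of \<nu>] B(2) by (auto simp: shapes_def)
    then have "int (deg m) = e - e0 \<gamma>" using mdeg_shape[OF B(1) m(1)] \<nu> by (simp add: shapes_def)
    then have "deg m = nat (e - e0 \<gamma>)" by simp
    then show "\<nu> \<in> shape B ` {m. keys m \<subseteq> B \<and> deg m = nat (e - e0 \<gamma>)}" using m by blast
  qed
  then show ?thesis using finite_mons[OF B(1)] finite_surj by blast
qed

lemma H_eq_0: "F \<in> H (ctype B) e \<Longrightarrow> finite B \<Longrightarrow> F B = 0 \<Longrightarrow> F = 0"
  using H_eq_orbp[of F B e] by simp

lemma shape_fam_independent: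
  assumes "t \<subseteq> shapes \<gamma> e" "(\<Sum>\<nu>\<in>t. fsc (c \<nu>) (shape_fam \<nu>)) = 0" "\<nu> \<in> t"
  shows "c \<nu> = 0"
proof -
  have ft: "finite t" using assms(1) finite_shapes finite_subset by blast
  obtain B where B: "finite B" "ctype B = \<gamma>" using ctype_exists by blast
  obtain m where m: "keys m \<subseteq> B" "shape B m = \<nu>"
    using shape_exists[OF B(1), of \<nu>] B(2) assms(1,3) by (auto simp: shapes_def)
  have "0 = lookup ((\<Sum>\<nu>\<in>t. fsc (c \<nu>) (shape_fam \<nu>)) B) m" unfolding assms(2) by simp
  also have "\<dots> = (\<Sum>\<nu>'\<in>t. if \<nu>' = \<nu> then c \<nu>' else 0)"
    unfolding sum_fam_apply lookup_sum fsc_apply lookup_Cn_mult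
    by (intro sum.cong refl) (auto simp: lookup_shape_fam[OF B(1)] m)
  also have "\<dots> = c \<nu>" using ft assms(3) by (simp add: sum.delta')
  finally show ?thesis ..
qed

text \<open>By naturality the coefficient of a monomial in \<open>F B\<close> depends only on its
  shape. The combination with these coefficients agrees with \<open>F\<close> on \<open>B\<close>,
  hence everywhere.\<close>

lemma shape_fam_span: "H \<gamma> e \<subseteq> fam.span (shape_fam ` shapes \<gamma> e)"
proof
  fix F assume F: "F \<in> H \<gamma> e"
  obtain B where B: "finite B" "ctype B = \<gamma>" using ctype_exists by blast
  have "\<forall>\<nu>\<in>shapes \<gamma> e. \<exists>m. keys m \<subseteq> B \<and> shape B m = \<nu>"
    using shape_exists[OF B(1)] B(2) by (auto simp: shapes_def)
  then obtain mm where mm: "\<And>\<nu>. \<nu> \<in> shapes \<gamma> e \<Longrightarrow> keys (mm \<nu>) \<subseteq> B \<and> shape B (mm \<nu>) = \<nu>" by metis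
  define G where "G = (\<Sum>\<nu>\<in>shapes \<gamma> e. fsc (lookup (F B) (mm \<nu>)) (shape_fam \<nu>))"
  have G: "G \<in> H \<gamma> e" unfolding G_def
    by (intro fam.subspace_sum[OF subspace_H] fam.subspace_scale[OF subspace_H] shape_fam_H)
  have "lookup (G B) m = lookup (F B) m" for m
  proof -
    have GB: "lookup (G B) m = (\<Sum>\<nu>\<in>shapes \<gamma> e. if keys m \<subseteq> B \<and> shape B m = \<nu> then lookup (F B) (mm \<nu>) else 0)"
      unfolding G_def sum_fam_apply lookup_sum fsc_apply lookup_Cn_mult
      by (intro sum.cong refl) (auto simp: lookup_shape_fam[OF B(1)])
    show ?thesis
    proof (cases "keys m \<subseteq> B \<and> shape B m \<in> shapes \<gamma> e")
      case True
      define \<nu> where "\<nu> = shape B m"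
      have GB': "lookup (G B) m = lookup (F B) (mm \<nu>)" unfolding GB using True finite_shapes
        by (simp add: sum.delta \<nu>_def)
      have n: "keys (mm \<nu>) \<subseteq> B" "shape B m = shape B (mm \<nu>)" using mm[of \<nu>] True by (auto simp: \<nu>_def)
      obtain q where q: "cperm q" "q ` B = B" "pmap q m = mm \<nu>"
        using shape_eq_perm[OF B(1) _ n] True by blast
      have "lookup (F B) m = lookup (ren q (F B)) (pmap q m)"
        using q(1) by (intro lookup_ren[symmetric]) (simp add: cperm_def bij_def)
      also have "ren q (F B) = F B" using H_natural[OF F q(1) B(1)] q(2) by simp
      finally show ?thesis using GB' q(3) by simp
    next
      case False
      have "lookup (F B) m = 0"
      proof (rule ccontr)
        assume "lookup (F B) m \<noteq> 0"
        then have "m \<in> keys (F B)" by (simp add: in_keys_iff)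
        then have "keys m \<subseteq> B" "int (deg m) = e - e0 \<gamma>"
          using H_polys[OF F, of B] H_homogi[OF F, of B] by (auto simp: polys_def homogi_def)
        then show False using False B mct_shape[of B m] mdeg_shape[OF B(1), of m] by (simp add: shapes_def)
      qed
      moreover have "(if keys m \<subseteq> B \<and> shape B m = \<nu> then lookup (F B) (mm \<nu>) else 0) = 0"
        if "\<nu> \<in> shapes \<gamma> e" for \<nu>
      proof (rule if_not_P)
        show "\<not> (keys m \<subseteq> B \<and> shape B m = \<nu>)" using that False by blast
      qed
      ultimately show ?thesis unfolding GB by (simp add: sum.neutral)
    qed
  qed
  then have "(F - G) B = 0" by (auto intro: poly_mapping_eqI)
  moreover have "F - G \<in> H (ctype B) e" unfolding B(2) by (rule fam.subspace_diff[OF subspace_H F G])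
  ultimately have "F = G" using H_eq_0[of "F - G" B e] B(1) by simp
  then show "F \<in> fam.span (shape_fam ` shapes \<gamma> e)"
    unfolding G_def using fam.span_sum fam.span_scale fam.span_base by (metis (no_types, lifting) image_eqI)
qed

lemma inj_shape_fam: "inj_on shape_fam (shapes \<gamma> e)"
proof (rule inj_onI)
  fix \<nu> \<nu>' assume n: "\<nu> \<in> shapes \<gamma> e" "\<nu>' \<in> shapes \<gamma> e" and eq: "shape_fam \<nu> = shape_fam \<nu>'"
  obtain B where B: "finite B" "ctype B = \<gamma>" using ctype_exists by blast
  obtain m where m: "keys m \<subseteq> B" "shape B m = \<nu>"
    using shape_exists[OF B(1), of \<nu>] B(2) n by (auto simp: shapes_def)
  then have "lookup (shape_fam \<nu>' B) m = 1" unfolding eq[symmetric] by (simp add: lookup_shape_fam[OF B(1)])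
  then show "\<nu> = \<nu>'" using m by (auto simp: lookup_shape_fam[OF B(1)] split: if_splits)
qed

lemma dim_H: "fam.dim (H \<gamma> e) = card (shapes \<gamma> e)"
proof -
  have "fam.independent (shape_fam ` shapes \<gamma> e)"
    unfolding fam.independent_explicit_module
  proof (intro allI impI)
    fix t u v assume t: "finite t" "t \<subseteq> shape_fam ` shapes \<gamma> e" "(\<Sum>v\<in>t. fsc (u v) v) = 0" "v \<in> t"
    define s where "s = {\<nu>\<in>shapes \<gamma> e. shape_fam \<nu> \<in> t}"
    have i: "inj_on shape_fam s" using inj_shape_fam by (rule inj_on_subset) (auto simp: s_def)
    have st: "t = shape_fam ` s" using t(2) by (auto simp: s_def)
    obtain \<nu> where \<nu>: "\<nu> \<in> s" "v = shape_fam \<nu>" using t(4) st by blast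
    have "(\<Sum>\<nu>\<in>s. fsc (u (shape_fam \<nu>)) (shape_fam \<nu>)) = 0"
      using t(3) unfolding st by (simp add: sum.reindex[OF i])
    then show "u v = 0" using shape_fam_independent[of s \<gamma> e "\<lambda>\<nu>. u (shape_fam \<nu>)" \<nu>] \<nu> by (auto simp: s_def)
  qed
  then have "card (shape_fam ` shapes \<gamma> e) = fam.dim (H \<gamma> e)"
    using shape_fam_H shape_fam_span by (intro fam.basis_card_eq_dim) auto
  then show ?thesis using card_image[OF inj_shape_fam] by metis
qed

end

section \<open>Bilinearity, the decomposable subspace and a complement to it\<close>

lemma star_add_left: "kernel.star h (F + F') G = kernel.star h F G + kernel.star h F' G"
  if "kernel h"
proof -
  interpret kernel h by fact
  show ?thesis by (auto simp: star_def fun_eq_iff distrib_right sum.distrib)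
qed

lemma star_fsc_left: "kernel.star h (fsc c F) G = fsc c (kernel.star h F G)"
  if "kernel h"
proof -
  interpret kernel h by fact
  show ?thesis by (auto simp: star_def fun_eq_iff fsc_def sum_distrib_left mult.assoc)
qed

context graded_kernel
begin

lemmas star_add = star_add_left[OF kernel_axioms]
lemmas star_fsc = star_fsc_left[OF kernel_axioms]

lemma star_0: "star 0 G = 0"
  by (auto simp: star_def fun_eq_iff)

lemma star_span_left:
  assumes "F \<in> fam.span A" "\<And>X. X \<in> A \<Longrightarrow> star X G \<in> fam.span C"
  shows "star F G \<in> fam.span C"
  using assms(1)
proof (induction rule: fam.span_induct_alt)
  case base
  then show ?case by (simp only: star_0 fam.span_zero)
next
  case (step c x y)
  show ?case unfolding star_add star_fsc
    by (rule fam.span_add[OF fam.span_scale[OF assms(2)[OF step(1)]] step(2)])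
qed

lemma star_span:
  assumes "F \<in> fam.span A" "G \<in> fam.span B" "\<And>X Y. X \<in> A \<Longrightarrow> Y \<in> B \<Longrightarrow> star X Y \<in> fam.span C"
  shows "star F G \<in> fam.span C"
proof (rule star_span_left[OF assms(1)])
  fix X assume X: "X \<in> A"
  have "star G X \<in> fam.span C"
    by (rule star_span_left[OF assms(2)]) (simp add: star_commute[of _ X] assms(3)[OF X])
  then show "star X G \<in> fam.span C" by (simp add: star_commute)
qed

lemma I_ren:
  assumes q: "cperm q" and x: "x \<in> I B"
  shows "ren q x \<in> I (q ` B)"
  using x unfolding I_def
proof (induction rule: ideal.span_induct_alt)
  case base
  then show ?case by (simp add: ideal.span_zero)
next
  case (step c x y)
  have inj: "inj q" and col: "\<And>a. fst (q a) = fst a" using q unfolding cperm_def bij_def by blast+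
  obtain T where T: "x = K T (B - T)" "T \<subseteq> B" "T \<noteq> {}" "T \<noteq> B" using step(1) by (auto simp: gens_def)
  have "ren q x = K (q ` T) (q ` B - q ` T)"
    unfolding T(1) using inj_on_subset[OF inj subset_UNIV] col by (simp add: K_ren image_set_diff[OF inj])
  moreover have "q ` T \<subseteq> q ` B" "q ` T \<noteq> {}" "q ` T \<noteq> q ` B"
    using T inj by (auto simp: inj_image_eq_iff)
  ultimately have "ren q x \<in> gens (q ` B)" unfolding gens_def by blast
  then have "ren q c * ren q x + ren q y \<in> ideal.span (gens (q ` B))"
    using step by (intro ideal.span_add ideal.span_scale) (auto intro: ideal.span_base)
  then show ?case by (simp add: ren_add ren_mult)
qed

text \<open>The generators are homogeneous, so each component of a multiple of a generator is again
  a multiple of it.\<close>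

lemma I_homog: "x \<in> I B \<Longrightarrow> hcomp d x \<in> I B"
  unfolding I_def
proof (induction rule: ideal.span_induct_alt)
  case base
  then show ?case by (simp add: ideal.span_zero)
next
  case (step c x y)
  then obtain k where k: "homog k x" using K_homog by (auto simp: gens_def)
  have "hcomp d (c * x) \<in> ideal.span (gens B)"
    unfolding hcomp_mult_homog[OF k] using step(1)
    by (auto intro: ideal.span_zero ideal.span_scale ideal.span_base)
  then show ?case using step by (simp add: hcomp_add ideal.span_add)
qed

text \<open>The decomposable part, described by ideals instead of products: the cancellation
  arguments work with ideals, and \<open>H_ideal_Dec\<close> leads back to products.\<close>

definition D :: "(nat \<Rightarrow>\<^sub>0 nat) \<Rightarrow> int \<Rightarrow> fam set" where
  "D \<gamma> e = {F \<in> H \<gamma> e. \<forall>S. F S \<in> I S}"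

lemma D_subset: "D \<gamma> e \<subseteq> H \<gamma> e" by (auto simp: D_def)

lemma subspace_D: "fam.subspace (D \<gamma> e)"
proof (rule fam.subspaceI)
  show "0 \<in> D \<gamma> e" using fam.subspace_0[OF subspace_H] by (auto simp: D_def I_def ideal.span_zero)
next
  fix F G assume "F \<in> D \<gamma> e" "G \<in> D \<gamma> e"
  then show "F + G \<in> D \<gamma> e"
    using fam.subspace_add[OF subspace_H] by (auto simp: D_def I_def intro: ideal.span_add)
next
  fix c F assume "F \<in> D \<gamma> e"
  then show "fsc c F \<in> D \<gamma> e"
    using fam.subspace_scale[OF subspace_H] by (auto simp: D_def I_def fsc_apply intro: ideal.span_scale)
qed

text \<open>A colour-preserving permutation carries the ideal, along with the family, from
  \<open>B\<close> to any other set of the same type, so one set suffices for the test.\<close>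

lemma D_I:
  assumes F: "F \<in> H \<gamma> e" and B: "finite B" "ctype B = \<gamma>" and FB: "F B \<in> I B"
  shows "F \<in> D \<gamma> e"
  unfolding D_def
proof (intro CollectI conjI F allI)
  fix S
  show "F S \<in> I S"
  proof (cases "finite S \<and> ctype S = \<gamma>")
    case True
    obtain f where f: "bij_betw f B S" "\<forall>a\<in>B. fst (f a) = fst a"
      using ctype_eq_bij[OF B(1), of S] True B(2) by auto
    obtain q where q: "cperm q" "\<forall>a\<in>B. q a = f a" using extend_cperm[OF B(1) f(1)] f(2) by blast
    have "q ` B = S" using q f by (auto simp: bij_betw_def)
    then show ?thesis using I_ren[OF q(1) FB] H_natural[OF F q(1) B(1)] by simp
  next
    case False
    then have "F S = 0" using H_support[OF F] H_infinite[OF F] by blast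
    then show ?thesis by (simp add: I_def ideal.span_zero)
  qed
qed

definition is_complement :: "(nat \<Rightarrow>\<^sub>0 nat) \<Rightarrow> int \<Rightarrow> fam set \<Rightarrow> bool" where
  "is_complement \<gamma> e W \<longleftrightarrow> finite W \<and> W \<subseteq> H \<gamma> e \<and> fam.indep_mod (D \<gamma> e) W \<and> H \<gamma> e \<subseteq> fam.span (D \<gamma> e \<union> W) \<and>
    (\<forall>A\<subseteq>H \<gamma> e. fam.indep_mod (D \<gamma> e) A \<longrightarrow> finite A \<and> card A \<le> card W) \<and>
    (\<forall>A. finite A \<longrightarrow> H \<gamma> e \<subseteq> fam.span (D \<gamma> e \<union> A) \<longrightarrow> card W \<le> card A)"

text \<open>Representatives of a basis of the indecomposables in this type and degree; for non-zero
  types these become the free generators.\<close>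

definition W :: "(nat \<Rightarrow>\<^sub>0 nat) \<Rightarrow> int \<Rightarrow> fam set" where
  "W \<gamma> e = (SOME W. is_complement \<gamma> e W)"

lemma is_complement_W: "is_complement \<gamma> e (W \<gamma> e)"
proof -
  have "\<exists>W. is_complement \<gamma> e W"
    unfolding is_complement_def
    by (rule fam.complement_exists[OF subspace_D D_subset, of "shape_fam ` shapes \<gamma> e"])
      (auto intro: finite_shapes subsetD[OF shape_fam_span])
  then show ?thesis unfolding W_def by (rule someI_ex)
qed

lemma W: "finite (W \<gamma> e)" "W \<gamma> e \<subseteq> H \<gamma> e" "fam.indep_mod (D \<gamma> e) (W \<gamma> e)"
    "H \<gamma> e \<subseteq> fam.span (D \<gamma> e \<union> W \<gamma> e)"
  and W_max: "A \<subseteq> H \<gamma> e \<Longrightarrow> fam.indep_mod (D \<gamma> e) A \<Longrightarrow> card A \<le> card (W \<gamma> e)"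
  and W_min: "finite A \<Longrightarrow> H \<gamma> e \<subseteq> fam.span (D \<gamma> e \<union> A) \<Longrightarrow> card (W \<gamma> e) \<le> card A"
  using is_complement_W[of \<gamma> e] unfolding is_complement_def by blast+

section \<open>The algebra is free\<close>

text \<open>Generators are tagged with type and degree, so that the bigrading of a product is a sum
  over the multiset of its factors. Type zero is left out because it contains the unit.\<close>

definition \<Omega> :: "((nat \<Rightarrow>\<^sub>0 nat) \<times> int \<times> fam) set" where
  "\<Omega> = {(\<gamma>, e, F). \<gamma> \<noteq> 0 \<and> F \<in> W \<gamma> e}"

definition gen :: "(nat \<Rightarrow>\<^sub>0 nat) \<times> int \<times> fam \<Rightarrow> fam" where "gen w = snd (snd w)"

definition gmsets :: "(nat \<Rightarrow>\<^sub>0 nat) \<Rightarrow> int \<Rightarrow> ((nat \<Rightarrow>\<^sub>0 nat) \<times> int \<times> fam) multiset set" where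
  "gmsets \<gamma> e = {M. set_mset M \<subseteq> \<Omega> \<and> (\<Sum>w\<in>#M. fst w) = \<gamma> \<and> (\<Sum>w\<in>#M. fst (snd w)) = e}"

lemma \<Omega>_H: "w \<in> \<Omega> \<Longrightarrow> gen w \<in> H (fst w) (fst (snd w))"
  by (auto simp: \<Omega>_def gen_def intro: subsetD[OF W(2)])

lemma gmsets_H: "M \<in> gmsets \<gamma> e \<Longrightarrow> Pi gen M \<in> H \<gamma> e"
  using Pi_H[of M gen fst "\<lambda>w. fst (snd w)"] \<Omega>_H by (auto simp: gmsets_def)

lemma Pi_union: "Pi g (M + N) S = star (Pi g M) (Pi g N) S"
proof (induction M arbitrary: S)
  case empty
  show ?case
  proof (cases "finite S")
    case True
    then show ?thesis by (simp add: star_commute[of one_fam] star_one)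
  next
    case False
    have "Pi g N S = 0" using False by (cases N) (auto simp: star_def one_fam_def)
    then show ?thesis using False by (simp add: star_def)
  qed
next
  case (add w M)
  have "star (g w) (Pi g (M + N)) S = star (g w) (star (Pi g M) (Pi g N)) S"
    using add.IH by (simp add: star_def)
  then show ?case by (simp add: star_assoc)
qed

text \<open>\<open>Pi_independent\<close> asks for independence modulo \<open>I B\<close>; the
  complements provide it modulo \<open>D\<close>, and \<open>D_I\<close> translates between the
  two.\<close>

lemma Pi_gen_independent:
  assumes "finite t" "t \<subseteq> gmsets \<gamma> e" "(\<Sum>M\<in>t. fsc (c M) (Pi gen M)) = 0" "M \<in> t"
  shows "c M = 0"
proof -
  obtain B where B: "finite B" "ctype B = \<gamma>" using ctype_exists by blast
  show ?thesis
  proof (rule Pi_independent[where \<Omega> = \<Omega> and g = gen and \<gamma> = fst and S = B and \<M> = t])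
    fix w S assume w: "w \<in> \<Omega>"
    show "gen w S = 0" if "ctype S \<noteq> fst w" using H_support[OF \<Omega>_H[OF w] that] .
    show "gen w S \<in> polys S" using H_polys[OF \<Omega>_H[OF w]] .
    show "fst w \<noteq> 0" using w by (auto simp: \<Omega>_def)
  next
    fix B A c w
    assume B: "finite B" and A: "finite A" "A \<subseteq> {w \<in> \<Omega>. fst w = ctype B}"
      and s: "(\<Sum>w\<in>A. Cn (c w) * gen w B) \<in> I B" and w: "w \<in> A"
    text \<open>The sum need not be homogeneous, so first pass to the component containing \<open>w\<close>.\<close>
    define e where "e = fst (snd w)"
    define A' where "A' = {w'\<in>A. fst (snd w') = e}"
    have wB: "gen w' B = 0 \<or> (fst (snd w') - e0 (ctype B) \<ge> 0)" if "w' \<in> A" for w'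
      using homogi_cases[OF H_homogi[OF \<Omega>_H[of w']], of B] that A by fastforce
    have i: "inj_on gen A'"
    proof (rule inj_onI)
      fix x y assume x: "x \<in> A'" and y: "y \<in> A'" and g: "gen x = gen y"
      have "fst x = fst y" using subsetD[OF A(2), of x] subsetD[OF A(2), of y] x y by (simp add: A'_def)
      then show "x = y" using x y g by (simp add: A'_def gen_def prod_eq_iff)
    qed
    have "(\<Sum>w\<in>A'. Cn (c w) * gen w B) \<in> I B"
    proof (cases "e - e0 (ctype B) \<ge> 0")
      case True
      define d where "d = nat (e - e0 (ctype B))"
      have "hcomp d (Cn (c w') * gen w' B) = (if w' \<in> A' then Cn (c w') * gen w' B else 0)" if "w' \<in> A" for w'
      proof (cases "w' \<in> A'")
        case w': True
        then have "homogi (int d) (gen w' B)"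
          using H_homogi[OF \<Omega>_H[of w'], of B] that A True by (auto simp: A'_def d_def)
        then show ?thesis using w' by (simp add: homogi_int hcomp_homog homog_Cn_mult)
      next
        case False
        then have ne: "fst (snd w') \<noteq> e" using that by (simp add: A'_def)
        show ?thesis
        proof (rule poly_mapping_eqI)
          fix m
          have "lookup (gen w' B) m = 0" if "deg m = d"
          proof (rule ccontr)
            assume "lookup (gen w' B) m \<noteq> 0"
            then have "int (deg m) = fst (snd w') - e0 (ctype B)"
              using H_homogi[OF \<Omega>_H[of w'], of B] \<open>w' \<in> A\<close> A by (auto simp: homogi_def in_keys_iff)
            then show False using that ne True by (simp add: d_def)
          qed
          then show "lookup (hcomp d (Cn (c w') * gen w' B)) m =
            lookup (if w' \<in> A' then Cn (c w') * gen w' B else 0) m"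
            using False by (simp add: lookup_hcomp lookup_Cn_mult)
        qed
      qed
      then have "hcomp d (\<Sum>w\<in>A. Cn (c w) * gen w B) = (\<Sum>w\<in>A. if w \<in> A' then Cn (c w) * gen w B else 0)"
        by (simp add: hcomp_sum)
      also have "\<dots> = (\<Sum>w\<in>A'. Cn (c w) * gen w B)"
        by (rule sum.mono_neutral_cong_right) (use A in \<open>auto simp: A'_def\<close>)
      finally show ?thesis using I_homog[OF s, of d] by simp
    next
      case False
      then have "gen w' B = 0" if "w' \<in> A'" for w' using wB[of w'] that by (auto simp: A'_def)
      then have "(\<Sum>w\<in>A'. Cn (c w) * gen w B) = 0" by (intro sum.neutral) auto
      then show ?thesis by (simp add: I_def ideal.span_zero)
    qed
    moreover define c' where "c' = (\<lambda>F. c (ctype B, e, F))"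
    have cc: "c w' = c' (gen w')" if "w' \<in> A'" for w'
    proof -
      have "w' = (ctype B, e, gen w')" using that A(2) by (auto simp: A'_def gen_def prod_eq_iff)
      then show ?thesis by (metis c'_def)
    qed
    ultimately have "(\<Sum>F\<in>gen ` A'. fsc (c' F) F) B \<in> I B"
      unfolding sum_fam_apply fsc_apply by (simp add: sum.reindex[OF i] cc)
    moreover have W': "gen ` A' \<subseteq> W (ctype B) e" using A(2) by (auto simp: A'_def \<Omega>_def gen_def)
    then have "(\<Sum>F\<in>gen ` A'. fsc (c' F) F) \<in> H (ctype B) e"
      using W(2) by (intro fam.subspace_sum[OF subspace_H] fam.subspace_scale[OF subspace_H]) auto
    ultimately have "(\<Sum>F\<in>gen ` A'. fsc (c' F) F) \<in> D (ctype B) e"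
      using B by (intro D_I) auto
    then have "c' (gen w) = 0"
      using fam.indep_modD[OF W(3) _ W', of c' "gen w"] A(1) w by (auto simp: A'_def e_def)
    then show "c w = 0" using cc[of w] w by (simp add: A'_def e_def)
  next
    show "(\<Sum>M\<in>t. Cn (c M) * Pi gen M B) = 0"
      using fun_cong[OF assms(3), of B] by (simp add: sum_fam_apply fsc_apply)
  qed (use assms B in \<open>auto simp: gmsets_def\<close>)
qed

text \<open>Induction on the size of the type: an element is a combination of generators and
  decomposables, and both factors of a decomposable have smaller type. In type zero there are only
  multiples of the unit, in degree zero.\<close>

lemma Pi_gen_span: "H \<gamma> e \<subseteq> fam.span (Pi gen ` gmsets \<gamma> e)"
proof (induction "deg \<gamma>" arbitrary: \<gamma> e rule: less_induct)
  case less
  show ?case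
  proof (cases "\<gamma> = 0")
    case True
    show ?thesis
    proof
      fix F assume F: "F \<in> H \<gamma> e"
      show "F \<in> fam.span (Pi gen ` gmsets \<gamma> e)"
      proof (cases "F {} = 0")
        case True
        then have "F = 0" using F \<open>\<gamma> = 0\<close> by (intro H_eq_0[of F "{}" e]) auto
        then show ?thesis by (simp only: fam.span_zero)
      next
        case False
        have k: "m = 0" if "m \<in> keys (F {})" for m
          using H_polys[OF F, of "{}"] that keys_eq_empty by (auto simp: polys_def)
        obtain m where m: "m \<in> keys (F {})" using False keys_eq_empty by blast
        then have "int (deg m) = e" using H_homogi[OF F, of "{}"] \<open>\<gamma> = 0\<close> by (simp add: homogi_def e0_0)
        then have "e = 0" using k[OF m] by simp
        have "F {} = Cn (lookup (F {}) 0)"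
          using k by (intro poly_mapping_eqI) (auto simp: Cn_def lookup_single when_def in_keys_iff)
        then have "F S = fsc (lookup (F {}) 0) one_fam S" for S
        proof (cases "S = {}")
          case ne: False
          then have "F S = 0" using H_support[OF F, of S] H_infinite[OF F, of S] ctype_eq_0[of S] \<open>\<gamma> = 0\<close> by (cases "finite S") auto
          then show ?thesis using ne by (simp add: fsc_apply one_fam_def)
        qed (simp add: fsc_apply one_fam_def)
        then have F': "F = fsc (lookup (F {}) 0) one_fam" by blast
        have "one_fam \<in> Pi gen ` gmsets \<gamma> e"
          using \<open>\<gamma> = 0\<close> \<open>e = 0\<close> by (intro image_eqI[of _ _ "{#}"]) (auto simp: gmsets_def)
        then show ?thesis by (subst F') (intro fam.span_scale fam.span_base)
      qed
    qed
  next
    case False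
    have "W \<gamma> e \<subseteq> fam.span (Pi gen ` gmsets \<gamma> e)"
    proof
      fix F assume F: "F \<in> W \<gamma> e"
      have "Pi gen {#(\<gamma>, e, F)#} S = F S" for S
      proof (cases "finite S")
        case True
        then show ?thesis by (simp add: star_one gen_def)
      next
        case False
        then show ?thesis using H_infinite[of F \<gamma> e S] F W(2) by (auto simp: star_def)
      qed
      then have "Pi gen {#(\<gamma>, e, F)#} = F" by blast
      moreover have "{#(\<gamma>, e, F)#} \<in> gmsets \<gamma> e" using F False by (simp add: gmsets_def \<Omega>_def)
      ultimately show "F \<in> fam.span (Pi gen ` gmsets \<gamma> e)" by (metis fam.span_base image_eqI)
    qed
    moreover have "D \<gamma> e \<subseteq> fam.span (Pi gen ` gmsets \<gamma> e)"
    proof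
      fix F assume F: "F \<in> D \<gamma> e"
      obtain B where B: "finite B" "ctype B = \<gamma>" using ctype_exists by blast
      have "F \<in> fam.span (Dec \<gamma> e)" using H_ideal_Dec[of F B e] F B by (auto simp: D_def)
      moreover have "Dec \<gamma> e \<subseteq> fam.span (Pi gen ` gmsets \<gamma> e)"
      proof
        fix X assume "X \<in> Dec \<gamma> e"
        then obtain F G \<gamma>1 \<gamma>2 e1 e2 where X: "X = star F G" "F \<in> H \<gamma>1 e1" "G \<in> H \<gamma>2 e2"
          "\<gamma>1 \<noteq> 0" "\<gamma>2 \<noteq> 0" "\<gamma>1 + \<gamma>2 = \<gamma>" "e1 + e2 = e" unfolding Dec_def by blast
        have d: "deg \<gamma>1 < deg \<gamma>" "deg \<gamma>2 < deg \<gamma>"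
          using X deg_eq_0[of \<gamma>1] deg_eq_0[of \<gamma>2] by (auto simp: X(6)[symmetric] deg_add)
        have "F \<in> fam.span (Pi gen ` gmsets \<gamma>1 e1)" "G \<in> fam.span (Pi gen ` gmsets \<gamma>2 e2)"
          using less[OF d(1), of e1] less[OF d(2), of e2] X by auto
        then show "X \<in> fam.span (Pi gen ` gmsets \<gamma> e)" unfolding X(1)
        proof (rule star_span)
          fix X Y assume "X \<in> Pi gen ` gmsets \<gamma>1 e1" "Y \<in> Pi gen ` gmsets \<gamma>2 e2"
          then obtain M N where MN: "X = Pi gen M" "M \<in> gmsets \<gamma>1 e1" "Y = Pi gen N" "N \<in> gmsets \<gamma>2 e2" by blast
          have "star X Y = Pi gen (M + N)" unfolding MN by (rule ext) (rule Pi_union[symmetric])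
          moreover have "M + N \<in> gmsets \<gamma> e" using MN X by (auto simp: gmsets_def)
          ultimately show "star X Y \<in> fam.span (Pi gen ` gmsets \<gamma> e)" by (metis fam.span_base image_eqI)
        qed
      qed
      then have "fam.span (Dec \<gamma> e) \<subseteq> fam.span (Pi gen ` gmsets \<gamma> e)" by (rule fam.span_minimal) simp
      ultimately show "F \<in> fam.span (Pi gen ` gmsets \<gamma> e)" by blast
    qed
    ultimately have "fam.span (D \<gamma> e \<union> W \<gamma> e) \<subseteq> fam.span (Pi gen ` gmsets \<gamma> e)"
      by (intro fam.span_minimal) auto
    then show ?thesis using W(4) by blast
  qed
qed

text \<open>The products of generators form a basis of the component, and so do the monomial
  symmetric functions.\<close>

theorem card_gmsets: "finite (gmsets \<gamma> e)" "card (gmsets \<gamma> e) = card (shapes \<gamma> e)"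
proof -
  have inj: "inj_on (Pi gen) (gmsets \<gamma> e)"
  proof (rule inj_onI, rule ccontr)
    fix M N assume MN: "M \<in> gmsets \<gamma> e" "N \<in> gmsets \<gamma> e" "Pi gen M = Pi gen N" "M \<noteq> N"
    define c where "c X = (if X = M then 1 else - 1 :: rat)" for X
    have "(\<Sum>X\<in>{M, N}. fsc (c X) (Pi gen X)) = fsc 1 (Pi gen M) + fsc (- 1) (Pi gen N)"
      using MN(4) by (auto simp: c_def)
    also have "\<dots> = fsc (1 + - 1) (Pi gen N)" unfolding MN(3) by (rule fam.scale_left_distrib[symmetric])
    finally have "(\<Sum>X\<in>{M, N}. fsc (c X) (Pi gen X)) = 0" by simp
    then have "c M = 0" using Pi_gen_independent[of "{M, N}" \<gamma> e c M] MN by auto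
    then show False by (simp add: c_def)
  qed
  have ind: "fam.independent (Pi gen ` gmsets \<gamma> e)"
    unfolding fam.independent_explicit_module
  proof (intro allI impI)
    fix t u v assume t: "finite t" "t \<subseteq> Pi gen ` gmsets \<gamma> e" "(\<Sum>v\<in>t. fsc (u v) v) = 0" "v \<in> t"
    define s where "s = {M\<in>gmsets \<gamma> e. Pi gen M \<in> t}"
    have i: "inj_on (Pi gen) s" using inj by (rule inj_on_subset) (auto simp: s_def)
    have st: "t = Pi gen ` s" using t(2) by (auto simp: s_def)
    then have fs: "finite s" using t(1) finite_imageD[OF _ i] by simp
    obtain M where M: "M \<in> s" "v = Pi gen M" using t(4) st by blast
    have "(\<Sum>M\<in>s. fsc (u (Pi gen M)) (Pi gen M)) = 0"
      using t(3) unfolding st by (simp add: sum.reindex[OF i])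
    then show "u v = 0" using Pi_gen_independent[OF fs, of \<gamma> e "\<lambda>M. u (Pi gen M)" M] M by (auto simp: s_def)
  qed
  have sub: "Pi gen ` gmsets \<gamma> e \<subseteq> H \<gamma> e" using gmsets_H by blast
  then have "Pi gen ` gmsets \<gamma> e \<subseteq> fam.span (shape_fam ` shapes \<gamma> e)" using shape_fam_span by blast
  then have "finite (Pi gen ` gmsets \<gamma> e)"
    by (rule conjunct1[OF fam.independent_span_bound[OF finite_imageI[OF finite_shapes] ind]])
  then show "finite (gmsets \<gamma> e)" using finite_imageD[OF _ inj] by blast
  have "card (Pi gen ` gmsets \<gamma> e) = fam.dim (H \<gamma> e)"
    by (rule fam.basis_card_eq_dim[OF sub Pi_gen_span ind])
  then show "card (gmsets \<gamma> e) = card (shapes \<gamma> e)"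
    using card_image[OF inj] dim_H by simp
qed

section \<open>The number of generators\<close>

definition psum :: "var set \<Rightarrow> var pol" where "psum S = (\<Sum>a\<in>S. V a)"

definition sigma :: "fam \<Rightarrow> fam" where "sigma F S = psum S * F S"

lemma psum_polys: "psum S \<in> polys S" by (auto simp: psum_def intro!: polys_sum polys_V)

lemma psum_homog: "homog 1 (psum S)" unfolding psum_def by (intro homog_sum homog_V)

lemma ren_psum: "inj_on q S \<Longrightarrow> ren q (psum S) = psum (q ` S)"
  by (simp add: psum_def ren_sum sum.reindex)

lemma sigma_H: "F \<in> H \<gamma> e \<Longrightarrow> sigma F \<in> H \<gamma> (e + 1)"
  unfolding H_def mem_Collect_eq
proof (elim conjE, intro conjI allI impI)
  assume n: "natural F" and h: "\<forall>S. homogi (e - e0 \<gamma>) (F S)" and p: "\<forall>S. F S \<in> polys S"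
    and s: "\<forall>S. \<not> (finite S \<and> ctype S = \<gamma>) \<longrightarrow> F S = 0"
  show "natural (sigma F)"
    unfolding natural_def
  proof (intro allI impI)
    fix q and S :: "var set" assume q: "cperm q" and S: "finite S"
    have "inj_on q S" using q inj_on_subset[of q UNIV S] by (simp add: cperm_def bij_def)
    then show "ren q (sigma F S) = sigma F (q ` S)"
      using n q S by (simp add: natural_def sigma_def ren_mult ren_psum)
  qed
  fix S
  show "sigma F S \<in> polys S" using p by (simp add: sigma_def polys_mult psum_polys)
  have "homogi (int 1) (psum S)" by (simp only: homogi_int psum_homog)
  from homogi_mult[OF this spec[OF h, of S]]
  show "homogi (e + 1 - e0 \<gamma>) (sigma F S)" by (simp add: sigma_def algebra_simps)
  show "sigma F S = 0" if "\<not> (finite S \<and> ctype S = \<gamma>)" using s that by (simp add: sigma_def)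
qed

text \<open>The derivation along \<open>B\<close> takes the sum of its variables to their number, a
  non-zero constant because \<open>\<gamma>\<close> is not zero; so \<open>cancel_linear\<close>
  applies.\<close>

lemma sigma_D:
  assumes "F \<in> H \<gamma> e" "sigma F \<in> D \<gamma> (e + 1)" "\<gamma> \<noteq> 0"
  shows "F \<in> D \<gamma> e"
proof -
  obtain B where B: "finite B" "ctype B = \<gamma>" using ctype_exists by blast
  have ne: "card B \<noteq> 0" using B assms(3) by auto
  have "der B (psum B) = Cn (of_nat (card B))"
    using B by (simp add: psum_def der_sum der_V Cn_of_nat)
  moreover have "F B * psum B \<in> ideal.span (gens B)"
    using assms(2) by (simp add: D_def sigma_def I_def mult.commute)
  moreover have "der B g \<in> ideal.span (gens B)" if "g \<in> gens B" for g
    using der_gens[OF B(1) that] by (simp add: ideal.span_zero)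
  ultimately have "F B \<in> ideal.span (gens B)"
    using cancel_linear[of "gens B" B "psum B" "of_nat (card B)" "F B"] ne by simp
  then show ?thesis using D_I[OF assms(1) B] by (simp add: I_def)
qed

theorem card_W_mono: "\<gamma> \<noteq> 0 \<Longrightarrow> card (W \<gamma> e) \<le> card (W \<gamma> (e + 1))"
proof -
  assume \<gamma>: "\<gamma> \<noteq> 0"
  have *: "inj_on sigma (W \<gamma> e) \<and> fam.indep_mod (D \<gamma> (e + 1)) (sigma ` W \<gamma> e)"
    by (rule fam.indep_mod_image[OF _ _ W(3) subspace_H W(2) fam.subspace_0[OF subspace_D]])
      (auto simp: sigma_def fun_eq_iff fsc_apply distrib_left mult.left_commute intro: sigma_D[OF _ _ \<gamma>])
  then have "card (sigma ` W \<gamma> e) \<le> card (W \<gamma> (e + 1))"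
    by (intro W_max) (auto intro: sigma_H subsetD[OF W(2)])
  then show ?thesis using * card_image by metis
qed

lemma card_W_small: "e < e0 \<gamma> \<Longrightarrow> card (W \<gamma> e) = 0"
proof -
  assume e: "e < e0 \<gamma>"
  have "F = 0" if F: "F \<in> H \<gamma> e" for F
  proof
    fix S
    show "F S = 0 S" using homogi_cases[OF H_homogi[OF F, of S]] e by auto
  qed
  then have "H \<gamma> e \<subseteq> fam.span (D \<gamma> e \<union> {})" by (auto intro: fam.span_zero)
  from W_min[OF _ this] show ?thesis by simp
qed

text \<open>Modulo the ideal all differences of variables are nilpotent. Let \<open>C\<close> be the set of the variables
  that become equal to a given one modulo an ideal containing all the generators. If \<open>C\<close> is not everything,
  then the generator \<open>K C (B - C)\<close> is a product of differences, and by induction the claim holds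
  after adding any of them to the ideal.\<close>

lemma nilpotent_prod:
  fixes z :: "'b::comm_ring_1"
  assumes "finite A" "\<And>a. a \<in> A \<Longrightarrow> \<exists>N. z ^ N \<in> ideal.span (Set.insert (f a) G)"
  shows "\<exists>N. z ^ N \<in> ideal.span (Set.insert (prod f A) G)"
  using assms
proof (induction A rule: finite_induct)
  case empty
  have "1 \<in> ideal.span (Set.insert 1 G)" by (simp add: ideal.span_base)
  then have "z ^ 0 \<in> ideal.span (Set.insert 1 G)" by simp
  then show ?case by (simp only: prod.empty) blast
next
  case (insert a A)
  obtain N where N: "z ^ N \<in> ideal.span (Set.insert (f a) G)" using insert.prems by blast
  obtain N' where N': "z ^ N' \<in> ideal.span (Set.insert (prod f A) G)" using insert by blast
  obtain k where k: "z ^ N - k * f a \<in> ideal.span G" using N unfolding ideal.span_insert by blast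
  obtain k' where k': "z ^ N' - k' * prod f A \<in> ideal.span G" using N' unfolding ideal.span_insert by blast
  have "z ^ (N + N') - k * k' * prod f (Set.insert a A) =
      z ^ N' * (z ^ N - k * f a) + k * f a * (z ^ N' - k' * prod f A)"
    using insert.hyps by (simp add: power_add algebra_simps)
  also have "\<dots> \<in> ideal.span G" by (intro ideal.span_add ideal.span_scale k k')
  finally show ?case unfolding ideal.span_insert by blast
qed

lemma V_diff_nilpotent:
  assumes B: "finite B" and ab: "a0 \<in> B" "b0 \<in> B"
  shows "\<exists>N. (V a0 - V b0) ^ N \<in> I B"
proof -
  \<comment> \<open>\<open>R\<close> records the pairs of variables that have been identified. Each
    step adds a pair, so the induction runs over the number of pairs not yet in
    \<open>R\<close>.\<close>
  define J where "J R = ideal.span (gens B \<union> (\<lambda>(a, b). V a - V b) ` R)" for R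
  have "\<exists>N. (V a0 - V b0) ^ N \<in> J R" if "R \<subseteq> B \<times> B" for R
    using that
  proof (induction "card (B \<times> B - R)" arbitrary: R rule: less_induct)
    case less
    define C where "C = {b\<in>B. V a0 - V b \<in> J R}"
    show ?case
    proof (cases "b0 \<in> C")
      case True
      then have "(V a0 - V b0) ^ 1 \<in> J R" by (simp add: C_def)
      then show ?thesis by blast
    next
      case False
      have J0: "0 \<in> J R" unfolding J_def by (rule ideal.span_zero)
      have Jm: "x - y \<in> J R" "x + y \<in> J R" if "x \<in> J R" "y \<in> J R" for x y
        using that unfolding J_def by (auto intro: ideal.span_diff ideal.span_add)
      have a0C: "a0 \<in> C" using ab J0 by (simp add: C_def)
      have CB: "C \<subseteq> B" by (auto simp: C_def)
      have step: "\<exists>N. (V a0 - V b0) ^ N \<in> ideal.span (Set.insert (V a - V b) (gens B \<union> (\<lambda>(a, b). V a - V b) ` R))"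
        if R': "(a, b) \<in> B \<times> B" "(a, b) \<notin> R" for a b
      proof -
        have "B \<times> B - Set.insert (a, b) R \<subset> B \<times> B - R" using R' by blast
        then have "card (B \<times> B - Set.insert (a, b) R) < card (B \<times> B - R)"
          using B by (intro psubset_card_mono) auto
        then have "\<exists>N. (V a0 - V b0) ^ N \<in> J (Set.insert (a, b) R)"
          using less.hyps[of "Set.insert (a, b) R"] less.prems R' by auto
        then show ?thesis by (simp add: J_def)
      qed
      \<comment> \<open>If such a pair were identified already, then \<open>b\<close> would belong
        to \<open>C\<close>; hence adding the pair is progress.\<close>
      have notR: "(a, b) \<notin> R" "(b, a) \<notin> R" if "a \<in> C" "b \<in> B - C" for a b
      proof -
        have aJ: "V a0 - V a \<in> J R" and bJ: "V a0 - V b \<notin> J R" using that by (auto simp: C_def)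
        have e: "V a0 - V b = (V a0 - V a) + (V a - V b)" "V a0 - V b = (V a0 - V a) - (V b - V a)" by auto
        have R: "V x - V y \<in> J R" if "(x, y) \<in> R" for x y
          using that unfolding J_def by (intro ideal.span_base) auto
        show "(a, b) \<notin> R" using R[of a b] Jm(2)[OF aJ] bJ e(1) by metis
        show "(b, a) \<notin> R" using R[of b a] Jm(1)[OF aJ] bJ e(2) by metis
      qed
      have "\<exists>N. (V a0 - V b0) ^ N \<in> ideal.span (Set.insert (K C (B - C)) (gens B \<union> (\<lambda>(a, b). V a - V b) ` R))"
        unfolding K_def
      proof (intro nilpotent_prod)
        fix a b assume a: "a \<in> C" and b: "b \<in> B - C"
        define l where "l = (if fst a \<le> fst b then V a - V b else V b - V a)"
        have "\<exists>N. (V a0 - V b0) ^ N \<in> ideal.span (Set.insert l (gens B \<union> (\<lambda>(a, b). V a - V b) ` R))"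
          using step[of a b] step[of b a] notR[OF a b] a b CB by (auto simp: l_def)
        \<comment> \<open>The factor \<open>kf a b\<close> is itself a product, of equal linear
          factors \<open>l\<close>.\<close>
        then have "\<exists>N. (V a0 - V b0) ^ N \<in> ideal.span (Set.insert (\<Prod>i<h (fst a) (fst b). l)
            (gens B \<union> (\<lambda>(a, b). V a - V b) ` R))"
          by (intro nilpotent_prod) auto
        then show "\<exists>N. (V a0 - V b0) ^ N \<in> ideal.span (Set.insert (kf a b) (gens B \<union> (\<lambda>(a, b). V a - V b) ` R))"
          by (simp add: kf_def l_def)
      qed (use B CB finite_subset in auto)
      moreover have "K C (B - C) \<in> gens B" using a0C CB False ab(2) unfolding gens_def by blast
      ultimately show ?thesis by (simp add: J_def insert_absorb)
    qed
  qed
  from this[of "{}"] show ?thesis by (simp add: J_def I_def)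
qed

text \<open>In each term of the binomial expansion one of the two exponents is large enough.\<close>

lemma nilpotent_add:
  fixes x y :: "'b::comm_ring_1"
  assumes "x ^ M \<in> ideal.span G" "y ^ N \<in> ideal.span G"
  shows "(x + y) ^ (M + N) \<in> ideal.span G"
  unfolding binomial_ring
proof (intro ideal.span_sum)
  fix k assume k: "k \<in> {..M + N}"
  show "of_nat (M + N choose k) * x ^ k * y ^ (M + N - k) \<in> ideal.span G"
  proof (cases "M \<le> k")
    case True
    then have "x ^ k = x ^ M * x ^ (k - M)" by (simp flip: power_add)
    then have "x ^ k \<in> ideal.span G" using assms(1) ideal_mult_right by metis
    then show ?thesis by (intro ideal_mult_right ideal.span_scale)
  next
    case False
    then have "M + N - k = N + (M - k)" by simp
    then have "y ^ (M + N - k) = y ^ N * y ^ (M - k)" by (simp add: power_add)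
    then have "y ^ (M + N - k) \<in> ideal.span G" using assms(2) ideal_mult_right by metis
    then show ?thesis by (intro ideal.span_scale)
  qed
qed

text \<open>The multiple of \<open>V a\<close> by the number of variables is the sum of
  \<open>psum B\<close> and of the differences \<open>V a - V b\<close>, all of them nilpotent
  modulo the enlarged ideal.\<close>

lemma V_nilpotent:
  assumes B: "finite B" and a: "a \<in> B"
  shows "\<exists>N. V a ^ N \<in> ideal.span (Set.insert (psum B) (gens B))"
proof -
  define R where "R = ideal.span (Set.insert (psum B) (gens B))"
  define c :: rat where "c = inverse (of_nat (card B))"
  have mono: "x \<in> R" if "x \<in> I B" for x
    using that ideal.span_mono[of "gens B" "Set.insert (psum B) (gens B)"] by (auto simp: R_def I_def)
  have "\<exists>N. (\<Sum>b\<in>A. V a - V b) ^ N \<in> R" if "A \<subseteq> B" for A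
    using finite_subset[OF that B] that
  proof (induction A rule: finite_induct)
    case empty
    have "(0 :: var pol) ^ 1 \<in> R" by (simp add: R_def ideal.span_zero)
    then show ?case by (simp only: sum.empty) blast
  next
    case (insert b A)
    obtain N where N: "(V a - V b) ^ N \<in> R" using V_diff_nilpotent[OF B a, of b] insert.prems mono by blast
    obtain N' where N': "(\<Sum>b\<in>A. V a - V b) ^ N' \<in> R" using insert by blast
    from nilpotent_add[OF N[unfolded R_def] N'[unfolded R_def]] show ?case
      using insert.hyps by (auto simp: R_def)
  qed
  from this[of B] obtain N where N: "(\<Sum>b\<in>B. V a - V b) ^ N \<in> R" by blast
  have "psum B ^ 1 \<in> R" unfolding R_def by (simp add: ideal.span_base)
  from nilpotent_add[OF this[unfolded R_def] N[unfolded R_def]]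
  have "(psum B + (\<Sum>b\<in>B. V a - V b)) ^ (1 + N) \<in> R" unfolding R_def .
  also have "psum B + (\<Sum>b\<in>B. V a - V b) = Cn (of_nat (card B)) * V a"
    by (simp add: psum_def sum_subtractf Cn_of_nat)
  finally have "Cn c ^ (1 + N) * (Cn (of_nat (card B)) * V a) ^ (1 + N) \<in> R"
    unfolding R_def by (rule ideal.span_scale)
  also have "Cn c ^ (1 + N) * (Cn (of_nat (card B)) * V a) ^ (1 + N) = (Cn c * Cn (of_nat (card B)) * V a) ^ (1 + N)"
    by (simp only: power_mult_distrib mult.assoc)
  also have "Cn c * Cn (of_nat (card B)) = (1 :: var pol)"
    unfolding Cn_mult[symmetric] c_def using B a by (subst left_inverse) auto
  finally show ?thesis unfolding R_def by (metis mult_1)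
qed

lemma V_power: "V a ^ n = single (single a n) 1"
  by (induction n) (auto simp: V_def mult_single simp flip: single_add)

text \<open>Pigeonhole: a monomial whose degree exceeds the sum of the exponents \<open>Na a\<close>
  is divisible by \<open>V a ^ Na a\<close> for some \<open>a\<close>.\<close>

lemma high_degree_in_ideal:
  assumes B: "finite B"
  shows "\<exists>N. \<forall>d\<ge>N. \<forall>f\<in>polys B. homog d f \<longrightarrow> f \<in> ideal.span (Set.insert (psum B) (gens B))"
proof -
  define R where "R = ideal.span (Set.insert (psum B) (gens B))"
  obtain Na where Na: "\<And>a. a \<in> B \<Longrightarrow> V a ^ Na a \<in> R" using V_nilpotent[OF B] unfolding R_def by metis
  define N where "N = Suc (\<Sum>a\<in>B. Na a)"
  have mon: "single m c \<in> R" if m: "keys m \<subseteq> B" "deg m \<ge> N" for m c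
  proof -
    have "\<exists>a\<in>B. Na a \<le> lookup m a"
    proof (rule ccontr)
      assume "\<not> ?thesis"
      then have "(\<Sum>a\<in>B. lookup m a) \<le> (\<Sum>a\<in>B. Na a)" by (intro sum_mono) (auto simp: not_le less_imp_le)
      then show False using m deg_superset[OF B m(1)] by (simp add: N_def)
    qed
    then obtain a where a: "a \<in> B" "Na a \<le> lookup m a" by blast
    have "single a (Na a) + (m - single a (Na a)) = m"
      using a(2) by (intro poly_mapping_eqI) (auto simp: lookup_add lookup_minus lookup_single when_def)
    then have "single m c = V a ^ Na a * single (m - single a (Na a)) c"
      by (simp add: V_power mult_single)
    then show ?thesis using Na[OF a(1)] unfolding R_def by (metis ideal_mult_right)
  qed
  have "f \<in> R" if "d \<ge> N" "f \<in> polys B" "homog d f" for d f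
  proof -
    have "(\<Sum>m\<in>keys f. single m (lookup f m)) \<in> R"
      unfolding R_def
      by (intro ideal.span_sum, unfold R_def[symmetric], intro mon) (use that in \<open>auto simp: polys_def homog_def\<close>)
    then show ?thesis using poly_mapping_sum_single[of f] by simp
  qed
  then show ?thesis unfolding R_def by blast
qed

lemma orbp_psum: "orbp B (psum B * g) = sigma (orbp B g)"
proof
  fix S
  have "ren p (psum B) = psum S" if "p \<in> Bij B S" for p
    using that by (auto simp: Bij_def bij_betw_def ren_psum)
  then show "orbp B (psum B * g) S = sigma (orbp B g) S"
    by (simp add: orbp_def sigma_def ren_mult sum_distrib_left)
qed

lemma orbp_I:
  assumes "finite B" "x \<in> polys B" "x \<in> I B" shows "orbp B x S \<in> I S"
  unfolding orbp_def I_def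
proof (intro ideal.span_sum)
  fix p assume p: "p \<in> Bij B S"
  obtain q where q: "cperm q" "\<forall>a\<in>B. q a = p a"
    using extend_cperm[OF assms(1), of p S] p unfolding Bij_def by blast
  have "q ` B = S" using q p by (auto simp: Bij_def bij_betw_def)
  moreover have "ren p x = ren q x" by (rule ren_cong[OF assms(2)]) (use q in auto)
  ultimately show "ren p x \<in> ideal.span (gens S)" using I_ren[OF q(1) assms(3)] by (simp add: I_def)
qed

lemma coeff_in_I: "x \<in> I B \<Longrightarrow> coeff_in (- B) 0 x \<in> I B"
  unfolding I_def by (rule coeff_in_ideal[OF gens_polys]) auto

text \<open>In high degree every polynomial in the variables of \<open>B\<close> is a multiple of
  \<open>psum B\<close> modulo the ideal. Symmetrising such a presentation writes an element as
  \<open>sigma\<close> of one of degree \<open>e\<close> plus a decomposable, so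
  \<open>sigma\<close> maps the generators of degree \<open>e\<close> to a spanning set modulo
  decomposables.\<close>

theorem card_W_eventually: "\<exists>E. \<forall>e\<ge>E. card (W \<gamma> (e + 1)) \<le> card (W \<gamma> e)"
proof -
  obtain B where B: "finite B" "ctype B = \<gamma>" using ctype_exists by blast
  obtain N where N: "\<And>d f. d \<ge> N \<Longrightarrow> f \<in> polys B \<Longrightarrow> homog d f \<Longrightarrow> f \<in> ideal.span (Set.insert (psum B) (gens B))"
    using high_degree_in_ideal[OF B(1)] by blast
  define b where "b = fsc (inverse (of_nat (card (Bij B B))))"
  have "card (W \<gamma> (e + 1)) \<le> card (W \<gamma> e)" if e: "e \<ge> e0 \<gamma> + int N" for e
  proof -
    define d where "d = nat (e - e0 \<gamma>)"
    have d: "e - e0 \<gamma> = int d" "e + 1 - e0 \<gamma> = int (Suc d)" "Suc d \<ge> N" using e by (auto simp: d_def)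
    have "F \<in> fam.span (D \<gamma> (e + 1) \<union> sigma ` W \<gamma> e)" if F: "F \<in> H \<gamma> (e + 1)" for F
    proof -
      have FB: "F B \<in> polys B" "homog (Suc d) (F B)"
        using H_polys[OF F] H_homogi[OF F, of B] unfolding d(2) homogi_int by blast+
      obtain k where k: "F B - k * psum B \<in> I B"
        using N[OF d(3) FB] unfolding ideal.span_insert I_def by blast
      \<comment> \<open>The cofactor is cut down to the variables of \<open>B\<close> and to degree
        \<open>d\<close>, so that its symmetrisation lies in \<open>H \<gamma> e\<close>.\<close>
      define g where "g = hcomp d (coeff_in (- B) 0 k)"
      have g: "g \<in> polys B" "homog d g" unfolding g_def by (auto intro: polys_hcomp coeff_in_0_polys homog_hcomp)
      define i where "i = F B - psum B * g"
      have "coeff_in (- B) 0 (k * psum B) = coeff_in (- B) 0 k * psum B"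
        using coeff_in_mult[OF psum_polys, of "- B" B 0 k] by (simp add: mult.commute)
      then have "coeff_in (- B) 0 (F B - k * psum B) + coeff_in (- B) 0 k * psum B = F B"
        using coeff_in_add[of "- B" 0 "F B - k * psum B" "k * psum B"] coeff_in_0_self[OF FB(1)] by simp
      then have "coeff_in (- B) 0 (F B - k * psum B) = F B - coeff_in (- B) 0 k * psum B"
        by (simp only: eq_diff_eq)
      moreover have "hcomp (Suc d) (F B - coeff_in (- B) 0 k * psum B) = i"
      proof -
        have "hcomp (Suc d) (coeff_in (- B) 0 k * psum B) = g * psum B"
          using hcomp_mult_homog[OF psum_homog[of B], of "Suc d" "coeff_in (- B) 0 k"] by (simp add: g_def)
        then show ?thesis
          using hcomp_add[of "Suc d" "F B - coeff_in (- B) 0 k * psum B" "coeff_in (- B) 0 k * psum B"]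
            hcomp_homog[OF FB(2)] by (simp add: i_def mult.commute eq_diff_eq)
      qed
      ultimately have iI: "i \<in> I B" using I_homog[OF coeff_in_I[OF k], of "Suc d"] by simp
      have i: "i \<in> polys B" "homog (Suc d) i"
        unfolding i_def using FB g psum_polys homog_mult[OF psum_homog[of B] g(2)]
        by (auto intro!: polys_diff polys_mult homog_diff)
      define F1 where "F1 = orbp B g"
      have F1: "F1 \<in> H \<gamma> e" unfolding F1_def B(2)[symmetric]
        by (intro orbp_H B g) (simp add: B d homogi_int g)
      have "orbp B i \<in> H \<gamma> (e + 1)" unfolding B(2)[symmetric]
        by (intro orbp_H B i) (simp add: B d homogi_int i del: of_nat_Suc)
      then have "orbp B i \<in> D \<gamma> (e + 1)" using orbp_I[OF B(1) i(1) iI] by (simp add: D_def)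
      then have 1: "orbp B i \<in> fam.span (D \<gamma> (e + 1) \<union> sigma ` W \<gamma> e)" by (simp add: fam.span_base)
      have "F1 \<in> fam.span (D \<gamma> e \<union> W \<gamma> e)" using F1 W(4) by blast
      then have 2: "sigma F1 \<in> fam.span (D \<gamma> (e + 1) \<union> sigma ` W \<gamma> e)"
      proof (induction rule: fam.span_induct_alt)
        case base
        have "sigma 0 = 0" by (auto simp: sigma_def fun_eq_iff)
        then show ?case by (simp only: fam.span_zero)
      next
        case (step c x y)
        have "sigma x \<in> D \<gamma> (e + 1) \<union> sigma ` W \<gamma> e"
        proof (cases "x \<in> W \<gamma> e")
          case False
          then have x: "x \<in> D \<gamma> e" using step(1) by blast
          then have "sigma x \<in> D \<gamma> (e + 1)"
            using sigma_H[of x \<gamma> e] by (auto simp: D_def sigma_def I_def intro: ideal.span_scale)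
          then show ?thesis by blast
        qed blast
        then have "fsc c (sigma x) + sigma y \<in> fam.span (D \<gamma> (e + 1) \<union> sigma ` W \<gamma> e)"
          using step by (intro fam.span_add fam.span_scale) (auto intro: fam.span_base)
        moreover have "sigma (fsc c x + y) = fsc c (sigma x) + sigma y"
          by (auto simp: sigma_def fun_eq_iff fsc_apply algebra_simps)
        ultimately show ?case by (simp only:)
      qed
      have "F = b (orbp B (F B))" using H_eq_orbp[of F B "e + 1"] F B by (simp add: b_def)
      also have "F B = psum B * g + i" by (simp add: i_def)
      also have "orbp B (psum B * g + i) = sigma F1 + orbp B i" by (simp add: orbp_add orbp_psum F1_def)
      finally have "F = b (sigma F1 + orbp B i)" .
      then show ?thesis unfolding b_def using 1 2 by (metis fam.span_add fam.span_scale)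
    qed
    then have "card (W \<gamma> (e + 1)) \<le> card (sigma ` W \<gamma> e)" using W(1) by (intro W_min) auto
    also have "\<dots> \<le> card (W \<gamma> e)" by (rule card_image_le[OF W(1)])
    finally show ?thesis .
  qed
  then show ?thesis by blast
qed

end

section \<open>A recursion for the plethystic logarithm\<close>

lemma fract_of_nat_neq_0: "j > 0 \<Longrightarrow> of_nat j \<noteq> (0 :: rat poly fract)"
proof -
  assume j: "j > 0"
  have "of_nat j = to_fract (of_nat j :: rat poly)" by (induction j) (auto simp: to_fract_add)
  then show ?thesis using j by (simp add: to_fract_eq_0_iff)
qed

lemma Fract_rep: obtains a b :: "rat poly" where "x = Fract a b" "b \<noteq> 0"
  by (cases x) auto

lemma pcompose_monom_neq_0: "k \<ge> 1 \<Longrightarrow> b \<noteq> 0 \<Longrightarrow> pcompose b (monom 1 k) \<noteq> (0 :: rat poly)"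
  using pcompose_eq_0[of b "monom 1 k"] by (auto simp: degree_monom_eq)

lemma q_subst_mult:
  assumes k: "k \<ge> 1" shows "q_subst k (x * y) = q_subst k x * q_subst k y"
proof -
  obtain a b where x: "x = Fract a b" "b \<noteq> 0" by (rule Fract_rep)
  obtain c d where y: "y = Fract c d" "d \<noteq> 0" by (rule Fract_rep)
  show ?thesis using x(2) y(2) by (simp add: x(1) y(1) q_subst_Fract[OF k] pcompose_mult)
qed

lemma q_subst_add:
  assumes k: "k \<ge> 1" shows "q_subst k (x + y) = q_subst k x + q_subst k y"
proof -
  obtain a b where x: "x = Fract a b" "b \<noteq> 0" by (rule Fract_rep)
  obtain c d where y: "y = Fract c d" "d \<noteq> 0" by (rule Fract_rep)
  show ?thesis using x(2) y(2)
    by (simp add: x(1) y(1) q_subst_Fract[OF k] pcompose_mult pcompose_add pcompose_monom_neq_0[OF k])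
qed

lemma q_subst_1: "k \<ge> 1 \<Longrightarrow> q_subst k 1 = 1"
  using q_subst_Fract[of k 1 1] by (simp add: One_fract_def pcompose_1)

lemma q_subst_of_nat: "k \<ge> 1 \<Longrightarrow> q_subst k (of_nat n) = of_nat n"
  by (induction n) (auto simp: q_subst_add q_subst_0 q_subst_1)

lemma q_subst_uminus: "k \<ge> 1 \<Longrightarrow> q_subst k (- x) = - q_subst k x"
  using q_subst_add[of k x "- x"] by (simp add: q_subst_0 eq_neg_iff_add_eq_0 add.commute)

lemma q_subst_of_int: "k \<ge> 1 \<Longrightarrow> q_subst k (of_int z) = of_int z"
  by (cases z) (auto simp: q_subst_uminus q_subst_of_nat q_subst_add q_subst_1 simp del: of_nat_Suc)

lemma q_subst_divide_of_nat: "k \<ge> 1 \<Longrightarrow> n > 0 \<Longrightarrow> q_subst k (x / of_nat n) = q_subst k x / of_nat n"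
proof -
  assume k: "k \<ge> 1" and n: "n > 0"
  have "q_subst k (x / of_nat n) * of_nat n = q_subst k (x / of_nat n * of_nat n)"
    using k by (simp only: q_subst_mult q_subst_of_nat)
  also have "x / of_nat n * of_nat n = x" using fract_of_nat_neq_0[OF n] by simp
  finally show ?thesis using fract_of_nat_neq_0[OF n] by (simp add: eq_divide_eq)
qed

lemma q_subst_sum: "k \<ge> 1 \<Longrightarrow> q_subst k (sum f A) = (\<Sum>a\<in>A. q_subst k (f a))"
  by (induction A rule: infinite_finite_induct) (auto simp: q_subst_add q_subst_0)

lemma pcompose_monom_monom: "pcompose (monom 1 k) (monom 1 l) = (monom 1 (k * l) :: rat poly)"
proof -
  have "pcompose (monom 1 1 ^ k) q = q ^ k" for q :: "rat poly"
    by (induction k) (auto simp: pcompose_mult pcompose_1 monom_Suc pcompose_pCons monom_0)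
  then show ?thesis by (simp add: monom_power mult.commute)
qed

lemma q_subst_q_subst:
  assumes k: "k \<ge> 1" "l \<ge> 1" shows "q_subst l (q_subst k x) = q_subst (k * l) x"
proof -
  have kl: "k * l \<ge> 1" using k by (cases k; cases l) auto
  obtain a b where x: "x = Fract a b" "b \<noteq> 0" by (rule Fract_rep)
  then show ?thesis
    by (simp add: q_subst_Fract[OF k(1)] q_subst_Fract[OF k(2)] q_subst_Fract[OF kl]
        pcompose_monom_neq_0[OF k(1)] pcompose_assoc[symmetric] pcompose_monom_monom)
qed

lemma q_subst_id: "q_subst 1 x = x"
proof -
  obtain a b where x: "x = Fract a b" "b \<noteq> 0" by (rule Fract_rep)
  have "monom 1 1 = [:0, 1 :: rat:]" by (simp add: monom_Suc monom_0)
  then show ?thesis using x by (simp add: q_subst_Fract)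
qed

text \<open>For a prime \<open>p\<close> dividing \<open>d\<close>, inserting or removing the factor
  \<open>p\<close> is a sign-reversing involution on the squarefree divisors of
  \<open>d\<close>.\<close>

lemma sum_moebius:
  assumes "d \<ge> 1" shows "(\<Sum>k\<in>{k. k dvd d}. moebius k) = (if d = 1 then 1 else 0)"
proof (cases "d = 1")
  case True
  then show ?thesis by (simp add: moebius_def)
next
  case False
  then obtain p where p: "prime p" "p dvd d" using prime_factor_nat by blast
  define S where "S = {k. k dvd d \<and> squarefree k}"
  have fin: "finite {k. k dvd d}" using assms by simp
  then have fS: "finite S" by (rule rev_finite_subset) (auto simp: S_def)
  define t where "t k = (if p dvd k then k div p else p * k)" for k
  have p0: "p > 0" using p(1) prime_gt_0_nat by blast
  have coprime: "coprime p k" if "\<not> p dvd k" for k using p(1) that by (simp add: prime_imp_coprime_nat)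
  have not_dvd: "\<not> p dvd k" if "squarefree (p * k)" for k
  proof
    assume "p dvd k"
    then have "p ^ 2 dvd p * k" by (auto simp: power2_eq_square)
    then have "p dvd 1" using that unfolding squarefree_def by blast
    then show False using p(1) by simp
  qed
  have tS: "t k \<in> S \<and> t (t k) = k \<and> moebius (t k) = - moebius k" if k: "k \<in> S" for k
  proof -
    have mu: "moebius (p * k) = - moebius k" "squarefree (p * k)" if "squarefree k" "\<not> p dvd k" for k
    proof -
      have k0: "k \<noteq> 0" using that(2) by (metis dvd_0_right)
      show sq: "squarefree (p * k)"
        using that coprime[OF that(2)] p(1) by (simp add: squarefree_mult_coprime squarefree_prime)
      have "prime_factors (p * k) = insert p (prime_factors k)"
        using p0 k0 p(1) by (simp add: prime_factors_product prime_prime_factors)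
      moreover have "p \<notin> prime_factors k" using that(2) by auto
      ultimately show "moebius (p * k) = - moebius k" using sq that(1) by (simp add: moebius_def)
    qed
    show ?thesis
    proof (cases "p dvd k")
      case True
      then obtain l where l: "k = p * l" by blast
      have "\<not> p dvd l" using k not_dvd[of l] by (auto simp: S_def l)
      moreover have "squarefree l" using k squarefree_mono[of l k] by (auto simp: S_def l)
      moreover have "l dvd d" using k dvd_trans[of l k d] by (auto simp: S_def l)
      moreover have "t k = l" using l p0 by (simp add: t_def)
      moreover have "t l = p * l" using \<open>\<not> p dvd l\<close> by (simp add: t_def)
      ultimately show ?thesis using mu[of l] l by (simp add: S_def)
    next
      case False
      then have "p * k dvd d" using k p(2) coprime[OF False] by (simp add: S_def divides_mult)
      moreover have "t k = p * k" using False by (simp add: t_def)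
      moreover have "t (p * k) = k" using p0 by (simp add: t_def)
      ultimately show ?thesis using False k mu[of k] by (simp add: S_def)
    qed
  qed
  have 1: "(\<Sum>k\<in>{k. k dvd d}. moebius k) = (\<Sum>k\<in>S. moebius k)"
    by (rule sum.mono_neutral_right[OF fin]) (auto simp: S_def moebius_def)
  have 2: "(\<Sum>k\<in>S. moebius k) = (\<Sum>k\<in>S. - moebius k)"
    by (rule sum.reindex_bij_witness[where i = t and j = t]) (simp_all add: tS)
  have "(\<Sum>k\<in>S. moebius k) = 0" using 2 unfolding sum_negf by linarith
  with 1 show ?thesis using False by simp
qed

section \<open>Powers and roots of monomials\<close>

definition kmul :: "nat \<Rightarrow> 'v mon \<Rightarrow> 'v mon" where "kmul k N = Poly_Mapping.map ((*) k) N"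

lemma lookup_kmul [simp]: "lookup (kmul k N) v = k * lookup N v"
  by (simp add: kmul_def lookup_map_mult)

lemma kmul_kmul: "kmul j (kmul k N) = kmul (j * k) N"
  by (rule poly_mapping_eqI) simp

lemma kmul_inj: "k \<ge> 1 \<Longrightarrow> kmul k N = kmul k N' \<longleftrightarrow> N = N'"
  by (auto simp: poly_mapping_eq_iff fun_eq_iff)

lemma kmul_eq_0: "k \<ge> 1 \<Longrightarrow> kmul k N = 0 \<longleftrightarrow> N = 0"
  by (auto simp: poly_mapping_eq_iff fun_eq_iff)

lemma kmul_1 [simp]: "kmul (Suc 0) N = N"
  by (rule poly_mapping_eqI) simp

lemma kmul_Suc: "kmul (Suc k) N = N + kmul k N"
  by (rule poly_mapping_eqI) (simp add: lookup_add)

lemma kmul_0 [simp]: "kmul 0 N = 0" "kmul k 0 = 0"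
  by (rule poly_mapping_eqI, simp)+

lemma deg_kmul: "deg (kmul k N) = k * deg N"
  by (induction k) (auto simp: kmul_Suc deg_add)

text \<open>The roots of \<open>M\<close> of all orders; monomials are written additively. The
  constant monomial is excluded because it is a root of itself of every order, which would make the
  set infinite.\<close>

definition roots :: "'v mon \<Rightarrow> (nat \<times> 'v mon) set" where
  "roots M = {(k, N). k \<ge> 1 \<and> N \<noteq> 0 \<and> kmul k N = M}"

lemma roots_0 [simp]: "roots 0 = {}" by (auto simp: roots_def kmul_eq_0)

lemma roots_le: "(k, N) \<in> roots M \<Longrightarrow> k \<le> deg M"
proof -
  assume a: "(k, N) \<in> roots M"
  then have "deg N \<noteq> 0" "deg M = k * deg N" by (auto simp: roots_def deg_eq_0 deg_kmul)
  then show ?thesis by simp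
qed

lemma finite_roots: "finite (roots M)"
proof (rule finite_imageD)
  have "fst ` roots M \<subseteq> {..deg M}" using roots_le by fastforce
  then show "finite (fst ` roots M)" using finite_subset by blast
  show "inj_on fst (roots M)"
    by (rule inj_onI) (auto simp: roots_def kmul_inj)
qed

text \<open>This makes the series for the logarithm locally finite.\<close>

lemma mps_nth_power_small:
  assumes "mps_nth u 0 = 0" "deg M < j" shows "mps_nth (u ^ j) M = 0"
  using assms(2)
proof (induction j arbitrary: M)
  case (Suc j)
  have "mps_nth u A * mps_nth (u ^ j) B = 0" if "A + B = M" for A B
  proof (cases "A = 0")
    case False
    then have "deg A \<noteq> 0" by (simp add: deg_eq_0)
    then have "deg B < j" using Suc.prems that deg_add[of A B] by auto
    then show ?thesis using Suc.IH by simp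
  qed (use assms in simp)
  then show ?case by (auto simp: times_mps.rep_eq antidiag_def intro!: sum.neutral)
qed simp

section \<open>Euler derivations of power series\<close>

lemma mps_nth_sum: "mps_nth (sum f A) M = (\<Sum>a\<in>A. mps_nth (f a) M)"
  by (induction A rule: infinite_finite_induct) (auto simp: zero_mps.rep_eq plus_mps.rep_eq)

lemma mps_const_mult: "mps_const (a * b) = mps_const a * (mps_const b :: ('v, 'a::comm_ring_1) mps)"
  by (rule mps_eqI) (simp add: mps_nth_const_mult, simp add: mps_const_def)

definition mps_euler :: "('v mon \<Rightarrow> 'a) \<Rightarrow> ('v, 'a::comm_ring_1) mps \<Rightarrow> ('v, 'a) mps" where
  "mps_euler l f = Abs_mps (\<lambda>M. l M * mps_nth f M)"

lemma mps_nth_euler [simp]: "mps_nth (mps_euler l f) M = l M * mps_nth f M"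
  by (simp add: mps_euler_def)

lemma mps_euler_mult:
  assumes "\<And>A B. l (A + B) = l A + l B"
  shows "mps_euler l (f * g) = mps_euler l f * g + f * mps_euler l g"
proof (rule mps_eqI)
  fix M
  have "mps_nth (mps_euler l (f * g)) M = (\<Sum>(A, B)\<in>antidiag M. l M * (mps_nth f A * mps_nth g B))"
    by (simp add: times_mps.rep_eq sum_distrib_left case_prod_unfold)
  also have "\<dots> = (\<Sum>(A, B)\<in>antidiag M. l A * mps_nth f A * mps_nth g B + mps_nth f A * (l B * mps_nth g B))"
    by (intro sum.cong refl) (auto simp: assms antidiag_def algebra_simps)
  also have "\<dots> = mps_nth (mps_euler l f * g + f * mps_euler l g) M"
    by (simp add: times_mps.rep_eq plus_mps.rep_eq sum.distrib case_prod_unfold)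
  finally show "mps_nth (mps_euler l (f * g)) M = mps_nth (mps_euler l f * g + f * mps_euler l g) M" .
qed

lemma mps_euler_sum: "mps_euler l (sum f A) = (\<Sum>a\<in>A. mps_euler l (f a))"
  by (rule mps_eqI) (simp add: mps_nth_sum sum_distrib_left)

lemma additive_0: "(\<And>A B. l (A + B) = l A + l B) \<Longrightarrow> l (0 :: 'v mon) = (0 :: 'a::comm_ring_1)"
  by (metis add_cancel_right_right add_0_right)

lemma mps_euler_const_mult: "mps_euler l (mps_const c * f) = mps_const c * mps_euler l f"
  by (rule mps_eqI) (simp add: mps_nth_const_mult mult.left_commute)

lemma mps_euler_power:
  fixes f :: "('v, 'a::comm_ring_1) mps"
  assumes l: "\<And>A B. l (A + B) = l A + l B"
  shows "mps_euler l (f ^ Suc j) = mps_const (of_nat (Suc j)) * f ^ j * mps_euler l f"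
proof (induction j)
  case 0
  have "mps_const 1 = (1 :: ('v, 'a) mps)" by (rule mps_eqI) (simp add: mps_const_def one_mps.rep_eq)
  then show ?case by simp
next
  case (Suc j)
  have c: "mps_const (of_nat (Suc (Suc j))) = 1 + (mps_const (of_nat (Suc j)) :: ('v, 'a) mps)"
    by (rule mps_eqI) (simp add: mps_const_def one_mps.rep_eq plus_mps.rep_eq)
  have "mps_euler l (f ^ Suc (Suc j)) = mps_euler l f * f ^ Suc j + f * mps_euler l (f ^ Suc j)"
    by (simp only: power_Suc[of f "Suc j"] mps_euler_mult[OF l])
  also have "\<dots> = (1 + mps_const (of_nat (Suc j))) * f ^ Suc j * mps_euler l f"
    unfolding Suc by (simp add: algebra_simps)
  finally show ?case by (simp only: c)
qed

text \<open>The identity is the coefficient of \<open>M\<close> in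
  \<open>d f = f * d (log f)\<close>, with \<open>d\<close> the derivation of weight
  \<open>l\<close>. The coefficients of the logarithm involved are those of a partial sum
  \<open>P\<close>, and \<open>f * d P\<close> is a geometric sum that telescopes up to a term of
  high order.\<close>

lemma mps_log_euler:
  fixes f :: "('v, rat poly fract) mps"
  assumes f0: "mps_nth f 0 = 1" and l: "\<And>A B. l (A + B) = l A + l B"
  shows "l M * mps_nth f M = (\<Sum>(A, B)\<in>antidiag M. mps_nth f A * (l B * mps_nth (mps_log f) B))"
proof -
  define u where "u = f - 1"
  have u0: "mps_nth u 0 = 0" by (simp add: u_def minus_mps.rep_eq one_mps.rep_eq f0)
  define J where "J = Suc (deg M)"
  define P where "P = (\<Sum>j<J. mps_const ((- 1) ^ (Suc j + 1) / of_nat (Suc j)) * u ^ Suc j)"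
  have log: "mps_nth (mps_log f) B = mps_nth P B" if "deg B < J" for B
  proof -
    define g where "g j = (if 1 \<le> j then mps_nth (mps_const ((- 1) ^ (j + 1) / of_nat j) * u ^ j) B else 0)" for j
    have "mps_nth (mps_log f) B = Sum_any g"
      by (simp only: mps_log_def mps_suminf_def mps_nth_Abs g_def[abs_def] u_def)
    also have "\<dots> = sum g (Suc ` {..<J})"
    proof (rule Sum_any.expand_superset)
      show "{a. g a \<noteq> 0} \<subseteq> Suc ` {..<J}"
      proof
        fix j assume j: "j \<in> {a. g a \<noteq> 0}"
        then have "1 \<le> j" by (auto simp: g_def split: if_splits)
        moreover have "\<not> deg B < j"
        proof
          assume "deg B < j"
          then have "g j = 0" using mps_nth_power_small[OF u0] by (simp add: g_def mps_nth_const_mult)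
          with j show False by simp
        qed
        ultimately show "j \<in> Suc ` {..<J}" using that by (intro image_eqI[of _ _ "j - 1"]) auto
      qed
    qed simp
    also have "\<dots> = mps_nth P B"
      by (subst sum.reindex) (auto simp: g_def P_def mps_nth_sum)
    finally show ?thesis .
  qed
  have "mps_euler l P = (\<Sum>j<J. (- u) ^ j * mps_euler l u)"
    unfolding P_def mps_euler_sum mps_euler_const_mult
  proof (intro sum.cong refl)
    fix j
    have 1: "mps_const ((- 1) ^ (Suc j + 1) / of_nat (Suc j)) * mps_const (of_nat (Suc j)) =
        (mps_const ((- 1) ^ j) :: ('v, rat poly fract) mps)"
      unfolding mps_const_mult[symmetric] using fract_of_nat_neq_0[of "Suc j"] by (simp del: of_nat_Suc)
    have 2: "mps_const ((- 1) ^ j) * x = (- 1) ^ j * x" for x :: "('v, rat poly fract) mps"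
      by (rule mps_eqI, induction j arbitrary: x)
        (auto simp: mps_nth_const_mult uminus_mps.rep_eq mult.assoc)
    show "mps_const ((- 1) ^ (Suc j + 1) / of_nat (Suc j)) * mps_euler l (u ^ Suc j) = (- u) ^ j * mps_euler l u"
      unfolding mps_euler_power[OF l] power_minus[of u] by (simp only: mult.assoc[symmetric] 1 2)
  qed
  also have "\<dots> = (\<Sum>j<J. (- u) ^ j) * mps_euler l u" by (simp add: sum_distrib_right)
  finally have "f * mps_euler l P = (1 - (- u)) * (\<Sum>j<J. (- u) ^ j) * mps_euler l u"
    by (simp add: u_def mult.assoc)
  also have "(1 - (- u)) * (\<Sum>j<J. (- u) ^ j) = 1 - (- u) ^ J"
    by (rule one_diff_power_eq[symmetric])
  also have "(1 - (- u) ^ J) * mps_euler l u = mps_euler l u - (- u) ^ J * mps_euler l u"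
    by (simp add: left_diff_distrib)
  finally have 1: "mps_nth (f * mps_euler l P) M = l M * mps_nth u M - mps_nth ((- u) ^ J * mps_euler l u) M"
    by (simp add: minus_mps.rep_eq)
  have "mps_nth ((- u) ^ J) A = 0" if "deg A \<le> deg M" for A
    using mps_nth_power_small[of "- u" A J] u0 that by (simp add: uminus_mps.rep_eq J_def)
  then have 2: "mps_nth ((- u) ^ J * mps_euler l u) M = 0"
    unfolding times_mps.rep_eq by (intro sum.neutral) (auto simp: antidiag_def deg_add)
  have 3: "l M * mps_nth u M = l M * mps_nth f M"
    using additive_0[of l, OF l] by (cases "M = 0") (auto simp: u_def minus_mps.rep_eq one_mps.rep_eq)
  have "l M * mps_nth f M = mps_nth (f * mps_euler l P) M"
    by (simp only: 3[symmetric] 1 2 diff_0_right)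
  also have "\<dots> = (\<Sum>(A, B)\<in>antidiag M. mps_nth f A * (l B * mps_nth P B))"
    by (simp add: times_mps.rep_eq)
  also have "\<dots> = (\<Sum>(A, B)\<in>antidiag M. mps_nth f A * (l B * mps_nth (mps_log f) B))"
    by (intro sum.cong refl) (auto simp: log antidiag_def deg_add J_def)
  finally show ?thesis .
qed

lemma psi_nth: "k \<ge> 1 \<Longrightarrow> mps_nth (psi k f) (kmul k N) = q_subst k (mps_nth f N)"
proof -
  assume k: "k \<ge> 1"
  have "{N'. Poly_Mapping.map ((*) k) N' = kmul k N} = {N}"
    using kmul_inj[OF k] by (auto simp: kmul_def[symmetric])
  then show ?thesis by (simp add: psi_def)
qed

lemma psi_nth_0: "(\<And>N. kmul k N \<noteq> M) \<Longrightarrow> mps_nth (psi k f) M = 0"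
  unfolding psi_def by (simp add: kmul_def[symmetric])

lemma Log_nth:
  assumes "M \<noteq> 0"
  shows "mps_nth (Log f) M = (\<Sum>(k, N)\<in>roots M. of_int (moebius k) / of_nat k * q_subst k (mps_nth (mps_log f) N))"
proof -
  define g where "g k = (if 1 \<le> k then of_int (moebius k) / of_nat k * mps_nth (psi k (mps_log f)) M else 0)" for k
  have g: "g = (\<lambda>k. if 1 \<le> k then mps_nth (mps_const (of_int (moebius k) / of_nat k) * psi k (mps_log f)) M else 0)"
    by (rule ext) (simp only: g_def mps_nth_const_mult)
  have "mps_nth (Log f) M = Sum_any g"
    by (simp only: Log_def mps_suminf_def mps_nth_Abs g)
  also have "\<dots> = sum g (fst ` roots M)"
  proof (rule Sum_any.expand_superset)
    show "{a. g a \<noteq> 0} \<subseteq> fst ` roots M"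
    proof
      fix k assume "k \<in> {a. g a \<noteq> 0}"
      then have k: "1 \<le> k" "mps_nth (psi k (mps_log f)) M \<noteq> 0" by (auto simp: g_def split: if_splits)
      then obtain N where "kmul k N = M" using psi_nth_0 by metis
      then have "(k, N) \<in> roots M" using k assms by (auto simp: roots_def)
      then show "k \<in> fst ` roots M" by force
    qed
  qed (simp add: finite_roots)
  also have "\<dots> = (\<Sum>x\<in>roots M. g (fst x))"
    by (subst sum.reindex) (auto intro!: inj_onI simp: roots_def kmul_inj)
  also have "\<dots> = (\<Sum>(k, N)\<in>roots M. of_int (moebius k) / of_nat k * q_subst k (mps_nth (mps_log f) N))"
    by (intro sum.cong refl) (auto simp: g_def roots_def psi_nth)
  finally show ?thesis .
qed

text \<open>Moebius inversion of the definition of \<open>Log\<close>: iterated roots are regrouped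
  by the total order \<open>d = j * k\<close>, and summing the Moebius function over the divisors of
  \<open>d\<close> leaves only \<open>d = 1\<close>.\<close>

lemma mps_log_eq_Log:
  assumes M: "M \<noteq> 0"
  shows "mps_nth (mps_log f) M = (\<Sum>(j, N)\<in>roots M. q_subst j (mps_nth (Log f) N) / of_nat j)"
proof -
  define L where "L = mps_nth (mps_log f)"
  define Y where "Y d k N = of_int (moebius k) / of_nat d * q_subst d (L N)" for d k N
  have "(\<Sum>(j, N)\<in>roots M. q_subst j (mps_nth (Log f) N) / of_nat j) =
      (\<Sum>(j, N)\<in>roots M. \<Sum>(k, N')\<in>roots N. Y (j * k) k N')"
  proof (intro sum.cong refl, clarify)
    fix j N assume "(j, N) \<in> roots M"
    then have j: "j \<ge> 1" "N \<noteq> 0" by (auto simp: roots_def)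
    have "q_subst j (mps_nth (Log f) N) / of_nat j =
        (\<Sum>x\<in>roots N. q_subst j (of_int (moebius (fst x)) / of_nat (fst x) * q_subst (fst x) (L (snd x))) / of_nat j)"
      unfolding Log_nth[OF j(2)] L_def q_subst_sum[OF j(1)] sum_divide_distrib by (simp add: case_prod_unfold)
    also have "\<dots> = (\<Sum>(k, N')\<in>roots N. Y (j * k) k N')"
    proof (intro sum.cong refl, clarify)
      fix k N' assume "(k, N') \<in> roots N"
      then have k: "k \<ge> 1" by (auto simp: roots_def)
      then show "q_subst j (of_int (moebius (fst (k, N'))) / of_nat (fst (k, N')) * q_subst (fst (k, N')) (L (snd (k, N')))) / of_nat j =
          Y (j * k) k N'"
        using j by (simp add: Y_def q_subst_mult q_subst_divide_of_nat q_subst_of_int q_subst_q_subst mult.commute)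
    qed
    finally show "q_subst j (mps_nth (Log f) N) / of_nat j = (\<Sum>(k, N')\<in>roots N. Y (j * k) k N')" .
  qed
  also have "\<dots> = (\<Sum>((j, N), (k, N'))\<in>(SIGMA x:roots M. roots (snd x)). Y (j * k) k N')"
    by (subst sum.Sigma[symmetric]) (auto simp: finite_roots case_prod_unfold)
  also have "\<dots> = (\<Sum>((d, N), k)\<in>(SIGMA x:roots M. {k. k dvd fst x}). Y d k N)"
    by (rule sum.reindex_bij_witness[where
          i = "\<lambda>((d, N), k). ((d div k, kmul k N), (k, N))" and
          j = "\<lambda>((j, N), (k, N')). ((j * k, N'), k)"])
      (auto simp: roots_def kmul_kmul kmul_eq_0 Suc_le_eq dvd_pos_nat dvd_div_eq_0_iff mult.commute elim!: dvdE)
  also have "\<dots> = (\<Sum>(d, N)\<in>roots M. \<Sum>k\<in>{k. k dvd d}. Y d k N)"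
  proof -
    have "\<forall>x\<in>roots M. finite {k. k dvd fst x}" by (auto simp: roots_def)
    then show ?thesis by (subst sum.Sigma[symmetric]) (auto simp: finite_roots case_prod_unfold)
  qed
  also have "\<dots> = (\<Sum>(d, N)\<in>roots M. if d = 1 then L N else 0)"
  proof (intro sum.cong refl, clarify)
    fix d N assume "(d, N) \<in> roots M"
    then have d: "d \<ge> 1" by (auto simp: roots_def)
    have "(\<Sum>k\<in>{k. k dvd d}. Y d k N) = of_int (\<Sum>k\<in>{k. k dvd d}. moebius k) / of_nat d * q_subst d (L N)"
      by (simp add: Y_def sum_distrib_right sum_divide_distrib)
    also have "\<dots> = (if d = 1 then L N else 0)"
      unfolding sum_moebius[OF d] using q_subst_id by auto
    finally show "(\<Sum>k\<in>{k. k dvd d}. Y d k N) = (if d = 1 then L N else 0)" .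
  qed
  also have "\<dots> = (\<Sum>(d, N)\<in>{(1::nat, M)}. if d = 1 then L N else 0)"
    using M by (intro sum.mono_neutral_right) (auto simp: finite_roots, auto simp: roots_def split: if_splits)
  finally show ?thesis by (simp add: L_def)
qed

text \<open>An additive weight satisfies \<open>l B = k * l N\<close> if \<open>B\<close> is the
  power of \<open>N\<close> of order \<open>k\<close>; this cancels the denominators in
  \<open>mps_log_eq_Log\<close>.\<close>

theorem Log_recursion:
  fixes f :: "('v, rat poly fract) mps"
  assumes f0: "mps_nth f 0 = 1" and l: "\<And>A B. l (A + B) = l A + l B"
  shows "l M * mps_nth f M = (\<Sum>(A, B)\<in>antidiag M. mps_nth f A *
    (\<Sum>(k, N)\<in>roots B. l N * q_subst k (mps_nth (Log f) N)))"
proof -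
  have lk: "l (kmul k N) = of_nat k * l N" for k N
    by (induction k) (auto simp: kmul_Suc l distrib_right additive_0[of l, OF l])
  have "l B * mps_nth (mps_log f) B = (\<Sum>(k, N)\<in>roots B. l N * q_subst k (mps_nth (Log f) N))" for B
  proof (cases "B = 0")
    case False
    have "l B * mps_nth (mps_log f) B = (\<Sum>(k, N)\<in>roots B. l B * (q_subst k (mps_nth (Log f) N) / of_nat k))"
      by (simp add: mps_log_eq_Log[OF False] sum_distrib_left case_prod_unfold)
    also have "\<dots> = (\<Sum>(k, N)\<in>roots B. l N * q_subst k (mps_nth (Log f) N))"
      by (intro sum.cong refl) (auto simp: roots_def lk fract_of_nat_neq_0)
    finally show ?thesis .
  qed (simp add: additive_0[of l, OF l])
  then show ?thesis using mps_log_euler[OF f0, of l M, OF l] by simp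
qed

text \<open>A family \<open>a\<close> solving this recursion for \<open>F\<close> is the plethystic logarithm of the series \<open>F\<close>.\<close>

definition log_rec :: "(nat \<Rightarrow> 'b \<Rightarrow> 'b) \<Rightarrow> ('v mon \<Rightarrow> 'b::comm_ring_1) \<Rightarrow> ('v mon \<Rightarrow> 'b) \<Rightarrow> bool" where
  "log_rec \<psi> F a \<longleftrightarrow> (\<forall>M. of_nat (deg M) * F M = (\<Sum>(A, B)\<in>antidiag M. F A *
    (\<Sum>(k, N)\<in>roots B. of_nat (deg N) * \<psi> k (a N))))"

text \<open>The index set of the recursion at \<open>M\<close>, without the single term that
  contains the unknown \<open>a M\<close> itself. All others refer to monomials of smaller degree,
  so the recursion can be solved.\<close>

definition log_rest :: "'v mon \<Rightarrow> (('v mon \<times> 'v mon) \<times> nat \<times> 'v mon) set" where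
  "log_rest M = (SIGMA x:antidiag M. roots (snd x)) - {((0, M), (1, M))}"

lemma log_rest_deg: "((A, B), (k, N)) \<in> log_rest M \<Longrightarrow> N \<noteq> 0 \<and> deg N < deg M \<and> k \<ge> 1 \<and> deg A \<le> deg M"
proof -
  assume a: "((A, B), (k, N)) \<in> log_rest M"
  then have k: "k \<ge> 1" "N \<noteq> 0" "kmul k N = B" "A + B = M" and ne: "\<not> (A = 0 \<and> B = M \<and> k = 1 \<and> N = M)"
    by (auto simp: log_rest_def roots_def)
  have d: "deg A + k * deg N = deg M" using k deg_add[of A B] by (auto simp: deg_kmul)
  have n: "deg N > 0" using k(2) deg_eq_0[of N] by auto
  have "deg N < deg M"
  proof (rule ccontr)
    assume "\<not> deg N < deg M"
    then have "k * deg N \<le> deg N" using d by linarith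
    then have "\<not> 2 \<le> k" using n mult_le_mono1[of 2 k "deg N"] by auto
    then have "k = 1" using k(1) by simp
    moreover have "deg A = 0" using d \<open>k = 1\<close> \<open>\<not> deg N < deg M\<close> by simp
    ultimately show False using ne k by (simp add: deg_eq_0)
  qed
  then show ?thesis using k d by simp
qed

lemma log_rec_solve:
  fixes a :: "'v mon \<Rightarrow> 'b::comm_ring_1"
  assumes r: "log_rec \<psi> F a" and F0: "F 0 = 1" and p1: "\<psi> 1 (a M) = a M" and M: "M \<noteq> 0"
  shows "of_nat (deg M) * a M = of_nat (deg M) * F M -
    (\<Sum>((A, B), (k, N))\<in>log_rest M. F A * (of_nat (deg N) * \<psi> k (a N)))"
proof -
  define g where "g = (\<lambda>((A, B :: 'v mon), (k, N)). F A * (of_nat (deg N) * \<psi> k (a N)))"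
  define X where "X = (SIGMA x:antidiag M. roots (snd x))"
  have fin: "finite X" by (auto simp: X_def finite_roots)
  have x: "((0, M), (1, M)) \<in> X" using M by (auto simp: X_def roots_def)
  have "of_nat (deg M) * F M = (\<Sum>(A, B)\<in>antidiag M. \<Sum>y\<in>roots B. g ((A, B), y))"
    using r by (simp add: log_rec_def sum_distrib_left g_def case_prod_unfold)
  also have "\<dots> = (\<Sum>x\<in>antidiag M. \<Sum>y\<in>roots (snd x). g (x, y))" by (simp add: case_prod_unfold)
  also have "\<dots> = sum g X" unfolding X_def
    by (subst sum.Sigma) (auto simp: finite_roots case_prod_unfold)
  also have "\<dots> = g ((0, M), (1, M)) + sum g (X - {((0, M), (1, M))})"
    by (rule sum.remove[OF fin x])
  also have "g ((0, M), (1, M)) = of_nat (deg M) * a M" using F0 p1 by (simp add: g_def)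
  finally show ?thesis by (simp add: g_def X_def log_rest_def)
qed

text \<open>The set \<open>S\<close> is closed under what the recursion refers to. It allows the
  conclusion when the two series agree on part of the monomials only.\<close>

lemma log_rec_unique:
  fixes a :: "'v mon \<Rightarrow> 'b::field"
  assumes "\<And>n. n > 0 \<Longrightarrow> of_nat n \<noteq> (0 :: 'b)"
    and a: "log_rec \<psi> F a" and b: "log_rec \<psi> G b" and FG: "\<And>M. M \<in> S \<Longrightarrow> F M = G M"
    and S: "\<And>M A B k N. M \<in> S \<Longrightarrow> ((A, B), (k, N)) \<in> log_rest M \<Longrightarrow> A \<in> S \<and> N \<in> S"
    and F0: "F 0 = 1" "G 0 = 1" and p1: "\<And>x. \<psi> 1 x = x" and M: "M \<noteq> 0" "M \<in> S"
  shows "a M = b M"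
  using M
proof (induction "deg M" arbitrary: M rule: less_induct)
  case less
  have "F A * (of_nat (deg N) * \<psi> k (a N)) = G A * (of_nat (deg N) * \<psi> k (b N))"
    if x: "((A, B), (k, N)) \<in> log_rest M" for A B k N
    using FG[of A] less.hyps[of N] log_rest_deg[OF x] S[OF less.prems(2) x] by simp
  then have "(\<Sum>((A, B), (k, N))\<in>log_rest M. F A * (of_nat (deg N) * \<psi> k (a N))) =
      (\<Sum>((A, B), (k, N))\<in>log_rest M. G A * (of_nat (deg N) * \<psi> k (b N)))"
    by (intro sum.cong refl) auto
  then have "of_nat (deg M) * a M = of_nat (deg M) * b M"
    using log_rec_solve[OF a F0(1) p1 less.prems(1)] log_rec_solve[OF b F0(2) p1 less.prems(1)] FG[OF less.prems(2)]
    by simp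
  moreover have "deg M > 0" using less.prems deg_eq_0[of M] by auto
  ultimately show ?case using assms(1) by simp
qed

section \<open>The Hilbert series of symmetric polynomials\<close>

definition colmsets :: "(nat \<Rightarrow>\<^sub>0 nat) \<Rightarrow> nat \<Rightarrow> (nat \<times> nat) multiset set" where
  "colmsets \<gamma> d = {\<nu>. mct \<nu> = \<gamma> \<and> mdeg \<nu> = d}"

lemma mct_add_mset [simp]: "mct (add_mset x \<nu>) = single (fst x) 1 + mct \<nu>"
  and mdeg_add_mset [simp]: "mdeg (add_mset x \<nu>) = snd x + mdeg \<nu>"
  and mct_empty [simp]: "mct {#} = 0" and mdeg_empty [simp]: "mdeg {#} = 0"
  by (simp_all add: mct_def mdeg_def)

lemma mct_eq_0: "mct \<nu> = 0 \<longleftrightarrow> \<nu> = {#}"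
proof (cases \<nu>)
  case (add x \<nu>')
  have "lookup (mct \<nu>) (fst x) > 0" by (simp add: add lookup_add)
  then have "mct \<nu> \<noteq> 0" by auto
  then show ?thesis by (simp add: add)
qed simp

lemma finite_colmsets: "finite (colmsets \<gamma> d)"
proof -
  obtain B where B: "finite B" "ctype B = \<gamma>" using ctype_exists by blast
  have "colmsets \<gamma> d \<subseteq> shape B ` {m. keys m \<subseteq> B \<and> deg m = d}"
  proof
    fix \<nu> assume \<nu>: "\<nu> \<in> colmsets \<gamma> d"
    then obtain m where m: "keys m \<subseteq> B" "shape B m = \<nu>"
      using shape_exists[OF B(1), of \<nu>] B(2) by (auto simp: colmsets_def)
    then show "\<nu> \<in> shape B ` {m. keys m \<subseteq> B \<and> deg m = d}"
      using mdeg_shape[OF B(1) m(1)] \<nu> by (auto simp: colmsets_def)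
  qed
  then show ?thesis using finite_mons[OF B(1)] finite_surj by blast
qed

definition csuc :: "nat \<Rightarrow> nat \<times> nat \<Rightarrow> nat \<times> nat" where
  "csuc i x = (if fst x = i then (fst x, Suc (snd x)) else x)"

lemma inj_csuc: "inj (csuc i)"
  by (auto simp: inj_def csuc_def split: if_splits)

lemma mct_csuc: "mct (image_mset (csuc i) \<nu>) = mct \<nu>"
  by (induction \<nu>) (auto simp: csuc_def)

lemma mdeg_csuc: "mdeg (image_mset (csuc i) \<nu>) = mdeg \<nu> + lookup (mct \<nu>) i"
  by (induction \<nu>) (auto simp: csuc_def lookup_add lookup_single when_def)

lemma csuc_surj:
  assumes "(i, 0) \<notin># \<nu>" shows "\<exists>\<nu>'. \<nu> = image_mset (csuc i) \<nu>'"
  using assms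
proof (induction \<nu>)
  case (add x \<nu>)
  then obtain \<nu>' where \<nu>': "\<nu> = image_mset (csuc i) \<nu>'" by auto
  have "\<exists>y. csuc i y = x"
  proof (cases "fst x = i")
    case True
    then obtain k where "x = (i, Suc k)" using add.prems by (cases x; cases "snd x") auto
    then show ?thesis by (intro exI[of _ "(i, k)"]) (simp add: csuc_def)
  next
    case False
    then show ?thesis by (intro exI[of _ x]) (simp add: csuc_def)
  qed
  then obtain y where "csuc i y = x" by blast
  then show ?case using \<nu>' by (intro exI[of _ "add_mset y \<nu>'"]) simp
qed simp

text \<open>Either the exponent zero occurs in colour \<open>i\<close> and one such entry is
  removed, or all exponents of this colour are positive and are lowered by one. This is the
  recursion for partitions with a bounded number of parts.\<close>

lemma card_colmsets:
  assumes "lookup \<gamma> i > 0"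
  shows "card (colmsets \<gamma> d) = card (colmsets (\<gamma> - single i 1) d) +
    (if lookup \<gamma> i \<le> d then card (colmsets \<gamma> (d - lookup \<gamma> i)) else 0)"
proof -
  define X where "X = {\<nu>\<in>colmsets \<gamma> d. (i, 0) \<in># \<nu>}"
  define Y where "Y = {\<nu>\<in>colmsets \<gamma> d. (i, 0) \<notin># \<nu>}"
  have g: "single i 1 + (\<gamma> - single i 1) = \<gamma>"
    using assms by (intro poly_mapping_eqI) (auto simp: lookup_add lookup_minus lookup_single when_def)
  have "card (colmsets \<gamma> d) = card X + card Y"
    using finite_colmsets[of \<gamma> d] by (subst card_Un_disjoint[symmetric]) (auto simp: X_def Y_def intro: arg_cong[of _ _ card])
  also have "X = add_mset (i, 0) ` colmsets (\<gamma> - single i 1) d"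
  proof (intro equalityI subsetI)
    fix \<nu> assume "\<nu> \<in> X"
    then obtain \<nu>' where \<nu>': "\<nu> = add_mset (i, 0) \<nu>'" and \<nu>: "\<nu> \<in> colmsets \<gamma> d"
      by (auto simp: X_def dest: multi_member_split)
    have "single i 1 + mct \<nu>' = single i 1 + (\<gamma> - single i 1)" using \<nu> g by (simp add: \<nu>' colmsets_def)
    then have "mct \<nu>' = \<gamma> - single i 1" by (rule add_left_imp_eq)
    then show "\<nu> \<in> add_mset (i, 0) ` colmsets (\<gamma> - single i 1) d" using \<nu> by (auto simp: \<nu>' colmsets_def)
  next
    fix \<nu> assume "\<nu> \<in> add_mset (i, 0) ` colmsets (\<gamma> - single i 1) d"
    then show "\<nu> \<in> X" using g by (auto simp: X_def colmsets_def)
  qed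
  also have "card \<dots> = card (colmsets (\<gamma> - single i 1) d)" by (rule card_image) (auto simp: inj_on_def)
  also have "card Y = (if lookup \<gamma> i \<le> d then card (colmsets \<gamma> (d - lookup \<gamma> i)) else 0)"
  proof (cases "lookup \<gamma> i \<le> d")
    case True
    have "Y = image_mset (csuc i) ` colmsets \<gamma> (d - lookup \<gamma> i)"
    proof (intro equalityI subsetI)
      fix \<nu> assume "\<nu> \<in> Y"
      then obtain \<nu>' where "\<nu> = image_mset (csuc i) \<nu>'" "\<nu> \<in> colmsets \<gamma> d" using csuc_surj[of i \<nu>] by (auto simp: Y_def)
      then show "\<nu> \<in> image_mset (csuc i) ` colmsets \<gamma> (d - lookup \<gamma> i)"
        by (auto simp: colmsets_def mct_csuc mdeg_csuc)
    next
      fix \<nu> assume "\<nu> \<in> image_mset (csuc i) ` colmsets \<gamma> (d - lookup \<gamma> i)"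
      then show "\<nu> \<in> Y" using True by (auto simp: Y_def colmsets_def mct_csuc mdeg_csuc csuc_def split: if_splits)
    qed
    moreover have "inj_on (image_mset (csuc i)) (colmsets \<gamma> (d - lookup \<gamma> i))"
      using multiset.inj_map[OF inj_csuc[of i]] by (rule inj_on_subset) simp
    ultimately show ?thesis using True card_image by auto
  next
    case False
    have "Y = {}"
    proof (rule equals0I)
      fix \<nu> assume "\<nu> \<in> Y"
      then obtain \<nu>' where "\<nu> = image_mset (csuc i) \<nu>'" "\<nu> \<in> colmsets \<gamma> d" using csuc_surj[of i \<nu>] by (auto simp: Y_def)
      then show False using False by (auto simp: colmsets_def mct_csuc mdeg_csuc)
    qed
    then show ?thesis using False by simp
  qed
  finally show ?thesis .
qed

definition colgf :: "(nat \<Rightarrow>\<^sub>0 nat) \<Rightarrow> rat fps" where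
  "colgf \<gamma> = Abs_fps (\<lambda>d. of_nat (card (colmsets \<gamma> d)))"

text \<open>The inverse of the Hilbert series of the polynomials that are symmetric in
  \<open>lookup \<gamma> i\<close> variables of each colour \<open>i\<close>.\<close>

definition qpoch :: "(nat \<Rightarrow>\<^sub>0 nat) \<Rightarrow> rat fps" where
  "qpoch \<gamma> = (\<Prod>i\<in>keys \<gamma>. \<Prod>t\<in>{1..lookup \<gamma> i}. 1 - fps_X ^ t)"

lemma colgf_step: "lookup \<gamma> i > 0 \<Longrightarrow> (1 - fps_X ^ lookup \<gamma> i) * colgf \<gamma> = colgf (\<gamma> - single i 1)"
proof (rule fps_ext)
  fix d assume i: "lookup \<gamma> i > 0"
  show "fps_nth ((1 - fps_X ^ lookup \<gamma> i) * colgf \<gamma>) d = fps_nth (colgf (\<gamma> - single i 1)) d"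
    using card_colmsets[OF i, of d] by (simp add: left_diff_distrib fps_X_power_mult_nth colgf_def)
qed

lemma qpoch_superset: "finite A \<Longrightarrow> keys \<gamma> \<subseteq> A \<Longrightarrow> qpoch \<gamma> = (\<Prod>i\<in>A. \<Prod>t\<in>{1..lookup \<gamma> i}. 1 - fps_X ^ t)"
  unfolding qpoch_def by (rule prod.mono_neutral_left) (auto simp: in_keys_iff)

lemma qpoch_step:
  assumes "lookup \<gamma> i > 0"
  shows "qpoch \<gamma> = qpoch (\<gamma> - single i 1) * (1 - fps_X ^ lookup \<gamma> i)"
proof -
  have i: "i \<in> keys \<gamma>" using assms by (simp add: in_keys_iff)
  have sub: "keys (\<gamma> - single i 1) \<subseteq> keys \<gamma>" by (auto simp: in_keys_iff lookup_minus simp del: lookup_not_eq_zero_eq_in_keys)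
  have "(\<Prod>j\<in>keys \<gamma> - {i}. \<Prod>t\<in>{1..lookup (\<gamma> - single i 1) j}. 1 - fps_X ^ t) =
      (\<Prod>j\<in>keys \<gamma> - {i}. \<Prod>t\<in>{1..lookup \<gamma> j}. 1 - (fps_X :: rat fps) ^ t)"
    by (intro prod.cong refl) (auto simp: lookup_minus lookup_single when_def)
  moreover have "lookup \<gamma> i = Suc (lookup (\<gamma> - single i 1) i)" using assms by (simp add: lookup_minus)
  then have "(\<Prod>t\<in>{1..lookup \<gamma> i}. 1 - (fps_X :: rat fps) ^ t) =
      (\<Prod>t\<in>{1..lookup (\<gamma> - single i 1) i}. 1 - fps_X ^ t) * (1 - fps_X ^ lookup \<gamma> i)"
    by simp
  ultimately show ?thesis
    using qpoch_superset[OF _ sub] qpoch_def[of \<gamma>] by (simp add: prod.remove[OF _ i] mult_ac)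
qed

lemma colgf_qpoch: "qpoch \<gamma> * colgf \<gamma> = 1"
proof (induction "deg \<gamma>" arbitrary: \<gamma>)
  case 0
  then have "\<gamma> = 0" by (simp add: deg_eq_0)
  moreover have "colmsets 0 d = (if d = 0 then {{#}} else {})" for d
    by (auto simp: colmsets_def mct_eq_0)
  ultimately show ?case by (intro fps_ext) (auto simp: qpoch_def colgf_def)
next
  case (Suc n)
  then have "\<gamma> \<noteq> 0" by auto
  then obtain i where i: "lookup \<gamma> i > 0" by (metis neq0_conv poly_mapping_eqI lookup_zero)
  have "single i 1 + (\<gamma> - single i 1) = \<gamma>"
    using i by (intro poly_mapping_eqI) (auto simp: lookup_add lookup_minus lookup_single when_def)
  then have "deg \<gamma> = Suc (deg (\<gamma> - single i 1))" by (metis deg_add deg_single plus_1_eq_Suc)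
  then have "qpoch (\<gamma> - single i 1) * colgf (\<gamma> - single i 1) = 1" using Suc by simp
  then show ?case unfolding colgf_step[OF i, symmetric] qpoch_step[OF i] by (simp add: mult_ac)
qed

section \<open>Expansion of rational functions at infinity\<close>

text \<open>The substitution \<open>q = 1 / X\<close>, so that Laurent series in \<open>X\<close>
  are expansions at infinity.\<close>

definition polyinf :: "rat poly \<Rightarrow> rat fls" where
  "polyinf p = poly (map_poly fls_const p) fls_X_inv"

lemma polyinf_0 [simp]: "polyinf 0 = 0" by (simp add: polyinf_def)

lemma polyinf_pCons: "polyinf (pCons a p) = fls_const a + fls_X_inv * polyinf p"
  by (simp add: polyinf_def map_poly_pCons)

lemma polyinf_1 [simp]: "polyinf 1 = 1"
  using polyinf_pCons[of 1 0] by (simp add: one_pCons)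

lemma polyinf_add: "polyinf (p + q) = polyinf p + polyinf q"
proof -
  have "map_poly fls_const (p + q) = map_poly fls_const p + (map_poly fls_const q :: rat fls poly)"
    by (rule poly_eqI) (simp add: coeff_map_poly fls_plus_const)
  then show ?thesis by (simp add: polyinf_def)
qed

lemma polyinf_smult: "polyinf (Polynomial.smult c p) = fls_const c * polyinf p"
proof -
  have "map_poly fls_const (Polynomial.smult c p) = Polynomial.smult (fls_const c) (map_poly fls_const p :: rat fls poly)"
    by (rule poly_eqI) (simp add: coeff_map_poly)
  then show ?thesis by (simp add: polyinf_def)
qed

lemma polyinf_mult: "polyinf (p * q) = polyinf p * polyinf q"
  by (induction p) (auto simp: mult_pCons_left polyinf_add polyinf_smult polyinf_pCons algebra_simps)

lemma polyinf_nth: "fls_nth (polyinf p) m = (if m \<le> 0 then coeff p (nat (- m)) else 0)"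
proof (induction p arbitrary: m)
  case (pCons a p)
  have "fls_nth (fls_X_inv * polyinf p) m = fls_nth (polyinf p) (m + 1)"
    by (simp add: fls_X_inv_times_conv_shift)
  moreover have "nat (- m) = Suc (nat (- (m + 1)))" if "m < 0" using that by simp
  ultimately show ?case
    by (cases "m < 0"; cases "m = 0") (auto simp: polyinf_pCons pCons.IH)
qed simp

lemma polyinf_eq_0: "polyinf p = 0 \<longleftrightarrow> p = 0"
proof
  assume "polyinf p = 0"
  then have "coeff p n = 0" for n using polyinf_nth[of p "- int n"] by simp
  then show "p = 0" by (intro poly_eqI) simp
qed simp

definition ratinf :: "rat poly fract \<Rightarrow> rat fls" where
  "ratinf x = (SOME y. \<exists>a b. b \<noteq> 0 \<and> x = Fract a b \<and> y = polyinf a / polyinf b)"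

lemma ratinf_Fract: "b \<noteq> 0 \<Longrightarrow> ratinf (Fract a b) = polyinf a / polyinf b"
proof -
  assume b: "b \<noteq> 0"
  then have "\<exists>y c d. d \<noteq> 0 \<and> Fract a b = Fract c d \<and> y = polyinf c / polyinf d" by blast
  from someI_ex[OF this] obtain c d where cd: "d \<noteq> 0" "Fract a b = Fract c d"
    "ratinf (Fract a b) = polyinf c / polyinf d" unfolding ratinf_def by blast
  have "a * d = c * b" using cd b by (simp add: eq_fract)
  then have "polyinf a * polyinf d = polyinf c * polyinf b" by (metis polyinf_mult)
  then show ?thesis using cd b by (simp add: frac_eq_eq polyinf_eq_0)
qed

lemma ratinf_add: "ratinf (x + y) = ratinf x + ratinf y"
proof -
  obtain a b where x: "x = Fract a b" "b \<noteq> 0" by (rule Fract_rep)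
  obtain c d where y: "y = Fract c d" "d \<noteq> 0" by (rule Fract_rep)
  show ?thesis using x(2) y(2)
    by (simp add: x(1) y(1) ratinf_Fract polyinf_mult polyinf_add add_frac_eq polyinf_eq_0)
qed

lemma ratinf_mult: "ratinf (x * y) = ratinf x * ratinf y"
proof -
  obtain a b where x: "x = Fract a b" "b \<noteq> 0" by (rule Fract_rep)
  obtain c d where y: "y = Fract c d" "d \<noteq> 0" by (rule Fract_rep)
  show ?thesis using x(2) y(2) by (simp add: x(1) y(1) ratinf_Fract polyinf_mult)
qed

lemma ratinf_to_fract: "ratinf (to_fract p) = polyinf p"
  using ratinf_Fract[of 1 p] by (simp add: to_fract_def)

lemma ratinf_0 [simp]: "ratinf 0 = 0" using ratinf_to_fract[of 0] by simp
lemma ratinf_1 [simp]: "ratinf 1 = 1" using ratinf_to_fract[of 1] by simp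

lemma ratinf_qvar: "ratinf qvar = fls_X_inv"
proof -
  have "polyinf [:0, 1:] = fls_X_inv" by (simp add: polyinf_pCons)
  then show ?thesis by (simp add: ratinf_to_fract)
qed

lemma ratinf_uminus: "ratinf (- x) = - ratinf x"
  using ratinf_add[of x "- x"] by (simp add: eq_neg_iff_add_eq_0 add.commute)

lemma ratinf_diff: "ratinf (x - y) = ratinf x - ratinf y"
  using ratinf_add[of x "- y"] by (simp add: ratinf_uminus)

lemma ratinf_of_nat: "ratinf (of_nat n) = of_nat n"
  by (induction n) (auto simp: ratinf_add)

lemma ratinf_sum: "ratinf (sum f A) = (\<Sum>a\<in>A. ratinf (f a))"
  by (induction A rule: infinite_finite_induct) (auto simp: ratinf_add)

lemma ratinf_prod: "ratinf (prod f A) = (\<Prod>a\<in>A. ratinf (f a))"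
  by (induction A rule: infinite_finite_induct) (auto simp: ratinf_mult)

lemma ratinf_power: "ratinf (x ^ n) = ratinf x ^ n"
  by (induction n) (auto simp: ratinf_mult)

lemma ratinf_eq_0: "ratinf x = 0 \<longleftrightarrow> x = 0"
proof -
  obtain a b where x: "x = Fract a b" "b \<noteq> 0" by (rule Fract_rep)
  have "Fract a b = 0 \<longleftrightarrow> a = 0" using x(2) by (simp add: Zero_fract_def eq_fract)
  then show ?thesis using x by (simp add: ratinf_Fract polyinf_eq_0)
qed

text \<open>Expansion loses nothing, so identities between Laurent series can be pulled back to
  rational functions.\<close>

lemma ratinf_inject: "ratinf x = ratinf y \<longleftrightarrow> x = y"
  using ratinf_eq_0[of "x - y"] by (simp add: ratinf_diff)

lemma ratinf_divide: "ratinf (x / y) = ratinf x / ratinf y"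
proof (cases "y = 0")
  case False
  have "ratinf (x / y) * ratinf y = ratinf x" using False by (simp add: ratinf_mult[symmetric])
  then show ?thesis using False by (simp add: eq_divide_eq ratinf_eq_0)
qed simp

lemma polyinf_pcompose:
  assumes k: "k \<ge> 1" shows "polyinf (pcompose p (monom 1 k)) = fls_compose_power (polyinf p) k"
proof -
  have m: "polyinf (monom 1 k) = fls_X_intpow (- int k)"
    by (rule fls_eqI) (auto simp: polyinf_nth)
  have c: "polyinf [:c:] = fls_const c" for c by (simp add: polyinf_pCons)
  show ?thesis
    by (induction p) (use k in \<open>auto simp: pcompose_pCons polyinf_add polyinf_mult m c polyinf_pCons\<close>)
qed

lemma ratinf_q_subst:
  assumes k: "k \<ge> 1" shows "ratinf (q_subst k x) = fls_compose_power (ratinf x) k"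
proof -
  obtain a b where x: "x = Fract a b" "b \<noteq> 0" by (rule Fract_rep)
  define y where "y = polyinf a / polyinf b"
  have "fls_compose_power (y * polyinf b) k = fls_compose_power y k * fls_compose_power (polyinf b) k"
    by (rule fls_compose_power_mult)
  moreover have "y * polyinf b = polyinf a" using x(2) by (simp add: y_def polyinf_eq_0)
  moreover have "fls_compose_power (polyinf b) k \<noteq> 0"
    using polyinf_pcompose[OF k, of b] pcompose_monom_neq_0[OF k x(2)] polyinf_eq_0 by metis
  ultimately show ?thesis
    using x by (simp add: q_subst_Fract[OF k] ratinf_Fract pcompose_monom_neq_0[OF k] polyinf_pcompose[OF k]
        y_def[symmetric] nonzero_divide_eq_eq)
qed

text \<open>The convolution may run over any finite set that contains the contributing indices,
  without reference to the orders of the two series.\<close>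

lemma fls_times_nth_superset:
  fixes f g :: "'a::comm_ring_1 fls"
  assumes "finite I" "\<And>i. fls_nth f i \<noteq> 0 \<Longrightarrow> fls_nth g (n - i) \<noteq> 0 \<Longrightarrow> i \<in> I"
  shows "fls_nth (f * g) n = (\<Sum>i\<in>I. fls_nth f i * fls_nth g (n - i))"
proof -
  define J where "J = {fls_subdegree f..n - fls_subdegree g}"
  have fJ: "finite J" by (simp add: J_def)
  have zJ: "fls_nth f i * fls_nth g (n - i) = 0" if "i \<notin> J" for i
    using fls_subdegree_leI[of f i] fls_subdegree_leI[of g "n - i"] that
    by (cases "fls_nth f i = 0"; cases "fls_nth g (n - i) = 0") (auto simp: J_def)
  have z: "fls_nth f i * fls_nth g (n - i) = 0" if "i \<notin> I" for i
    using assms(2)[of i] that by (cases "fls_nth f i = 0"; cases "fls_nth g (n - i) = 0") auto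
  have "(\<Sum>i\<in>J. fls_nth f i * fls_nth g (n - i)) = (\<Sum>i\<in>I \<union> J. fls_nth f i * fls_nth g (n - i))"
    using assms(1) fJ zJ by (intro sum.mono_neutral_left) auto
  also have "\<dots> = (\<Sum>i\<in>I. fls_nth f i * fls_nth g (n - i))"
    using assms(1) fJ z by (intro sum.mono_neutral_right) auto
  finally show ?thesis unfolding J_def fls_times_nth(2) .
qed

section \<open>The recursion for the dimensions\<close>

lemma deg_sum_mset: "deg (\<Sum>w\<in>#M. f w) = (\<Sum>w\<in>#M. deg (f w))"
  by (induction M) (auto simp: deg_add)

lemma sum_mset_replicate: "(\<Sum>w\<in>#replicate_mset k x. f w) = kmul k (f x)"
  by (induction k) (auto simp: kmul_Suc)

lemma kmul_of_nat: "kmul k m = of_nat k * m" for m :: "nat mon"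
  by (induction k) (auto simp: kmul_Suc distrib_right)

lemma fls_nth_sum: "fls_nth (sum f A) n = (\<Sum>a\<in>A. fls_nth (f a) n)"
  by (induction A rule: infinite_finite_induct) auto

lemma fls_nth_of_nat_mult: "fls_nth (of_nat k * f) n = of_nat k * fls_nth f n" for f :: "rat fls"
  by (induction k) (auto simp: distrib_right)

context graded_kernel
begin

text \<open>Count the triples of a product, one of its factors, and one of the occurrences of this factor.\<close>

lemma gmsets_recursion:
  assumes fin: "\<And>A k N. finite (R A k N)"
    and R: "\<And>A k N e'. k \<ge> 1 \<Longrightarrow> W N e' \<noteq> {} \<Longrightarrow> gmsets A (e - int k * e') \<noteq> {} \<Longrightarrow> e' \<in> R A k N"
  shows "deg \<gamma> * card (gmsets \<gamma> e) = (\<Sum>(A, B)\<in>antidiag \<gamma>. \<Sum>(k, N)\<in>roots B.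
    deg N * (\<Sum>e'\<in>R A k N. card (W N e') * card (gmsets A (e - int k * e'))))"
proof -
  \<comment> \<open>A factor \<open>w\<close> of multiplicity \<open>c\<close> is counted once for
    each \<open>k\<close> from \<open>1\<close> to \<open>c\<close>. Splitting off \<open>k\<close>
    copies of \<open>w\<close> turns this count into a sum over roots of order
    \<open>k\<close>.\<close>
  define Q where "Q = {(k, w, M). k \<ge> 1 \<and> w \<in> \<Omega> \<and> M + replicate_mset k w \<in> gmsets \<gamma> e}"
  define P where "P = (SIGMA M:gmsets \<gamma> e. SIGMA w:set_mset M. {1..count M w})"
  define T where "T = (SIGMA x:antidiag \<gamma>. roots (snd x))"
  \<comment> \<open>Only types are recorded: that of the remaining product \<open>M\<close>, and
    that of the \<open>k\<close> copies of \<open>w\<close> together with its root, the type of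
    \<open>w\<close>.\<close>
  define \<kappa> where "\<kappa> = (\<lambda>(k::nat, w :: (nat \<Rightarrow>\<^sub>0 nat) \<times> int \<times> fam, M :: ((nat \<Rightarrow>\<^sub>0 nat) \<times> int \<times> fam) multiset). ((\<Sum>x\<in>#M. fst x, kmul k (fst w)), (k, fst w)))"
  define d where "d = (\<lambda>(k::nat, w :: (nat \<Rightarrow>\<^sub>0 nat) \<times> int \<times> fam, M :: ((nat \<Rightarrow>\<^sub>0 nat) \<times> int \<times> fam) multiset). deg (fst w))"
  have \<Omega>: "w \<in> \<Omega>" if "M \<in> gmsets \<gamma> e" "w \<in># M" for M w using that by (auto simp: gmsets_def)
  have sub: "M - replicate_mset k w + replicate_mset k w = M" if "k \<le> count M w" for M w and k :: nat
    using that by (simp add: count_le_replicate_mset_subset_eq subset_mset.diff_add)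
  have finP: "finite P" unfolding P_def by (intro finite_SigmaI card_gmsets) auto
  have "deg \<gamma> * card (gmsets \<gamma> e) = (\<Sum>M\<in>gmsets \<gamma> e. \<Sum>w\<in>#M. deg (fst w))"
    by (simp add: gmsets_def deg_sum_mset[symmetric])
  also have "\<dots> = (\<Sum>M\<in>gmsets \<gamma> e. \<Sum>w\<in>set_mset M. \<Sum>k\<in>{1..count M w}. deg (fst w))"
    by (intro sum.cong refl, subst sum_mset_count[OF finite_set_mset]) auto
  also have "\<dots> = (\<Sum>M\<in>gmsets \<gamma> e. \<Sum>(w, k)\<in>(SIGMA w:set_mset M. {1..count M w}). deg (fst w))"
    by (intro sum.cong refl sum.Sigma) auto
  also have "\<dots> = (\<Sum>(M, w, k)\<in>P. deg (fst w))"
    unfolding P_def by (subst sum.Sigma) (auto intro: card_gmsets)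
  also have "\<dots> = sum d Q"
  proof (rule sum.reindex_bij_witness[where i = "\<lambda>(k, w, M). (M + replicate_mset k w, w, k)" and
        j = "\<lambda>(M, w, k). (k, w, M - replicate_mset k w)"], goal_cases)
    case (1 x)
    then show ?case by (auto simp: P_def sub)
  next
    case (2 x)
    then show ?case using \<Omega> by (auto simp: P_def Q_def sub)
  qed (auto simp: P_def Q_def d_def)
  also have "Q = (\<lambda>(M, w, k). (k, w, M - replicate_mset k w)) ` P"
  proof (intro equalityI subsetI)
    fix x assume x: "x \<in> Q"
    obtain k w M where e: "x = (k, w, M)" by (cases x)
    show "x \<in> (\<lambda>(M, w, k). (k, w, M - replicate_mset k w)) ` P"
      using x by (intro image_eqI[of _ _ "(M + replicate_mset k w, w, k)"]) (auto simp: e Q_def P_def)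
  next
    fix x assume "x \<in> (\<lambda>(M, w, k). (k, w, M - replicate_mset k w)) ` P"
    then show "x \<in> Q" using \<Omega> by (auto simp: P_def Q_def sub)
  qed
  then have finQ: "finite Q" using finP by simp
  have \<kappa>Q: "\<kappa> ` Q \<subseteq> T"
    by (auto simp: Q_def T_def \<kappa>_def antidiag_def roots_def gmsets_def \<Omega>_def sum_mset_replicate kmul_eq_0 kmul_of_nat)
  have "finite T" by (auto simp: T_def finite_roots)
  from sum.group[OF finQ this \<kappa>Q, of d]
  have "sum d Q = (\<Sum>y\<in>T. sum d {x\<in>Q. \<kappa> x = y})" ..
  also have "\<dots> = (\<Sum>((A, B), (k, N))\<in>T. deg N * (\<Sum>e'\<in>R A k N. card (W N e') * card (gmsets A (e - int k * e'))))"
  proof (intro sum.cong refl, clarify)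
    fix A B k N assume T: "((A, B), (k, N)) \<in> T"
    then have k: "k \<ge> 1" "N \<noteq> 0" "kmul k N = B" "A + B = \<gamma>" by (auto simp: T_def roots_def)
    define Z where "Z = (SIGMA e':R A k N. W N e' \<times> gmsets A (e - int k * e'))"
    have "{x\<in>Q. \<kappa> x = ((A, B), (k, N))} = (\<lambda>(e', F, M). (k, (N, e', F), M)) ` Z"
    proof (intro equalityI subsetI)
      fix x assume x: "x \<in> {x\<in>Q. \<kappa> x = ((A, B), (k, N))}"
      then obtain e' F M where e: "x = (k, (N, e', F), M)" by (cases x) (auto simp: \<kappa>_def)
      have F: "F \<in> W N e'" using x by (auto simp: e Q_def \<Omega>_def)
      have "(\<Sum>w\<in>#replicate_mset k (N, e', F). fst (snd w)) = int k * e'" by simp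
      then have M: "M \<in> gmsets A (e - int k * e')" using x by (auto simp: e Q_def \<kappa>_def gmsets_def)
      have "e' \<in> R A k N" using R[OF k(1), of N e' A] F M by blast
      then show "x \<in> (\<lambda>(e', F, M). (k, (N, e', F), M)) ` Z"
        using F M by (intro image_eqI[of _ _ "(e', F, M)"]) (auto simp: e Z_def)
    next
      fix x assume "x \<in> (\<lambda>(e', F, M). (k, (N, e', F), M)) ` Z"
      then obtain e' F M where x: "x = (k, (N, e', F), M)" "F \<in> W N e'" "M \<in> gmsets A (e - int k * e')"
        by (auto simp: Z_def)
      then show "x \<in> {x\<in>Q. \<kappa> x = ((A, B), (k, N))}"
        using k by (auto simp: Q_def \<kappa>_def \<Omega>_def gmsets_def sum_mset_replicate kmul_of_nat)
    qed
    moreover have "inj_on (\<lambda>(e', F, M). (k, (N, e', F), M)) Z" by (auto simp: inj_on_def)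
    ultimately have "card {x\<in>Q. \<kappa> x = ((A, B), (k, N))} = card Z"
      by (simp only: card_image)
    also have "\<dots> = (\<Sum>e'\<in>R A k N. card (W N e') * card (gmsets A (e - int k * e')))"
      unfolding Z_def using fin W(1) card_gmsets(1) by (subst card_SigmaI) (auto simp: card_cartesian_product)
    finally have c: "card {x\<in>Q. \<kappa> x = ((A, B), (k, N))} = (\<Sum>e'\<in>R A k N. card (W N e') * card (gmsets A (e - int k * e')))" .
    have "sum d {x\<in>Q. \<kappa> x = ((A, B), (k, N))} = (\<Sum>x\<in>{x\<in>Q. \<kappa> x = ((A, B), (k, N))}. deg N)"
      by (intro sum.cong refl) (auto simp: \<kappa>_def d_def)
    then show "sum d {x\<in>Q. \<kappa> x = ((A, B), (k, N))} =
        deg N * (\<Sum>e'\<in>R A k N. card (W N e') * card (gmsets A (e - int k * e')))"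
      by (simp add: c mult.commute)
  qed
  also have "\<dots> = (\<Sum>x\<in>antidiag \<gamma>. \<Sum>y\<in>roots (snd x). case (x, y) of ((A, B), (k, N)) \<Rightarrow>
      deg N * (\<Sum>e'\<in>R A k N. card (W N e') * card (gmsets A (e - int k * e'))))"
    unfolding T_def by (subst sum.Sigma) (auto simp: finite_roots case_prod_unfold)
  finally show ?thesis by (simp add: case_prod_unfold)
qed

text \<open>The coefficient of \<open>X ^ e\<close> is the dimension of the component of degree
  \<open>e\<close>; the shift multiplies by the power \<open>e0 \<gamma>\<close> of
  \<open>X\<close>, which may be negative.\<close>

definition Fhat :: "(nat \<Rightarrow>\<^sub>0 nat) \<Rightarrow> rat fls" where
  "Fhat \<gamma> = fls_shift (- e0 \<gamma>) (fps_to_fls (colgf \<gamma>))"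

definition What :: "(nat \<Rightarrow>\<^sub>0 nat) \<Rightarrow> rat fls" where
  "What \<gamma> = fls_shift (- e0 \<gamma>) (fps_to_fls (Abs_fps (\<lambda>d. of_nat (card (W \<gamma> (e0 \<gamma> + int d))))))"

lemma shapes_small: "e < e0 \<gamma> \<Longrightarrow> shapes \<gamma> e = {}"
  by (auto simp: shapes_def)

lemma Fhat_nth: "fls_nth (Fhat \<gamma>) e = of_nat (card (gmsets \<gamma> e))"
proof (cases "e < e0 \<gamma>")
  case True
  then show ?thesis using card_gmsets(2)[of \<gamma> e] shapes_small[OF True] by (simp add: Fhat_def)
next
  case False
  then have "shapes \<gamma> e = colmsets \<gamma> (nat (e - e0 \<gamma>))" by (auto simp: shapes_def colmsets_def)
  then show ?thesis using False card_gmsets(2)[of \<gamma> e] by (simp add: Fhat_def colgf_def)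
qed

lemma What_nth: "fls_nth (What \<gamma>) e = of_nat (card (W \<gamma> e))"
  using card_W_small[of e \<gamma>] by (cases "e < e0 \<gamma>") (auto simp: What_def)

text \<open>Compared coefficient by coefficient, this is \<open>gmsets_recursion\<close>.\<close>

lemma log_rec_hat: "log_rec (\<lambda>k x. fls_compose_power x k) Fhat What"
  unfolding log_rec_def
proof (intro allI fls_eqI)
  fix \<gamma> e
  \<comment> \<open>Both counts vanish below the shifts of their types. This bounds
    \<open>e'\<close> below by \<open>e0 N\<close> and, as \<open>e' \<le> k * e'\<close> for
    positive \<open>e'\<close>, above by \<open>e - e0 A\<close>; the absolute value covers
    non-positive \<open>e'\<close>.\<close>
  define R :: "(nat \<Rightarrow>\<^sub>0 nat) \<Rightarrow> nat \<Rightarrow> (nat \<Rightarrow>\<^sub>0 nat) \<Rightarrow> int set"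
    where "R = (\<lambda>A k N. {e0 N..\<bar>e - e0 A\<bar>})"
  have WN: "W N e' = {}" if "e' < e0 N" for N e' using card_W_small[OF that] W(1) by simp
  have gA: "gmsets A e' = {}" if "e' < e0 A" for A e'
    using card_gmsets[of A e'] shapes_small[OF that] by simp
  have R: "e' \<in> R A k N" if k: "k \<ge> 1" "W N e' \<noteq> {}" "gmsets A (e - int k * e') \<noteq> {}" for A k N e'
  proof -
    have "e0 N \<le> e'" using WN[of e' N] k by force
    moreover have "e0 A \<le> e - int k * e'" using gA[of "e - int k * e'" A] k by force
    then have "e' \<le> \<bar>e - e0 A\<bar>"
    proof (cases "e' \<le> 0")
      case False
      then have "1 * e' \<le> int k * e'" using k(1) by (intro mult_right_mono) auto
      then show ?thesis using \<open>e0 A \<le> e - int k * e'\<close> by linarith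
    qed linarith
    ultimately show ?thesis by (simp add: R_def)
  qed
  have c: "fls_nth (Fhat A * fls_compose_power (What N) k) e =
      of_nat (\<Sum>e'\<in>R A k N. card (W N e') * card (gmsets A (e - int k * e')))" if k: "k \<ge> 1" for A k N
  proof -
    have i: "inj_on (\<lambda>e'. int k * e') (R A k N)" using k by (auto simp: inj_on_def)
    have n: "fls_nth (fls_compose_power (What N) k) (int k * e') = of_nat (card (W N e'))" for e'
      using k by (simp add: What_nth fls_nth_compose_power)
    have "fls_nth (fls_compose_power (What N) k * Fhat A) e =
        (\<Sum>i\<in>(\<lambda>e'. int k * e') ` R A k N. fls_nth (fls_compose_power (What N) k) i * fls_nth (Fhat A) (e - i))"
    proof (rule fls_times_nth_superset)
      fix i assume i: "fls_nth (fls_compose_power (What N) k) i \<noteq> 0" "fls_nth (Fhat A) (e - i) \<noteq> 0"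
      then have "int k dvd i" using k by (auto simp: fls_nth_compose_power split: if_splits)
      then obtain e' where e': "i = int k * e'" by blast
      then have "W N e' \<noteq> {}" "gmsets A (e - int k * e') \<noteq> {}" using i n by (auto simp: Fhat_nth)
      then show "i \<in> (\<lambda>e'. int k * e') ` R A k N" using R[OF k] e' by blast
    qed (simp add: R_def)
    also have "\<dots> = (\<Sum>e'\<in>R A k N. of_nat (card (W N e')) * of_nat (card (gmsets A (e - int k * e'))))"
      unfolding sum.reindex[OF i] by (simp only: comp_def n Fhat_nth)
    finally show ?thesis by (simp add: mult.commute)
  qed
  have "fls_nth (\<Sum>(A, B)\<in>antidiag \<gamma>. Fhat A * (\<Sum>(k, N)\<in>roots B. of_nat (deg N) * fls_compose_power (What N) k)) e =
      (\<Sum>(A, B)\<in>antidiag \<gamma>. \<Sum>(k, N)\<in>roots B. of_nat (deg N) * fls_nth (Fhat A * fls_compose_power (What N) k) e)"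
    by (simp add: fls_nth_sum sum_distrib_left case_prod_unfold fls_nth_of_nat_mult mult.left_commute)
  also have "\<dots> = (\<Sum>(A, B)\<in>antidiag \<gamma>. \<Sum>(k, N)\<in>roots B.
      of_nat (deg N * (\<Sum>e'\<in>R A k N. card (W N e') * card (gmsets A (e - int k * e')))))"
    by (intro sum.cong refl, clarify, intro sum.cong refl) (auto simp: roots_def c)
  also have "\<dots> = of_nat (deg \<gamma> * card (gmsets \<gamma> e))"
    using gmsets_recursion[of R e \<gamma>] R by (simp add: R_def case_prod_unfold)
  finally show "fls_nth (of_nat (deg \<gamma>) * Fhat \<gamma>) e = fls_nth (\<Sum>(A, B)\<in>antidiag \<gamma>.
      Fhat A * (\<Sum>(k, N)\<in>roots B. of_nat (deg N) * fls_compose_power (What N) k)) e"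
    by (simp add: fls_nth_of_nat_mult Fhat_nth)
qed

end

section \<open>Rational functions that are regular at the origin\<close>

text \<open>The local ring of rational functions without a pole at \<open>q = 0\<close>.\<close>

definition reg0 :: "rat poly fract set" where
  "reg0 = {x. \<exists>a b. coeff b 0 \<noteq> 0 \<and> x = Fract a b}"

lemma reg0_Fract: "coeff b 0 \<noteq> 0 \<Longrightarrow> Fract a b \<in> reg0" by (auto simp: reg0_def)

lemma coeff_mult_0': "coeff (p * q) 0 = coeff p 0 * coeff q 0" for p q :: "rat poly"
  by (simp add: coeff_mult)

lemma reg0_add: "x \<in> reg0 \<Longrightarrow> y \<in> reg0 \<Longrightarrow> x + y \<in> reg0"
proof -
  assume "x \<in> reg0" "y \<in> reg0"
  then obtain a b c d where x: "coeff b 0 \<noteq> 0" "x = Fract a b" and y: "coeff d 0 \<noteq> 0" "y = Fract c d"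
    by (auto simp: reg0_def)
  then have "b \<noteq> 0" "d \<noteq> 0" by auto
  then show ?thesis using x y by (auto simp: coeff_mult_0' intro!: reg0_Fract)
qed

lemma reg0_mult: "x \<in> reg0 \<Longrightarrow> y \<in> reg0 \<Longrightarrow> x * y \<in> reg0"
proof -
  assume "x \<in> reg0" "y \<in> reg0"
  then obtain a b c d where x: "coeff b 0 \<noteq> 0" "x = Fract a b" and y: "coeff d 0 \<noteq> 0" "y = Fract c d"
    by (auto simp: reg0_def)
  then show ?thesis by (auto simp: coeff_mult_0' intro!: reg0_Fract)
qed

lemma reg0_to_fract: "to_fract p \<in> reg0" by (auto simp: to_fract_def intro!: reg0_Fract)

lemma reg0_0: "0 \<in> reg0" using reg0_to_fract[of 0] by simp
lemma reg0_1: "1 \<in> reg0" using reg0_to_fract[of 1] by simp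
lemma reg0_of_nat: "of_nat n \<in> reg0" by (induction n) (auto intro: reg0_0 reg0_1 reg0_add)
lemma reg0_uminus: "x \<in> reg0 \<Longrightarrow> - x \<in> reg0"
  using reg0_mult[of "to_fract (- 1)" x] reg0_to_fract[of "- 1"] by (simp add: to_fract_uminus)
lemma reg0_diff: "x \<in> reg0 \<Longrightarrow> y \<in> reg0 \<Longrightarrow> x - y \<in> reg0"
  using reg0_add[of x "- y"] reg0_uminus by simp
lemma reg0_sum: "(\<And>a. a \<in> A \<Longrightarrow> f a \<in> reg0) \<Longrightarrow> sum f A \<in> reg0"
  by (induction A rule: infinite_finite_induct) (auto intro: reg0_add reg0_0)
lemma reg0_prod: "(\<And>a. a \<in> A \<Longrightarrow> f a \<in> reg0) \<Longrightarrow> prod f A \<in> reg0"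
  by (induction A rule: infinite_finite_induct) (auto intro: reg0_mult reg0_1)
lemma reg0_power: "x \<in> reg0 \<Longrightarrow> x ^ n \<in> reg0"
  by (induction n) (auto intro: reg0_mult reg0_1)

lemma reg0_inverse_to_fract: "coeff p 0 \<noteq> 0 \<Longrightarrow> inverse (to_fract p) \<in> reg0"
  by (auto simp: to_fract_def intro!: reg0_Fract)

lemma reg0_q_subst:
  assumes k: "k \<ge> 1" and x: "x \<in> reg0" shows "q_subst k x \<in> reg0"
proof -
  obtain a b where ab: "coeff b 0 \<noteq> 0" "x = Fract a b" using x by (auto simp: reg0_def)
  then have "b \<noteq> 0" by auto
  have "coeff (pcompose b (monom 1 k)) 0 = coeff b 0"
    using k by (simp add: poly_0_coeff_0[symmetric] poly_pcompose poly_monom power_0_left)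
  then show ?thesis using ab q_subst_Fract[OF k \<open>b \<noteq> 0\<close>, of a] by (auto intro!: reg0_Fract)
qed

text \<open>Solving the recursion only divides by positive integers, which are units in
  \<open>reg0\<close>.\<close>

lemma log_rec_reg0:
  assumes r: "log_rec q_subst F a" and F0: "F 0 = 1" and F: "\<And>\<gamma>. F \<gamma> \<in> reg0" and M: "M \<noteq> 0"
  shows "a M \<in> reg0"
  using M
proof (induction "deg M" arbitrary: M rule: less_induct)
  case less
  have "of_nat (deg M) * F M - (\<Sum>((A, B), (k, N))\<in>log_rest M. F A * (of_nat (deg N) * q_subst k (a N))) \<in> reg0"
    using log_rest_deg less.hyps
    by (intro reg0_diff reg0_mult reg0_of_nat F reg0_sum)
      (auto intro!: reg0_mult reg0_of_nat F reg0_q_subst dest!: log_rest_deg)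
  then have 1: "of_nat (deg M) * a M \<in> reg0" using log_rec_solve[OF r F0 q_subst_id less.prems] by simp
  have d: "deg M > 0" using less.prems deg_eq_0[of M] by auto
  have "of_nat (deg M) = to_fract (of_nat (deg M))" by (induction ("deg M")) (auto simp: to_fract_add)
  moreover have "coeff (of_nat (deg M) :: rat poly) 0 \<noteq> 0" using d by (simp add: of_nat_poly)
  ultimately have 2: "inverse (of_nat (deg M)) \<in> reg0" using reg0_inverse_to_fract by metis
  have "inverse (of_nat (deg M)) * (of_nat (deg M) * a M) \<in> reg0" by (rule reg0_mult[OF 2 1])
  then show ?case using fract_of_nat_neq_0[OF d] by (simp add: mult.assoc[symmetric])
qed

section \<open>Positivity for quivers with enough loops\<close>

lemma to_fract_power: "to_fract (p ^ n) = to_fract p ^ n"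
  by (induction n) (auto simp: to_fract_mult)

lemma fps_to_fls_prod: "fps_to_fls (prod f A) = (\<Prod>a\<in>A. fps_to_fls (f a :: rat fps))"
  by (induction A rule: infinite_finite_induct) (auto simp: fls_times_fps_to_fls)

lemma fls_compose_power_id: "fls_compose_power x (Suc 0) = x"
  by (rule fls_eqI) (simp add: fls_compose_power.rep_eq)

lemma fls_X_inv_power_mult: "fls_X_inv ^ n * g = fls_shift (int n) g" for g :: "rat fls"
proof (induction n)
  case (Suc n)
  have "fls_X_inv ^ Suc n * g = fls_X_inv * (fls_X_inv ^ n * g)" by (simp only: power_Suc mult.assoc)
  also have "\<dots> = fls_shift 1 (fls_shift (int n) g)" by (simp only: Suc fls_X_inv_times_conv_shift)
  finally show ?case by (simp add: add.commute)
qed simp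

locale loop_quiver =
  fixes cc :: "nat \<Rightarrow> nat \<Rightarrow> nat"
  assumes loops: "cc i i \<ge> 1"
begin

text \<open>Minus the symmetrised Euler form, and below the Euler form itself.\<close>

definition hh :: "nat \<Rightarrow> nat \<Rightarrow> nat" where
  "hh i j = (if i = j then 2 * (cc i i - 1) else cc i j + cc j i)"

definition cform :: "(nat \<Rightarrow>\<^sub>0 nat) \<Rightarrow> nat" where
  "cform \<gamma> = (\<Sum>i\<in>keys \<gamma>. \<Sum>j\<in>keys \<gamma>. lookup \<gamma> i * lookup \<gamma> j * cc i j)"

definition e00 :: "(nat \<Rightarrow>\<^sub>0 nat) \<Rightarrow> int" where
  "e00 \<gamma> = int (\<Sum>i\<in>keys \<gamma>. lookup \<gamma> i ^ 2) - int (cform \<gamma>)"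

lemma sum_ctype:
  assumes "finite S" shows "(\<Sum>i\<in>keys (ctype S). int (lookup (ctype S) i) * f i) = (\<Sum>a\<in>S. f (fst a))"
proof -
  have "keys (ctype S) \<subseteq> fst ` S"
  proof
    fix i assume "i \<in> keys (ctype S)"
    then have "card {a\<in>S. fst a = i} \<noteq> 0" using lookup_ctype[OF assms, of i] by (simp add: in_keys_iff)
    then have "{a\<in>S. fst a = i} \<noteq> {}" by (metis card.empty)
    then show "i \<in> fst ` S" by blast
  qed
  then have "(\<Sum>i\<in>keys (ctype S). int (lookup (ctype S) i) * f i) = (\<Sum>i\<in>fst ` S. int (lookup (ctype S) i) * f i)"
    using assms by (intro sum.mono_neutral_left) (auto simp: in_keys_iff)
  also have "\<dots> = (\<Sum>i\<in>fst ` S. \<Sum>a\<in>{a\<in>S. fst a = i}. f (fst a))"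
    by (intro sum.cong refl) (simp add: lookup_ctype[OF assms])
  also have "\<dots> = (\<Sum>a\<in>S. f (fst a))" using assms by (rule sum.image_gen[symmetric])
  finally show ?thesis .
qed

lemma e00_ctype:
  assumes "finite S"
  shows "e00 (ctype S) = (\<Sum>a\<in>S. \<Sum>b\<in>S. (if fst a = fst b then 1 else 0) - int (cc (fst a) (fst b)))"
proof -
  define \<gamma> where "\<gamma> = ctype S"
  define g where "g i j = (if i = j then 1 else 0) - int (cc i j)" for i j
  have "int (\<Sum>i\<in>keys \<gamma>. lookup \<gamma> i ^ 2) = (\<Sum>i\<in>keys \<gamma>. \<Sum>j\<in>keys \<gamma>. int (lookup \<gamma> i * lookup \<gamma> j) * (if i = j then 1 else 0))"
    by (simp add: power2_eq_square if_distrib[of "\<lambda>x. _ * x"] sum.delta cong: if_cong)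
  then have "e00 \<gamma> = (\<Sum>i\<in>keys \<gamma>. int (lookup \<gamma> i) * (\<Sum>j\<in>keys \<gamma>. int (lookup \<gamma> j) * g i j))"
    by (simp add: e00_def cform_def g_def sum_subtractf[symmetric] sum_distrib_left right_diff_distrib mult.assoc)
  then show ?thesis unfolding \<gamma>_def by (simp only: sum_ctype[OF assms] g_def)
qed

sublocale graded_kernel hh e00
proof
  show "hh i j = hh j i" for i j by (simp add: hh_def)
  show "even (hh i i)" for i by (simp add: hh_def)
  show "e00 0 = 0" by (simp add: e00_def cform_def)
  fix T U :: "var set" assume T: "finite T" and U: "finite U" and TU: "T \<inter> U = {}"
  define g where "g a b = (if fst a = fst b then 1 else 0) - int (cc (fst a) (fst b))" for a b :: var
  \<comment> \<open>The diagonal entries of \<open>hh\<close> use truncated subtraction; the loops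
    make it exact.\<close>
  have g: "g a b + g b a = - int (hh (fst a) (fst b))" for a b
    using loops[of "fst a"] by (auto simp: g_def hh_def of_nat_diff)
  have s: "(\<Sum>a\<in>U. \<Sum>b\<in>T. g a b) = (\<Sum>a\<in>T. \<Sum>b\<in>U. g b a)" by (rule sum.swap)
  have "e00 (ctype T + ctype U) = (\<Sum>a\<in>T \<union> U. \<Sum>b\<in>T \<union> U. g a b)"
    using e00_ctype[of "T \<union> U"] T U ctype_Un[OF T U TU] by (simp add: g_def)
  also have "\<dots> = (\<Sum>a\<in>T. \<Sum>b\<in>T. g a b) + (\<Sum>a\<in>U. \<Sum>b\<in>U. g a b) + (\<Sum>a\<in>T. \<Sum>b\<in>U. g a b + g b a)"
    using T U TU by (simp add: sum.union_disjoint sum.distrib s)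
  also have "\<dots> = e00 (ctype T) + e00 (ctype U) - (\<Sum>a\<in>T. \<Sum>b\<in>U. int (hh (fst a) (fst b)))"
    using T U by (simp add: e00_ctype g g_def[symmetric] sum_negf)
  finally show "e00 (ctype T + ctype U) = e00 (ctype T) + e00 (ctype U) - (\<Sum>a\<in>T. \<Sum>b\<in>U. int (hh (fst a) (fst b)))" .
qed

definition ff :: "(nat \<Rightarrow>\<^sub>0 nat) \<Rightarrow> rat poly fract" where
  "ff \<gamma> = qvar ^ cform \<gamma> / (\<Prod>i\<in>keys \<gamma>. \<Prod>s<lookup \<gamma> i. qvar ^ lookup \<gamma> i - qvar ^ s)"

text \<open>With \<open>q = 1 / X\<close> each factor equals
  \<open>q ^ n * (1 - X ^ (n - s))\<close>; the powers of \<open>q\<close> collect to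
  \<open>q ^ (n ^ 2)\<close>.\<close>

lemma prod_GL_inf:
  "(\<Prod>s<n. fls_X_inv ^ n - fls_X_inv ^ s) = fls_X_inv ^ (n ^ 2) * fps_to_fls (\<Prod>t\<in>{1..n}. 1 - fps_X ^ t :: rat fps)"
proof -
  have x: "fls_X_inv * fls_X = (1 :: rat fls)" by (simp add: fls_X_inv_times_conv_shift fls_X_conv_shift_1)
  have "(\<Prod>s<n. fls_X_inv ^ n - fls_X_inv ^ s) = (\<Prod>s<n. fls_X_inv ^ n * (1 - fls_X ^ (n - s)) :: rat fls)"
  proof (intro prod.cong refl)
    fix s assume "s \<in> {..<n}"
    then have "n = s + (n - s)" by simp
    then have "fls_X_inv ^ n * fls_X ^ (n - s) = (fls_X_inv ^ s * fls_X_inv ^ (n - s)) * (fls_X ^ (n - s) :: rat fls)"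
      by (metis power_add)
    also have "\<dots> = fls_X_inv ^ s" by (simp add: mult.assoc power_mult_distrib[symmetric] x)
    finally show "fls_X_inv ^ n - fls_X_inv ^ s = fls_X_inv ^ n * (1 - fls_X ^ (n - s) :: rat fls)"
      by (simp add: right_diff_distrib)
  qed
  also have "\<dots> = (fls_X_inv ^ n) ^ n * (\<Prod>s<n. 1 - fls_X ^ (n - s))" by (simp add: prod.distrib)
  also have "(\<Prod>s<n. 1 - fls_X ^ (n - s)) = (\<Prod>t\<in>{1..n}. 1 - (fls_X :: rat fls) ^ t)"
    by (rule prod.reindex_bij_witness[where i = "\<lambda>t. n - t" and j = "\<lambda>s. n - s"]) auto
  also have "\<dots> = fps_to_fls (\<Prod>t\<in>{1..n}. 1 - fps_X ^ t)"
    by (simp add: fps_to_fls_prod fps_to_fls_minus fps_to_fls_power fps_X_to_fls)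
  finally show ?thesis by (simp add: power_mult[symmetric] power2_eq_square)
qed

text \<open>The powers of \<open>q\<close> combine to the exponent \<open>- e00 \<gamma>\<close>,
  which is the shift of the grading, and the remaining product is inverse to the Hilbert series
  \<open>colgf\<close>.\<close>

lemma ratinf_ff: "ratinf (ff \<gamma>) = Fhat \<gamma>"
proof -
  define s where "s = (\<Sum>i\<in>keys \<gamma>. lookup \<gamma> i ^ 2)"
  have "(\<Prod>i\<in>keys \<gamma>. \<Prod>s<lookup \<gamma> i. fls_X_inv ^ lookup \<gamma> i - fls_X_inv ^ s) = fls_X_inv ^ s * fps_to_fls (qpoch \<gamma>)"
    by (simp add: prod_GL_inf prod.distrib power_sum s_def qpoch_def fps_to_fls_prod)
  then have f: "ratinf (ff \<gamma>) = fls_X_inv ^ cform \<gamma> / (fls_X_inv ^ s * fps_to_fls (qpoch \<gamma>))"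
    by (simp add: ff_def ratinf_divide ratinf_prod ratinf_diff ratinf_power ratinf_qvar)
  have q: "fps_to_fls (qpoch \<gamma>) * fps_to_fls (colgf \<gamma>) = (1 :: rat fls)"
    using colgf_qpoch[of \<gamma>] by (metis fls_times_fps_to_fls fps_one_to_fls)
  note p = fls_X_inv_power_mult
  have "Fhat \<gamma> * (fls_X_inv ^ s * fps_to_fls (qpoch \<gamma>)) = fls_X_inv ^ s * fls_shift (- e00 \<gamma>) (fps_to_fls (qpoch \<gamma>) * fps_to_fls (colgf \<gamma>))"
    by (simp add: Fhat_def fls_shifted_times_simps mult_ac)
  also have "\<dots> = fls_shift (int s) (fls_shift (- e00 \<gamma>) 1)" unfolding q p ..
  also have "\<dots> = fls_X_inv ^ cform \<gamma> * 1" unfolding p by (simp add: e00_def s_def)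
  finally have "Fhat \<gamma> * (fls_X_inv ^ s * fps_to_fls (qpoch \<gamma>)) = fls_X_inv ^ cform \<gamma>" by simp
  moreover have "fls_X_inv ^ s * fps_to_fls (qpoch \<gamma>) \<noteq> 0" using q by auto
  ultimately show ?thesis unfolding f by (subst nonzero_divide_eq_eq) auto
qed

text \<open>The loops alone contribute the squares. This leaves enough powers of \<open>q\<close> to
  make the quotients by the orders of the general linear groups regular at
  \<open>q = 0\<close>.\<close>

lemma cform_ge: "(\<Sum>i\<in>keys \<gamma>. lookup \<gamma> i ^ 2) \<le> cform \<gamma>"
  unfolding cform_def
proof (rule sum_mono)
  fix i assume i: "i \<in> keys \<gamma>"
  have "lookup \<gamma> i ^ 2 \<le> lookup \<gamma> i * lookup \<gamma> i * cc i i" using loops[of i] by (simp add: power2_eq_square)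
  also have "\<dots> \<le> (\<Sum>j\<in>keys \<gamma>. lookup \<gamma> i * lookup \<gamma> j * cc i j)"
    using i by (intro member_le_sum) auto
  finally show "lookup \<gamma> i ^ 2 \<le> (\<Sum>j\<in>keys \<gamma>. lookup \<gamma> i * lookup \<gamma> j * cc i j)" .
qed

text \<open>One power \<open>q ^ n\<close> goes to each factor, and after cancelling
  \<open>q ^ s\<close> the denominator \<open>q ^ (n - s) - 1\<close> does not vanish at the
  origin.\<close>

lemma reg0_GL: "qvar ^ (n ^ 2) / (\<Prod>s<n. qvar ^ n - qvar ^ s) \<in> reg0"
proof -
  have q0: "qvar \<noteq> 0" by simp
  have "qvar ^ (n ^ 2) / (\<Prod>s<n. qvar ^ n - qvar ^ s) = (\<Prod>s<n. qvar ^ n / (qvar ^ n - qvar ^ s))"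
    by (simp add: prod_dividef power2_eq_square power_mult)
  also have "\<dots> = (\<Prod>s<n. qvar ^ (n - s) * inverse (to_fract ([:0, 1:] ^ (n - s) - 1)))"
  proof (intro prod.cong refl)
    fix s assume "s \<in> {..<n}"
    then have n: "qvar ^ n = qvar ^ s * qvar ^ (n - s)" by (simp add: power_add[symmetric])
    have "qvar ^ n / (qvar ^ n - qvar ^ s) = (qvar ^ s * qvar ^ (n - s)) / (qvar ^ s * (qvar ^ (n - s) - 1))"
      by (simp add: n right_diff_distrib)
    also have "\<dots> = qvar ^ (n - s) / (qvar ^ (n - s) - 1)" using q0 by (subst mult_divide_mult_cancel_left) auto
    finally show "qvar ^ n / (qvar ^ n - qvar ^ s) = qvar ^ (n - s) * inverse (to_fract ([:0, 1:] ^ (n - s) - 1))"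
      by (simp add: field_class.field_divide_inverse to_fract_diff to_fract_power)
  qed
  also have "\<dots> \<in> reg0"
  proof (intro reg0_prod reg0_mult reg0_power reg0_to_fract reg0_inverse_to_fract)
    fix s assume "s \<in> {..<n}"
    then show "coeff ([:0, 1:] ^ (n - s) - 1 :: rat poly) 0 \<noteq> 0"
      by (simp add: poly_0_coeff_0[symmetric] power_0_left)
  qed
  finally show ?thesis .
qed

lemma reg0_ff: "ff \<gamma> \<in> reg0"
proof -
  define s where "s = (\<Sum>i\<in>keys \<gamma>. lookup \<gamma> i ^ 2)"
  have "cform \<gamma> = (cform \<gamma> - s) + s" using cform_ge by (simp add: s_def)
  then have "qvar ^ cform \<gamma> = qvar ^ (cform \<gamma> - s) * qvar ^ s" by (metis power_add)
  then have "ff \<gamma> = qvar ^ (cform \<gamma> - s) * (\<Prod>i\<in>keys \<gamma>. qvar ^ (lookup \<gamma> i ^ 2) / (\<Prod>s<lookup \<gamma> i. qvar ^ lookup \<gamma> i - qvar ^ s))"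
    by (simp add: ff_def s_def power_sum prod_dividef)
  also have "\<dots> \<in> reg0" by (intro reg0_mult reg0_power reg0_to_fract reg0_prod reg0_GL)
  finally show ?thesis .
qed

lemma ff_0: "ff 0 = 1" by (simp add: ff_def cform_def)

text \<open>Expansion at infinity turns the recursion into the one satisfied by \<open>What\<close>,
  and uniqueness identifies the two solutions. Multiplication by \<open>q - 1\<close> then takes
  differences of the numbers of generators in consecutive degrees.\<close>

theorem log_rec_positive:
  assumes r: "log_rec q_subst ff a" and \<gamma>: "\<gamma> \<noteq> 0"
  shows "\<exists>p :: nat poly. (qvar - 1) * a \<gamma> = to_fract (map_poly of_nat p)"
proof -
  have "log_rec (\<lambda>k x. fls_compose_power x k) Fhat (\<lambda>\<gamma>. ratinf (a \<gamma>))"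
    unfolding log_rec_def
  proof
    fix M
    have "ratinf (of_nat (deg M) * ff M) = ratinf (\<Sum>(A, B)\<in>antidiag M. ff A * (\<Sum>(k, N)\<in>roots B. of_nat (deg N) * q_subst k (a N)))"
      using r by (simp add: log_rec_def)
    also have "\<dots> = (\<Sum>(A, B)\<in>antidiag M. Fhat A * (\<Sum>(k, N)\<in>roots B. of_nat (deg N) * fls_compose_power (ratinf (a N)) k))"
      unfolding ratinf_sum case_prod_unfold ratinf_mult ratinf_ff ratinf_of_nat
      by (intro sum.cong refl arg_cong2[of _ _ _ _ "(*)"]) (auto simp: roots_def ratinf_q_subst)
    finally show "of_nat (deg M) * Fhat M = (\<Sum>(A, B)\<in>antidiag M. Fhat A * (\<Sum>(k, N)\<in>roots B. of_nat (deg N) * fls_compose_power (ratinf (a N)) k))"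
      by (simp add: ratinf_mult ratinf_of_nat ratinf_ff)
  qed
  then have aW: "ratinf (a \<gamma>) = What \<gamma>"
    using log_rec_hat ratinf_ff[of 0] ff_0 \<gamma>
    by (intro log_rec_unique[where S = UNIV and G = Fhat and \<psi> = "\<lambda>k x. fls_compose_power x k" and F = Fhat and a = "\<lambda>\<gamma>. ratinf (a \<gamma>)" and b = What])
      (auto simp: fls_compose_power_id)
  define A where "A = (qvar - 1) * a \<gamma>"
  \<comment> \<open>By \<open>card_W_mono\<close> this subtraction is not truncated, which is where
    positivity comes from.\<close>
  define m where "m j = card (W \<gamma> (j + 1)) - card (W \<gamma> j)" for j
  have nth: "fls_nth (ratinf A) j = of_nat (m j)" for j
  proof -
    have "fls_nth (ratinf A) j = fls_nth (fls_X_inv * What \<gamma>) j - fls_nth (What \<gamma>) j"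
      by (simp add: A_def ratinf_mult ratinf_diff ratinf_qvar aW left_diff_distrib)
    also have "\<dots> = of_nat (card (W \<gamma> (j + 1))) - of_nat (card (W \<gamma> j))"
      by (simp add: fls_X_inv_times_conv_shift What_nth)
    finally show ?thesis using card_W_mono[OF \<gamma>, of j] by (simp add: m_def of_nat_diff)
  qed
  obtain E where E: "\<And>e. e \<ge> E \<Longrightarrow> card (W \<gamma> (e + 1)) \<le> card (W \<gamma> e)" using card_W_eventually by blast
  \<comment> \<open>Large enough for the increments to vanish outside the interval from
    \<open>- L\<close> to \<open>L\<close>: the numbers are constant from \<open>E\<close> on, and
    there are no generators below \<open>e00 \<gamma>\<close>.\<close>
  define L where "L = nat (\<bar>E\<bar> + \<bar>e00 \<gamma>\<bar> + 1)"
  have m0: "m j = 0" if "\<bar>j\<bar> > int L" for j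
  proof (cases "j \<ge> 0")
    case True
    then show ?thesis using E[of j] that by (simp add: m_def L_def)
  next
    case False
    then show ?thesis using card_W_small[of "j + 1" \<gamma>] that by (simp add: m_def L_def)
  qed
  \<comment> \<open>As \<open>X\<close> is \<open>1 / q\<close>, the increment at degree
    \<open>j\<close> is the coefficient of \<open>q ^ (- j)\<close>; the factor \<open>q ^ L\<close>
    clears the denominator.\<close>
  define P :: "rat poly" where "P = (\<Sum>n\<le>2 * L. monom (of_nat (m (int L - int n))) n)"
  have P: "coeff P n = of_nat (m (int L - int n))" for n
  proof -
    have "coeff P n = (if n \<le> 2 * L then of_nat (m (int L - int n)) else 0)"
      by (simp add: P_def coeff_sum)
    then show ?thesis using m0[of "int L - int n"] by auto
  qed
  have "ratinf (qvar ^ L * A) = polyinf P"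
  proof (rule fls_eqI)
    fix i
    have "fls_nth (ratinf (qvar ^ L * A)) i = of_nat (m (i + int L))"
      by (simp add: ratinf_mult ratinf_power ratinf_qvar fls_X_inv_power_mult nth)
    also have "\<dots> = fls_nth (polyinf P) i" using m0[of "i + int L"] by (auto simp: polyinf_nth P add.commute)
    finally show "fls_nth (ratinf (qvar ^ L * A)) i = fls_nth (polyinf P) i" .
  qed
  then have LP: "qvar ^ L * A = to_fract P" using ratinf_inject ratinf_to_fract by metis
  have "a \<gamma> \<in> reg0" by (rule log_rec_reg0[OF r ff_0 reg0_ff \<gamma>])
  then have "A \<in> reg0" unfolding A_def by (intro reg0_mult reg0_diff reg0_1 reg0_to_fract)
  then obtain u b where ub: "coeff b 0 \<noteq> 0" "A = Fract u b" by (auto simp: reg0_def)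
  then have b0: "b \<noteq> 0" by auto
  have mon: "qvar ^ L = to_fract (monom 1 L)"
    by (simp add: to_fract_power[symmetric] monom_altdef)
  have "monom 1 L * u = P * b"
    using LP b0 unfolding mon ub(2) by (simp add: to_fract_def eq_fract)
  then have dvd: "monom 1 L dvd P * b" by (metis dvd_triv_left)
  \<comment> \<open>The denominator \<open>b\<close> does not vanish at the origin, so it is prime
    to \<open>q\<close>, and \<open>q ^ L\<close> divides \<open>P\<close> itself.\<close>
  have P0: "coeff P k = 0" if "k < L" for k
  proof (cases "P = 0")
    case False
    have "order 0 b = 0" using ub(1) by (intro order_0I) (simp add: poly_0_coeff_0)
    then have "order 0 (P * b) = order 0 P" using False b0 by (subst order_mult) auto
    then have "monom 1 L dvd P" using dvd False b0 by (simp add: monom_1_dvd_iff)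
    then show ?thesis using that by (simp add: monom_1_dvd_iff')
  qed simp
  define p :: "nat poly" where "p = (\<Sum>n\<le>L. monom (m (- int n)) n)"
  have "P = monom 1 L * map_poly of_nat p"
  proof (rule poly_eqI)
    fix n
    have "coeff p i = (if i \<le> L then m (- int i) else 0)" for i by (simp add: p_def coeff_sum)
    then have p: "coeff p i = m (- int i)" for i using m0[of "- int i"] by auto
    show "coeff P n = coeff (monom 1 L * map_poly of_nat p) n"
      using P0[of n] by (auto simp: coeff_monom_mult coeff_map_poly P p of_nat_diff)
  qed
  then have "qvar ^ L * A = to_fract (monom 1 L * map_poly of_nat p)" by (simp only: LP)
  then have "qvar ^ L * A = qvar ^ L * to_fract (map_poly of_nat p)" by (simp only: to_fract_mult mon)
  moreover have "qvar ^ L \<noteq> 0" by simp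
  ultimately have "A = to_fract (map_poly of_nat p)" using mult_left_cancel by blast
  then show ?thesis unfolding A_def by blast
qed

end

section \<open>The coefficients of the series of a quiver\<close>

text \<open>The recursion restricts to the image of \<open>\<iota>\<close>: only monomials in
  \<open>G\<close> contribute, and a divisor in \<open>G\<close> of a monomial in the image is in
  the image. The weight \<open>l\<close> becomes the degree there.\<close>

lemma log_rec_Log:
  fixes f :: "('v, rat poly fract) mps" and \<iota> :: "'w mon \<Rightarrow> 'v mon"
    and l :: "'v mon \<Rightarrow> rat poly fract"
  assumes f0: "mps_nth f 0 = 1"
    and l: "\<And>A B. l (A + B) = l A + l B" "\<And>\<gamma>. l (\<iota> \<gamma>) = of_nat (deg \<gamma>)"
    and \<iota>: "\<And>\<alpha> \<beta>. \<iota> (\<alpha> + \<beta>) = \<iota> \<alpha> + \<iota> \<beta>" "inj \<iota>"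
    and G: "supp_in f G" "supp_in (Log f) G" "\<And>k N. N \<in> G \<Longrightarrow> kmul k N \<in> G"
    and range: "\<And>A B \<gamma>. A + B = \<iota> \<gamma> \<Longrightarrow> A \<in> G \<Longrightarrow> A \<in> range \<iota>"
  shows "log_rec q_subst (\<lambda>\<gamma>. mps_nth f (\<iota> \<gamma>)) (\<lambda>\<gamma>. mps_nth (Log f) (\<iota> \<gamma>))"
  unfolding log_rec_def
proof
  fix \<gamma>
  define a where "a = mps_nth (Log f)"
  define g where "g B = (\<Sum>(k, N)\<in>roots B. l N * q_subst k (a N))" for B
  have \<iota>0: "\<iota> 0 = 0" using \<iota>(1)[of 0 0] by (simp add: poly_mapping_eq_iff fun_eq_iff lookup_add)
  have k\<iota>: "kmul k (\<iota> N) = \<iota> (kmul k N)" for k N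
    by (induction k) (auto simp: kmul_Suc \<iota> \<iota>0)
  have \<iota>eq: "\<iota> x = \<iota> y \<longleftrightarrow> x = y" for x y using \<iota>(2) by (auto simp: inj_def)
  have gG: "B \<in> G" if "g B \<noteq> 0" for B
  proof -
    have "\<exists>x\<in>roots B. (case x of (k, N) \<Rightarrow> l N * q_subst k (a N)) \<noteq> 0"
    proof (rule ccontr)
      assume "\<not> ?thesis"
      then have "g B = 0" unfolding g_def by (intro sum.neutral) simp
      then show False using that by simp
    qed
    then obtain k N where kN: "(k, N) \<in> roots B" "l N * q_subst k (a N) \<noteq> 0" by auto
    then have "a N \<noteq> 0" using q_subst_0[of k] by (auto simp: roots_def)
    then have "N \<in> G" using G(2) by (auto simp: supp_in_def a_def)
    then show ?thesis using G(3)[of N k] kN(1) by (auto simp: roots_def)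
  qed
  have g\<iota>: "g (\<iota> \<beta>) = (\<Sum>(k, N)\<in>roots \<beta>. of_nat (deg N) * q_subst k (a (\<iota> N)))" for \<beta>
  proof -
    define X where "X = (\<lambda>(k :: nat, N). (k, \<iota> N)) ` roots \<beta>"
    have sub: "X \<subseteq> roots (\<iota> \<beta>)"
    proof
      fix x assume "x \<in> X"
      then obtain k N where x: "x = (k, \<iota> N)" "k \<ge> 1" "N \<noteq> 0" "kmul k N = \<beta>" by (auto simp: X_def roots_def)
      then show "x \<in> roots (\<iota> \<beta>)" using \<iota>eq[of N 0] by (simp add: roots_def k\<iota> \<iota>0)
    qed
    have "g (\<iota> \<beta>) = (\<Sum>(k, N)\<in>X. l N * q_subst k (a N))"
      unfolding g_def
    proof (rule sum.mono_neutral_right[OF finite_roots sub], intro ballI, clarify)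
      fix k N assume x: "(k, N) \<in> roots (\<iota> \<beta>)" "(k, N) \<notin> X"
      then have k: "k \<ge> 1" "N \<noteq> 0" "kmul k N = \<iota> \<beta>" by (auto simp: roots_def)
      have "a N = 0"
      proof (rule ccontr)
        assume "a N \<noteq> 0"
        then have "N \<in> G" using G(2) by (auto simp: supp_in_def a_def)
        moreover have "N + kmul (k - 1) N = \<iota> \<beta>" using k kmul_Suc[of "k - 1" N] by simp
        ultimately obtain N' where N': "N = \<iota> N'" using range by blast
        then have "kmul k N' = \<beta>" "N' \<noteq> 0" using k k\<iota> \<iota>eq \<iota>0 by auto
        then have "(k, N) \<in> X" using k N' by (auto simp: X_def roots_def intro!: image_eqI[of _ _ "(k, N')"])
        then show False using x by simp
      qed
      then show "l N * q_subst k (a N) = 0" using k by (simp add: q_subst_0)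
    qed
    also have "\<dots> = (\<Sum>(k, N)\<in>roots \<beta>. of_nat (deg N) * q_subst k (a (\<iota> N)))"
      unfolding X_def by (subst sum.reindex) (auto simp: inj_on_def \<iota>eq l(2) intro!: sum.cong)
    finally show ?thesis .
  qed
  define Y where "Y = (\<lambda>(\<alpha>, \<beta>). (\<iota> \<alpha>, \<iota> \<beta>)) ` antidiag \<gamma>"
  have sub: "Y \<subseteq> antidiag (\<iota> \<gamma>)" by (auto simp: Y_def \<iota>(1)[symmetric])
  have "of_nat (deg \<gamma>) * mps_nth f (\<iota> \<gamma>) = (\<Sum>(A, B)\<in>antidiag (\<iota> \<gamma>). mps_nth f A * g B)"
    using Log_recursion[OF f0, of l "\<iota> \<gamma>", OF l(1)] by (simp add: g_def a_def l(2))
  also have "\<dots> = (\<Sum>(A, B)\<in>Y. mps_nth f A * g B)"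
  proof (rule sum.mono_neutral_right[OF finite_antidiag sub], intro ballI, clarify)
    fix A B assume x: "(A, B) \<in> antidiag (\<iota> \<gamma>)" "(A, B) \<notin> Y"
    show "mps_nth f A * g B = 0"
    proof (rule ccontr)
      assume "mps_nth f A * g B \<noteq> 0"
      then have "A \<in> G" "B \<in> G" using G(1) gG by (auto simp: supp_in_def)
      moreover have AB: "A + B = \<iota> \<gamma>" "B + A = \<iota> \<gamma>" using x by (auto simp: add.commute)
      ultimately obtain \<alpha> \<beta> where "A = \<iota> \<alpha>" "B = \<iota> \<beta>" using range by blast
      moreover from this have "\<alpha> + \<beta> = \<gamma>" using AB(1) \<iota>eq by (simp add: \<iota>(1)[symmetric])
      ultimately have "(A, B) \<in> Y" by (auto simp: Y_def intro!: image_eqI[of _ _ "(\<alpha>, \<beta>)"])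
      then show False using x by simp
    qed
  qed
  also have "\<dots> = (\<Sum>(\<alpha>, \<beta>)\<in>antidiag \<gamma>. mps_nth f (\<iota> \<alpha>) * g (\<iota> \<beta>))"
    unfolding Y_def by (subst sum.reindex) (auto simp: inj_on_def \<iota>eq intro!: sum.cong)
  finally show "of_nat (deg \<gamma>) * mps_nth f (\<iota> \<gamma>) = (\<Sum>(A, B)\<in>antidiag \<gamma>. mps_nth f (\<iota> A) *
      (\<Sum>(k, N)\<in>roots B. of_nat (deg N) * q_subst k (mps_nth (Log f) (\<iota> N))))"
    by (simp add: g\<iota> a_def)
qed

text \<open>In the monomial of a tuple of partitions, a part \<open>k\<close> contributes
  \<open>k\<close> to the exponent of a variable \<open>(i, k)\<close>. Dividing by \<open>k\<close>
  makes the weight the total number of parts.\<close>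

definition wt :: "(nat \<times> nat) mon \<Rightarrow> rat poly fract" where
  "wt M = (\<Sum>v\<in>keys M. of_nat (lookup M v) / of_nat (snd v))"

lemma wt_superset: "finite A \<Longrightarrow> keys M \<subseteq> A \<Longrightarrow> wt M = (\<Sum>v\<in>A. of_nat (lookup M v) / of_nat (snd v))"
  unfolding wt_def by (rule sum.mono_neutral_left) (auto simp: in_keys_iff)

lemma wt_add: "wt (A + B) = wt A + wt B"
proof -
  have f: "finite (keys A \<union> keys B)" by simp
  show ?thesis
    using wt_superset[OF f, of "A + B"] wt_superset[OF f, of A] wt_superset[OF f, of B] keys_add[of A B]
    by (simp add: lookup_add sum.distrib add_divide_distrib)
qed

lemma wt_single: "wt (single v c) = of_nat c / of_nat (snd v)"
  by (subst wt_superset[of "{v}"]) auto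

lemma wt_sum: "wt (sum f A) = (\<Sum>a\<in>A. wt (f a))"
proof -
  have "wt 0 = 0" by (simp add: wt_def)
  then show ?thesis by (induction A rule: infinite_finite_induct) (simp_all add: wt_add)
qed

text \<open>The monomial with exponent \<open>k \<gamma>\<^sub>p\<close> at the variable \<open>(i, k)\<close>, where \<open>p\<close> is the position of the
  vertex \<open>v\<^sub>i\<^sup>k\<close>.\<close>

definition pos :: "nat \<Rightarrow> nat \<Rightarrow> nat \<times> nat" where "pos n p = (p mod n, p div n + 1)"

definition iota1 :: "nat \<Rightarrow> nat mon \<Rightarrow> (nat \<times> nat) mon" where
  "iota1 n \<gamma> = (\<Sum>p\<in>keys \<gamma>. single (pos n p) (snd (pos n p) * lookup \<gamma> p))"

definition iota2 :: "nat mon \<Rightarrow> (nat \<times> nat) mon" where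
  "iota2 = pmap (\<lambda>p. (p, 1))"

lemma pos_eq: "n > 0 \<Longrightarrow> pos n p = (i, k) \<longleftrightarrow> i < n \<and> k \<ge> 1 \<and> p = (k - 1) * n + i"
proof
  assume n: "n > 0" and "pos n p = (i, k)"
  then have "i = p mod n" "k = p div n + 1" by (auto simp: pos_def)
  then show "i < n \<and> k \<ge> 1 \<and> p = (k - 1) * n + i" using n by simp
qed (auto simp: pos_def)

lemma lookup_iota1:
  assumes n: "n > 0"
  shows "lookup (iota1 n \<gamma>) (i, k) = (if i < n \<and> k \<ge> 1 then k * lookup \<gamma> ((k - 1) * n + i) else 0)"
proof -
  have "lookup (iota1 n \<gamma>) (i, k) = (\<Sum>p\<in>keys \<gamma>. if pos n p = (i, k) then snd (pos n p) * lookup \<gamma> p else 0)"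
    by (simp add: iota1_def lookup_sum lookup_single when_def)
  also have "\<dots> = (\<Sum>p\<in>keys \<gamma>. if p = (k - 1) * n + i then (if i < n \<and> k \<ge> 1 then k * lookup \<gamma> p else 0) else 0)"
    by (intro sum.cong refl) (use pos_eq[OF n, of _ i k] in \<open>(simp, metis snd_conv)\<close>)
  finally show ?thesis by (auto simp: sum.delta not_in_keys_iff_lookup_eq_zero)
qed

lemma iota1_add: "n > 0 \<Longrightarrow> iota1 n (\<alpha> + \<beta>) = iota1 n \<alpha> + iota1 n \<beta>"
  by (rule poly_mapping_eqI) (auto simp: lookup_iota1 lookup_add distrib_left split: prod.splits simp del: split_paired_All)

lemma lookup_iota2: "lookup (iota2 \<gamma>) (p, k) = (if k = 1 then lookup \<gamma> p else 0)"
proof (cases "k = 1")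
  case True
  then show ?thesis unfolding iota2_def using lookup_pmap_inj[of "\<lambda>p. (p, Suc 0)" p \<gamma>] by (simp add: inj_on_def)
next
  case False
  then have "(p, k) \<notin> keys (iota2 \<gamma>)" using keys_pmap[of "\<lambda>p. (p, Suc 0)" \<gamma>] by (auto simp: iota2_def)
  then show ?thesis using False by (simp add: in_keys_iff)
qed

lemma inj_iota1:
  assumes n: "n > 0" shows "inj (iota1 n)"
proof (rule injI, rule poly_mapping_eqI)
  fix \<alpha> \<beta> p assume e: "iota1 n \<alpha> = iota1 n \<beta>"
  have "lookup (iota1 n \<gamma>) (p mod n, p div n + 1) = (p div n + 1) * lookup \<gamma> p" for \<gamma>
    using n by (simp add: lookup_iota1)
  then have "(p div n + 1) * lookup \<alpha> p = (p div n + 1) * lookup \<beta> p" using e by metis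
  then show "lookup \<alpha> p = lookup \<beta> p" by (simp only: mult_cancel1) simp
qed

lemma kac_mons_range_iota1:
  assumes n: "n > 0" and M: "M \<in> kac_mons n" shows "M \<in> range (iota1 n)"
proof -
  define f where "f p = lookup M (pos n p) div snd (pos n p)" for p
  have inj: "inj (pos n)"
  proof (rule injI)
    fix x y assume "pos n x = pos n y"
    moreover obtain i k where "pos n x = (i, k)" by fastforce
    ultimately show "x = y" using pos_eq[OF n, of x i k] pos_eq[OF n, of y i k] by simp
  qed
  have "{p. f p \<noteq> 0} \<subseteq> pos n -` keys M"
  proof
    fix p assume "p \<in> {p. f p \<noteq> 0}"
    then have "lookup M (pos n p) \<noteq> 0" by (auto simp: f_def simp del: lookup_not_eq_zero_eq_in_keys intro!: gr0I)
    then show "p \<in> pos n -` keys M" by (simp add: in_keys_iff)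
  qed
  moreover have "finite (pos n -` keys M)" using inj by (intro finite_vimageI) auto
  ultimately have "finite {p. f p \<noteq> 0}" by (rule finite_subset)
  then have l: "lookup (Abs_poly_mapping f) p = f p" for p by simp
  have "M = iota1 n (Abs_poly_mapping f)"
  proof (rule poly_mapping_eqI)
    fix v :: "nat \<times> nat"
    obtain i k where v: "v = (i, k)" by fastforce
    have d: "k dvd lookup M (i, k)" "lookup M (i, k) \<noteq> 0 \<Longrightarrow> i < n" using M by (auto simp: kac_mons_def)
    show "lookup M v = lookup (iota1 n (Abs_poly_mapping f)) v"
    proof (cases "i < n \<and> k \<ge> 1")
      case True
      then have "pos n ((k - 1) * n + i) = (i, k)" using pos_eq[OF n] by blast
      then show ?thesis using True d(1) by (simp add: v lookup_iota1[OF n] l f_def)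
    next
      case False
      \<comment> \<open>For \<open>k = 0\<close>, divisibility by \<open>k\<close> says that the
        exponent is zero.\<close>
      then have "lookup M (i, k) = 0" using d by (cases "k = 0") auto
      then show ?thesis using False by (simp only: v lookup_iota1[OF n] if_False)
    qed
  qed
  then show ?thesis by blast
qed

lemma kmul_kac_mons: "N \<in> kac_mons n \<Longrightarrow> kmul k N \<in> kac_mons n"
  by (simp add: kmul_def kac_mons_map)

lemma log_rec_iota1:
  assumes n: "dim_row C = n" "n > 0"
  shows "log_rec q_subst (\<lambda>\<gamma>. mps_nth (Q_series C) (iota1 n \<gamma>)) (\<lambda>\<gamma>. mps_nth (Log (Q_series C)) (iota1 n \<gamma>))"
proof (rule log_rec_Log[where l = wt and G = "kac_mons n"])
  show "wt (iota1 n \<gamma>) = of_nat (deg \<gamma>)" for \<gamma>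
  proof -
    have "of_nat (snd (pos n p)) \<noteq> (0 :: rat poly fract)" for p
      by (rule fract_of_nat_neq_0) (simp add: pos_def)
    then show ?thesis by (simp add: iota1_def wt_sum wt_single deg_def)
  qed
  show "A \<in> range (iota1 n)" if "A \<in> kac_mons n" for A
    using kac_mons_range_iota1[OF n(2) that] .
qed (use n supp_in_Q_series[of C] supp_in_Log_Q[of C] in
    \<open>auto simp: wt_add mps_nth_Q_series_0 iota1_add inj_iota1 kmul_kac_mons\<close>)

text \<open>The image of \<open>iota2\<close> consists of all monomials in the variables
  \<open>(p, 1)\<close> and is therefore closed under divisors.\<close>

lemma log_rec_iota2:
  "log_rec q_subst (\<lambda>\<gamma>. mps_nth (Q_series C) (iota2 \<gamma>)) (\<lambda>\<gamma>. mps_nth (Log (Q_series C)) (iota2 \<gamma>))"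
proof (rule log_rec_Log[where l = wt and G = "kac_mons (dim_row C)"])
  show "wt (iota2 \<gamma>) = of_nat (deg \<gamma>)" for \<gamma>
    by (simp add: iota2_def pmap_def wt_sum wt_single deg_def)
  show "iota2 (\<alpha> + \<beta>) = iota2 \<alpha> + iota2 \<beta>" for \<alpha> \<beta> by (simp add: iota2_def pmap_add)
  show "inj iota2"
    by (rule injI, rule poly_mapping_eqI) (metis lookup_iota2)
  show "A \<in> range iota2" if AB: "A + B = iota2 \<gamma>" for A B \<gamma>
  proof -
    have A: "lookup A (p, k) = 0" if "k \<noteq> 1" for p k
      using arg_cong[OF AB, of "\<lambda>M. lookup M (p, k)"] that by (simp add: lookup_add lookup_iota2)
    have "finite ((\<lambda>p. (p, 1)) -` keys A)" by (intro finite_vimageI) (auto simp: inj_on_def)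
    then have "finite {p. lookup A (p, Suc 0) \<noteq> 0}" by (simp add: vimage_def in_keys_iff)
    then have l: "lookup (Abs_poly_mapping (\<lambda>p. lookup A (p, Suc 0))) p = lookup A (p, Suc 0)" for p by simp
    have "A = iota2 (Abs_poly_mapping (\<lambda>p. lookup A (p, Suc 0)))"
    proof (rule poly_mapping_eqI)
      fix v :: "nat \<times> nat"
      obtain p k where v: "v = (p, k)" by fastforce
      show "lookup A v = lookup (iota2 (Abs_poly_mapping (\<lambda>p. lookup A (p, Suc 0)))) v"
        using A[of k p] by (cases "k = 1") (auto simp: v lookup_iota2 l)
    qed
    then show ?thesis by blast
  qed
qed (use supp_in_Q_series[of C] supp_in_Log_Q[of C] in
    \<open>auto simp: wt_add mps_nth_Q_series_0 kmul_kac_mons\<close>)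

lemma Q_series_nth:
  assumes "as \<in> vec_tuples (dim_row C)"
  shows "mps_nth (Q_series C) (X_mon (dim_row C) as) = Q_coeff C as"
proof -
  define n where "n = dim_row C"
  have "{as'. as' \<in> vec_tuples n \<and> X_mon n as' = X_mon n as} = {as}"
    using inj_onD[OF inj_on_X_mon[of n]] assms by (auto simp: n_def)
  moreover have "X_mon n as \<noteq> 0"
  proof
    assume z: "X_mon n as = 0"
    have l: "last as = as ! (length as - 1)" "length as \<ge> 1"
      using assms by (auto simp: vec_tuples_def last_conv_nth Suc_le_eq)
    have "last as $ i = 0" if "i < n" for i
      using arg_cong[OF z, of "\<lambda>M. lookup M (i, length as)"] that l by (auto simp: lookup_X_mon)
    moreover have "last as \<in> carrier_vec n" using assms by (auto simp: vec_tuples_def n_def)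
    ultimately have "last as = 0\<^sub>v n" by (intro eq_vecI) auto
    then show False using assms by (auto simp: vec_tuples_def n_def)
  qed
  ultimately show ?thesis by (simp add: Q_series_def plus_mps.rep_eq one_mps.rep_eq n_def[symmetric])
qed

text \<open>The indices beyond the quiver are treated as isolated vertices with one loop.\<close>

definition cc_of :: "nat mat \<Rightarrow> nat \<Rightarrow> nat \<Rightarrow> nat" where
  "cc_of C i j = (if i < dim_row C \<and> j < dim_row C then C $$ (i, j) else if i = j then 1 else 0)"

lemma loop_quiver_cc_of: "enough_loops C \<Longrightarrow> loop_quiver (cc_of C)"
  by unfold_locales (auto simp: cc_of_def enough_loops_def)

lemma cform_superset:
  assumes "loop_quiver cc" "keys \<gamma> \<subseteq> {..<N}"
  shows "loop_quiver.cform cc \<gamma> = (\<Sum>i<N. \<Sum>j<N. lookup \<gamma> i * lookup \<gamma> j * cc i j)"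
proof -
  interpret loop_quiver cc by fact
  have "cform \<gamma> = (\<Sum>i<N. \<Sum>j\<in>keys \<gamma>. lookup \<gamma> i * lookup \<gamma> j * cc i j)"
    unfolding cform_def using assms(2) by (intro sum.mono_neutral_left) (auto simp: in_keys_iff)
  also have "\<dots> = (\<Sum>i<N. \<Sum>j<N. lookup \<gamma> i * lookup \<gamma> j * cc i j)"
    using assms(2) by (intro sum.cong refl sum.mono_neutral_left) (auto simp: in_keys_iff)
  finally show ?thesis .
qed

lemma ff_superset:
  assumes "loop_quiver cc" "keys \<gamma> \<subseteq> {..<N}"
  shows "loop_quiver.ff cc \<gamma> = qvar ^ (\<Sum>i<N. \<Sum>j<N. lookup \<gamma> i * lookup \<gamma> j * cc i j) /
    (\<Prod>i<N. \<Prod>s<lookup \<gamma> i. qvar ^ lookup \<gamma> i - qvar ^ s)"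
proof -
  interpret loop_quiver cc by fact
  have "(\<Prod>i\<in>keys \<gamma>. \<Prod>s<lookup \<gamma> i. qvar ^ lookup \<gamma> i - qvar ^ s) = (\<Prod>i<N. \<Prod>s<lookup \<gamma> i. qvar ^ lookup \<gamma> i - qvar ^ s)"
    using assms(2) by (intro prod.mono_neutral_left) (auto simp: in_keys_iff)
  then show ?thesis by (simp add: ff_def cform_superset[OF assms])
qed

text \<open>A tuple of length one has \<open>\<beta> = \<alpha>\<close>, so the Euler forms cancel
  and \<open>card_R C \<alpha> / card_GL \<alpha>\<close> remains.\<close>

lemma Q_series_iota2:
  assumes C: "C \<in> carrier_mat N N" "enough_loops C" and \<gamma>: "keys \<gamma> \<subseteq> {..<N}"
  shows "mps_nth (Q_series C) (iota2 \<gamma>) = loop_quiver.ff (cc_of C) \<gamma>"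
proof (cases "\<gamma> = 0")
  case True
  have "loop_quiver.ff (cc_of C) 0 = 1" by (rule loop_quiver.ff_0[OF loop_quiver_cc_of[OF C(2)]])
  then show ?thesis using True by (simp add: iota2_def mps_nth_Q_series_0)
next
  case False
  define \<alpha> where "\<alpha> = vec N (lookup \<gamma>)"
  have dim: "dim_row C = N" "dim_col C = N" using C by auto
  have "\<alpha> \<noteq> 0\<^sub>v N"
  proof
    assume "\<alpha> = 0\<^sub>v N"
    then have "lookup \<gamma> p = 0" for p
      using \<gamma> by (cases "p < N") (auto simp: \<alpha>_def in_keys_iff subset_iff dest: arg_cong[of _ _ "\<lambda>v :: nat vec. v $ p"])
    then show False using False by (auto intro: poly_mapping_eqI)
  qed
  then have as: "[\<alpha>] \<in> vec_tuples (dim_row C)" by (simp add: vec_tuples_def dim \<alpha>_def)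
  have X: "X_mon N [\<alpha>] = iota2 \<gamma>"
  proof (rule poly_mapping_eqI)
    fix v :: "nat \<times> nat"
    obtain p k where v: "v = (p, k)" by fastforce
    have "p < N \<or> lookup \<gamma> p = 0" using \<gamma> by (auto simp: in_keys_iff subset_iff)
    then show "lookup (X_mon N [\<alpha>]) v = lookup (iota2 \<gamma>) v"
      by (cases "k = 1") (auto simp: v lookup_X_mon lookup_iota2 \<alpha>_def)
  qed
  have "tail_sum N [\<alpha>] 1 = \<alpha>" by (auto simp: tail_sum_def \<alpha>_def)
  then have "Q_coeff C [\<alpha>] = card_R C \<alpha> / card_GL \<alpha>"
    by (simp add: Q_coeff_def dim)
  also have "\<alpha> \<bullet> (C *\<^sub>v \<alpha>) = (\<Sum>i<N. \<Sum>j<N. lookup \<gamma> i * lookup \<gamma> j * cc_of C i j)"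
    by (simp add: scalar_prod_def \<alpha>_def dim cc_of_def atLeast0LessThan sum_distrib_left mult_ac)
  then have "card_R C \<alpha> / card_GL \<alpha> = loop_quiver.ff (cc_of C) \<gamma>"
    unfolding ff_superset[OF loop_quiver_cc_of[OF C(2)] \<gamma>] card_R_def card_GL_def by (simp add: \<alpha>_def)
  finally show ?thesis using Q_series_nth[OF as] by (simp add: dim X)
qed

section \<open>The quiver \<open>\<Gamma>\<^sub>m\<close>\<close>

text \<open>The pair \<open>(l, t)\<close> is counted once for each \<open>k\<close> up to
  \<open>min l t\<close>; this is the origin of the minimum in \<open>bform\<close>.\<close>

lemma sum_tails:
  fixes f :: "nat \<Rightarrow> nat \<Rightarrow> 'r::comm_ring_1"
  shows "(\<Sum>k=1..m. \<Sum>l=k..m. \<Sum>t=k..m. f l t) = (\<Sum>l=1..m. \<Sum>t=1..m. of_nat (min l t) * f l t)"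
proof -
  have "(\<Sum>k=1..m. \<Sum>l=k..m. \<Sum>t=k..m. f l t) =
      (\<Sum>k=1..m. \<Sum>l=1..m. \<Sum>t=1..m. if k \<le> min l t then f l t else 0)"
  proof (rule sum.cong[OF refl])
    fix k assume "k \<in> {1..m}"
    then have k: "{k..m} = {l \<in> {1..m}. k \<le> l}" by auto
    have "(\<Sum>l=k..m. \<Sum>t=k..m. f l t) = (\<Sum>l=1..m. if k \<le> l then \<Sum>t=1..m. if k \<le> t then f l t else 0 else 0)"
      unfolding k by (simp only: sum.inter_filter finite_atLeastAtMost)
    also have "\<dots> = (\<Sum>l=1..m. \<Sum>t=1..m. if k \<le> min l t then f l t else 0)"
      by (intro sum.cong refl) auto
    finally show "(\<Sum>l=k..m. \<Sum>t=k..m. f l t) = (\<Sum>l=1..m. \<Sum>t=1..m. if k \<le> min l t then f l t else 0)" .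
  qed
  also have "\<dots> = (\<Sum>l=1..m. \<Sum>t=1..m. \<Sum>k=1..m. if k \<le> min l t then f l t else 0)"
    by (subst sum.swap) (rule sum.cong[OF refl], rule sum.swap)
  also have "\<dots> = (\<Sum>l=1..m. \<Sum>t=1..m. of_nat (min l t) * f l t)"
  proof (intro sum.cong refl)
    fix l t assume "l \<in> {1..m}" "t \<in> {1..m}"
    then have "{k \<in> {1..m}. k \<le> min l t} = {1..min l t}" by auto
    then show "(\<Sum>k=1..m. if k \<le> min l t then f l t else 0) = of_nat (min l t) * f l t"
      by (simp add: sum.inter_filter[symmetric] del: min_less_iff_conj min.bounded_iff)
  qed
  finally show ?thesis .
qed

text \<open>A matrix of the quadratic form behind \<open>Gamma\<close>, before terms with equal
  monomials are collected.\<close>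

definition bform :: "(nat \<Rightarrow> nat \<Rightarrow> int) \<Rightarrow> nat \<times> nat \<Rightarrow> nat \<times> nat \<Rightarrow> int" where
  "bform D x y = (if x = y then 1 else 0) + int (min (snd x) (snd y)) * D (fst x) (fst y)"

lemma tail_form:
  fixes v :: "nat \<times> nat \<Rightarrow> 'r::comm_ring_1"
  shows "(\<Sum>k=1..m. (\<Sum>i<n. v (i, k) * v (i, k)) +
      (\<Sum>i<n. \<Sum>j<n. (\<Sum>l=k..m. v (i, l)) * (of_int (D i j) * (\<Sum>t=k..m. v (j, t))))) =
    (\<Sum>x\<in>{..<n} \<times> {1..m}. \<Sum>y\<in>{..<n} \<times> {1..m}. of_int (bform D x y) * (v x * v y))"
    (is "?L = ?R")
proof -
  define P where "P = {..<n} \<times> {1..m}"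
  have fP: "finite P" by (simp add: P_def)
  have SP: "sum g P = (\<Sum>i<n. \<Sum>l=1..m. g (i, l))" for g :: "_ \<Rightarrow> 'r"
    by (simp add: P_def sum.cartesian_product)
  have "(\<Sum>x\<in>P. \<Sum>y\<in>P. of_int (bform D x y) * (v x * v y)) =
      (\<Sum>x\<in>P. \<Sum>y\<in>P. if x = y then v x * v y else 0) +
      (\<Sum>x\<in>P. \<Sum>y\<in>P. of_nat (min (snd x) (snd y)) * (v x * (of_int (D (fst x) (fst y)) * v y)))"
    unfolding sum.distrib[symmetric]
    by (intro sum.cong refl) (auto simp: bform_def algebra_simps)
  also have "(\<Sum>x\<in>P. \<Sum>y\<in>P. if x = y then v x * v y else 0) = (\<Sum>k=1..m. \<Sum>i<n. v (i, k) * v (i, k))"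
    by (subst sum.swap[of _ "{..<n}"]) (simp add: fP, simp add: P_def sum.cartesian_product case_prod_unfold)
  also have "(\<Sum>x\<in>P. \<Sum>y\<in>P. of_nat (min (snd x) (snd y)) * (v x * (of_int (D (fst x) (fst y)) * v y))) =
      (\<Sum>i<n. \<Sum>l=1..m. \<Sum>j<n. \<Sum>t=1..m. of_nat (min l t) * (v (i, l) * (of_int (D i j) * v (j, t))))"
    by (simp only: SP fst_conv snd_conv)
  also have "\<dots> = (\<Sum>i<n. \<Sum>j<n. \<Sum>l=1..m. \<Sum>t=1..m. of_nat (min l t) * (v (i, l) * (of_int (D i j) * v (j, t))))"
    by (intro sum.cong refl sum.swap)
  also have "\<dots> = (\<Sum>i<n. \<Sum>j<n. \<Sum>k=1..m. (\<Sum>l=k..m. v (i, l)) * (of_int (D i j) * (\<Sum>t=k..m. v (j, t))))"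
    unfolding sum_tails[symmetric] by (simp only: sum_distrib_right) (simp only: sum_distrib_left)
  also have "\<dots> = (\<Sum>k=1..m. \<Sum>i<n. \<Sum>j<n. (\<Sum>l=k..m. v (i, l)) * (of_int (D i j) * (\<Sum>t=k..m. v (j, t))))"
    by (subst sum.swap, subst sum.swap[of _ "{1..m}" "{..<n}"], simp)
  finally show ?thesis by (simp add: P_def sum.distrib)
qed

text \<open>The matrix \<open>C - I\<close> over the integers, that is, minus the matrix of the
  Euler form.\<close>

definition euler_defect :: "nat mat \<Rightarrow> nat \<Rightarrow> nat \<Rightarrow> int" where
  "euler_defect C i j = int (C $$ (i, j)) - (if i = j then 1 else 0)"

lemma single_add_eq_iff:
  "single x (1::nat) + single y 1 = single a 1 + single b 1 \<longleftrightarrow> (x, y) \<in> {(a, b), (b, a)}"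
proof
  assume e: "single x (1::nat) + single y 1 = single a 1 + single b 1"
  have l: "(if x = z then 1 else 0) + (if y = z then 1 else 0) = (if a = z then 1 else 0) + (if b = z then (1::nat) else 0)" for z
    using arg_cong[OF e, of "\<lambda>M. lookup M z"] by (simp only: lookup_add lookup_single when_def)
  show "(x, y) \<in> {(a, b), (b, a)}"
  proof (cases "x = a")
    case True
    then show ?thesis using l[of y] by (cases "b = y") auto
  next
    case False
    then have "b = x" using l[of x] by (cases "b = x") auto
    then show ?thesis using False l[of a] by (cases "y = a") auto
  qed
qed (auto simp: add.commute)

text \<open>Two ordered pairs give the monomial of \<open>a\<close> and \<open>b\<close>. For
  \<open>a = b\<close> the set collapses to one element, so that a diagonal entry is counted
  once.\<close>

lemma lookup_Gamma_form:
  assumes C: "C \<in> carrier_mat n n" and ab: "a \<in> {..<n} \<times> {1..m}" "b \<in> {..<n} \<times> {1..m}"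
  shows "lookup (Gamma_form m C) (single a 1 + single b 1) =
    (\<Sum>(x, y)\<in>{(a, b), (b, a)}. bform (euler_defect C) x y)"
proof -
  define P where "P = {..<n} \<times> {1..m}"
  define v where "v x = var (fst x) (snd x)" for x
  have dim: "dim_row C = n" "dim_col C = n" using C by auto
  have "Gamma_form m C = (\<Sum>k=1..m. (\<Sum>i<n. v (i, k) * v (i, k)) +
      (\<Sum>i<n. \<Sum>j<n. (\<Sum>l=k..m. v (i, l)) * (of_int (euler_defect C i j) * (\<Sum>t=k..m. v (j, t)))))"
    unfolding Gamma_form_def Let_def
    by (intro sum.cong refl) (simp add: dim scalar_prod_def v_def atLeast0LessThan sum_distrib_left euler_defect_def)
  also have "\<dots> = (\<Sum>x\<in>P. \<Sum>y\<in>P. of_int (bform (euler_defect C) x y) * (v x * v y))"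
    unfolding P_def by (rule tail_form)
  also have "\<dots> = (\<Sum>(x, y)\<in>P \<times> P. single (single x 1 + single y 1) (bform (euler_defect C) x y))"
    unfolding sum.cartesian_product
    by (intro sum.cong refl) (auto simp: v_def var_def mult_single single_of_int[symmetric])
  finally have "lookup (Gamma_form m C) (single a 1 + single b 1) =
      (\<Sum>z\<in>P \<times> P. if z \<in> {(a, b), (b, a)} then bform (euler_defect C) (fst z) (snd z) else 0)"
    by (simp add: lookup_sum case_prod_unfold lookup_single when_def single_add_eq_iff[simplified] prod_eq_iff)
  also have "\<dots> = (\<Sum>z\<in>(P \<times> P) \<inter> {(a, b), (b, a)}. bform (euler_defect C) (fst z) (snd z))"
    by (rule sum.inter_restrict[symmetric]) (simp add: P_def)
  also have "(P \<times> P) \<inter> {(a, b), (b, a)} = {(a, b), (b, a)}" using ab by (auto simp: P_def)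
  finally show ?thesis by (simp only: case_prod_unfold)
qed

text \<open>This makes the conversion by \<open>nat\<close> in \<open>Gamma\<close> faithful, and
  its diagonal case supplies the loops of \<open>Gamma m C\<close>.\<close>

lemma bform_nonneg:
  assumes "C \<in> carrier_mat n n" "enough_loops C" "x \<in> {..<n} \<times> {1..m}" "y \<in> {..<n} \<times> {1..m}"
  shows "bform (euler_defect C) x y \<ge> (if x = y then 1 else 0)"
proof -
  have "euler_defect C (fst x) (fst y) \<ge> 0"
    using assms unfolding euler_defect_def enough_loops_def by (cases x; cases y) (auto dest: spec[of _ "fst x"])
  then show ?thesis by (simp add: bform_def)
qed

lemma pos_mem: "p < m * n \<Longrightarrow> pos n p \<in> {..<n} \<times> {1..m}"
  by (cases "n = 0") (auto simp: pos_def less_mult_imp_div_less Suc_le_eq)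

lemma Gamma_index:
  assumes C: "C \<in> carrier_mat n n" "enough_loops C" and p: "p < m * n" "p' < m * n"
  shows "int (Gamma m C $$ (p, p')) = (if p \<le> p' then
    \<Sum>(x, y)\<in>{(pos n p, pos n p'), (pos n p', pos n p)}. bform (euler_defect C) x y else 0)"
proof -
  have dim: "dim_row C = n" using C by auto
  note P = pos_mem[OF p(1)] pos_mem[OF p(2)]
  have "bform (euler_defect C) (pos n p) (pos n p') \<ge> 0" "bform (euler_defect C) (pos n p') (pos n p) \<ge> 0"
    using bform_nonneg[OF C P] bform_nonneg[OF C P(2,1)] by (auto split: if_splits)
  then have "(\<Sum>(x, y)\<in>{(pos n p, pos n p'), (pos n p', pos n p)}. bform (euler_defect C) x y) \<ge> 0"
    by (intro sum_nonneg) auto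
  then show ?thesis
    using p lookup_Gamma_form[OF C(1) P] by (simp only: Gamma_def Let_def dim index_mat prod.case pos_def split: if_split) auto
qed

lemma Gamma_carrier: "C \<in> carrier_mat n n \<Longrightarrow> Gamma m C \<in> carrier_mat (m * n) (m * n)"
  by (auto simp: Gamma_def Let_def)

lemma enough_loops_Gamma:
  assumes C: "C \<in> carrier_mat n n" "enough_loops C"
  shows "enough_loops (Gamma m C)"
  unfolding enough_loops_def
proof (intro allI impI)
  fix p assume "p < dim_row (Gamma m C)"
  then have p: "p < m * n" using Gamma_carrier[OF C(1), of m] by simp
  have "int (Gamma m C $$ (p, p)) \<ge> 1"
    using Gamma_index[OF C p p] bform_nonneg[OF C pos_mem[OF p] pos_mem[OF p]] by simp
  then show "Gamma m C $$ (p, p) \<ge> 1" by simp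
qed

text \<open>A quadratic form does not change when the entries below the diagonal of its matrix are
  moved above it.\<close>

lemma sum_symmetrize:
  fixes w :: "nat \<Rightarrow> int"
  shows "(\<Sum>p<N. \<Sum>p'<N. w p * w p' * (if p \<le> p' then (if p = p' then B p p else B p p' + B p' p) else 0)) =
    (\<Sum>p<N. \<Sum>p'<N. w p * w p' * B p p')"
proof -
  have "(\<Sum>p<N. \<Sum>p'<N. w p * w p' * (if p \<le> p' then (if p = p' then B p p else B p p' + B p' p) else 0)) =
      (\<Sum>p<N. \<Sum>p'<N. if p \<le> p' then w p * w p' * B p p' else 0) +
      (\<Sum>p<N. \<Sum>p'<N. if p < p' then w p * w p' * B p' p else 0)"
    unfolding sum.distrib[symmetric] by (intro sum.cong refl) (auto simp: distrib_left)
  also have "(\<Sum>p<N. \<Sum>p'<N. if p < p' then w p * w p' * B p' p else 0) =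
      (\<Sum>p<N. \<Sum>p'<N. if p' < p then w p * w p' * B p p' else 0)"
    by (subst sum.swap, intro sum.cong refl) (simp add: mult_ac)
  finally show ?thesis
    unfolding sum.distrib[symmetric] by (auto intro!: sum.cong)
qed

lemma position_less:
  assumes "i < n" "1 \<le> k" "k \<le> m" shows "(k - 1) * n + i < m * (n :: nat)"
proof -
  have "(k - 1) * n + i < (k - 1) * n + n" using assms(1) by simp
  also have "\<dots> = k * n" using assms(2) by (cases k) auto
  also have "\<dots> \<le> m * n" using assms(3) by simp
  finally show ?thesis .
qed

lemma bij_betw_pos: "n > 0 \<Longrightarrow> bij_betw (pos n) {..<m * n} ({..<n} \<times> {1..m})"
proof (rule bij_betw_byWitness[where f' = "\<lambda>(i, k). (k - 1) * n + i"])
  assume n: "n > 0"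
  show "(\<lambda>(i, k). (k - 1) * n + i) ` ({..<n} \<times> {1..m}) \<subseteq> {..<m * n}"
    using position_less[of _ n _ m] by auto
qed (auto simp: pos_def less_mult_imp_div_less Suc_le_eq intro: pos_mem)

text \<open>By \<open>sum_symmetrize\<close> the triangular matrix of arrows and the full matrix
  \<open>bform\<close> give the same quadratic form, which \<open>tail_form\<close> turns back into
  sums over tails.\<close>

lemma Gamma_quadratic_form:
  assumes C: "C \<in> carrier_mat n n" "enough_loops C" and n: "n > 0"
    and v: "\<And>p. p < m * n \<Longrightarrow> v (pos n p) = w p"
  shows "int (\<Sum>p<m * n. \<Sum>p'<m * n. w p * w p' * cc_of (Gamma m C) p p') =
    (\<Sum>k=1..m. (\<Sum>i<n. int (v (i, k)) * int (v (i, k))) + (\<Sum>i<n. \<Sum>j<n.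
      (\<Sum>l=k..m. int (v (i, l))) * (euler_defect C i j * (\<Sum>t=k..m. int (v (j, t))))))"
proof -
  define B where "B p p' = bform (euler_defect C) (pos n p) (pos n p')" for p p'
  have dim: "dim_row (Gamma m C) = m * n" using Gamma_carrier[OF C(1), of m] by simp
  have inj: "pos n p = pos n p' \<longleftrightarrow> p = p'" if "p < m * n" "p' < m * n" for p p'
    using bij_betw_pos[OF n, of m] that by (auto simp: bij_betw_def inj_on_def)
  have "int (\<Sum>p<m * n. \<Sum>p'<m * n. w p * w p' * cc_of (Gamma m C) p p') =
      (\<Sum>p<m * n. \<Sum>p'<m * n. int (w p) * int (w p') * (if p \<le> p' then (if p = p' then B p p else B p p' + B p' p) else 0))"
    unfolding of_nat_sum of_nat_mult
    by (intro sum.cong refl) (simp add: cc_of_def dim Gamma_index[OF C] B_def inj)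
  also have "\<dots> = (\<Sum>p<m * n. \<Sum>p'<m * n. int (w p) * int (w p') * B p p')" by (rule sum_symmetrize)
  also have "\<dots> = (\<Sum>p<m * n. \<Sum>p'<m * n. int (v (pos n p)) * int (v (pos n p')) * bform (euler_defect C) (pos n p) (pos n p'))"
    by (simp add: B_def v)
  also have "\<dots> = (\<Sum>p<m * n. \<Sum>y\<in>{..<n} \<times> {1..m}. int (v (pos n p)) * int (v y) * bform (euler_defect C) (pos n p) y)"
    by (intro sum.cong refl sum.reindex_bij_betw[OF bij_betw_pos[OF n]])
  also have "\<dots> = (\<Sum>x\<in>{..<n} \<times> {1..m}. \<Sum>y\<in>{..<n} \<times> {1..m}. int (v x) * int (v y) * bform (euler_defect C) x y)"
    by (rule sum.reindex_bij_betw[OF bij_betw_pos[OF n]])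
  also have "\<dots> = (\<Sum>x\<in>{..<n} \<times> {1..m}. \<Sum>y\<in>{..<n} \<times> {1..m}. of_int (bform (euler_defect C) x y) * (int (v x) * int (v y)))"
    by (intro sum.cong refl) simp
  also note tail_form[symmetric]
  finally show ?thesis by simp
qed

section \<open>Euler forms in the coefficients of the series\<close>

lemma qvar_neq_0: "qvar \<noteq> 0"
  by simp

lemma euler_form_defect:
  assumes C: "C \<in> carrier_mat n n" and v: "v \<in> carrier_vec n"
  shows "euler_form C (map_vec int v) (map_vec int v) = - (\<Sum>i<n. \<Sum>j<n. int (v $ i) * (euler_defect C i j * int (v $ j)))"
    (is "_ = - ?U")
    and "int (v \<bullet> (C *\<^sub>v v)) = (\<Sum>i<n. int (v $ i) * int (v $ i)) +
      (\<Sum>i<n. \<Sum>j<n. int (v $ i) * (euler_defect C i j * int (v $ j)))"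
proof -
  have dim: "dim_row C = n" "dim_col C = n" "dim_vec v = n" using C v by auto
  have "euler_form C (map_vec int v) (map_vec int v) =
      (\<Sum>i<n. \<Sum>j<n. int (v $ i) * (((if i = j then 1 else 0) - int (C $$ (i, j))) * int (v $ j)))"
    by (simp add: euler_form_def scalar_prod_def dim atLeast0LessThan sum_distrib_left)
  also have "\<dots> = - ?U"
    unfolding sum_negf[symmetric] by (intro sum.cong refl) (simp add: euler_defect_def algebra_simps)
  finally show "euler_form C (map_vec int v) (map_vec int v) = - ?U" .
  have "int (v \<bullet> (C *\<^sub>v v)) = (\<Sum>i<n. \<Sum>j<n. int (v $ i) * (int (C $$ (i, j)) * int (v $ j)))"
    by (simp add: scalar_prod_def dim atLeast0LessThan sum_distrib_left)
  also have "\<dots> = (\<Sum>i<n. \<Sum>j<n. (if i = j then int (v $ i) * int (v $ j) else 0) + int (v $ i) * (euler_defect C i j * int (v $ j)))"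
    by (intro sum.cong refl) (auto simp: euler_defect_def algebra_simps)
  finally show "int (v \<bullet> (C *\<^sub>v v)) = (\<Sum>i<n. int (v $ i) * int (v $ i)) + ?U"
    by (simp add: sum.distrib sum.delta)
qed

lemma powi_sum: "x \<noteq> 0 \<Longrightarrow> x powi (sum f A) = (\<Prod>a\<in>A. x powi f a)" for x :: "'a::field"
  by (induction A rule: infinite_finite_induct) (auto simp: power_int_add)

text \<open>The Euler form of \<open>\<alpha>\<close> cancels the exponent of \<open>card_R\<close>
  up to the sum of squares, and the Euler form of \<open>\<beta>\<close> in the denominator
  contributes the form of \<open>C - I\<close>. What remains is one summand of the form defining
  \<open>Gamma\<close>.\<close>

lemma Q_factor:
  assumes C: "C \<in> carrier_mat n n" and v: "\<alpha> \<in> carrier_vec n" "\<beta> \<in> carrier_vec n"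
  shows "qvar powi euler_form C (map_vec int \<alpha>) (map_vec int \<alpha>) /
        qvar powi euler_form C (map_vec int \<beta>) (map_vec int \<beta>) * (card_R C \<alpha> / card_GL \<alpha>) =
    qvar powi ((\<Sum>i<n. int (\<alpha> $ i) * int (\<alpha> $ i)) +
      (\<Sum>i<n. \<Sum>j<n. int (\<beta> $ i) * (euler_defect C i j * int (\<beta> $ j)))) / card_GL \<alpha>"
proof -
  define U where "U v = (\<Sum>i<n. \<Sum>j<n. int (v $ i) * (euler_defect C i j * int (v $ j)))" for v :: "nat vec"
  define T where "T = (\<Sum>i<n. int (\<alpha> $ i) * int (\<alpha> $ i))"
  have R: "card_R C \<alpha> = qvar powi (T + U \<alpha>)"
    unfolding card_R_def T_def U_def euler_form_defect(2)[OF C v(1), symmetric] by simp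
  have "qvar powi (- U \<alpha>) / qvar powi (- U \<beta>) * qvar powi (T + U \<alpha>) = qvar powi (- U \<alpha> - - U \<beta> + (T + U \<alpha>))"
    by (simp only: power_int_add power_int_diff qvar_neq_0 simp_thms)
  also have "- U \<alpha> - - U \<beta> + (T + U \<alpha>) = T + U \<beta>" by simp
  finally show ?thesis
    unfolding euler_form_defect(1)[OF C v(1)] euler_form_defect(1)[OF C v(2)] R U_def[symmetric] T_def[symmetric]
    by (metis times_divide_eq_right)
qed

lemma Q_series_iota1:
  assumes C: "C \<in> carrier_mat n n" "enough_loops C" and n: "n > 0" and \<gamma>: "keys \<gamma> \<subseteq> {..<m * n}"
  shows "mps_nth (Q_series C) (iota1 n \<gamma>) = loop_quiver.ff (cc_of (Gamma m C)) \<gamma>"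
proof (cases "\<gamma> = 0")
  case True
  have "loop_quiver.ff (cc_of (Gamma m C)) 0 = 1"
    by (rule loop_quiver.ff_0[OF loop_quiver_cc_of[OF enough_loops_Gamma[OF C]]])
  then show ?thesis using True by (simp add: iota1_def mps_nth_Q_series_0)
next
  case False
  define v where "v x = lookup \<gamma> ((snd x - 1) * n + fst x)" for x
  \<comment> \<open>A tuple must end in a non-zero vector, so its length \<open>r\<close> is the
    largest level at which \<open>\<gamma>\<close> is non-zero, possibly less than
    \<open>m\<close>.\<close>
  define K where "K = (\<lambda>p. snd (pos n p)) ` keys \<gamma>"
  define r where "r = Max K"
  define as where "as = map (\<lambda>k. vec n (\<lambda>i. v (i, k))) [1..<r + 1]"
  have dim: "dim_row C = n" using C by auto
  have vpos: "v (pos n p) = lookup \<gamma> p" for p using n by (simp add: v_def pos_def)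
  have K: "finite K" "K \<noteq> {}" using False by (auto simp: K_def)
  then have rK: "r \<in> K" unfolding r_def by (rule Max_in)
  then obtain p0 where p0: "p0 \<in> keys \<gamma>" "r = snd (pos n p0)" by (auto simp: K_def)
  have r: "1 \<le> r" "r \<le> m" using p0 \<gamma> pos_mem[of p0 m n] by (auto simp: mem_Times_iff)
  have big: "v (i, k) = 0" if "i < n" "k > r" for i k
  proof (rule ccontr)
    define p where "p = (k - 1) * n + i"
    assume "v (i, k) \<noteq> 0"
    then have "p \<in> keys \<gamma>" by (simp add: v_def p_def in_keys_iff)
    moreover have "pos n p = (i, k)" using that r pos_eq[OF n, of p i k] by (simp add: p_def)
    ultimately have "k \<in> K" by (force simp: K_def)
    then have "k \<le> r" using K by (simp add: r_def)
    then show False using that by simp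
  qed
  have len: "length as = r" by (simp add: as_def)
  have nth: "as ! (k - 1) = vec n (\<lambda>i. v (i, k))" if "1 \<le> k" "k \<le> r" for k
    using that by (simp add: as_def nth_upt del: upt_Suc)
  have "last as = vec n (\<lambda>i. v (i, r))"
    using nth[of r] r len by (metis last_conv_nth length_0_conv not_one_le_zero order_refl)
  moreover have "v (fst (pos n p0), r) \<noteq> 0" using vpos[of p0] p0 by (simp add: in_keys_iff)
  moreover have "fst (pos n p0) < n" using n by (simp add: pos_def)
  ultimately have "last as \<noteq> 0\<^sub>v n" by (metis index_vec index_zero_vec(1))
  then have as: "as \<in> vec_tuples (dim_row C)"
    using r by (auto simp: vec_tuples_def dim as_def)
  have X: "X_mon n as = iota1 n \<gamma>"
  proof (rule poly_mapping_eqI)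
    fix z :: "nat \<times> nat"
    obtain i k where z: "z = (i, k)" by fastforce
    show "lookup (X_mon n as) z = lookup (iota1 n \<gamma>) z"
      using big[of i k] nth[of k] by (auto simp: z lookup_X_mon lookup_iota1[OF n] len v_def)
  qed
  define \<alpha> where "\<alpha> k = vec n (\<lambda>i. v (i, k))" for k
  define \<beta> where "\<beta> k = vec n (\<lambda>i. \<Sum>l=k..m. v (i, l))" for k
  define E where "E k = (\<Sum>i<n. int (v (i, k)) * int (v (i, k))) + (\<Sum>i<n. \<Sum>j<n.
      (\<Sum>l=k..m. int (v (i, l))) * (euler_defect C i j * (\<Sum>t=k..m. int (v (j, t)))))" for k
  have tail: "tail_sum n as k = \<beta> k" if "1 \<le> k" for k
  proof (rule eq_vecI)
    fix i assume "i < dim_vec (\<beta> k)"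
    then have i: "i < n" by (simp add: \<beta>_def)
    have "(\<Sum>l=k..m. v (i, l)) = (\<Sum>l=k..r. v (i, l))"
      using r i big that by (intro sum.mono_neutral_right) auto
    also have "\<dots> = (\<Sum>l=k..r. as ! (l - 1) $ i)"
      using i that nth by (intro sum.cong refl) auto
    finally show "tail_sum n as k $ i = \<beta> k $ i"
      using i by (simp add: tail_sum_def \<beta>_def len)
  qed (simp add: tail_sum_def \<beta>_def)
  have "Q_coeff C as = (\<Prod>k=1..r. qvar powi E k / card_GL (\<alpha> k))"
    unfolding Q_coeff_def len Let_def dim
  proof (intro prod.cong refl)
    fix k assume "k \<in> {1..r}"
    then have k: "1 \<le> k" "k \<le> r" by auto
    have "\<alpha> k \<in> carrier_vec n" "\<beta> k \<in> carrier_vec n" by (auto simp: \<alpha>_def \<beta>_def)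
    note Q_factor[OF C(1) this]
    then show "qvar powi euler_form C (map_vec int (as ! (k - 1))) (map_vec int (as ! (k - 1))) /
        qvar powi euler_form C (map_vec int (tail_sum n as k)) (map_vec int (tail_sum n as k)) *
        (card_R C (as ! (k - 1)) / card_GL (as ! (k - 1))) = qvar powi E k / card_GL (\<alpha> k)"
      unfolding nth[OF k] tail[OF k(1)] \<alpha>_def[symmetric] by (simp add: E_def \<alpha>_def \<beta>_def)
  qed
  \<comment> \<open>The levels between \<open>r\<close> and \<open>m\<close> carry zero vectors and
    contribute the factor one.\<close>
  also have "\<dots> = (\<Prod>k=1..m. qvar powi E k / card_GL (\<alpha> k))"
  proof (rule prod.mono_neutral_left)
    show "\<forall>k\<in>{1..m} - {1..r}. qvar powi E k / card_GL (\<alpha> k) = 1"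
    proof
      fix k assume "k \<in> {1..m} - {1..r}"
      then have "v (i, l) = 0" if "i < n" "l \<ge> k" for i l using that big by auto
      then show "qvar powi E k / card_GL (\<alpha> k) = 1" by (simp add: E_def card_GL_def \<alpha>_def)
    qed
  qed (use r in auto)
  also have "\<dots> = qvar powi (\<Sum>k=1..m. E k) / (\<Prod>k=1..m. card_GL (\<alpha> k))"
    by (simp only: powi_sum[OF qvar_neq_0] prod_dividef)
  also have "(\<Sum>k=1..m. E k) = int (\<Sum>p<m * n. \<Sum>p'<m * n. lookup \<gamma> p * lookup \<gamma> p' * cc_of (Gamma m C) p p')"
    unfolding E_def by (rule Gamma_quadratic_form[OF C n, where w = "lookup \<gamma>", symmetric]) (rule vpos)
  also have "(\<Prod>k=1..m. card_GL (\<alpha> k)) = (\<Prod>i<n. \<Prod>k=1..m. \<Prod>s<v (i, k). qvar ^ v (i, k) - qvar ^ s)"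
    by (subst prod.swap) (simp add: card_GL_def \<alpha>_def)
  also have "\<dots> = (\<Prod>x\<in>{..<n} \<times> {1..m}. \<Prod>s<v x. qvar ^ v x - qvar ^ s)"
    by (simp add: prod.cartesian_product case_prod_unfold)
  also have "\<dots> = (\<Prod>p<m * n. \<Prod>s<v (pos n p). qvar ^ v (pos n p) - qvar ^ s)"
    by (rule prod.reindex_bij_betw[OF bij_betw_pos[OF n], symmetric])
  also have "qvar powi int (\<Sum>p<m * n. \<Sum>p'<m * n. lookup \<gamma> p * lookup \<gamma> p' * cc_of (Gamma m C) p p') /
      (\<Prod>p<m * n. \<Prod>s<v (pos n p). qvar ^ v (pos n p) - qvar ^ s) = loop_quiver.ff (cc_of (Gamma m C)) \<gamma>"
    unfolding ff_superset[OF loop_quiver_cc_of[OF enough_loops_Gamma[OF C]] \<gamma>] vpos power_int_of_nat ..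
  finally show ?thesis using Q_series_nth[OF as] by (simp add: dim X)
qed

section \<open>Refined Kac functions\<close>

lemma keys_log_rest:
  assumes M: "keys M \<subseteq> S" and x: "((A, B), (k, N)) \<in> log_rest M"
  shows "keys A \<subseteq> S \<and> keys N \<subseteq> S"
proof -
  have k: "k \<ge> 1" "A + kmul k N = M" using x by (auto simp: log_rest_def roots_def)
  have "lookup M v = lookup A v + k * lookup N v" for v using k(2) by (auto simp: lookup_add)
  then show ?thesis using M k(1) by (fastforce simp: in_keys_iff)
qed

text \<open>Both logarithms are compared with that of an auxiliary series with the coefficients
  \<open>ff\<close>, in variables indexed by positions. The given series agree with it on monomials
  in the first \<open>m * n\<close> positions, and there the recursion only refers to monomials of
  the same kind.\<close>

lemma Log_coefficients:
  assumes C: "C \<in> carrier_mat n n" "enough_loops C" and n: "n > 0"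
    and \<gamma>: "\<gamma> \<noteq> 0" "keys \<gamma> \<subseteq> {..<m * n}"
  shows "mps_nth (Log (Q_series C)) (iota1 n \<gamma>) = mps_nth (Log (Q_series (Gamma m C))) (iota2 \<gamma>)"
    and "\<exists>p :: nat poly. (qvar - 1) * mps_nth (Log (Q_series C)) (iota1 n \<gamma>) = to_fract (map_poly of_nat p)"
proof -
  interpret loop_quiver "cc_of (Gamma m C)" by (rule loop_quiver_cc_of[OF enough_loops_Gamma[OF C]])
  have dim: "dim_row C = n" using C by auto
  define a where "a = mps_nth (Log (Abs_mps ff))"
  have a: "log_rec q_subst ff a"
    using Log_recursion[of "Abs_mps ff" "\<lambda>M. of_nat (deg M)"]
    by (simp add: log_rec_def ff_0 deg_add a_def)
  have u: "b \<gamma> = a \<gamma>" if b: "log_rec q_subst F b" and F: "\<And>\<gamma>. keys \<gamma> \<subseteq> {..<m * n} \<Longrightarrow> F \<gamma> = ff \<gamma>" for F b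
  proof (rule log_rec_unique[OF fract_of_nat_neq_0 b a, where S = "{\<gamma>. keys \<gamma> \<subseteq> {..<m * n}}"])
    show "A \<in> {\<gamma>. keys \<gamma> \<subseteq> {..<m * n}} \<and> N \<in> {\<gamma>. keys \<gamma> \<subseteq> {..<m * n}}"
      if "M \<in> {\<gamma>. keys \<gamma> \<subseteq> {..<m * n}}" "((A, B), (k, N)) \<in> log_rest M" for M A B k N
      using keys_log_rest[OF _ that(2)] that(1) by simp
    show "F 0 = 1" using F[of 0] by (simp add: ff_0)
  qed (use \<gamma> F in \<open>simp_all add: ff_0 q_subst_id del: One_nat_def\<close>)
  have 1: "mps_nth (Log (Q_series C)) (iota1 n \<gamma>) = a \<gamma>"
    by (rule u[OF log_rec_iota1[OF dim n]]) (rule Q_series_iota1[OF C n])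
  have 2: "mps_nth (Log (Q_series (Gamma m C))) (iota2 \<gamma>) = a \<gamma>"
    by (rule u[OF log_rec_iota2]) (rule Q_series_iota2[OF Gamma_carrier[OF C(1)] enough_loops_Gamma[OF C]])
  show "mps_nth (Log (Q_series C)) (iota1 n \<gamma>) = mps_nth (Log (Q_series (Gamma m C))) (iota2 \<gamma>)"
    using 1 2 by simp
  show "\<exists>p :: nat poly. (qvar - 1) * mps_nth (Log (Q_series C)) (iota1 n \<gamma>) = to_fract (map_poly of_nat p)"
    unfolding 1 by (rule log_rec_positive[OF a \<gamma>(1)])
qed

text \<open>The vector \<open>\<gamma>\<close> of multiplicities by position is the common index of
  the two monomials; a non-zero \<open>lam\<close> forces it to be non-zero and \<open>n\<close> to
  be positive.\<close>

lemma kac_monomials: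
  assumes lam: "lam \<in> tuples n (partitions_le m) - {0\<^sub>v n}"
  obtains \<gamma> where "n > 0" "\<gamma> \<noteq> 0" "keys \<gamma> \<subseteq> {..<m * n}" "X_mon n (partition_vecs lam) = iota1 n \<gamma>"
    "X_mon (m * n) (partition_vecs (tau m lam)) = iota2 \<gamma>"
proof -
  define c where "c p = (if p < m * n then count (lam $ (p mod n)) (p div n + 1) else 0)" for p
  define \<gamma> where "\<gamma> = Abs_poly_mapping c"
  have dim: "dim_vec lam = n" "lam \<noteq> 0\<^sub>v n" using lam by (auto simp: tuples_def)
  have le: "lam $ i \<in> partitions_le m" if "i < n" for i
    using lam that dim by (auto simp: tuples_def vec_set_def)
  have lam': "lam \<in> tuples n partitions - {0\<^sub>v n}"
    using lam by (auto simp: tuples_def partitions_le_def)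
  have "finite {p. c p \<noteq> 0}" by (rule finite_subset[of _ "{..<m * n}"]) (auto simp: c_def)
  then have l: "lookup \<gamma> = c" by (simp add: \<gamma>_def)
  obtain i where i: "i < n" "lam $ i \<noteq> {#}"
    using dim by (metis eq_vecI index_zero_vec zero_multiset_def)
  then obtain k where k: "k \<in># lam $ i" by auto
  have n: "n > 0" using i by simp
  have k1: "1 \<le> k" "k \<le> m" using le[OF i(1)] k by (auto simp: partitions_le_def partitions_def Suc_le_eq intro!: gr0I)
  define p where "p = (k - 1) * n + i"
  have p: "pos n p = (i, k)" using pos_eq[OF n, of p i k] i k1 by (simp add: p_def)
  have "p < m * n" unfolding p_def by (rule position_less[OF i(1) k1])
  then have cp: "c p \<noteq> 0" using p k by (simp add: c_def pos_def)
  have X1: "X_mon n (partition_vecs lam) = iota1 n \<gamma>"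
  proof (rule poly_mapping_eqI)
    fix z :: "nat \<times> nat"
    obtain i k where z: "z = (i, k)" by fastforce
    have "count (lam $ i) k = c ((k - 1) * n + i)" if i: "i < n" "k \<ge> 1"
    proof (cases "k \<le> m")
      case True
      have "pos n ((k - 1) * n + i) = (i, k)" using pos_eq[OF n, of _ i k] i by simp
      moreover have "(k - 1) * n + i < m * n" by (rule position_less[OF i True])
      ultimately show ?thesis by (simp add: c_def pos_def)
    next
      case False
      then have "count (lam $ i) k = 0" using le[OF i(1)] by (auto simp: partitions_le_def count_eq_zero_iff)
      moreover have "m * n \<le> (k - 1) * n" using False by (intro mult_le_mono1) simp
      then have "\<not> (k - 1) * n + i < m * n" by (intro leD trans_le_add1)
      then have "c ((k - 1) * n + i) = 0" by (simp only: c_def if_False)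
      ultimately show ?thesis by simp
    qed
    then show "lookup (X_mon n (partition_vecs lam)) z = lookup (iota1 n \<gamma>) z"
      by (cases "k = 0") (auto simp: z lookup_X_mon_partition_vecs[OF lam'] lookup_iota1[OF n] l)
  qed
  have tau: "tau m lam = vec (m * n) (\<lambda>p. replicate_mset (c p) 1)"
    by (rule eq_vecI) (auto simp: tau_def dim c_def)
  have "tau m lam \<noteq> 0\<^sub>v (m * n)"
  proof
    assume "tau m lam = 0\<^sub>v (m * n)"
    then have "tau m lam $ p = {#}" using \<open>p < m * n\<close> by simp
    then show False using \<open>p < m * n\<close> cp by (simp add: tau)
  qed
  then have tau': "tau m lam \<in> tuples (m * n) partitions - {0\<^sub>v (m * n)}"
    by (auto simp: tau tuples_def vec_set_def partitions_def split: if_splits)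
  have X2: "X_mon (m * n) (partition_vecs (tau m lam)) = iota2 \<gamma>"
  proof (rule poly_mapping_eqI)
    fix z :: "nat \<times> nat"
    obtain p k where z: "z = (p, k)" by fastforce
    have "p < m * n \<or> c p = 0" by (simp add: c_def)
    then show "lookup (X_mon (m * n) (partition_vecs (tau m lam))) z = lookup (iota2 \<gamma>) z"
      unfolding z lookup_X_mon_partition_vecs[OF tau'] lookup_iota2 l by (auto simp: tau)
  qed
  have "keys \<gamma> \<subseteq> {..<m * n}" by (auto simp: in_keys_iff l c_def split: if_splits)
  moreover have "\<gamma> \<noteq> 0" using cp l by auto
  ultimately show thesis using that n X1 X2 by blast
qed

lemma kac_mult: "C \<in> carrier_mat n n \<Longrightarrow> kac C lam = (qvar - 1) * mps_nth (Log (Q_series C)) (X_mon n (partition_vecs lam))"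
  by (auto simp: kac_def mps_nth_const_mult)

theorem theorem3p2:
  fixes n :: nat and C :: "nat mat"
  assumes "C \<in> carrier_mat n n" and "enough_loops C"
  shows "(\<forall>m\<ge>1. \<forall>lam \<in> tuples n (partitions_le m) - {0\<^sub>v n}.
            kac C lam = kac (Gamma m C) (tau m lam)) \<and>
         (\<forall>lam \<in> tuples n partitions - {0\<^sub>v n}.
            \<exists>p :: nat poly. kac C lam = to_fract (map_poly of_nat p))"
proof (intro conjI allI impI ballI)
  fix m :: nat and lam assume "lam \<in> tuples n (partitions_le m) - {0\<^sub>v n}"
  then obtain \<gamma> where g: "n > 0" "\<gamma> \<noteq> 0" "keys \<gamma> \<subseteq> {..<m * n}"
    and X: "X_mon n (partition_vecs lam) = iota1 n \<gamma>" "X_mon (m * n) (partition_vecs (tau m lam)) = iota2 \<gamma>"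
    by (rule kac_monomials)
  then show "kac C lam = kac (Gamma m C) (tau m lam)"
    using Log_coefficients(1)[OF assms g]
    by (simp add: kac_mult[OF assms(1)] kac_mult[OF Gamma_carrier[OF assms(1)]])
next
  fix lam assume lam: "lam \<in> tuples n partitions - {0\<^sub>v n}"
  \<comment> \<open>The largest part that occurs serves as \<open>m\<close>, which reduces arbitrary
    tuples to bounded ones.\<close>
  define m where "m = Max (\<Union>p\<in>set\<^sub>v lam. set_mset p)"
  have "x \<le> m" if "p \<in> set\<^sub>v lam" "x \<in># p" for p x
    unfolding m_def using that by (intro Max_ge) (auto simp: vec_set_def)
  then have "lam \<in> tuples n (partitions_le m) - {0\<^sub>v n}"
    using lam by (auto simp: tuples_def partitions_le_def)
  then obtain \<gamma> where g: "n > 0" "\<gamma> \<noteq> 0" "keys \<gamma> \<subseteq> {..<m * n}"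
    and X: "X_mon n (partition_vecs lam) = iota1 n \<gamma>" "X_mon (m * n) (partition_vecs (tau m lam)) = iota2 \<gamma>"
    by (rule kac_monomials)
  then show "\<exists>p :: nat poly. kac C lam = to_fract (map_poly of_nat p)"
    using Log_coefficients(2)[OF assms g] by (simp add: kac_mult[OF assms(1)])
qed

end
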